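(* Let $D^1=(X,d^1)$, $D^2=(X,d^2)$ and $D^3=(X,d^3)$ be $\mathbb Z/2\mathbb Z$-graded Fredholm complexes over a field $\mathbb F$ such that $d^1_\pm-d^2_\pm$ and $d^2_\pm-d^3_\pm$ are of finite rank. Then the perturbation isomorphisms satisfy: (1) $P(D^1,D^2)=P(D^2,D^1)^{-1}$; (2) $P(D^3,D^2)\circ P(D^2,D^1)=P(D^3,D^1)$.
   Context: All vector spaces are over a field $\mathbb F$ and may be infinite dimensional. For a finite dimensional $V$, $|V|=\Lambda^{\dim V}(V)$; linear maps induce maps on exterior powers denoted by the same symbol; for a nonzero vector $v$ of a line, $v^*$ is the dual vector with $v^*(v)=1$. A $\mathbb Z/2\mathbb Z$-graded complex $D=(X,d)$ consists of vector spaces $X_\pm$ and linear maps $d_+:X_+\to X_-$, $d_-:X_-\to X_+$ with $d_-d_+=0=d_+d_-$. Put $H_+(D)=\ker d_+/\mathrm{Im}\,d_-$, $H_-(D)=\ker d_-/\mathrm{Im}\,d_+$. $D$ is Fredholm if these are finite dimensional; then $\mathrm{Ind}(D)=\dim H_+(D)-\dim H_-(D)$ and $|D|=|H_+(D)|\otimes|H_-(D)|^*$. A pseudo-inverse of a linear map $A$ is a linear map $A^\dagger$ with $AA^\dagger A=A$, $A^\dagger AA^\dagger=A^\dagger$. A pseudo-inverse $D^\dagger$ of $D$ consists of pseudo-inverses $d_+^\dagger:X_-\to X_+$, $d_-^\dagger:X_+\to X_-$ of $d_\pm$ with $d_-^\dagger d_+^\dagger=0=d_+^\dagger d_-^\dagger$.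 An invertible $T:V\to V$ with $1-T$ of finite rank is of determinant class, and $\det T:=\det(T|_E)$ for any finite dimensional invariant $E\supseteq\mathrm{Im}(1-T)$. Perturbation isomorphism. Let $D=(X,d)$ and $\Delta=(X,\delta)$ be Fredholm complexes with $d_\pm-\delta_\pm$ of finite rank (then $\mathrm{Ind}(D)=\mathrm{Ind}(\Delta)$). Choose pseudo-inverses $D^\dagger,\Delta^\dagger$ with $d_\pm^\dagger-\delta_\pm^\dagger$ of finite rank. Put $\sigma_+=d_++d_-^\dagger$, $\sigma_-=d_-+d_+^\dagger$, $\tau_+=\delta_++\delta_-^\dagger$, $\tau_-=\delta_-+\delta_+^\dagger$, $P_+=1-\sigma_-\sigma_+$ (idempotent onto $\ker\sigma_+$), $Q_-=1-\tau_+\tau_-$ (idempotent onto $\ker\tau_-$). The inclusions and quotient maps give canonical isomorphisms $H_+(D)\cong\ker\sigma_+$, $H_-(D)\cong\mathrm{Coker}\,\sigma_+$, $H_-(\Delta)\cong\ker\tau_-$, $H_+(\Delta)\cong\mathrm{Coker}\,\tau_-$. If $\mathrm{Ind}(D)\le0$, choose linear maps $L:\ker\sigma_+\to X_-$ with $\ker\sigma_+\to\mathrm{Coker}\,\sigma_+$ injective; $M:\ker\tau_-\to X_+$ with $\ker\tau_-\to\mathrm{Coker}\,\tau_-$ surjective and $\mathrm{Im}\,M\cap\mathrm{Im}\,\tau_-=0$; $N:\ker\tau_-\to X_-$ inducing an isomorphism $\ker M\to X_-/(\mathrm{Im}\,\sigma_++\mathrm{Im}\,L)$ and vanishing on a complement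 of $\ker M$ in $\ker\tau_-$. Then $\Sigma=(\sigma_++LP_+)(\tau_-+MQ_-)+NQ_-:X_-\to X_-$ is of determinant class and $P(\Delta,D):|D|\to|\Delta|$ is $$s\otimes(Ls\wedge Nt_1)^*\mapsto\det(\Sigma)^{-1}\,Mt_0\otimes(t_0\wedge t_1)^*$$ for nonzero $s\in|\ker\sigma_+|$, $t_1\in|\ker M|$, $t_0\in|\ker N|$. If $\mathrm{Ind}(D)\ge0$, choose linear maps $L:\ker\sigma_+\to X_-$ with $\ker\sigma_+\to\mathrm{Coker}\,\sigma_+$ surjective and $\mathrm{Im}\,L\cap\mathrm{Im}\,\sigma_+=0$; $M:\ker\tau_-\to X_+$ with $\ker\tau_-\to\mathrm{Coker}\,\tau_-$ injective; $N:\ker\sigma_+\to X_+$ inducing an isomorphism $\ker L\to X_+/(\mathrm{Im}\,M+\mathrm{Im}\,\tau_-)$ and vanishing on a complement of $\ker L$ in $\ker\sigma_+$. Then $\Sigma=(\tau_-+MQ_-)(\sigma_++LP_+)+NP_+:X_+\to X_+$ is of determinant class and $P(\Delta,D)$ is $$(s_0\wedge s_1)\otimes(Ls_1)^*\mapsto\det(\Sigma)^{-1}\,(Ns_0\wedge Mt)\otimes t^*$$ for nonzero $s_0\in|\ker L|$, $s_1\in|\ker N|$, $t\in|\ker\tau_-|$. $P(\Delta,D)$ is independent of all choices. *)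

theory Defs
  imports "Jordan_Normal_Form.VS_Connect" "HOL-Algebra.AbelCoset"
begin

section \<open>Vector spaces on a carrier\<close>

text \<open>
  The spaces \<open>X\<^sub>+\<close> and \<open>X\<^sub>-\<close> are whole types with a scalar multiplication \<open>s\<close> (\<^locale>\<open>vector_space\<close>).
  Subspaces, cohomology groups, exterior powers, duals and tensor products are \<open>module\<close> records over
  \<open>class_ring\<close>, to which the notions of the VectorSpace development apply. The ring
  fields \<open>mult\<close> and \<open>one\<close> of such a record carry no meaning.
\<close>

definition vs_of :: "('f::field \<Rightarrow> 'v::ab_group_add \<Rightarrow> 'v) \<Rightarrow> 'v set \<Rightarrow> ('f, 'v) module" where
  "vs_of s S = \<lparr>carrier = S, mult = undefined, one = undefined, zero = 0, add = (+), smult = s\<rparr>"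

abbreviation ker_set :: "('v \<Rightarrow> 'w::zero) \<Rightarrow> 'v set" where
  "ker_set f \<equiv> {x. f x = 0}"

abbreviation vdim :: "('f::field, 'v) module \<Rightarrow> nat" where
  "vdim V \<equiv> vectorspace.dim class_ring V"

abbreviation hom_vs :: "('f::field, 'v) module \<Rightarrow> ('f, 'w) module \<Rightarrow> ('v \<Rightarrow> 'w) set" where
  "hom_vs V W \<equiv> LinearCombinations.module_hom class_ring V W"

definition quot_vs :: "('f::field, 'v) module \<Rightarrow> 'v set \<Rightarrow> ('f, 'v set) module" where
  "quot_vs V W =
     \<lparr>carrier = a_rcosets\<^bsub>V\<^esub> W, mult = undefined, one = undefined, zero = W,
      add = set_add V, smult = (\<lambda>c A. \<Union>a\<in>A. W +>\<^bsub>V\<^esub> (c \<odot>\<^bsub>V\<^esub> a))\<rparr>"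

definition free_vs :: "'c set \<Rightarrow> ('f::field, 'c \<Rightarrow> 'f) module" where
  "free_vs B =
     \<lparr>carrier = {r. finite {b. r b \<noteq> 0} \<and> {b. r b \<noteq> 0} \<subseteq> B}, mult = undefined, one = undefined,
      zero = (\<lambda>_. 0), add = (\<lambda>r r' b. r b + r' b), smult = (\<lambda>c r b. c * r b)\<rparr>"

definition free_gen :: "'c \<Rightarrow> 'c \<Rightarrow> 'f::field" where
  "free_gen x = (\<lambda>b. if b = x then 1 else 0)"

abbreviation free_span :: "'c set \<Rightarrow> ('c \<Rightarrow> 'f::field) set \<Rightarrow> ('c \<Rightarrow> 'f) set" where
  "free_span B R \<equiv> LinearCombinations.module.span class_ring (free_vs B) R"

definition dual_vs :: "('f::field, 'v) module \<Rightarrow> ('f, 'v \<Rightarrow> 'f) module" where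
  "dual_vs V =
     \<lparr>carrier = hom_vs V (vs_of times UNIV) \<inter> extensional (carrier V),
      mult = undefined, one = undefined, zero = (\<lambda>v\<in>carrier V. 0),
      add = (\<lambda>\<phi> \<psi>. \<lambda>v\<in>carrier V. \<phi> v + \<psi> v), smult = (\<lambda>c \<phi>. \<lambda>v\<in>carrier V. c * \<phi> v)\<rparr>"

text \<open>\<open>v\<^sup>*\<close> for a nonzero vector \<open>v\<close> of a line.\<close>

definition dual_vec :: "('f::field, 'v) module \<Rightarrow> 'v \<Rightarrow> 'v \<Rightarrow> 'f" where
  "dual_vec V v = (THE \<phi>. \<phi> \<in> carrier (dual_vs V) \<and> \<phi> v = 1)"


section \<open>Tensor products and exterior powers\<close>

definition tensor_rels :: "('f::field, 'v) module \<Rightarrow> ('f, 'w) module \<Rightarrow> ('v \<times> 'w \<Rightarrow> 'f) set" where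
  "tensor_rels V W =
     {(\<lambda>b. free_gen (v \<oplus>\<^bsub>V\<^esub> v', w) b - free_gen (v, w) b - free_gen (v', w) b) | v v' w.
        v \<in> carrier V \<and> v' \<in> carrier V \<and> w \<in> carrier W} \<union>
     {(\<lambda>b. free_gen (v, w \<oplus>\<^bsub>W\<^esub> w') b - free_gen (v, w) b - free_gen (v, w') b) | v w w'.
        v \<in> carrier V \<and> w \<in> carrier W \<and> w' \<in> carrier W} \<union>
     {(\<lambda>b. free_gen (c \<odot>\<^bsub>V\<^esub> v, w) b - c * free_gen (v, w) b) | c v w.
        v \<in> carrier V \<and> w \<in> carrier W} \<union>
     {(\<lambda>b. free_gen (v, c \<odot>\<^bsub>W\<^esub> w) b - c * free_gen (v, w) b) | c v w.
        v \<in> carrier V \<and> w \<in> carrier W}"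

definition tensor_vs ::
    "('f::field, 'v) module \<Rightarrow> ('f, 'w) module \<Rightarrow> ('f, ('v \<times> 'w \<Rightarrow> 'f) set) module" where
  "tensor_vs V W =
     quot_vs (free_vs (carrier V \<times> carrier W)) (free_span (carrier V \<times> carrier W) (tensor_rels V W))"

definition tensor :: "('f::field, 'v) module \<Rightarrow> ('f, 'w) module \<Rightarrow> 'v \<Rightarrow> 'w \<Rightarrow> ('v \<times> 'w \<Rightarrow> 'f) set" where
  "tensor V W v w =
     free_span (carrier V \<times> carrier W) (tensor_rels V W)
       +>\<^bsub>free_vs (carrier V \<times> carrier W)\<^esub> free_gen (v, w)"

definition tuples :: "nat \<Rightarrow> ('f::field, 'v) module \<Rightarrow> 'v list set" where
  "tuples n V = {vs. length vs = n \<and> set vs \<subseteq> carrier V}"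

definition alt_rels :: "nat \<Rightarrow> ('f::field, 'v) module \<Rightarrow> ('v list \<Rightarrow> 'f) set" where
  "alt_rels n V =
     {(\<lambda>b. free_gen (vs[i := x \<oplus>\<^bsub>V\<^esub> y]) b - free_gen (vs[i := x]) b - free_gen (vs[i := y]) b) | vs i x y.
        vs \<in> tuples n V \<and> i < n \<and> x \<in> carrier V \<and> y \<in> carrier V} \<union>
     {(\<lambda>b. free_gen (vs[i := c \<odot>\<^bsub>V\<^esub> x]) b - c * free_gen (vs[i := x]) b) | vs i c x.
        vs \<in> tuples n V \<and> i < n \<and> x \<in> carrier V} \<union>
     {free_gen vs | vs. vs \<in> tuples n V \<and> (\<exists>i j. i < j \<and> j < n \<and> vs ! i = vs ! j)}"

abbreviation alt_span :: "nat \<Rightarrow> ('f::field, 'v) module \<Rightarrow> ('v list \<Rightarrow> 'f) set" where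
  "alt_span n V \<equiv> free_span (tuples n V) (alt_rels n V)"

text \<open>
  \<open>\<Lambda>\<^sup>n(V)\<close>, where \<open>v\<^sub>1 \<and> \<dots> \<and> v\<^sub>n\<close> is the class of \<open>free_gen [v\<^sub>1, \<dots>, v\<^sub>n]\<close>;
  \<open>\<Lambda>\<^sup>0(V)\<close> is the field, with basis the class of \<open>free_gen []\<close>.
\<close>

definition ext_power :: "nat \<Rightarrow> ('f::field, 'v) module \<Rightarrow> ('f, ('v list \<Rightarrow> 'f) set) module" where
  "ext_power n V = quot_vs (free_vs (tuples n V)) (alt_span n V)"

text \<open>\<open>\<Lambda>\<^sup>n(V) \<rightarrow> \<Lambda>\<^sup>n(W)\<close> induced by \<open>f : V \<rightarrow> W\<close>, by push-forward of representatives.\<close>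

definition ext_map ::
    "nat \<Rightarrow> ('f::field, 'w) module \<Rightarrow> ('v \<Rightarrow> 'w) \<Rightarrow> ('v list \<Rightarrow> 'f) set \<Rightarrow> ('w list \<Rightarrow> 'f) set" where
  "ext_map n W f \<omega> =
     (\<Union>r\<in>\<omega>. alt_span n W +>\<^bsub>free_vs (tuples n W)\<^esub> (\<lambda>ws. \<Sum>vs | r vs \<noteq> 0 \<and> map f vs = ws. r vs))"

text \<open>
  The product \<open>\<Lambda>\<^sup>p(V) \<times> \<Lambda>\<^sup>q(V) \<rightarrow> \<Lambda>\<^sup>p\<^sup>+\<^sup>q(V)\<close> induced by concatenation of tuples; a list that is not of
  length \<open>p + q\<close> splits into parts outside the supports of \<open>r\<close> and \<open>r'\<close>.
\<close>

definition wedge ::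
    "('f::field, 'v) module \<Rightarrow> nat \<Rightarrow> nat \<Rightarrow> ('v list \<Rightarrow> 'f) set \<Rightarrow> ('v list \<Rightarrow> 'f) set \<Rightarrow> ('v list \<Rightarrow> 'f) set" where
  "wedge V p q \<omega> \<eta> =
     (\<Union>r\<in>\<omega>. \<Union>r'\<in>\<eta>.
        alt_span (p + q) V +>\<^bsub>free_vs (tuples (p + q) V)\<^esub> (\<lambda>us. r (take p us) * r' (drop p us)))"

definition det_line :: "('f::field, 'v) module \<Rightarrow> ('f, ('v list \<Rightarrow> 'f) set) module" where
  "det_line V = ext_power (vdim V) V"

definition nonzero :: "('f::field, 'v) module \<Rightarrow> 'v set" where
  "nonzero V = carrier V - {\<zero>\<^bsub>V\<^esub>}"


section \<open>Determinant class operators\<close>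

definition finite_rank :: "('f::field \<Rightarrow> 'w::ab_group_add \<Rightarrow> 'w) \<Rightarrow> ('v \<Rightarrow> 'w) \<Rightarrow> bool" where
  "finite_rank s f \<longleftrightarrow> (\<exists>B. finite B \<and> range f \<subseteq> Modules.module.span s B)"

text \<open>\<open>det(T|\<^sub>E)\<close>, computed in an ordered basis of \<open>E\<close>.\<close>

definition det_on ::
    "('f::field \<Rightarrow> 'v::ab_group_add \<Rightarrow> 'v) \<Rightarrow> 'v set \<Rightarrow> ('v \<Rightarrow> 'v) \<Rightarrow> 'f" where
  "det_on s E T =
     (let bs = (SOME bs. distinct bs \<and> \<not> Modules.module.dependent s (set bs) \<and>
                         Modules.module.span s (set bs) = E)
      in Determinant.det (mat (length bs) (length bs)
           (\<lambda>(i, j). Modules.module.representation s (set bs) (T (bs ! j)) (bs ! i))))"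

definition class_det ::
    "('f::field \<Rightarrow> 'v::ab_group_add \<Rightarrow> 'v) \<Rightarrow> ('v \<Rightarrow> 'v) \<Rightarrow> 'f" where
  "class_det s T =
     det_on s (SOME E. (\<exists>B. finite B \<and> E = Modules.module.span s B) \<and> T ` E \<subseteq> E \<and>
                       range (\<lambda>x. x - T x) \<subseteq> E) T"


section \<open>Graded Fredholm complexes\<close>

record ('a, 'b) z2_complex =
  d_plus :: "'a \<Rightarrow> 'b"
  d_minus :: "'b \<Rightarrow> 'a"

text \<open>\<open>pinv_plus\<close> is a pseudo-inverse of \<open>d\<^sub>+\<close> and \<open>pinv_minus\<close> one of \<open>d\<^sub>-\<close>.\<close>

record ('a, 'b) z2_pinv =
  pinv_plus :: "'b \<Rightarrow> 'a"
  pinv_minus :: "'a \<Rightarrow> 'b"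

definition is_complex ::
    "('f::field \<Rightarrow> 'a::ab_group_add \<Rightarrow> 'a) \<Rightarrow> ('f \<Rightarrow> 'b::ab_group_add \<Rightarrow> 'b) \<Rightarrow> ('a, 'b) z2_complex \<Rightarrow> bool" where
  "is_complex sp sm D \<longleftrightarrow>
     Vector_Spaces.linear sp sm (d_plus D) \<and> Vector_Spaces.linear sm sp (d_minus D) \<and>
     (\<forall>x. d_minus D (d_plus D x) = 0) \<and> (\<forall>y. d_plus D (d_minus D y) = 0)"

definition H_plus ::
    "('f::field \<Rightarrow> 'a::ab_group_add \<Rightarrow> 'a) \<Rightarrow> ('a, 'b::zero) z2_complex \<Rightarrow> ('f, 'a set) module" where
  "H_plus sp D = quot_vs (vs_of sp (ker_set (d_plus D))) (range (d_minus D))"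

definition H_minus ::
    "('f::field \<Rightarrow> 'b::ab_group_add \<Rightarrow> 'b) \<Rightarrow> ('a::zero, 'b) z2_complex \<Rightarrow> ('f, 'b set) module" where
  "H_minus sm D = quot_vs (vs_of sm (ker_set (d_minus D))) (range (d_plus D))"

definition fredholm ::
    "('f::field \<Rightarrow> 'a::ab_group_add \<Rightarrow> 'a) \<Rightarrow> ('f \<Rightarrow> 'b::ab_group_add \<Rightarrow> 'b) \<Rightarrow> ('a, 'b) z2_complex \<Rightarrow> bool" where
  "fredholm sp sm D \<longleftrightarrow>
     is_complex sp sm D \<and>
     vectorspace.fin_dim class_ring (H_plus sp D) \<and> vectorspace.fin_dim class_ring (H_minus sm D)"

definition Ind ::
    "('f::field \<Rightarrow> 'a::ab_group_add \<Rightarrow> 'a) \<Rightarrow> ('f \<Rightarrow> 'b::ab_group_add \<Rightarrow> 'b) \<Rightarrow> ('a, 'b) z2_complex \<Rightarrow> int" where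
  "Ind sp sm D = int (vdim (H_plus sp D)) - int (vdim (H_minus sm D))"

text \<open>\<open>|D| = |H\<^sub>+(D)| \<otimes> |H\<^sub>-(D)|\<^sup>*\<close>, and the vectors \<open>u \<otimes> v\<^sup>*\<close> in it.\<close>

definition cx_line where
  "cx_line sp sm D = tensor_vs (det_line (H_plus sp D)) (dual_vs (det_line (H_minus sm D)))"

definition cx_tensor where
  "cx_tensor sp sm D u v =
     tensor (det_line (H_plus sp D)) (dual_vs (det_line (H_minus sm D)))
       u (dual_vec (det_line (H_minus sm D)) v)"

definition pseudo_inverse ::
    "('f::field \<Rightarrow> 'v::ab_group_add \<Rightarrow> 'v) \<Rightarrow> ('f \<Rightarrow> 'w::ab_group_add \<Rightarrow> 'w) \<Rightarrow> ('v \<Rightarrow> 'w) \<Rightarrow> ('w \<Rightarrow> 'v) \<Rightarrow> bool" where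
  "pseudo_inverse s s' A B \<longleftrightarrow>
     Vector_Spaces.linear s' s B \<and> (\<forall>x. A (B (A x)) = A x) \<and> (\<forall>y. B (A (B y)) = B y)"

definition cx_pseudo_inverse ::
    "('f::field \<Rightarrow> 'a::ab_group_add \<Rightarrow> 'a) \<Rightarrow> ('f \<Rightarrow> 'b::ab_group_add \<Rightarrow> 'b) \<Rightarrow>
     ('a, 'b) z2_complex \<Rightarrow> ('a, 'b) z2_pinv \<Rightarrow> bool" where
  "cx_pseudo_inverse sp sm D D' \<longleftrightarrow>
     pseudo_inverse sp sm (d_plus D) (pinv_plus D') \<and> pseudo_inverse sm sp (d_minus D) (pinv_minus D') \<and>
     (\<forall>y. pinv_minus D' (pinv_plus D' y) = 0) \<and> (\<forall>x. pinv_plus D' (pinv_minus D' x) = 0)"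

definition fold_plus :: "('a, 'b::ab_group_add) z2_complex \<Rightarrow> ('a, 'b) z2_pinv \<Rightarrow> 'a \<Rightarrow> 'b" where
  "fold_plus D D' = (\<lambda>x. d_plus D x + pinv_minus D' x)"

definition fold_minus :: "('a::ab_group_add, 'b) z2_complex \<Rightarrow> ('a, 'b) z2_pinv \<Rightarrow> 'b \<Rightarrow> 'a" where
  "fold_minus D D' = (\<lambda>y. d_minus D y + pinv_plus D' y)"


section \<open>The perturbation isomorphism\<close>

abbreviation ker_vs :: "('f::field \<Rightarrow> 'v::ab_group_add \<Rightarrow> 'v) \<Rightarrow> ('v \<Rightarrow> 'w::zero) \<Rightarrow> ('f, 'v) module" where
  "ker_vs s f \<equiv> vs_of s (ker_set f)"

abbreviation vcoset :: "('f::field \<Rightarrow> 'v::ab_group_add \<Rightarrow> 'v) \<Rightarrow> 'v set \<Rightarrow> 'v \<Rightarrow> 'v set" where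
  "vcoset s W v \<equiv> W +>\<^bsub>vs_of s UNIV\<^esub> v"

abbreviation coker_vs :: "('f::field \<Rightarrow> 'w::ab_group_add \<Rightarrow> 'w) \<Rightarrow> ('v \<Rightarrow> 'w) \<Rightarrow> ('f, 'w set) module" where
  "coker_vs s f \<equiv> quot_vs (vs_of s UNIV) (range f)"

text \<open>
  For a cohomology group \<open>H = Z/W\<close> (\<open>W \<subseteq> Z \<subseteq> X\<close>), the isomorphism \<open>|ker \<sigma>| \<rightarrow> |H|\<close> induced by
  \<open>x \<mapsto> x + W\<close>, and the inverse \<open>|Coker \<sigma>| \<rightarrow> |H|\<close> of the isomorphism induced by
  \<open>z + W \<mapsto> z + Im \<sigma>\<close>.
\<close>

definition ker_to_H ::
    "('f::field \<Rightarrow> 'v::ab_group_add \<Rightarrow> 'v) \<Rightarrow> ('v \<Rightarrow> 'w::zero) \<Rightarrow> 'v set \<Rightarrow> ('f, 'v set) module \<Rightarrow>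
     ('v list \<Rightarrow> 'f) set \<Rightarrow> ('v set list \<Rightarrow> 'f) set" where
  "ker_to_H s \<sigma> W H = ext_map (vdim (ker_vs s \<sigma>)) H (vcoset s W)"

definition coker_to_H ::
    "('f::field \<Rightarrow> 'v::ab_group_add \<Rightarrow> 'v) \<Rightarrow> ('w \<Rightarrow> 'v) \<Rightarrow> ('f, 'v set) module \<Rightarrow>
     ('v set list \<Rightarrow> 'f) set \<Rightarrow> ('v set list \<Rightarrow> 'f) set" where
  "coker_to_H s \<sigma> H =
     inv_into (carrier (det_line H))
       (ext_map (vdim H) (coker_vs s \<sigma>) (\<lambda>A. \<Union>a\<in>A. vcoset s (range \<sigma>) a))"

text \<open>
  The conditions on the choice of \<open>L\<close>, \<open>M\<close>, \<open>N\<close>, for \<open>\<sigma> : X \<rightarrow> Y\<close> and \<open>\<tau> : Y \<rightarrow> X\<close>. The case of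
  nonpositive index is \<open>\<sigma> = \<sigma>\<^sub>+\<close>, \<open>\<tau> = \<tau>\<^sub>-\<close>; the conditions of the other case are the same with the
  roles of \<open>(\<sigma>\<^sub>+, L)\<close> and \<open>(\<tau>\<^sub>-, M)\<close> exchanged. \<open>L\<close>, \<open>M\<close>, \<open>N\<close> matter only on \<open>ker \<sigma>\<close>, \<open>ker \<tau>\<close>, \<open>ker \<tau>\<close>.
\<close>

definition admissible ::
    "('f::field \<Rightarrow> 'x::ab_group_add \<Rightarrow> 'x) \<Rightarrow> ('f \<Rightarrow> 'y::ab_group_add \<Rightarrow> 'y) \<Rightarrow>
     ('x \<Rightarrow> 'y) \<Rightarrow> ('y \<Rightarrow> 'x) \<Rightarrow> ('x \<Rightarrow> 'y) \<Rightarrow> ('y \<Rightarrow> 'x) \<Rightarrow> ('y \<Rightarrow> 'y) \<Rightarrow> bool" where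
  "admissible sx sy \<sigma> \<tau> L M N \<longleftrightarrow>
     (let ker_M = {y \<in> ker_set \<tau>. M y = 0};
          im_\<sigma>L = {a + b | a b. a \<in> range \<sigma> \<and> b \<in> L ` ker_set \<sigma>}
      in
       L \<in> hom_vs (ker_vs sx \<sigma>) (vs_of sy UNIV) \<and>
       inj_on (\<lambda>x. vcoset sy (range \<sigma>) (L x)) (ker_set \<sigma>) \<and>
       M \<in> hom_vs (ker_vs sy \<tau>) (vs_of sx UNIV) \<and>
       (\<lambda>y. vcoset sx (range \<tau>) (M y)) ` ker_set \<tau> = carrier (coker_vs sx \<tau>) \<and>
       M ` ker_set \<tau> \<inter> range \<tau> = {0} \<and>
       N \<in> hom_vs (ker_vs sy \<tau>) (vs_of sy UNIV) \<and>
       bij_betw (\<lambda>y. vcoset sy im_\<sigma>L (N y)) ker_M (carrier (quot_vs (vs_of sy UNIV) im_\<sigma>L)) \<and>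
       (\<exists>C. Modules.module.subspace sy C \<and> C \<inter> ker_M = {0} \<and>
            {a + b | a b. a \<in> C \<and> b \<in> ker_M} = ker_set \<tau> \<and> (\<forall>y\<in>C. N y = 0)))"

text \<open>\<open>(\<sigma> + L P)(\<tau> + M Q) + N Q\<close> with \<open>P = 1 - \<sigma>' \<sigma>\<close> and \<open>Q = 1 - \<tau>' \<tau>\<close>.\<close>

definition Sigma_op ::
    "('x::ab_group_add \<Rightarrow> 'y::ab_group_add) \<Rightarrow> ('y \<Rightarrow> 'x) \<Rightarrow> ('y \<Rightarrow> 'x) \<Rightarrow> ('x \<Rightarrow> 'y) \<Rightarrow>
     ('x \<Rightarrow> 'y) \<Rightarrow> ('y \<Rightarrow> 'x) \<Rightarrow> ('y \<Rightarrow> 'y) \<Rightarrow> 'y \<Rightarrow> 'y" where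
  "Sigma_op \<sigma> \<sigma>' \<tau> \<tau>' L M N y =
     (let P = (\<lambda>x. x - \<sigma>' (\<sigma> x)); Q = (\<lambda>y. y - \<tau>' (\<tau> y)); x = \<tau> y + M (Q y)
      in \<sigma> x + L (P x) + N (Q y))"

definition perturbation_data ::
    "('f::field \<Rightarrow> 'a::ab_group_add \<Rightarrow> 'a) \<Rightarrow> ('f \<Rightarrow> 'b::ab_group_add \<Rightarrow> 'b) \<Rightarrow>
     ('a, 'b) z2_complex \<Rightarrow> ('a, 'b) z2_complex \<Rightarrow> ('a, 'b) z2_pinv \<Rightarrow> ('a, 'b) z2_pinv \<Rightarrow> bool" where
  "perturbation_data sp sm \<Delta> D \<Delta>' D' \<longleftrightarrow>
     cx_pseudo_inverse sp sm D D' \<and> cx_pseudo_inverse sp sm \<Delta> \<Delta>' \<and>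
     finite_rank sp (\<lambda>y. pinv_plus D' y - pinv_plus \<Delta>' y) \<and>
     finite_rank sm (\<lambda>x. pinv_minus D' x - pinv_minus \<Delta>' x)"

text \<open>
  The next two predicates express the defining formula of \<open>P(\<Delta>, D)\<close> in the cases \<open>Ind D \<le> 0\<close> and
  \<open>Ind D \<ge> 0\<close>, for given choices.
\<close>

definition formula_nonpos ::
    "('f::field \<Rightarrow> 'a::ab_group_add \<Rightarrow> 'a) \<Rightarrow> ('f \<Rightarrow> 'b::ab_group_add \<Rightarrow> 'b) \<Rightarrow>
     ('a, 'b) z2_complex \<Rightarrow> ('a, 'b) z2_complex \<Rightarrow> ('a, 'b) z2_pinv \<Rightarrow> ('a, 'b) z2_pinv \<Rightarrow>
     ('a \<Rightarrow> 'b) \<Rightarrow> ('b \<Rightarrow> 'a) \<Rightarrow> ('b \<Rightarrow> 'b) \<Rightarrow> _ \<Rightarrow> bool" where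
  "formula_nonpos sp sm \<Delta> D \<Delta>' D' L M N \<phi> \<longleftrightarrow>
     (let \<sigma>p = fold_plus D D'; \<sigma>m = fold_minus D D'; \<tau>p = fold_plus \<Delta> \<Delta>'; \<tau>m = fold_minus \<Delta> \<Delta>';
          K\<sigma> = ker_vs sp \<sigma>p; K\<tau> = ker_vs sm \<tau>m;
          KM = vs_of sm {y \<in> ker_set \<tau>m. M y = 0}; KN = vs_of sm {y \<in> ker_set \<tau>m. N y = 0};
          Xm = vs_of sm UNIV; C\<sigma> = coker_vs sm \<sigma>p; C\<tau> = coker_vs sp \<tau>m;
          k = vdim K\<sigma>; m = vdim KM; n = vdim KN;
          \<Sigma> = Sigma_op \<sigma>p \<sigma>m \<tau>m \<tau>p L M N
      in \<forall>s \<in> nonzero (det_line K\<sigma>). \<forall>t1 \<in> nonzero (det_line KM). \<forall>t0 \<in> nonzero (det_line KN).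
           let Ls_Nt1 = ext_map (k + m) C\<sigma> (vcoset sm (range \<sigma>p))
                          (wedge Xm k m (ext_map k Xm L s) (ext_map m Xm N t1));
               Mt0 = ext_map n C\<tau> (\<lambda>y. vcoset sp (range \<tau>m) (M y)) t0;
               t0_t1 = wedge K\<tau> n m (ext_map n K\<tau> id t0) (ext_map m K\<tau> id t1)
           in \<phi> (cx_tensor sp sm D
                   (ker_to_H sp \<sigma>p (range (d_minus D)) (H_plus sp D) s)
                   (coker_to_H sm \<sigma>p (H_minus sm D) Ls_Nt1))
              = inverse (class_det sm \<Sigma>) \<odot>\<^bsub>cx_line sp sm \<Delta>\<^esub>
                cx_tensor sp sm \<Delta>
                   (coker_to_H sp \<tau>m (H_plus sp \<Delta>) Mt0)
                   (ker_to_H sm \<tau>m (range (d_plus \<Delta>)) (H_minus sm \<Delta>) t0_t1))"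

definition formula_nonneg ::
    "('f::field \<Rightarrow> 'a::ab_group_add \<Rightarrow> 'a) \<Rightarrow> ('f \<Rightarrow> 'b::ab_group_add \<Rightarrow> 'b) \<Rightarrow>
     ('a, 'b) z2_complex \<Rightarrow> ('a, 'b) z2_complex \<Rightarrow> ('a, 'b) z2_pinv \<Rightarrow> ('a, 'b) z2_pinv \<Rightarrow>
     ('a \<Rightarrow> 'b) \<Rightarrow> ('b \<Rightarrow> 'a) \<Rightarrow> ('a \<Rightarrow> 'a) \<Rightarrow> _ \<Rightarrow> bool" where
  "formula_nonneg sp sm \<Delta> D \<Delta>' D' L M N \<phi> \<longleftrightarrow>
     (let \<sigma>p = fold_plus D D'; \<sigma>m = fold_minus D D'; \<tau>p = fold_plus \<Delta> \<Delta>'; \<tau>m = fold_minus \<Delta> \<Delta>';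
          K\<sigma> = ker_vs sp \<sigma>p; K\<tau> = ker_vs sm \<tau>m;
          KL = vs_of sp {x \<in> ker_set \<sigma>p. L x = 0}; KN = vs_of sp {x \<in> ker_set \<sigma>p. N x = 0};
          Xp = vs_of sp UNIV; C\<sigma> = coker_vs sm \<sigma>p; C\<tau> = coker_vs sp \<tau>m;
          k = vdim K\<tau>; l = vdim KL; n = vdim KN;
          \<Sigma> = Sigma_op \<tau>m \<tau>p \<sigma>p \<sigma>m M L N
      in \<forall>s0 \<in> nonzero (det_line KL). \<forall>s1 \<in> nonzero (det_line KN). \<forall>t \<in> nonzero (det_line K\<tau>).
           let s0_s1 = wedge K\<sigma> l n (ext_map l K\<sigma> id s0) (ext_map n K\<sigma> id s1);
               Ls1 = ext_map n C\<sigma> (\<lambda>x. vcoset sm (range \<sigma>p) (L x)) s1;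
               Ns0_Mt = ext_map (l + k) C\<tau> (vcoset sp (range \<tau>m))
                          (wedge Xp l k (ext_map l Xp N s0) (ext_map k Xp M t))
           in \<phi> (cx_tensor sp sm D
                   (ker_to_H sp \<sigma>p (range (d_minus D)) (H_plus sp D) s0_s1)
                   (coker_to_H sm \<sigma>p (H_minus sm D) Ls1))
              = inverse (class_det sp \<Sigma>) \<odot>\<^bsub>cx_line sp sm \<Delta>\<^esub>
                cx_tensor sp sm \<Delta>
                   (coker_to_H sp \<tau>m (H_plus sp \<Delta>) Ns0_Mt)
                   (ker_to_H sm \<tau>m (range (d_plus \<Delta>)) (H_minus sm \<Delta>) t))"

text \<open>
  \<open>\<phi>\<close> is the map \<open>|D| \<rightarrow> |\<Delta>|\<close> obtained from some choices. For index zero both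
  constructions are allowed.
\<close>

definition is_perturbation_map where
  "is_perturbation_map sp sm \<Delta> D \<phi> \<longleftrightarrow>
     \<phi> \<in> hom_vs (cx_line sp sm D) (cx_line sp sm \<Delta>) \<and> \<phi> \<in> extensional (carrier (cx_line sp sm D)) \<and>
     (\<exists>\<Delta>' D'. perturbation_data sp sm \<Delta> D \<Delta>' D' \<and>
       (Ind sp sm D \<le> 0 \<and>
          (\<exists>L M N. admissible sp sm (fold_plus D D') (fold_minus \<Delta> \<Delta>') L M N \<and>
                   formula_nonpos sp sm \<Delta> D \<Delta>' D' L M N \<phi>) \<or>
        Ind sp sm D \<ge> 0 \<and>
          (\<exists>L M N. admissible sm sp (fold_minus \<Delta> \<Delta>') (fold_plus D D') M L N \<and>
                   formula_nonneg sp sm \<Delta> D \<Delta>' D' L M N \<phi>)))"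

text \<open>\<open>P(\<Delta>, D)\<close>; the definite description is justified by the independence of all choices.\<close>

definition perturbation_iso where
  "perturbation_iso sp sm \<Delta> D = (THE \<phi>. is_perturbation_map sp sm \<Delta> D \<phi>)"

end

theory Submission
  imports Defs "HOL-Library.Function_Algebras" "HOL-Library.Product_Plus"
begin

text \<open>
  Choose pseudo-inverses and let \<open>\<sigma>\<^sub>+ : X\<^sub>+ \<rightarrow> X\<^sub>-\<close> be the folded operator of a Fredholm complex. Bases \<open>ss\<close> of a complement of
  \<open>Im \<sigma>\<^sub>-\<close> and \<open>cs\<close> of a complement of \<open>Im \<sigma>\<^sub>+\<close> determine a generator \<open>\<xi>\<close> of \<open>|D|\<close> and, after adding a space of sequences on which
  a shift compensates the index, an invertible completion \<open>T\<close> of \<open>\<sigma>\<^sub>+\<close>. For \<open>D\<close> and \<open>\<Delta>\<close> the completions differ by a map of finite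
  rank, and \<open>\<Sigma>\<close> is conjugate to \<open>T\<^sub>\<Delta>\<^sup>-\<^sup>1 T\<^sub>D\<close> up to an identity summand. Hence in both cases the defining formula says
  \<open>\<phi> \<xi>\<^sub>D = det (T\<^sub>D\<^sup>-\<^sup>1 T\<^sub>\<Delta>) \<xi>\<^sub>\<Delta>\<close>. Changing the pseudo-inverse conjugates \<open>T\<close> by unipotent maps composed with base changes, so
  this condition does not depend on the choices; choosing compatible pseudo-inverses for all three complexes, both claims become
  multiplicativity of the determinant.
\<close>

section \<open>Linear algebra modulo a subspace\<close>

text \<open>A perturbation of finite rank cannot make a folded operator of nonzero index invertible;
  hence the two cases of the defining formula and the maps \<open>L\<close>, \<open>M\<close>,
  \<open>N\<close>, which belong to a pair of complexes and cannot be kept for three. The completion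
  \<open>T\<close> belongs to a single complex, so that composition becomes formal. That close
  complexes have equal index is itself read off from the completions: an injective finite rank
  perturbation of the identity is surjective.

  The main obstacle is the change of pseudo-inverse. Two pseudo-inverses of one complex may differ
  by a map of infinite rank, and then their completions have no relative determinant. The
  automorphisms conjugating one completion into the other can however be compared between the two
  complexes, where they do differ by finite rank. Their unipotent parts have relative determinant 1
  over any field, because each acts trivially on the quotients of a flag with three steps; the base
  changes that remain are absorbed by the generators of the lines.\<close>

definition lcomb :: "('f::field \<Rightarrow> 'v::ab_group_add \<Rightarrow> 'v) \<Rightarrow> 'v list \<Rightarrow> (nat \<Rightarrow> 'f) \<Rightarrow> 'v" where
  "lcomb s bs a = (\<Sum>i<length bs. s (a i) (bs ! i))"

text \<open>\<open>bs\<close> lists representatives of a basis of \<open>Z/W\<close>.\<close>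

definition qbasis :: "('f::field \<Rightarrow> 'v::ab_group_add \<Rightarrow> 'v) \<Rightarrow> 'v set \<Rightarrow> 'v set \<Rightarrow> 'v list \<Rightarrow> bool" where
  "qbasis s Z W bs \<longleftrightarrow> set bs \<subseteq> Z \<and> (\<forall>x\<in>Z. \<exists>a. x - lcomb s bs a \<in> W) \<and>
     (\<forall>a. lcomb s bs a \<in> W \<longrightarrow> (\<forall>i<length bs. a i = 0))"

text \<open>Demanding zero beyond the length makes the coordinate function unique as a function on
  all naturals, so that additivity and homogeneity become equations between functions.\<close>

definition qcoord :: "('f::field \<Rightarrow> 'v::ab_group_add \<Rightarrow> 'v) \<Rightarrow> 'v set \<Rightarrow> 'v list \<Rightarrow> 'v \<Rightarrow> nat \<Rightarrow> 'f" where
  "qcoord s W bs x = (SOME a. x - lcomb s bs a \<in> W \<and> (\<forall>i\<ge>length bs. a i = 0))"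

section \<open>Coordinates modulo a subspace\<close>

context vector_space
begin

lemma lcomb_add: "lcomb scale bs (\<lambda>i. a i + b i) = lcomb scale bs a + lcomb scale bs b"
  by (simp add: lcomb_def scale_left_distrib sum.distrib)

lemma lcomb_diff: "lcomb scale bs (\<lambda>i. a i - b i) = lcomb scale bs a - lcomb scale bs b"
  by (simp add: lcomb_def scale_left_diff_distrib sum_subtractf)

lemma lcomb_scale: "lcomb scale bs (\<lambda>i. c * a i) = scale c (lcomb scale bs a)"
  by (simp add: lcomb_def scale_sum_right)

lemma lcomb_zero: "lcomb scale bs (\<lambda>i. 0) = 0"
  by (simp add: lcomb_def)

lemma lcomb_Nil [simp]: "lcomb scale [] a = 0"
  by (simp add: lcomb_def)

lemma lcomb_cong: "(\<And>i. i < length bs \<Longrightarrow> a i = b i) \<Longrightarrow> lcomb scale bs a = lcomb scale bs b"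
  by (simp add: lcomb_def)

lemma lcomb_unit: "i < length bs \<Longrightarrow> lcomb scale bs (\<lambda>j. if j = i then 1 else 0) = bs ! i"
  by (simp add: lcomb_def if_distrib[of "\<lambda>c. scale c _"] cong: if_cong)

lemma lcomb_sum: "lcomb scale bs (\<lambda>i. \<Sum>j\<in>J. f j i) = (\<Sum>j\<in>J. lcomb scale bs (f j))"
  by (simp add: lcomb_def scale_sum_left sum.swap[of _ J])

lemma lcomb_mem: "subspace Z \<Longrightarrow> set bs \<subseteq> Z \<Longrightarrow> lcomb scale bs a \<in> Z"
  unfolding lcomb_def by (intro subspace_sum subspace_scale) auto

lemma lcomb_span: "lcomb scale bs a \<in> span (set bs)"
  by (rule lcomb_mem) (auto intro: span_base)

lemma lcomb_append:
  "lcomb scale (us @ vs) a = lcomb scale us a + lcomb scale vs (\<lambda>i. a (i + length us))"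
proof -
  have "lcomb scale (us @ vs) a = (\<Sum>i<length us. scale (a i) ((us @ vs) ! i))
      + (\<Sum>i = length us..<length us + length vs. scale (a i) ((us @ vs) ! i))"
    unfolding lcomb_def lessThan_atLeast0 by (simp add: sum.atLeastLessThan_concat)
  also have "(\<Sum>i = length us..<length us + length vs. scale (a i) ((us @ vs) ! i))
      = (\<Sum>i<length vs. scale (a (i + length us)) (vs ! i))"
    using sum.shift_bounds_nat_ivl[of "\<lambda>i. scale (a i) ((us @ vs) ! i)" 0 "length us" "length vs"]
    by (simp add: lessThan_atLeast0 add.commute nth_append)
  finally show ?thesis by (simp add: lcomb_def nth_append)
qed

lemma qbasisI:
  assumes "set bs \<subseteq> Z" "\<And>x. x \<in> Z \<Longrightarrow> \<exists>a. x - lcomb scale bs a \<in> W"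
    "\<And>a i. lcomb scale bs a \<in> W \<Longrightarrow> i < length bs \<Longrightarrow> a i = 0"
  shows "qbasis scale Z W bs"
  using assms by (auto simp: qbasis_def)

lemma qbasis_set: "qbasis scale Z W bs \<Longrightarrow> set bs \<subseteq> Z"
  by (simp add: qbasis_def)

lemma qbasis_nth: "qbasis scale Z W bs \<Longrightarrow> i < length bs \<Longrightarrow> bs ! i \<in> Z"
  by (auto simp: qbasis_def)

lemma qbasis_indep: "qbasis scale Z W bs \<Longrightarrow> lcomb scale bs a \<in> W \<Longrightarrow> i < length bs \<Longrightarrow> a i = 0"
  by (simp add: qbasis_def)

lemma qcoord_rest:
  assumes "qbasis scale Z W bs" "x \<in> Z"
  shows "x - lcomb scale bs (qcoord scale W bs x) \<in> W"
    and "length bs \<le> i \<Longrightarrow> qcoord scale W bs x i = 0"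
proof -
  obtain a where a: "x - lcomb scale bs a \<in> W" using assms by (auto simp: qbasis_def)
  let ?b = "\<lambda>i. if i < length bs then a i else 0"
  have "x - lcomb scale bs ?b \<in> W \<and> (\<forall>i\<ge>length bs. ?b i = 0)"
    using a lcomb_cong[of bs ?b a] by simp
  from someI[of "\<lambda>a. x - lcomb scale bs a \<in> W \<and> (\<forall>i\<ge>length bs. a i = 0)", OF this]
  show "x - lcomb scale bs (qcoord scale W bs x) \<in> W"
    and "length bs \<le> i \<Longrightarrow> qcoord scale W bs x i = 0"
    by (auto simp: qcoord_def)
qed

lemma qcoord_unique:
  assumes q: "qbasis scale Z W bs" and W: "subspace W"
    and "x - lcomb scale bs a \<in> W" "x - lcomb scale bs b \<in> W" "i < length bs"
  shows "a i = b i"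
proof -
  have "lcomb scale bs (\<lambda>i. a i - b i) = (x - lcomb scale bs b) - (x - lcomb scale bs a)"
    by (simp add: lcomb_diff)
  then have "lcomb scale bs (\<lambda>i. a i - b i) \<in> W"
    using assms subspace_diff[OF W] by metis
  from qbasis_indep[OF q this] assms show ?thesis by simp
qed

lemma qcoord_eqI:
  assumes q: "qbasis scale Z W bs" and W: "subspace W" and x: "x \<in> Z"
    and a: "x - lcomb scale bs a \<in> W" and 0: "\<And>i. i \<ge> length bs \<Longrightarrow> a i = 0"
  shows "qcoord scale W bs x = a"
proof
  fix i
  show "qcoord scale W bs x i = a i"
    using qcoord_unique[OF q W qcoord_rest(1)[OF q x] a, of i] qcoord_rest(2)[OF q x, of i] 0[of i]
    by (cases "i < length bs") auto
qed

lemma qcoord_add: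
  assumes q: "qbasis scale Z W bs" and W: "subspace W" and Z: "subspace Z" and x: "x \<in> Z" "y \<in> Z"
  shows "qcoord scale W bs (x + y) = (\<lambda>i. qcoord scale W bs x i + qcoord scale W bs y i)"
proof (rule qcoord_eqI[OF q W])
  show "x + y \<in> Z" using x subspace_add[OF Z] by auto
  have "x + y - lcomb scale bs (\<lambda>i. qcoord scale W bs x i + qcoord scale W bs y i)
    = (x - lcomb scale bs (qcoord scale W bs x)) + (y - lcomb scale bs (qcoord scale W bs y))"
    by (simp add: lcomb_add)
  then show "x + y - lcomb scale bs (\<lambda>i. qcoord scale W bs x i + qcoord scale W bs y i) \<in> W"
    using qcoord_rest(1)[OF q x(1)] qcoord_rest(1)[OF q x(2)] subspace_add[OF W] by metis
qed (use qcoord_rest(2)[OF q] x in auto)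

lemma qcoord_scale:
  assumes q: "qbasis scale Z W bs" and W: "subspace W" and Z: "subspace Z" and x: "x \<in> Z"
  shows "qcoord scale W bs (scale c x) = (\<lambda>i. c * qcoord scale W bs x i)"
proof (rule qcoord_eqI[OF q W])
  show "scale c x \<in> Z" using x subspace_scale[OF Z] by auto
  have "scale c x - lcomb scale bs (\<lambda>i. c * qcoord scale W bs x i)
    = scale c (x - lcomb scale bs (qcoord scale W bs x))"
    by (simp add: lcomb_scale scale_right_diff_distrib)
  then show "scale c x - lcomb scale bs (\<lambda>i. c * qcoord scale W bs x i) \<in> W"
    using qcoord_rest(1)[OF q x(1)] subspace_scale[OF W] by metis
qed (use qcoord_rest(2)[OF q] x in auto)

lemma qcoord_zero:
  assumes q: "qbasis scale Z W bs" and W: "subspace W" and x: "x \<in> Z" "x \<in> W"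
  shows "qcoord scale W bs x = (\<lambda>i. 0)"
  using x by (intro qcoord_eqI[OF q W]) (auto simp: lcomb_zero)

lemma qcoord_nth:
  assumes q: "qbasis scale Z W bs" and W: "subspace W" and i: "i < length bs"
  shows "qcoord scale W bs (bs ! i) = (\<lambda>j. if j = i then 1 else 0)"
  using i by (intro qcoord_eqI[OF q W qbasis_nth[OF q]]) (auto simp: lcomb_unit subspace_0[OF W])

lemma qcoord_lcomb:
  assumes q: "qbasis scale Z W bs" and W: "subspace W" and Z: "subspace Z"
    and 0: "\<And>i. i \<ge> length bs \<Longrightarrow> a i = 0"
  shows "qcoord scale W bs (lcomb scale bs a) = a"
  using lcomb_mem[OF Z qbasis_set[OF q]] 0 by (intro qcoord_eqI[OF q W]) (auto simp: subspace_0[OF W])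

lemma qcoord_cong_mod:
  assumes q: "qbasis scale Z W bs" and W: "subspace W" and "x \<in> Z" "y \<in> Z" "x - y \<in> W"
  shows "qcoord scale W bs x = qcoord scale W bs y"
proof (rule qcoord_eqI[OF q W])
  have "x - lcomb scale bs (qcoord scale W bs y) = (x - y) + (y - lcomb scale bs (qcoord scale W bs y))"
    by simp
  then show "x - lcomb scale bs (qcoord scale W bs y) \<in> W"
    using qcoord_rest(1)[OF q] assms subspace_add[OF W] by metis
qed (use assms qcoord_rest(2)[OF q] in auto)

text \<open>For \<open>W\<close> \<subseteq> \<open>U\<close> \<subseteq> \<open>Z\<close> the basis
  of \<open>U/W\<close> comes first in the list. Independence is tested modulo \<open>U\<close>
  first, which kills the coefficients of \<open>es\<close>, and then modulo
  \<open>W\<close>.\<close>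

lemma qbasis_append:
  assumes es: "qbasis scale Z U es" and bs: "qbasis scale U W bs" and U: "subspace U" "U \<subseteq> Z" "W \<subseteq> U"
  shows "qbasis scale Z W (bs @ es)"
proof (rule qbasisI)
  show "set (bs @ es) \<subseteq> Z" using qbasis_set[OF es] qbasis_set[OF bs] U by auto
next
  fix x assume "x \<in> Z"
  then obtain a where a: "x - lcomb scale es a \<in> U" using es by (auto simp: qbasis_def)
  then obtain b where b: "x - lcomb scale es a - lcomb scale bs b \<in> W" using bs by (auto simp: qbasis_def)
  define c where "c i = (if i < length bs then b i else a (i - length bs))" for i
  have "lcomb scale (bs @ es) c = lcomb scale bs b + lcomb scale es a"
    unfolding lcomb_append by (intro arg_cong2[where f = "(+)"] lcomb_cong) (auto simp: c_def)
  with b show "\<exists>a. x - lcomb scale (bs @ es) a \<in> W"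
    by (intro exI[of _ c]) (simp add: algebra_simps)
next
  fix a i assume W: "lcomb scale (bs @ es) a \<in> W" and i: "i < length (bs @ es)"
  have bU: "lcomb scale bs a \<in> U" using lcomb_mem[OF U(1) qbasis_set[OF bs]] .
  have "lcomb scale es (\<lambda>i. a (i + length bs)) = lcomb scale (bs @ es) a - lcomb scale bs a"
    by (simp add: lcomb_append)
  then have "lcomb scale es (\<lambda>i. a (i + length bs)) \<in> U"
    using subspace_diff[OF U(1) _ bU] W U(3) by auto
  from qbasis_indep[OF es this] have 1: "a (j + length bs) = 0" if "j < length es" for j using that by auto
  then have "lcomb scale es (\<lambda>i. a (i + length bs)) = lcomb scale es (\<lambda>i. 0)"
    by (intro lcomb_cong) auto
  then have "lcomb scale bs a \<in> W" using W by (simp add: lcomb_append lcomb_zero)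
  from qbasis_indep[OF bs this] 1[of "i - length bs"] i show "a i = 0"
    by (cases "i < length bs") auto
qed

text \<open>Applied later with \<open>W\<close> the range of a folded operator: an identity of
  operators on the whole infinite dimensional space is checked on that range and on finitely many
  vectors.\<close>

lemma linear_eq_on_qbasis:
  assumes q: "qbasis scale Z W bs" and F: "Vector_Spaces.linear scale s' F" and G: "Vector_Spaces.linear scale s' G"
    and W: "\<And>x. x \<in> W \<Longrightarrow> F x = G x" and b: "\<And>i. i < length bs \<Longrightarrow> F (bs ! i) = G (bs ! i)"
    and x: "x \<in> Z"
  shows "F x = G x"
proof -
  interpret F: Vector_Spaces.linear scale s' F by fact
  interpret G: Vector_Spaces.linear scale s' G by fact
  obtain a where a: "x - lcomb scale bs a \<in> W" using q x by (auto simp: qbasis_def)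
  have "F (lcomb scale bs a) = G (lcomb scale bs a)"
    by (simp add: lcomb_def F.sum G.sum F.scale G.scale b)
  with W[OF a] show ?thesis by (simp add: F.diff G.diff)
qed

lemma qbasis_independent:
  assumes d: "distinct bs" and i: "independent (set bs)"
  shows "qbasis scale (span (set bs)) {0} bs"
proof (rule qbasisI)
  have bij: "bij_betw ((!) bs) {..<length bs} (set bs)" using d by (simp add: bij_betw_nth)
  have eq: "lcomb scale bs a = (\<Sum>v\<in>set bs. scale (a (the_inv_into {..<length bs} ((!) bs) v)) v)" for a
    unfolding lcomb_def using bij
    by (subst sum.reindex_bij_betw[OF bij, symmetric])
       (auto intro!: sum.cong simp: the_inv_into_f_f bij_betw_def)
  show "set bs \<subseteq> span (set bs)" by (auto intro: span_base)
  {
    fix x assume "x \<in> span (set bs)"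
    then obtain u where "x = (\<Sum>v\<in>set bs. scale (u v) v)" by (auto simp: span_finite)
    then have "x = lcomb scale bs (\<lambda>i. u (bs ! i))"
      unfolding lcomb_def by (subst (asm) sum.reindex_bij_betw[OF bij, symmetric]) simp
    then show "\<exists>a. x - lcomb scale bs a \<in> {0}" by auto
  }
  fix a j assume "lcomb scale bs a \<in> {0}" and j: "j < length bs"
  then have "(\<Sum>v\<in>set bs. scale (a (the_inv_into {..<length bs} ((!) bs) v)) v) = 0" using eq by auto
  then have "a (the_inv_into {..<length bs} ((!) bs) (bs ! j)) = 0"
    using i j unfolding dependent_finite[OF finite_set] by (metis nth_mem)
  then show "a j = 0" using bij j by (simp add: the_inv_into_f_f bij_betw_def)
qed

lemma independent_qbasis:
  assumes q: "qbasis scale Z {0} bs" and Z: "subspace Z"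
  shows "distinct bs" "independent (set bs)" "span (set bs) = Z"
proof -
  show d: "distinct bs"
  proof (rule ccontr)
    assume "\<not> distinct bs"
    then obtain i j where ij: "i < length bs" "j < length bs" "i \<noteq> j" "bs ! i = bs ! j"
      by (auto simp: distinct_conv_nth)
    have "lcomb scale bs (\<lambda>k. (if k = i then 1 else 0) - (if k = j then 1 else 0)) = 0"
      unfolding lcomb_diff using ij by (simp add: lcomb_unit)
    from qbasis_indep[OF q, of "\<lambda>k. (if k = i then 1 else 0) - (if k = j then 1 else 0)" i] this ij
    show False by simp
  qed
  have bij: "bij_betw ((!) bs) {..<length bs} (set bs)" using d by (simp add: bij_betw_nth)
  show "independent (set bs)"
  proof (rule independent_if_scalars_zero)
    fix f x assume f: "(\<Sum>x\<in>set bs. scale (f x) x) = 0" and x: "x \<in> set bs"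
    then obtain i where i: "i < length bs" "x = bs ! i" by (auto simp: in_set_conv_nth)
    have "lcomb scale bs (\<lambda>i. f (bs ! i)) = 0"
      unfolding lcomb_def using f by (subst (asm) sum.reindex_bij_betw[OF bij, symmetric]) simp
    from qbasis_indep[OF q, of "\<lambda>i. f (bs ! i)" i] this i show "f x = 0" by simp
  qed simp
  show "span (set bs) = Z"
  proof
    show "span (set bs) \<subseteq> Z" using q Z by (intro span_minimal) (auto simp: qbasis_def)
    show "Z \<subseteq> span (set bs)"
    proof
      fix x assume "x \<in> Z"
      then obtain a where "x = lcomb scale bs a" using q by (auto simp: qbasis_def)
      then show "x \<in> span (set bs)" using lcomb_span by auto
    qed
  qed
qed

section \<open>Complements, existence of quotient bases, and dimension\<close>

lemma subspace_projection:
  assumes "subspace S"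
  shows "\<exists>p. Vector_Spaces.linear scale scale p \<and> range p = S \<and> (\<forall>x\<in>S. p x = x)"
proof -
  interpret vp: vector_space_pair scale scale by unfold_locales
  have "Vector_Spaces.linear scale scale id" by (rule linear_id)
  from vp.linear_exists_left_inverse_on[OF this assms] obtain g
    where "range g \<subseteq> S" "Vector_Spaces.linear scale scale g" "\<forall>v\<in>S. g v = v" by auto
  moreover from this have "range g = S" by (metis image_subset_iff rangeI subset_antisym subsetI)
  ultimately show ?thesis by auto
qed

lemma subspace_complement:
  assumes S: "subspace S" and Z: "subspace Z" and SZ: "S \<subseteq> Z"
  shows "\<exists>C. subspace C \<and> C \<subseteq> Z \<and> C \<inter> S = {0} \<and> (\<forall>x\<in>Z. \<exists>y\<in>C. x - y \<in> S)"
proof -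
  obtain p where p: "Vector_Spaces.linear scale scale p" "range p = S" "\<And>x. x \<in> S \<Longrightarrow> p x = x"
    using subspace_projection[OF S] by metis
  interpret p: Vector_Spaces.linear scale scale p by fact
  let ?C = "Z \<inter> {x. p x = 0}"
  have "subspace ?C" using Z p.subspace_kernel by (rule subspace_inter)
  moreover have "?C \<inter> S = {0}"
  proof -
    have "x = 0" if "x \<in> ?C \<inter> S" for x using p(3)[of x] that by auto
    moreover have "0 \<in> ?C \<inter> S" using subspace_0[OF S] subspace_0[OF Z] p.zero by simp
    ultimately show ?thesis by blast
  qed
  moreover have "\<exists>y\<in>?C. x - y \<in> S" if "x \<in> Z" for x
  proof (rule bexI[of _ "x - p x"])
    have pS: "p x \<in> S" using p(2) by auto
    then show "x - (x - p x) \<in> S" by simp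
    show "x - p x \<in> ?C" using that pS SZ Z p(3)[OF pS] by (auto simp: p.diff intro: subspace_diff)
  qed
  ultimately show ?thesis by (intro exI[of _ ?C]) auto
qed

lemma qbasis_exists_span:
  assumes U: "subspace U" and B: "U \<subseteq> span B" "finite B"
  shows "\<exists>bs. qbasis scale U {0} bs"
proof -
  obtain C where C: "C \<subseteq> U" "independent C" "U \<subseteq> span C" using maximal_independent_subset by blast
  have "finite C" using independent_span_bound[OF B(2) C(2)] C B by auto
  then obtain bs where bs: "set bs = C" "distinct bs" using finite_distinct_list by blast
  have "span C = U" using C U by (simp add: span_minimal subset_antisym)
  then show ?thesis using qbasis_independent[of bs] bs C by auto
qed

text \<open>For a projection \<open>p\<close> onto \<open>U\<close>, the kernel of \<open>p\<close>
  inside \<open>Z\<close> is a copy of \<open>Z/U\<close>, and the map \<open>x - p x\<close>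
  carries the finite spanning set \<open>B\<close> to one of this copy.\<close>

lemma qbasis_exists:
  assumes U: "subspace U" and Z: "subspace Z" "U \<subseteq> Z" and B: "\<And>x. x \<in> Z \<Longrightarrow> \<exists>y\<in>span B. x - y \<in> U" "finite B"
  shows "\<exists>bs. qbasis scale Z U bs"
proof -
  obtain p where p: "Vector_Spaces.linear scale scale p" "range p = U" "\<And>x. x \<in> U \<Longrightarrow> p x = x"
    using subspace_projection[OF U] by metis
  interpret p: Vector_Spaces.linear scale scale p by fact
  have pU: "p x \<in> U" for x using p(2) by auto
  let ?C = "Z \<inter> {x. p x = 0}"
  have C: "subspace ?C" using Z(1) p.subspace_kernel by (rule subspace_inter)
  interpret q: Vector_Spaces.linear scale scale "\<lambda>x. x - p x"
    using p(1) linear_compose_sub by (unfold_locales) (auto simp: p.add p.scale scale_right_diff_distrib)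
  have "?C \<subseteq> span ((\<lambda>x. x - p x) ` B)"
  proof
    fix x assume x: "x \<in> ?C"
    then obtain y where y: "y \<in> span B" "x - y \<in> U" using B(1) by auto
    have "x - y = p x - p y" using p(3)[OF y(2)] by (simp add: p.diff)
    then have "x = y - p y" using x by (simp add: algebra_simps)
    then show "x \<in> span ((\<lambda>x. x - p x) ` B)" using y(1) q.span_image by auto
  qed
  from qbasis_exists_span[OF C this] B(2) obtain bs where bs: "qbasis scale ?C {0} bs" by auto
  have "qbasis scale Z U bs"
  proof (rule qbasisI)
    show "set bs \<subseteq> Z" using qbasis_set[OF bs] by auto
  next
    fix x assume "x \<in> Z"
    then have "x - p x \<in> ?C" using pU[of x] Z p(3)[OF pU[of x]] by (auto simp: p.diff intro: subspace_diff)
    with bs obtain a where "x - p x - lcomb scale bs a = 0" unfolding qbasis_def by blast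
    then have "x - p x = lcomb scale bs a" by simp
    then have "x - lcomb scale bs a = p x" by (simp add: algebra_simps)
    then show "\<exists>a. x - lcomb scale bs a \<in> U" using pU by metis
  next
    fix a i assume a: "lcomb scale bs a \<in> U" and i: "i < length bs"
    have "lcomb scale bs a \<in> ?C" using lcomb_mem[OF C qbasis_set[OF bs]] .
    with p(3)[OF a] have "lcomb scale bs a = 0" by simp
    then show "a i = 0" using qbasis_indep[OF bs] i by simp
  qed
  then show ?thesis ..
qed

lemma qbasis_exists_fin:
  assumes U: "subspace U" and Z: "subspace Z" "U \<subseteq> Z" and B: "Z \<subseteq> span B" "finite B"
  shows "\<exists>bs. qbasis scale Z U bs"
  by (rule qbasis_exists[OF U Z]) (use B subspace_0[OF U] in force)+

text \<open>With a projection \<open>p\<close> onto \<open>W\<close>, the map \<open>x - p x\<close>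
  turns bases modulo \<open>W\<close> into honest lists of vectors, to which the exchange bound for
  independent sets applies.\<close>

lemma qbasis_length_le:
  assumes us: "qbasis scale Z W us" and vs: "qbasis scale Z W vs" and W: "subspace W" and Z: "subspace Z"
  shows "length us \<le> length vs"
proof -
  let ?B = "set vs"
  obtain p where p: "Vector_Spaces.linear scale scale p" "range p = W" "\<And>x. x \<in> W \<Longrightarrow> p x = x"
    using subspace_projection[OF W] by metis
  interpret p: Vector_Spaces.linear scale scale p by fact
  interpret q: Vector_Spaces.linear scale scale "\<lambda>x. x - p x"
    by (unfold_locales) (auto simp: p.add p.scale scale_right_diff_distrib)
  have hom: "lcomb scale (map (\<lambda>x. x - p x) bs) a = lcomb scale bs a - p (lcomb scale bs a)" for bs a
    using q.sum[of "\<lambda>i. scale (a i) (bs ! i)" "{..<length bs}"] by (simp add: lcomb_def q.scale[symmetric])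
  have pW: "p x \<in> W" for x using p(2) by auto
  have "qbasis scale (span (set (map (\<lambda>x. x - p x) us))) {0} (map (\<lambda>x. x - p x) us)"
  proof (rule qbasisI)
    show "set (map (\<lambda>x. x - p x) us) \<subseteq> span (set (map (\<lambda>x. x - p x) us))" by (rule span_superset)
    fix x assume "x \<in> span (set (map (\<lambda>x. x - p x) us))"
    then obtain y where y: "y \<in> span (set us)" "x = y - p y" using q.span_image by auto
    from y(1) have "\<exists>a. y = lcomb scale us a"
    proof (induction rule: span_induct_alt)
      case base then show ?case using lcomb_zero by metis
    next
      case (step c x y)
      then obtain i a where "i < length us" "x = us ! i" "y = lcomb scale us a" by (auto simp: in_set_conv_nth)
      then have "scale c x + y = lcomb scale us (\<lambda>j. c * (if j = i then 1 else 0) + a j)"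
        unfolding lcomb_add lcomb_scale by (simp add: lcomb_unit)
      then show ?case by blast
    qed
    with y show "\<exists>a. x - lcomb scale (map (\<lambda>x. x - p x) us) a \<in> {0}" by (auto simp: hom)
  next
    fix a i assume "lcomb scale (map (\<lambda>x. x - p x) us) a \<in> {0}" "i < length (map (\<lambda>x. x - p x) us)"
    then show "a i = 0" using qbasis_indep[OF us, of a i] pW[of "lcomb scale us a"] by (simp add: hom)
  qed
  note iu = independent_qbasis[OF this subspace_span]
  have "set (map (\<lambda>x. x - p x) us) \<subseteq> span (set (map (\<lambda>x. x - p x) vs))"
  proof
    fix y assume "y \<in> set (map (\<lambda>x. x - p x) us)"
    then obtain x where x: "x \<in> Z" "y = x - p x" using qbasis_set[OF us] by auto
    then obtain a where a: "x - lcomb scale vs a \<in> W" using vs by (auto simp: qbasis_def)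
    have "x - lcomb scale vs a = p x - p (lcomb scale vs a)" using p(3)[OF a] by (simp add: p.diff)
    then have "y = lcomb scale (map (\<lambda>x. x - p x) vs) a" unfolding hom x(2) by (simp add: algebra_simps)
    then show "y \<in> span (set (map (\<lambda>x. x - p x) vs))" using lcomb_span by metis
  qed
  from independent_span_bound[OF finite_set iu(2) this]
  have "card (set (map (\<lambda>x. x - p x) us)) \<le> card (set (map (\<lambda>x. x - p x) vs))" by simp
  then show ?thesis
    using distinct_card[OF iu(1)] card_length[of "map (\<lambda>x. x - p x) vs"] by simp
qed

lemma qbasis_length:
  assumes "qbasis scale Z W us" "qbasis scale Z W vs" "subspace W" "subspace Z"
  shows "length us = length vs"
  using qbasis_length_le[OF assms] qbasis_length_le[OF assms(2,1,3,4)] by simp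

end

lemma linear_lcomb:
  assumes "Vector_Spaces.linear s s' f"
  shows "f (lcomb s bs a) = lcomb s' (map f bs) a"
proof -
  interpret Vector_Spaces.linear s s' f by fact
  show ?thesis by (simp add: lcomb_def sum scale)
qed

context vector_space
begin

section \<open>Maps of finite rank\<close>

lemma finite_rank_lcomb: "finite_rank scale (\<lambda>x. lcomb scale bs (a x))"
  using lcomb_span unfolding finite_rank_def by (intro exI[of _ "set bs"]) auto

lemma finite_rank_0: "finite_rank scale (\<lambda>x. 0)"
  unfolding finite_rank_def by (intro exI[of _ "{}"]) auto

lemma finite_rank_add:
  assumes "finite_rank scale f" "finite_rank scale g"
  shows "finite_rank scale (\<lambda>x. f x + g x)"
proof -
  obtain B C where B: "finite B" "range f \<subseteq> span B" and C: "finite C" "range g \<subseteq> span C"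
    using assms by (auto simp: finite_rank_def)
  have "f x + g x \<in> span (B \<union> C)" for x
  proof (rule span_add)
    show "f x \<in> span (B \<union> C)" using B span_mono[of B "B \<union> C"] by auto
    show "g x \<in> span (B \<union> C)" using C span_mono[of C "B \<union> C"] by auto
  qed
  then show ?thesis unfolding finite_rank_def using B C by (intro exI[of _ "B \<union> C"]) auto
qed

lemma finite_rank_uminus: "finite_rank scale f \<Longrightarrow> finite_rank scale (\<lambda>x. - f x)"
  unfolding finite_rank_def by (metis image_subset_iff span_neg)

lemma finite_rank_diff:
  assumes "finite_rank scale f" "finite_rank scale g"
  shows "finite_rank scale (\<lambda>x. f x - g x)"
  using finite_rank_add[OF assms(1) finite_rank_uminus[OF assms(2)]] by simp

lemma finite_rank_diff_swap:
  "finite_rank scale (\<lambda>x. f x - g x) \<Longrightarrow> finite_rank scale (\<lambda>x. g x - f x)"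
  using finite_rank_uminus[of "\<lambda>x. f x - g x"] by simp

lemma finite_rank_diff_trans:
  assumes "finite_rank scale (\<lambda>x. f x - g x)" "finite_rank scale (\<lambda>x. g x - h x)"
  shows "finite_rank scale (\<lambda>x. f x - h x)"
  using finite_rank_add[OF assms] by simp

lemma finite_rank_diff_add:
  assumes "finite_rank scale (\<lambda>x. f x - f' x)" "finite_rank scale (\<lambda>x. g x - g' x)"
  shows "finite_rank scale (\<lambda>x. (f x + g x) - (f' x + g' x))"
  using finite_rank_add[OF assms] by (simp add: algebra_simps)

lemma finite_rank_diff_diff:
  assumes "finite_rank scale (\<lambda>x. f x - f' x)" "finite_rank scale (\<lambda>x. g x - g' x)"
  shows "finite_rank scale (\<lambda>x. (f x - g x) - (f' x - g' x))"
  using finite_rank_diff[OF assms] by (simp add: algebra_simps)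

lemma finite_rank_diff_refl: "finite_rank scale (\<lambda>x. f x - f x)"
  using finite_rank_0 by simp

end

lemma finite_rank_compose_right: "finite_rank s f \<Longrightarrow> finite_rank s (\<lambda>x. f (g x))"
  by (auto simp: finite_rank_def)

lemma finite_rank_compose_left:
  assumes L: "Vector_Spaces.linear s s' L" and f: "finite_rank s f"
  shows "finite_rank s' (\<lambda>x. L (f x))"
proof -
  interpret Vector_Spaces.linear s s' L by fact
  obtain B where B: "finite B" "range f \<subseteq> vs1.span B" using f by (auto simp: finite_rank_def)
  then have "range (\<lambda>x. L (f x)) \<subseteq> vs2.span (L ` B)" using span_image[of B] by auto
  with B show ?thesis unfolding finite_rank_def by blast
qed

text \<open>Telescoping: \<open>f g - f' g' = f (g - g') + (f - f') g'\<close>.\<close>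

lemma finite_rank_diff_compose:
  assumes L: "Vector_Spaces.linear s s' f" and f: "finite_rank s' (\<lambda>x. f x - f' x)"
    and g: "finite_rank s (\<lambda>x. g x - g' x)"
  shows "finite_rank s' (\<lambda>x. f (g x) - f' (g' x))"
proof -
  interpret Vector_Spaces.linear s s' f by fact
  have "finite_rank s' (\<lambda>x. f (g x - g' x) + (f (g' x) - f' (g' x)))"
    by (intro vs2.finite_rank_add finite_rank_compose_left[OF L g] finite_rank_compose_right[OF f])
  then show ?thesis by (simp add: diff)
qed

section \<open>Determinants of finite rank perturbations\<close>

text \<open>With \<open>cs = map T bs\<close> this says that \<open>C\<close> is the matrix of
  \<open>T\<close>. Admitting an arbitrary list \<open>cs\<close> treats base changes and matrices
  of operators alike, and \<open>crep_trans\<close> multiplies either kind.\<close>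

definition crep :: "('f::field \<Rightarrow> 'v::ab_group_add \<Rightarrow> 'v) \<Rightarrow> 'v list \<Rightarrow> 'f mat \<Rightarrow> 'v list \<Rightarrow> bool" where
  "crep s bs C cs \<longleftrightarrow> C \<in> carrier_mat (length bs) (length cs) \<and>
     (\<forall>j<length cs. cs ! j = lcomb s bs (\<lambda>i. C $$ (i, j)))"

abbreviation finv :: "('v \<Rightarrow> 'w) \<Rightarrow> 'w \<Rightarrow> 'v" where "finv \<equiv> inv_into UNIV"

definition bijlin where
  "bijlin s s' A \<longleftrightarrow> Vector_Spaces.linear s s' A \<and> bij A"

text \<open>\<open>det (A\<^sup>-\<^sup>1 A')\<close>, for isomorphisms that differ by a map of finite rank.\<close>

definition kappa where
  "kappa s A A' = class_det s (\<lambda>x. finv A (A' x))"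

text \<open>Let \<open>N = A - 1\<close>. Over the polynomial ring, \<open>1 + X N\<close> has the
  inverse \<open>1 - X N + (X N)^2\<close>, so its determinant is a unit, that is, a constant
  polynomial. Its values at 0 and 1 are the determinants of the identity and of \<open>A\<close>. No
  eigenvalues and no division occur, so the argument holds over every field.\<close>

lemma cube_zero_det:
  fixes A :: "'f::field mat"
  assumes A: "A \<in> carrier_mat n n" and N: "(A - 1\<^sub>m n) * (A - 1\<^sub>m n) * (A - 1\<^sub>m n) = 0\<^sub>m n n"
  shows "det A = 1"
proof -
  let ?h = "map_mat (\<lambda>c::'f. [:c:])"
  define N where "N = A - 1\<^sub>m n"
  define X :: "'f poly" where "X = [:0, 1:]"
  define M where "M = X \<cdot>\<^sub>m ?h N"
  interpret h: comm_ring_hom "\<lambda>c::'f. [:c:]" by unfold_locales (auto simp: one_pCons)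
  interpret hi: inj_comm_ring_hom "\<lambda>c::'f. [:c:]" by unfold_locales auto
  have Nc: "N \<in> carrier_mat n n" using A by (auto simp: N_def)
  have hN: "?h N \<in> carrier_mat n n" using Nc by simp
  have Mc: "M \<in> carrier_mat n n" using hN by (simp add: M_def)
  have "?h N * ?h N * ?h N = ?h (N * N * N)"
    using h.mat_hom_mult[OF Nc Nc] h.mat_hom_mult[OF mult_carrier_mat[OF Nc Nc] Nc] by metis
  also have "\<dots> = 0\<^sub>m n n" using N by (auto simp: N_def)
  finally have 0: "?h N * ?h N * ?h N = 0\<^sub>m n n" .
  have sm: "(a \<cdot>\<^sub>m P) * (b \<cdot>\<^sub>m Q) = (a * b) \<cdot>\<^sub>m (P * Q)"
    if P: "P \<in> carrier_mat n n" and Q: "Q \<in> carrier_mat n n" for a b :: "'f poly" and P Q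
  proof -
    have "(a \<cdot>\<^sub>m P) * (b \<cdot>\<^sub>m Q) = a \<cdot>\<^sub>m (P * (b \<cdot>\<^sub>m Q))"
      using Q by (intro mult_smult_assoc_mat[OF P, where nc = n]) auto
    also have "P * (b \<cdot>\<^sub>m Q) = b \<cdot>\<^sub>m (P * Q)" by (rule mult_smult_distrib[OF P Q])
    also have "a \<cdot>\<^sub>m (b \<cdot>\<^sub>m (P * Q)) = (a * b) \<cdot>\<^sub>m (P * Q)" by (intro eq_matI) auto
    finally show ?thesis .
  qed
  have "M * M * M = (X * X * X) \<cdot>\<^sub>m (?h N * ?h N * ?h N)"
    unfolding M_def sm[OF hN hN] sm[OF mult_carrier_mat[OF hN hN] hN] ..
  then have M3: "M * M * M = 0\<^sub>m n n" unfolding 0 by simp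
  have M3': "M * (M * M) = 0\<^sub>m n n" using M3 assoc_mult_mat[OF Mc Mc Mc] by simp
  have MM: "M * M \<in> carrier_mat n n" using Mc by simp
  have "(1\<^sub>m n + M) * ((1\<^sub>m n - M) + M * M) = 1\<^sub>m n * ((1\<^sub>m n - M) + M * M) + M * ((1\<^sub>m n - M) + M * M)"
    using Mc MM by (intro add_mult_distrib_mat[of _ n n]) auto
  also have "M * ((1\<^sub>m n - M) + M * M) = M * (1\<^sub>m n - M) + M * (M * M)"
    using Mc MM by (intro mult_add_distrib_mat[of _ n n]) auto
  also have "M * (1\<^sub>m n - M) = M - M * M"
    using Mc by (subst mult_minus_distrib_mat[of _ n n]) auto
  also have "1\<^sub>m n * ((1\<^sub>m n - M) + M * M) = (1\<^sub>m n - M) + M * M" using Mc MM by simp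
  also have "(1\<^sub>m n - M) + M * M + (M - M * M + M * (M * M)) = 1\<^sub>m n"
    unfolding M3' using Mc MM by (intro eq_matI) auto
  finally have "det (1\<^sub>m n + M) * det ((1\<^sub>m n - M) + M * M) = 1"
    using det_mult[of "1\<^sub>m n + M" n "(1\<^sub>m n - M) + M * M"] Mc MM by simp
  then have "det (1\<^sub>m n + M) dvd 1" by (metis dvd_triv_left)
  then have deg: "degree (det (1\<^sub>m n + M)) = 0" by (metis is_unit_iff_degree dvd_0_left_iff zero_neq_one)
  then obtain c where c: "det (1\<^sub>m n + M) = [:c:]" by (metis degree_eq_zeroE)
  \<comment> \<open>Evaluation at \<open>a\<close> is a ring homomorphism and therefore commutes
    with the determinant.\<close>
  have ev: "poly (det (1\<^sub>m n + M)) a = det (1\<^sub>m n + a \<cdot>\<^sub>m N)" for a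
  proof -
    interpret e: comm_ring_hom "\<lambda>p::'f poly. poly p a" by unfold_locales auto
    have "map_mat (\<lambda>p. poly p a) (1\<^sub>m n + M) = 1\<^sub>m n + a \<cdot>\<^sub>m N"
      using Nc by (intro eq_matI) (auto simp: M_def X_def)
    then show ?thesis by (metis e.hom_det)
  qed
  have "1\<^sub>m n + 0 \<cdot>\<^sub>m N = 1\<^sub>m n" "1\<^sub>m n + 1 \<cdot>\<^sub>m N = A" using Nc A by (auto simp: N_def intro!: eq_matI)
  then show ?thesis using ev[of 0] ev[of 1] c by simp
qed

context vector_space
begin

lemma identity_mod_invariant:
  assumes "subspace E" "range (\<lambda>x. x - T x) \<subseteq> E" "x \<in> E"
  shows "T x \<in> E"
proof -
  have "x - T x \<in> E" using assms(2) by blast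
  from subspace_diff[OF assms(1,3) this] show ?thesis by simp
qed

section \<open>Matrices relative to lists of vectors\<close>

lemma crepD:
  assumes "crep scale bs C cs"
  shows "C \<in> carrier_mat (length bs) (length cs)"
    and "j < length cs \<Longrightarrow> cs ! j = lcomb scale bs (\<lambda>i. C $$ (i, j))"
  using assms by (auto simp: crep_def)

lemma crep_lcomb:
  assumes "crep scale bs C cs"
  shows "lcomb scale cs a = lcomb scale bs (\<lambda>i. \<Sum>j<length cs. C $$ (i, j) * a j)"
proof -
  have "lcomb scale cs a = (\<Sum>j<length cs. scale (a j) (lcomb scale bs (\<lambda>i. C $$ (i, j))))"
    using crepD[OF assms] by (simp add: lcomb_def)
  also have "\<dots> = lcomb scale bs (\<lambda>i. \<Sum>j<length cs. a j * C $$ (i, j))"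
    by (simp add: lcomb_sum lcomb_scale)
  finally show ?thesis by (simp add: mult.commute)
qed

lemma crep_trans:
  assumes C: "crep scale bs C cs" and D: "crep scale cs D ds"
  shows "crep scale bs (C * D) ds"
  unfolding crep_def
proof (intro conjI allI impI)
  note c = crepD(1)[OF C] and d = crepD(1)[OF D]
  show "C * D \<in> carrier_mat (length bs) (length ds)" using c d by simp
  fix j assume j: "j < length ds"
  have "ds ! j = lcomb scale bs (\<lambda>i. \<Sum>k<length cs. C $$ (i, k) * D $$ (k, j))"
    using crepD(2)[OF D j] crep_lcomb[OF C] by metis
  also have "\<dots> = lcomb scale bs (\<lambda>i. (C * D) $$ (i, j))"
    using c d j by (intro lcomb_cong) (simp add: scalar_prod_def lessThan_atLeast0)
  finally show "ds ! j = lcomb scale bs (\<lambda>i. (C * D) $$ (i, j))" .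
qed

lemma crep_self: "crep scale bs (1\<^sub>m (length bs)) bs"
  unfolding crep_def
proof (intro conjI allI impI)
  fix j assume j: "j < length bs"
  have "lcomb scale bs (\<lambda>i. 1\<^sub>m (length bs) $$ (i, j)) = lcomb scale bs (\<lambda>i. if i = j then 1 else 0)"
    using j by (intro lcomb_cong) auto
  then show "bs ! j = lcomb scale bs (\<lambda>i. 1\<^sub>m (length bs) $$ (i, j))"
    using j by (simp add: lcomb_unit)
qed simp

lemma crep_diff:
  assumes "crep scale bs C cs" "crep scale bs D ds" "length cs = length ds"
  shows "crep scale bs (C - D) (map (\<lambda>j. cs ! j - ds ! j) [0..<length cs])"
  unfolding crep_def
proof (intro conjI allI impI)
  note c = crepD(1)[OF assms(1)] and d = crepD(1)[OF assms(2)]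
  show "C - D \<in> carrier_mat (length bs) (length (map (\<lambda>j. cs ! j - ds ! j) [0..<length cs]))"
    using minus_carrier_mat[OF d, of C] assms(3) by simp
  fix j assume "j < length (map (\<lambda>j. cs ! j - ds ! j) [0..<length cs])"
  then have j: "j < length cs" by simp
  have "lcomb scale bs (\<lambda>i. (C - D) $$ (i, j)) = lcomb scale bs (\<lambda>i. C $$ (i, j) - D $$ (i, j))"
    using c d j assms(3) by (intro lcomb_cong) auto
  also have "\<dots> = cs ! j - ds ! j" using crepD(2)[OF assms(1)] crepD(2)[OF assms(2)] j assms(3)
    by (simp add: lcomb_diff)
  finally show "map (\<lambda>j. cs ! j - ds ! j) [0..<length cs] ! j = lcomb scale bs (\<lambda>i. (C - D) $$ (i, j))"
    using j by simp
qed

lemma crep_exists: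
  assumes q: "qbasis scale Z {0} bs" and cs: "set cs \<subseteq> Z"
  shows "\<exists>C. crep scale bs C cs"
proof (intro exI)
  let ?C = "mat (length bs) (length cs) (\<lambda>(i, j). qcoord scale {0} bs (cs ! j) i)"
  show "crep scale bs ?C cs"
    unfolding crep_def
  proof (intro conjI allI impI)
    fix j assume j: "j < length cs"
    have "lcomb scale bs (\<lambda>i. ?C $$ (i, j)) = lcomb scale bs (qcoord scale {0} bs (cs ! j))"
      using j by (intro lcomb_cong) auto
    then show "cs ! j = lcomb scale bs (\<lambda>i. ?C $$ (i, j))"
      using qcoord_rest(1)[OF q, of "cs ! j"] cs j by (auto simp: subset_iff)
  qed simp
qed

lemma crep_unique:
  assumes q: "qbasis scale Z {0} bs" and C: "crep scale bs C cs" and D: "crep scale bs D cs"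
  shows "C = D"
proof (rule eq_matI)
  note c = crepD[OF C] and d = crepD[OF D]
  show "dim_row C = dim_row D" "dim_col C = dim_col D" using c d by auto
  fix i j assume "i < dim_row D" "j < dim_col D"
  then have ij: "i < length bs" "j < length cs" using d(1) by auto
  have "lcomb scale bs (\<lambda>i. C $$ (i, j) - D $$ (i, j)) = 0"
    using c(2)[OF ij(2)] d(2)[OF ij(2)] by (simp add: lcomb_diff)
  then show "C $$ (i, j) = D $$ (i, j)" using qbasis_indep[OF q, of "\<lambda>i. C $$ (i, j) - D $$ (i, j)" i] ij by simp
qed

end

lemma crep_map:
  assumes f: "Vector_Spaces.linear s s' f" and C: "crep s bs C cs"
  shows "crep s' (map f bs) C (map f cs)"
  using C unfolding crep_def by (auto simp: linear_lcomb[OF f])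

lemma linear_vs:
  assumes "Vector_Spaces.linear s s' f"
  shows "vector_space s" "vector_space s'"
  using assms by (auto simp: Vector_Spaces.linear_def)

lemma linear_comp:
  "Vector_Spaces.linear s s' f \<Longrightarrow> Vector_Spaces.linear s' s'' g \<Longrightarrow> Vector_Spaces.linear s s'' (\<lambda>x. g (f x))"
  using Vector_Spaces.linear_compose[of s s' f s'' g] by (simp add: o_def)

lemma linear_range_subspace: "Vector_Spaces.linear s s' f \<Longrightarrow> Modules.module.subspace s' (range f)"
proof -
  assume "Vector_Spaces.linear s s' f"
  then interpret Vector_Spaces.linear s s' f .
  show ?thesis using subspace_image[OF vs1.subspace_UNIV] by simp
qed

lemma linear_kernel_subspace: "Vector_Spaces.linear s s' f \<Longrightarrow> Modules.module.subspace s (ker_set f)"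
proof -
  assume "Vector_Spaces.linear s s' f"
  then interpret Vector_Spaces.linear s s' f .
  show ?thesis by (rule subspace_kernel)
qed

lemma crep_map_comp:
  assumes T: "Vector_Spaces.linear s s T"
    and A: "crep s bs A (map T bs)" and B: "crep s bs B (map S bs)"
  shows "crep s bs (A * B) (map (\<lambda>x. T (S x)) bs)"
proof -
  interpret vector_space s using linear_vs[OF T] by simp
  have "crep s (map T bs) B (map T (map S bs))" by (rule crep_map[OF T B])
  from crep_trans[OF A this] show ?thesis by (simp add: o_def)
qed

lemma qbasis_map_inj:
  assumes f: "Vector_Spaces.linear s s' f" and q: "qbasis s Z {0} bs" and Z: "Modules.module.subspace s Z" and inj: "inj_on f Z"
  shows "qbasis s' (f ` Z) {0} (map f bs)"
proof -
  interpret Vector_Spaces.linear s s' f by fact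
  show ?thesis
  proof (rule vs2.qbasisI)
    show "set (map f bs) \<subseteq> f ` Z" using vs1.qbasis_set[OF q] by auto
    fix x assume "x \<in> f ` Z"
    then obtain y where y: "y \<in> Z" "x = f y" by auto
    then obtain a where "y = lcomb s bs a" using q by (auto simp: qbasis_def)
    then show "\<exists>a. x - lcomb s' (map f bs) a \<in> {0}" using y by (auto simp: linear_lcomb[OF f])
  next
    fix a i assume "lcomb s' (map f bs) a \<in> {0}" "i < length (map f bs)"
    moreover have "f (lcomb s bs a) = f 0 \<Longrightarrow> lcomb s bs a = 0"
      using inj_onD[OF inj _ vs1.lcomb_mem[OF Z vs1.qbasis_set[OF q]] vs1.subspace_0[OF Z]] by blast
    ultimately show "a i = 0" using vs1.qbasis_indep[OF q] by (simp add: linear_lcomb[OF f, symmetric])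
  qed
qed

context vector_space
begin

section \<open>Determinants of operators of determinant class\<close>

lemma det_basis_change:
  assumes E: "subspace E" and T: "Vector_Spaces.linear scale scale T"
    and bs: "qbasis scale E {0} bs" and cs: "qbasis scale E {0} cs"
    and A: "crep scale bs A (map T bs)" and B: "crep scale cs B (map T cs)"
  shows "det A = det B"
proof -
  obtain C where C: "crep scale bs C cs" using crep_exists[OF bs qbasis_set[OF cs]] by auto
  obtain D where D: "crep scale cs D bs" using crep_exists[OF cs qbasis_set[OF bs]] by auto
  have n: "length cs = length bs" by (rule qbasis_length[OF cs bs _ E]) simp
  let ?n = "length bs"
  have c: "C \<in> carrier_mat ?n ?n" "D \<in> carrier_mat ?n ?n" "A \<in> carrier_mat ?n ?n"
    using crepD(1)[OF C] crepD(1)[OF D] crepD(1)[OF A] n by auto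
  have "C * D = 1\<^sub>m (length bs)" using crep_unique[OF bs crep_trans[OF C D] crep_self] .
  then have "det C * det D = 1" using det_mult[OF c(1,2)] by simp
  moreover have "D * (A * C) = B"
    using crep_unique[OF cs crep_trans[OF D crep_trans[OF A crep_map[OF T C]]] B] .
  moreover have "det (D * (A * C)) = det D * (det A * det C)"
    using det_mult[OF c(2) mult_carrier_mat[OF c(3,1)]] det_mult[OF c(3,1)] by simp
  ultimately show ?thesis by (metis mult.assoc mult.commute mult.right_neutral)
qed

text \<open>\<open>T\<close> induces the identity on \<open>F/E\<close>. In a basis of
  \<open>F\<close> that prolongs one of \<open>E\<close> its matrix is therefore block triangular
  with diagonal blocks \<open>A\<close> and 1.\<close>

lemma det_extend:
  assumes E: "subspace E" "subspace F" "E \<subseteq> F" "F \<subseteq> span G" "finite G"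
    and T: "Vector_Spaces.linear scale scale T" and r: "range (\<lambda>x. x - T x) \<subseteq> E"
    and bs: "qbasis scale E {0} bs" and cs: "qbasis scale F {0} cs"
    and A: "crep scale bs A (map T bs)" and B: "crep scale cs B (map T cs)"
  shows "det A = det B"
proof -
  obtain es where es: "qbasis scale F E es" using qbasis_exists_fin[OF E(1,2,3,4,5)] by auto
  have q: "qbasis scale F {0} (bs @ es)"
    using qbasis_append[OF es bs E(1) E(3)] subspace_0[OF E(1)] by auto
  let ?n = "length bs" and ?k = "length es"
  have a: "A \<in> carrier_mat ?n ?n" using crepD(1)[OF A] by simp
  have "set (map (\<lambda>x. T x - x) es) \<subseteq> E" using r subspace_neg[OF E(1)] by fastforce
  from crep_exists[OF bs this] obtain X where X: "crep scale bs X (map (\<lambda>x. T x - x) es)" by auto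
  have x: "X \<in> carrier_mat ?n ?k" using crepD(1)[OF X] by simp
  let ?M = "four_block_mat A X (0\<^sub>m ?k ?n) (1\<^sub>m ?k)"
  have "crep scale (bs @ es) ?M (map T (bs @ es))"
    unfolding crep_def
  proof (intro conjI allI impI)
    show "?M \<in> carrier_mat (length (bs @ es)) (length (map T (bs @ es)))" using a x by simp
    fix j assume "j < length (map T (bs @ es))"
    then have j: "j < ?n + ?k" by simp
    show "map T (bs @ es) ! j = lcomb scale (bs @ es) (\<lambda>i. ?M $$ (i, j))"
    proof (cases "j < ?n")
      case True
      have "lcomb scale bs (\<lambda>i. ?M $$ (i, j)) = lcomb scale bs (\<lambda>i. A $$ (i, j))"
        using a x j True by (intro lcomb_cong) auto
      moreover have "lcomb scale es (\<lambda>i. ?M $$ (i + ?n, j)) = lcomb scale es (\<lambda>i. 0)"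
        using a x j True by (intro lcomb_cong) auto
      ultimately show ?thesis using crepD(2)[OF A, of j] True by (simp add: lcomb_append lcomb_zero nth_append)
    next
      case False
      then have j': "j - ?n < ?k" using j by simp
      have "lcomb scale bs (\<lambda>i. ?M $$ (i, j)) = lcomb scale bs (\<lambda>i. X $$ (i, j - ?n))"
        using a x j False by (intro lcomb_cong) auto
      also have "\<dots> = T (es ! (j - ?n)) - es ! (j - ?n)" using crepD(2)[OF X, of "j - ?n"] j' by simp
      finally have 1: "lcomb scale bs (\<lambda>i. ?M $$ (i, j)) = T (es ! (j - ?n)) - es ! (j - ?n)" .
      have "lcomb scale es (\<lambda>i. ?M $$ (i + ?n, j)) = lcomb scale es (\<lambda>i. if i = j - ?n then 1 else 0)"
        using a x j False by (intro lcomb_cong) auto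
      also have "\<dots> = es ! (j - ?n)" using j' by (simp add: lcomb_unit)
      finally show ?thesis using 1 j j' False by (simp add: lcomb_append nth_append)
    qed
  qed
  from det_basis_change[OF E(2) T q cs this B] have "det ?M = det B" .
  moreover have "det ?M = det A * det (1\<^sub>m ?k)"
    by (rule det_four_block_mat_lower_left_zero[OF a x]) auto
  ultimately show ?thesis by simp
qed

text \<open>\<open>E\<close> and \<open>E'\<close> need not be comparable, so both are enlarged to
  the span of their union.\<close>

lemma det_well_defined:
  assumes E: "subspace E" and E': "subspace E'"
    and T: "Vector_Spaces.linear scale scale T" and r: "range (\<lambda>x. x - T x) \<subseteq> E" "range (\<lambda>x. x - T x) \<subseteq> E'"
    and bs: "qbasis scale E {0} bs" and cs: "qbasis scale E' {0} cs"
    and A: "crep scale bs A (map T bs)" and B: "crep scale cs B (map T cs)"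
  shows "det A = det B"
proof -
  let ?F = "span (set bs \<union> set cs)"
  note ib = independent_qbasis[OF bs E] and ic = independent_qbasis[OF cs E']
  have EF: "E \<subseteq> ?F" "E' \<subseteq> ?F" using ib ic span_mono[of "set bs" "set bs \<union> set cs"] span_mono[of "set cs" "set bs \<union> set cs"] by auto
  obtain ds where ds: "qbasis scale ?F {0} ds"
    using qbasis_exists_span[OF subspace_span, of "set bs \<union> set cs"] by auto
  have "set (map T ds) \<subseteq> ?F"
  proof
    fix y assume "y \<in> set (map T ds)"
    then obtain x where x: "x \<in> ?F" "y = T x" using qbasis_set[OF ds] by auto
    then show "y \<in> ?F" using identity_mod_invariant[OF subspace_span _ x(1), of T] r EF by auto
  qed
  from crep_exists[OF ds this] obtain C where C: "crep scale ds C (map T ds)" by auto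
  show ?thesis
    using det_extend[OF E subspace_span EF(1) subset_refl _ T r(1) bs ds A C]
      det_extend[OF E' subspace_span EF(2) subset_refl _ T r(2) cs ds B C] by simp
qed

lemma representation_qcoord:
  assumes d: "distinct bs" and i: "independent (set bs)" and x: "x \<in> span (set bs)" and k: "k < length bs"
  shows "representation (set bs) x (bs ! k) = qcoord scale {0} bs x k"
proof -
  have q: "qbasis scale (span (set bs)) {0} bs" by (rule qbasis_independent[OF d i])
  have bij: "bij_betw ((!) bs) {..<length bs} (set bs)" using d by (simp add: bij_betw_nth)
  have "x = (\<Sum>v\<in>set bs. scale (representation (set bs) x v) v)"
    using sum_representation_eq[OF i x, of "set bs"] by simp
  also have "\<dots> = lcomb scale bs (\<lambda>j. representation (set bs) x (bs ! j))"
    unfolding lcomb_def by (subst sum.reindex_bij_betw[OF bij, symmetric]) simp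
  finally have "x - lcomb scale bs (\<lambda>j. representation (set bs) x (bs ! j)) \<in> {0}" by simp
  from qcoord_unique[OF q subspace_single_0 this qcoord_rest(1)[OF q x] k] show ?thesis .
qed

text \<open>The definition of \<open>class_det\<close> chooses a subspace and an ordered basis by
  \<open>SOME\<close>. Nothing is known about these choices beyond their defining conditions, but
  these suffice for \<open>det_well_defined\<close>. From here on \<open>class_det\<close> is
  computed in any convenient subspace.\<close>

lemma class_det_eqI:
  assumes E: "subspace E" and T: "Vector_Spaces.linear scale scale T" and r: "range (\<lambda>x. x - T x) \<subseteq> E"
    and bs: "qbasis scale E {0} bs" and A: "crep scale bs A (map T bs)"
  shows "class_det scale T = det A"
proof -
  let ?P = "\<lambda>E. (\<exists>B. finite B \<and> E = span B) \<and> T ` E \<subseteq> E \<and> range (\<lambda>x. x - T x) \<subseteq> E"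
  define E' where "E' = (SOME E. ?P E)"
  have "T ` E \<subseteq> E"
  proof
    fix y assume "y \<in> T ` E"
    then obtain x where x: "x \<in> E" "y = T x" by auto
    then show "y \<in> E" using identity_mod_invariant[OF E r x(1)] by simp
  qed
  then have "?P E" using independent_qbasis(3)[OF bs E] r by (auto intro!: exI[of _ "set bs"])
  then have P: "?P E'" unfolding E'_def by (rule someI)
  then obtain B where B: "finite B" "E' = span B" by auto
  have E': "subspace E'" using B by simp
  obtain es where es: "qbasis scale E' {0} es" using qbasis_exists_span[OF E', of B] B by auto
  let ?Q = "\<lambda>bs. distinct bs \<and> \<not> dependent (set bs) \<and> span (set bs) = E'"
  define cs where "cs = (SOME bs. ?Q bs)"
  have "?Q es" using independent_qbasis[OF es E'] by simp
  then have Q: "?Q cs" unfolding cs_def by (rule someI)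
  then have cs: "qbasis scale E' {0} cs" using qbasis_independent[of cs] by simp
  have Tcs: "set (map T cs) \<subseteq> E'" using P qbasis_set[OF cs] by auto
  let ?C = "mat (length cs) (length cs) (\<lambda>(i, j). representation (set cs) (T (cs ! j)) (cs ! i))"
  have "crep scale cs ?C (map T cs)"
    unfolding crep_def
  proof (intro conjI allI impI)
    fix j assume j: "j < length (map T cs)"
    have Tj: "T (cs ! j) \<in> span (set cs)" using Tcs j Q by auto
    have "lcomb scale cs (\<lambda>i. ?C $$ (i, j)) = lcomb scale cs (qcoord scale {0} cs (T (cs ! j)))"
      using j representation_qcoord[of cs "T (cs ! j)"] Q Tj by (intro lcomb_cong) auto
    then show "map T cs ! j = lcomb scale cs (\<lambda>i. ?C $$ (i, j))"
      using qcoord_rest(1)[OF cs, of "T (cs ! j)"] Tj Q j by auto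
  qed simp
  from det_well_defined[OF E' E T _ r cs bs this A] P have "det ?C = det A" by blast
  moreover have "class_det scale T = det ?C"
    unfolding class_det_def E'_def[symmetric] det_on_def cs_def[symmetric] by (simp add: Let_def)
  ultimately show ?thesis by simp
qed

text \<open>The parameter \<open>B\<close> allows the subspace to contain also the range of a second
  operator, so that one basis serves both.\<close>

lemma det_class_basis:
  assumes T: "Vector_Spaces.linear scale scale T" and f: "finite_rank scale (\<lambda>x. x - T x)" and B: "finite B"
  shows "\<exists>E bs A. subspace E \<and> span B \<subseteq> E \<and> range (\<lambda>x. x - T x) \<subseteq> E \<and> qbasis scale E {0} bs \<and> crep scale bs A (map T bs)"
proof -
  obtain G where G: "finite G" "range (\<lambda>x. x - T x) \<subseteq> span G" using f by (auto simp: finite_rank_def)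
  let ?E = "span (B \<union> G)"
  have r: "range (\<lambda>x. x - T x) \<subseteq> ?E" using G span_mono[of G "B \<union> G"] by auto
  obtain bs where bs: "qbasis scale ?E {0} bs" using qbasis_exists_span[OF subspace_span subset_refl, of "B \<union> G"] B G by auto
  have "set (map T bs) \<subseteq> ?E"
  proof
    fix y assume "y \<in> set (map T bs)"
    then obtain x where x: "x \<in> ?E" "y = T x" using qbasis_set[OF bs] by auto
    then show "y \<in> ?E" using identity_mod_invariant[OF subspace_span r x(1)] by simp
  qed
  from crep_exists[OF bs this] bs r show ?thesis
    by (intro exI[of _ ?E]) (auto intro: span_mono[THEN subsetD])
qed

text \<open>One subspace is taken that contains the ranges of \<open>1 - T\<close> and
  \<open>1 - S\<close>. It contains the range of \<open>1 - T S = (1 - S) + (1 - T) S\<close>, and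
  matrices multiply there.\<close>

lemma class_det_compose:
  assumes T: "Vector_Spaces.linear scale scale T" and fT: "finite_rank scale (\<lambda>x. x - T x)"
    and S: "Vector_Spaces.linear scale scale S" and fS: "finite_rank scale (\<lambda>x. x - S x)"
  shows "class_det scale (\<lambda>x. T (S x)) = class_det scale T * class_det scale S"
proof -
  obtain G where G: "finite G" "range (\<lambda>x. x - S x) \<subseteq> span G" using fS by (auto simp: finite_rank_def)
  obtain E bs A where E: "subspace E" "span G \<subseteq> E" and rT: "range (\<lambda>x. x - T x) \<subseteq> E"
    and bs: "qbasis scale E {0} bs" and A: "crep scale bs A (map T bs)"
    using det_class_basis[OF T fT G(1)] by auto
  have rS: "range (\<lambda>x. x - S x) \<subseteq> E" using G E by auto
  have "set (map S bs) \<subseteq> E"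
  proof
    fix y assume "y \<in> set (map S bs)"
    then obtain x where x: "x \<in> E" "y = S x" using qbasis_set[OF bs] by auto
    then show "y \<in> E" using identity_mod_invariant[OF E(1) rS x(1)] by simp
  qed
  from crep_exists[OF bs this] obtain B where B: "crep scale bs B (map S bs)" by auto
  have "range (\<lambda>x. x - T (S x)) \<subseteq> E"
  proof clarify
    fix x
    have "(x - S x) + (S x - T (S x)) \<in> E" using rT rS by (intro subspace_add[OF E(1)]) auto
    then show "x - T (S x) \<in> E" by simp
  qed
  from class_det_eqI[OF E(1) linear_comp[OF S T] this bs crep_map_comp[OF T A B]]
  have "class_det scale (\<lambda>x. T (S x)) = det (A * B)" .
  then show ?thesis
    using class_det_eqI[OF E(1) T rT bs A] class_det_eqI[OF E(1) S rS bs B]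
      det_mult[of A "length bs" B] crepD(1)[OF A] crepD(1)[OF B] by simp
qed

lemma class_det_id: "class_det scale (\<lambda>x. x) = 1"
proof -
  have "qbasis scale {0} {0} []" by (rule qbasisI) auto
  moreover have "crep scale [] (1\<^sub>m 0) (map (\<lambda>x. x) [])" by (simp add: crep_def)
  ultimately have "class_det scale (\<lambda>x. x) = det (1\<^sub>m 0 :: 'a mat)"
    by (intro class_det_eqI[OF subspace_single_0 linear_ident]) auto
  then show ?thesis by simp
qed

text \<open>On a finite dimensional \<open>E\<close> containing the range of \<open>1 - T\<close>,
  injectivity gives \<open>T E = E\<close> by counting. Any \<open>x\<close> differs from
  \<open>T x\<close> by an element of \<open>E\<close>, which is then also a value of
  \<open>T\<close>. This is the source of the stability of the index.\<close>

lemma inj_imp_surj_finite_rank: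
  assumes T: "Vector_Spaces.linear scale scale T" and f: "finite_rank scale (\<lambda>x. x - T x)" and inj: "inj T"
  shows "surj T"
proof -
  interpret T: Vector_Spaces.linear scale scale T by fact
  obtain E bs A where E: "subspace E" and r: "range (\<lambda>x. x - T x) \<subseteq> E" and bs: "qbasis scale E {0} bs"
    using det_class_basis[OF T f, of "{}"] by auto
  have TE: "subspace (T ` E)" "T ` E \<subseteq> E"
  proof -
    show "subspace (T ` E)" using T.subspace_image[OF E] .
    show "T ` E \<subseteq> E"
    proof
      fix y assume "y \<in> T ` E"
      then obtain x where x: "x \<in> E" "y = T x" by auto
      then show "y \<in> E" using identity_mod_invariant[OF E r x(1)] by simp
    qed
  qed
  have spanE: "E \<subseteq> span (set bs)" using independent_qbasis(3)[OF bs E] by simp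
  obtain es where es: "qbasis scale E (T ` E) es" using qbasis_exists_fin[OF TE(1) E TE(2) spanE] by auto
  have "qbasis scale (T ` E) {0} (map T bs)" using qbasis_map_inj[OF T bs E] inj by (auto intro: inj_on_subset)
  from qbasis_append[OF es this TE] have "qbasis scale E {0} (map T bs @ es)"
    using subspace_0[OF TE(1)] by auto
  from qbasis_length[OF this bs subspace_single_0 E] have "es = []" by simp
  then have ET: "E \<subseteq> T ` E" using es by (auto simp: qbasis_def)
  have "x \<in> range T" for x
  proof -
    have "x - T x \<in> E" using r by auto
    then obtain z where "x - T x = T z" using ET by auto
    then have "x = T (z + x)" by (simp add: T.add algebra_simps)
    then show ?thesis by blast
  qed
  then show ?thesis by auto
qed

end

text \<open>The last hypothesis says that \<iota> carries the range of \<open>1 - T\<close> onto a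
  set containing that of \<open>1 - T'\<close>; hence the image of a basis computes the second
  determinant with the same matrix. With \<iota> invertible this is conjugation invariance, with
  \<iota> the inclusion of a summand it is stabilisation by an identity.\<close>

lemma class_det_transfer:
  assumes \<iota>: "Vector_Spaces.linear s s' \<iota>" "inj \<iota>"
    and T: "Vector_Spaces.linear s s T" and f: "finite_rank s (\<lambda>x. x - T x)"
    and T': "Vector_Spaces.linear s' s' T'" and c: "\<And>x. T' (\<iota> x) = \<iota> (T x)"
    and r': "\<And>y. \<exists>x. y - T' y = \<iota> (x - T x)"
  shows "class_det s' T' = class_det s T"
proof -
  interpret Vector_Spaces.linear s s' \<iota> by fact
  obtain E bs A where E: "vs1.subspace E" and r: "range (\<lambda>x. x - T x) \<subseteq> E"
    and bs: "qbasis s E {0} bs" and A: "crep s bs A (map T bs)"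
    using vs1.det_class_basis[OF T f, of "{}"] by auto
  have q: "qbasis s' (\<iota> ` E) {0} (map \<iota> bs)"
    using qbasis_map_inj[OF \<iota>(1) bs E] \<iota>(2) by (auto intro: inj_on_subset)
  have "crep s' (map \<iota> bs) A (map \<iota> (map T bs))" by (rule crep_map[OF \<iota>(1) A])
  moreover have "map \<iota> (map T bs) = map T' (map \<iota> bs)" by (simp add: c)
  ultimately have A': "crep s' (map \<iota> bs) A (map T' (map \<iota> bs))" by (simp only:)
  have "range (\<lambda>y. y - T' y) \<subseteq> \<iota> ` E"
  proof clarify
    fix y
    obtain x where "y - T' y = \<iota> (x - T x)" using r' by blast
    then show "y - T' y \<in> \<iota> ` E" using r by auto
  qed
  from vs2.class_det_eqI[OF subspace_image[OF E] T' this q A'] vs1.class_det_eqI[OF E T r bs A]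
  show ?thesis by simp
qed

section \<open>Relative determinants of isomorphisms\<close>

lemma bijlinI: "Vector_Spaces.linear s s' A \<Longrightarrow> bij A \<Longrightarrow> bijlin s s' A"
  by (simp add: bijlin_def)

lemma bijlinD:
  assumes "bijlin s s' A"
  shows "Vector_Spaces.linear s s' A" "bij A" "inj A" "surj A" "A (finv A y) = y" "finv A (A x) = x"
  using assms by (auto simp: bijlin_def bij_def surj_f_inv_f)

lemma bijlin_inv:
  assumes A: "bijlin s s' A"
  shows "bijlin s' s (finv A)"
proof (rule bijlinI)
  interpret A: Vector_Spaces.linear s s' A using bijlinD(1)[OF A] .
  show "Vector_Spaces.linear s' s (finv A)"
  proof (unfold_locales, goal_cases)
    case (1 b1 b2) then show ?case using bijlinD[OF A] by (metis A.add)
  next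
    case (2 r b) then show ?case using bijlinD[OF A] by (metis A.scale)
  qed
  show "bij (finv A)" using bijlinD(2)[OF A] by (rule bij_imp_bij_inv)
qed

lemma bijlin_comp:
  assumes "bijlin s s' B" "bijlin s' s'' A"
  shows "bijlin s s'' (\<lambda>x. A (B x))"
  using assms linear_comp[of s s' B s'' A] bij_comp[of B A] by (auto simp: bijlin_def o_def)

lemma inv_comp_fun:
  assumes "bijlin s s' B" "bijlin s' s'' A"
  shows "finv (\<lambda>x. A (B x)) = (\<lambda>z. finv B (finv A z))"
  by (rule inv_equality) (auto simp: bijlinD[OF assms(1)] bijlinD[OF assms(2)])

lemma kappa_linear_finite_rank:
  assumes A: "bijlin s s' A" and A': "Vector_Spaces.linear s s' A'" and f: "finite_rank s' (\<lambda>x. A x - A' x)"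
  shows "Vector_Spaces.linear s s (\<lambda>x. finv A (A' x))" "finite_rank s (\<lambda>x. x - finv A (A' x))"
proof -
  show "Vector_Spaces.linear s s (\<lambda>x. finv A (A' x))"
    by (rule linear_comp[OF A' bijlinD(1)[OF bijlin_inv[OF A]]])
  interpret i: Vector_Spaces.linear s' s "finv A" using bijlinD(1)[OF bijlin_inv[OF A]] .
  have "finite_rank s (\<lambda>x. finv A (A x - A' x))"
    by (rule finite_rank_compose_left[OF i.linear_axioms f])
  then show "finite_rank s (\<lambda>x. x - finv A (A' x))" by (simp add: i.diff bijlinD[OF A])
qed

text \<open>\<open>(A B)^-1 A' B'\<close> is the product of \<open>B^-1 (A^-1 A') B\<close> and
  \<open>B^-1 B'\<close>, and the first factor is conjugate to \<open>A^-1 A'\<close>.\<close>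

lemma kappa_compose:
  assumes A: "bijlin s' s'' A" and A': "Vector_Spaces.linear s' s'' A'" and fA: "finite_rank s'' (\<lambda>x. A x - A' x)"
    and B: "bijlin s s' B" and B': "Vector_Spaces.linear s s' B'" and fB: "finite_rank s' (\<lambda>x. B x - B' x)"
  shows "kappa s (\<lambda>x. A (B x)) (\<lambda>x. A' (B' x)) = kappa s' A A' * kappa s B B'"
proof -
  interpret vector_space s using linear_vs[OF B'] by simp
  interpret iB: Vector_Spaces.linear s' s "finv B" using bijlinD(1)[OF bijlin_inv[OF B]] .
  let ?F = "\<lambda>y. finv A (A' y)"
  let ?G = "\<lambda>x. finv B (?F (B x))"
  note F = kappa_linear_finite_rank[OF A A' fA] and H = kappa_linear_finite_rank[OF B B' fB]
  have G: "Vector_Spaces.linear s s ?G"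
    by (intro linear_comp[OF linear_comp[OF _ F(1)]] bijlinD(1)[OF B] bijlinD(1)[OF bijlin_inv[OF B]])
  have fG: "finite_rank s (\<lambda>x. x - ?G x)"
  proof -
    have "finite_rank s (\<lambda>x. finv B (B x - ?F (B x)))"
      by (intro finite_rank_compose_left[OF iB.linear_axioms] finite_rank_compose_right[OF F(2)])
    then show ?thesis by (simp add: iB.diff bijlinD[OF B])
  qed
  have "class_det s ?G = class_det s' ?F"
  proof (rule class_det_transfer[OF bijlinD(1)[OF bijlin_inv[OF B]] _ F G])
    show "inj (finv B)" using bijlinD(3)[OF bijlin_inv[OF B]] .
    show "?G (finv B x) = finv B (?F x)" for x by (simp add: bijlinD[OF B])
    show "\<exists>x. y - ?G y = finv B (x - ?F x)" for y
      by (intro exI[of _ "B y"]) (simp add: iB.diff bijlinD[OF B])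
  qed
  moreover have "kappa s (\<lambda>x. A (B x)) (\<lambda>x. A' (B' x)) = class_det s (\<lambda>x. ?G (finv B (B' x)))"
    unfolding kappa_def inv_comp_fun[OF B A] by (simp add: bijlinD[OF B])
  ultimately show ?thesis
    using class_det_compose[OF G fG H] by (simp add: kappa_def)
qed

text \<open>\<open>A^-1 C = (A^-1 B) (B^-1 C)\<close>. Applied to the completions of three
  complexes, this is the composition law of perturbation isomorphisms.\<close>

lemma kappa_trans:
  assumes A: "bijlin s s' A" and B: "bijlin s s' B" and C: "Vector_Spaces.linear s s' C"
    and fAB: "finite_rank s' (\<lambda>x. A x - B x)" and fBC: "finite_rank s' (\<lambda>x. B x - C x)"
  shows "kappa s A B * kappa s B C = kappa s A C"
proof -
  interpret vector_space s using linear_vs[OF C] by simp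
  show ?thesis
    using class_det_compose[OF kappa_linear_finite_rank[OF A bijlinD(1)[OF B] fAB] kappa_linear_finite_rank[OF B C fBC]]
    by (simp add: kappa_def bijlinD[OF B])
qed

lemma kappa_self:
  assumes A: "bijlin s s' A"
  shows "kappa s A A = 1"
proof -
  interpret vector_space s using linear_vs[OF bijlinD(1)[OF A]] by simp
  show ?thesis using class_det_id by (simp add: kappa_def bijlinD[OF A])
qed

lemma kappa_swap:
  assumes A: "bijlin s s' A" and B: "bijlin s s' B" and f: "finite_rank s' (\<lambda>x. A x - B x)"
  shows "kappa s A B * kappa s B A = 1"
proof -
  interpret vector_space s' using linear_vs[OF bijlinD(1)[OF A]] by simp
  show ?thesis
    using kappa_trans[OF A B bijlinD(1)[OF A] f finite_rank_diff_swap[OF f]] kappa_self[OF A] by simp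
qed

text \<open>Separately \<open>g\<close> and \<open>h\<close> need not have determinants, since
  \<open>g - 1\<close> may have infinite rank. But there is a finite dimensional subspace
  \<open>?E\<close> that contains the range of \<open>g - h\<close> and is stable under
  \<open>g - 1\<close>; it is then stable under \<open>h\<close> and under the inverse of
  \<open>g\<close> as well. On it both matrices are unipotent and \<open>cube_zero_det\<close>
  applies.\<close>

lemma kappa_unipotent:
  assumes g: "bijlin s s g" and h: "Vector_Spaces.linear s s h" and f: "finite_rank s (\<lambda>x. g x - h x)"
    and g3: "\<And>x. (let n = (\<lambda>x. g x - x) in n (n (n x))) = 0"
    and h3: "\<And>x. (let n = (\<lambda>x. h x - x) in n (n (n x))) = 0"
  shows "kappa s g h = 1"
proof -
  interpret g: Vector_Spaces.linear s s g using bijlinD(1)[OF g] .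
  interpret h: Vector_Spaces.linear s s h by fact
  interpret ig: Vector_Spaces.linear s s "finv g" using bijlinD(1)[OF bijlin_inv[OF g]] .
  define n where "n = (\<lambda>x. g x - x)"
  define m where "m = (\<lambda>x. h x - x)"
  have n: "Vector_Spaces.linear s s n" and m: "Vector_Spaces.linear s s m"
    unfolding n_def m_def by (unfold_locales, auto simp: g.add g.scale h.add h.scale g.vs1.scale_right_diff_distrib)+
  interpret n: Vector_Spaces.linear s s n by fact
  have n3: "n (n (n x)) = 0" "m (m (m x)) = 0" for x using g3 h3 by (auto simp: n_def m_def Let_def)
  obtain B where B: "finite B" "range (\<lambda>x. g x - h x) \<subseteq> g.vs1.span B" using f by (auto simp: finite_rank_def)
  \<comment> \<open>The images under \<open>n\<close> and its square are added; as the cube of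
    \<open>n\<close> is zero, the span becomes stable under \<open>n\<close>.\<close>
  let ?G = "B \<union> n ` B \<union> n ` n ` B"
  let ?E = "g.vs1.span ?G"
  have E: "g.vs1.subspace ?E" by simp
  obtain bs where bs: "qbasis s ?E {0} bs"
    using g.vs1.qbasis_exists_span[OF E subset_refl] B by auto
  have nE: "n x \<in> ?E" if "x \<in> ?E" for x
  proof -
    have "n ` ?E = g.vs1.span (n ` ?G)" by (rule n.span_image[symmetric])
    also have "\<dots> \<subseteq> ?E"
    proof (rule g.vs1.span_minimal)
      have "n ` ?G \<subseteq> insert 0 ?G" by (auto simp: n3)
      moreover have "insert 0 ?G \<subseteq> ?E" unfolding insert_subset using g.vs1.span_superset g.vs1.span_zero by (intro conjI)
      ultimately show "n ` ?G \<subseteq> ?E" by (rule order_trans)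
    qed simp
    finally show ?thesis using that by auto
  qed
  have gE: "g x \<in> ?E" if "x \<in> ?E" for x
    using g.vs1.span_add[OF nE[OF that] that] by (simp add: n_def)
  have BE: "g x - h x \<in> ?E" for x using B(2) g.vs1.span_mono[of B ?G] by auto
  have hE: "h x \<in> ?E" if "x \<in> ?E" for x
    using g.vs1.span_diff[OF gE[OF that] BE[of x]] by simp
  have gx: "finv g (h x) = x - finv g (g x - h x)" for x by (simp add: ig.diff bijlinD[OF g])
  \<comment> \<open>The geometric series for the inverse of \<open>1 + n\<close> stops after the
    square. It exhibits the inverse as a polynomial in \<open>n\<close>, so that it preserves
    \<open>?E\<close>.\<close>
  have ginv: "finv g y = y - n y + n (n y)" for y
  proof -
    have "g (y - n y + n (n y)) = y"
      using n3(1)[of y] by (simp add: g.add g.diff n_def algebra_simps)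
    then show ?thesis using bijlinD(6)[OF g] by metis
  qed
  have igE: "finv g x \<in> ?E" if "x \<in> ?E" for x
    unfolding ginv using that nE by (intro g.vs1.span_add g.vs1.span_diff) auto
  have sub: "set bs \<subseteq> ?E" using g.vs1.qbasis_set[OF bs] .
  have "set (map g bs) \<subseteq> ?E" using sub gE by auto
  from g.vs1.crep_exists[OF bs this] obtain A where A: "crep s bs A (map g bs)" by auto
  have "set (map h bs) \<subseteq> ?E" using sub hE by auto
  from g.vs1.crep_exists[OF bs this] obtain H where H: "crep s bs H (map h bs)" by auto
  have "set (map (\<lambda>x. finv g (h x)) bs) \<subseteq> ?E" using sub hE igE by auto
  from g.vs1.crep_exists[OF bs this] obtain K where K: "crep s bs K (map (\<lambda>x. finv g (h x)) bs)" by auto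
  let ?n = "length bs"
  have carr: "A \<in> carrier_mat ?n ?n" "H \<in> carrier_mat ?n ?n" "K \<in> carrier_mat ?n ?n"
    using g.vs1.crepD(1)[OF A] g.vs1.crepD(1)[OF H] g.vs1.crepD(1)[OF K] by auto
  have det1: "det X = 1" if X: "crep s bs X (map f bs)" and f: "Vector_Spaces.linear s s (\<lambda>x. f x - x)"
    and f3: "\<And>x. (\<lambda>x. f x - x) ((\<lambda>x. f x - x) ((\<lambda>x. f x - x) x)) = 0" for X f
  proof (rule cube_zero_det)
    show Xc: "X \<in> carrier_mat ?n ?n" using g.vs1.crepD(1)[OF X] by simp
    let ?N = "X - 1\<^sub>m ?n" and ?f = "\<lambda>x. f x - x"
    have "map (\<lambda>j. map f bs ! j - bs ! j) [0..<length (map f bs)] = map ?f bs"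
      by (rule nth_equalityI) auto
    with g.vs1.crep_diff[OF X g.vs1.crep_self] have N: "crep s bs ?N (map ?f bs)" by simp
    have "crep s bs (?N * (?N * ?N)) (map (\<lambda>x. ?f (?f (?f x))) bs)"
      using crep_map_comp[OF f N crep_map_comp[OF f N N]] .
    moreover have "map (\<lambda>x. ?f (?f (?f x))) bs = map (\<lambda>x. 0) bs" using f3 by simp
    moreover have "crep s bs (0\<^sub>m ?n ?n) (map (\<lambda>x. 0) bs)"
      unfolding crep_def by (auto simp: lcomb_def)
    ultimately have "?N * (?N * ?N) = 0\<^sub>m ?n ?n" using g.vs1.crep_unique[OF bs] by metis
    moreover have "?N \<in> carrier_mat ?n ?n" by (rule minus_carrier_mat) simp
    ultimately show "?N * ?N * ?N = 0\<^sub>m ?n ?n" by (simp add: assoc_mult_mat[of ?N ?n ?n ?N ?n ?N ?n])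
  qed
  have "det A = 1" using det1[OF A] n n3(1) by (simp add: n_def)
  moreover have "det H = 1" using det1[OF H] m n3(2) by (simp add: m_def)
  moreover have "crep s bs (A * K) (map (\<lambda>x. g (finv g (h x))) bs)"
    by (rule crep_map_comp[OF g.linear_axioms A K])
  then have "A * K = H" using g.vs1.crep_unique[OF bs _ H] by (simp add: bijlinD[OF g])
  ultimately have dK: "det K = 1" using det_mult[OF carr(1,3)] by simp
  have r: "range (\<lambda>x. x - finv g (h x)) \<subseteq> ?E" using BE igE by (auto simp: gx)
  from g.vs1.class_det_eqI[OF E linear_comp[OF h ig.linear_axioms] r bs K] dK
  show ?thesis by (simp add: kappa_def)
qed

text \<open>\<open>W\<close> is the identity on \<open>K\<close> and has the matrix \<open>C\<close>
  modulo \<open>K\<close>, where \<open>K\<close> may be infinite dimensional. Only the finitely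
  many errors \<open>W (es ! j) - lcomb s es ...\<close> in \<open>K\<close> matter: they span the
  subspace \<open>?U\<close>, and the span of \<open>?U\<close> and \<open>es\<close> can be used to
  compute the determinant.\<close>

lemma class_det_mod:
  assumes W: "Vector_Spaces.linear s s W" and K: "Modules.module.subspace s K" and WK: "\<And>x. x \<in> K \<Longrightarrow> W x = x"
    and es: "qbasis s UNIV K es" and C: "C \<in> carrier_mat (length es) (length es)"
    and rel: "\<And>j. j < length es \<Longrightarrow> W (es ! j) - lcomb s es (\<lambda>i. C $$ (i, j)) \<in> K"
  shows "class_det s W = det C" "finite_rank s (\<lambda>x. x - W x)"
proof -
  interpret W: Vector_Spaces.linear s s W by fact
  let ?k = "map (\<lambda>j. W (es ! j) - lcomb s es (\<lambda>i. C $$ (i, j))) [0..<length es]"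
  let ?U = "W.vs1.span (set ?k)"
  have kK: "set ?k \<subseteq> K" using rel by auto
  have UK: "?U \<subseteq> K" using kK K by (intro W.vs1.span_minimal) auto
  from W.vs1.qbasis_exists_span[OF W.vs1.subspace_span subset_refl finite_set[of ?k]]
  obtain ks where ks: "qbasis s ?U {0} ks" ..
  let ?E = "W.vs1.span (set es \<union> ?U)"
  have E: "W.vs1.subspace ?E" by simp
  have UE: "?U \<subseteq> ?E" by (auto intro: W.vs1.span_base)
  have esU: "qbasis s ?E ?U es"
  proof (rule W.vs1.qbasisI)
    show "set es \<subseteq> ?E" by (auto intro: W.vs1.span_base)
    fix x assume "x \<in> ?E"
    then obtain y z where yz: "y \<in> W.vs1.span (set es)" "z \<in> W.vs1.span ?U" "x = y + z"
      unfolding W.vs1.span_Un by auto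
    from yz(2) have z: "z \<in> ?U" unfolding W.vs1.span_span .
    from yz(1) have "\<exists>a. y = lcomb s es a"
    proof (induction rule: W.vs1.span_induct_alt)
      case base then show ?case using W.vs1.lcomb_zero by metis
    next
      case (step c x y)
      then obtain i a where "i < length es" "x = es ! i" "y = lcomb s es a" by (auto simp: in_set_conv_nth)
      then have "s c x + y = lcomb s es (\<lambda>j. c * (if j = i then 1 else 0) + a j)"
        unfolding W.vs1.lcomb_add W.vs1.lcomb_scale by (simp add: W.vs1.lcomb_unit)
      then show ?case by blast
    qed
    then obtain a where "y = lcomb s es a" ..
    then have "x - lcomb s es a = z" using yz(3) by simp
    then show "\<exists>a. x - lcomb s es a \<in> ?U" using z by metis
  next
    fix a i assume "lcomb s es a \<in> ?U" "i < length es"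
    then show "a i = 0" using W.vs1.qbasis_indep[OF es] UK by auto
  qed
  have q: "qbasis s ?E {0} (ks @ es)"
    using W.vs1.qbasis_append[OF esU ks W.vs1.subspace_span UE] by (simp add: W.vs1.span_zero)
  let ?n = "length es" and ?m = "length ks"
  have "set ?k \<subseteq> ?U" by (rule W.vs1.span_superset)
  from W.vs1.crep_exists[OF ks this] obtain X where X: "crep s ks X ?k" by auto
  have x: "X \<in> carrier_mat ?m ?n" using W.vs1.crepD(1)[OF X] by simp
  \<comment> \<open>The identity block is the action on \<open>?U\<close>, and \<open>X\<close>
    records the errors.\<close>
  let ?M = "four_block_mat (1\<^sub>m ?m) X (0\<^sub>m ?n ?m) C"
  have M: "crep s (ks @ es) ?M (map W (ks @ es))"
    unfolding crep_def
  proof (intro conjI allI impI)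
    show "?M \<in> carrier_mat (length (ks @ es)) (length (map W (ks @ es)))" using C x by simp
    fix j assume "j < length (map W (ks @ es))"
    then have j: "j < ?m + ?n" by simp
    show "map W (ks @ es) ! j = lcomb s (ks @ es) (\<lambda>i. ?M $$ (i, j))"
    proof (cases "j < ?m")
      case True
      have "lcomb s ks (\<lambda>i. ?M $$ (i, j)) = lcomb s ks (\<lambda>i. if i = j then 1 else 0)"
        using C x j True by (intro W.vs1.lcomb_cong) auto
      moreover have "lcomb s es (\<lambda>i. ?M $$ (i + ?m, j)) = lcomb s es (\<lambda>i. 0)"
        using C x j True by (intro W.vs1.lcomb_cong) auto
      moreover have "W (ks ! j) = ks ! j"
        using WK W.vs1.qbasis_set[OF ks] UK True nth_mem by blast
      ultimately show ?thesis using True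
        by (simp add: W.vs1.lcomb_append W.vs1.lcomb_zero W.vs1.lcomb_unit nth_append)
    next
      case False
      then have j': "j - ?m < ?n" using j by simp
      have "lcomb s ks (\<lambda>i. ?M $$ (i, j)) = lcomb s ks (\<lambda>i. X $$ (i, j - ?m))"
        using C x j False by (intro W.vs1.lcomb_cong) auto
      moreover have "lcomb s es (\<lambda>i. ?M $$ (i + ?m, j)) = lcomb s es (\<lambda>i. C $$ (i, j - ?m))"
        using C x j False by (intro W.vs1.lcomb_cong) auto
      ultimately show ?thesis
        using W.vs1.crepD(2)[OF X, of "j - ?m"] j j' False by (simp add: W.vs1.lcomb_append nth_append diff_eq_eq)
    qed
  qed
  have r: "range (\<lambda>x. x - W x) \<subseteq> ?E"
  proof clarify
    fix x
    obtain a where a: "x - lcomb s es a \<in> K" using es unfolding qbasis_def by blast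
    have "x - W x = lcomb s es a - W (lcomb s es a)" using WK[OF a] by (simp add: W.diff algebra_simps)
    also have "W (lcomb s es a) = lcomb s (map W es) a" by (rule linear_lcomb[OF W])
    finally have 1: "x - W x = lcomb s es a - lcomb s (map W es) a" .
    have "set (map W es) \<subseteq> ?E"
    proof
      fix y assume "y \<in> set (map W es)"
      then obtain j where j: "j < ?n" "y = W (es ! j)" by (auto simp: in_set_conv_nth)
      have "lcomb s es (\<lambda>i. C $$ (i, j)) + (W (es ! j) - lcomb s es (\<lambda>i. C $$ (i, j))) \<in> ?E"
      proof (rule W.vs1.span_add)
        show "lcomb s es (\<lambda>i. C $$ (i, j)) \<in> ?E" by (rule W.vs1.lcomb_mem[OF E]) (auto intro: W.vs1.span_base)
        show "W (es ! j) - lcomb s es (\<lambda>i. C $$ (i, j)) \<in> ?E"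
          using j by (intro W.vs1.span_base UnI2) (auto intro!: W.vs1.span_base)
      qed
      then show "y \<in> ?E" using j by simp
    qed
    then show "x - W x \<in> ?E" unfolding 1
      by (intro W.vs1.span_diff W.vs1.lcomb_mem[OF E]) (auto intro: W.vs1.span_base)
  qed
  have "class_det s W = det ?M" by (rule W.vs1.class_det_eqI[OF E W r q M])
  also have "\<dots> = det (1\<^sub>m ?m) * det C" by (rule det_four_block_mat_lower_left_zero[OF _ x _ C]) auto
  finally show "class_det s W = det C" by simp
  show "finite_rank s (\<lambda>x. x - W x)"
    unfolding finite_rank_def using r W.vs1.independent_qbasis(3)[OF q E]
    by (intro exI[of _ "set (ks @ es)"]) auto
qed

section \<open>Presentations of module records\<close>

text \<open>
  \<open>\<pi>\<close> identifies the record \<open>V\<close> with \<open>Z/W\<close>. Every record in sight (subspaces, cohomology, exterior powers, duals, tensor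
  products) is presented in this way, which reduces statements about records to linear algebra on whole types.
\<close>

definition presents ::
    "('f::field \<Rightarrow> 'z::ab_group_add \<Rightarrow> 'z) \<Rightarrow> 'z set \<Rightarrow> 'z set \<Rightarrow> ('z \<Rightarrow> 'v) \<Rightarrow> ('f, 'v) module \<Rightarrow> bool" where
  "presents s Z W \<pi> V \<longleftrightarrow> vector_space s \<and> Modules.module.subspace s Z \<and> Modules.module.subspace s W \<and> W \<subseteq> Z \<and>
     carrier V = \<pi> ` Z \<and> (\<forall>x\<in>Z. \<forall>y\<in>Z. \<pi> x = \<pi> y \<longleftrightarrow> x - y \<in> W) \<and>
     (\<forall>x\<in>Z. \<forall>y\<in>Z. \<pi> x \<oplus>\<^bsub>V\<^esub> \<pi> y = \<pi> (x + y)) \<and> (\<forall>c. \<forall>x\<in>Z. c \<odot>\<^bsub>V\<^esub> \<pi> x = \<pi> (s c x)) \<and> \<zero>\<^bsub>V\<^esub> = \<pi> 0"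

text \<open>A line with generator \<open>g\<close> is the case in which the field itself, modulo
  zero, presents \<open>V\<close>. The general rules about \<open>presents\<close> thus apply to
  lines.\<close>

abbreviation is_line :: "('f::field, 'v) module \<Rightarrow> 'v \<Rightarrow> bool" where
  "is_line V g \<equiv> presents (*) UNIV {0} (\<lambda>c. c \<odot>\<^bsub>V\<^esub> g) V"

lemma vector_space_field: "vector_space ((*) :: 'f::field \<Rightarrow> 'f \<Rightarrow> 'f)"
  by unfold_locales (simp_all add: algebra_simps)

definition fscale :: "'f::field \<Rightarrow> ('c \<Rightarrow> 'f) \<Rightarrow> 'c \<Rightarrow> 'f" where
  "fscale c r = (\<lambda>b. c * r b)"

text \<open>All functions into the field form a vector space on a whole type, and the carrier of
  \<open>free_vs\<close> becomes the subspace \<open>fsupp\<close> of it.\<close>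

interpretation fs: vector_space "fscale :: 'f::field \<Rightarrow> ('c \<Rightarrow> 'f) \<Rightarrow> 'c \<Rightarrow> 'f"
  by unfold_locales (auto simp: fscale_def algebra_simps fun_eq_iff)

definition fsupp :: "'c set \<Rightarrow> ('c \<Rightarrow> 'f::field) set" where
  "fsupp B = {r. finite {b. r b \<noteq> 0} \<and> {b. r b \<noteq> 0} \<subseteq> B}"

lemma presentsD:
  assumes "presents s Z W \<pi> V"
  shows "vector_space s" "Modules.module.subspace s Z" "Modules.module.subspace s W" "W \<subseteq> Z"
    "carrier V = \<pi> ` Z" "x \<in> Z \<Longrightarrow> y \<in> Z \<Longrightarrow> \<pi> x = \<pi> y \<longleftrightarrow> x - y \<in> W"
    "x \<in> Z \<Longrightarrow> y \<in> Z \<Longrightarrow> \<pi> x \<oplus>\<^bsub>V\<^esub> \<pi> y = \<pi> (x + y)" "x \<in> Z \<Longrightarrow> c \<odot>\<^bsub>V\<^esub> \<pi> x = \<pi> (s c x)"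
    "\<zero>\<^bsub>V\<^esub> = \<pi> 0"
  using assms by (auto simp: presents_def)

section \<open>Subspaces and quotients as presented records\<close>

lemma vs_of_presents:
  assumes "vector_space s" "Modules.module.subspace s Z"
  shows "presents s Z {0} (\<lambda>x. x) (vs_of s Z)"
proof -
  interpret vector_space s by fact
  show ?thesis using assms by (auto simp: presents_def vs_of_def subspace_0)
qed

lemma vcoset_eq: "W +>\<^bsub>vs_of s Z\<^esub> v = (\<lambda>w. w + v) ` W"
  by (auto simp: a_r_coset_def' vs_of_def)

lemma coset_eq_iff:
  fixes x y :: "'v::ab_group_add"
  assumes "vector_space s" "Modules.module.subspace s W"
  shows "(\<lambda>w. w + x) ` W = (\<lambda>w. w + y) ` W \<longleftrightarrow> x - y \<in> W"
proof -
  interpret vector_space s by fact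
  show ?thesis
  proof
    assume "(\<lambda>w. w + x) ` W = (\<lambda>w. w + y) ` W"
    then have "0 + x \<in> (\<lambda>w. w + y) ` W" using subspace_0[OF assms(2)] by blast
    then show "x - y \<in> W" by auto
  next
    assume d: "x - y \<in> W"
    have "w + x \<in> (\<lambda>w. w + y) ` W" if "w \<in> W" for w
      using subspace_add[OF assms(2) that d] by (intro image_eqI[of _ _ "w + (x - y)"]) auto
    moreover have "w + y \<in> (\<lambda>w. w + x) ` W" if "w \<in> W" for w
      using subspace_diff[OF assms(2) that d] by (intro image_eqI[of _ _ "w - (x - y)"]) auto
    ultimately show "(\<lambda>w. w + x) ` W = (\<lambda>w. w + y) ` W" by blast
  qed
qed

lemma quot_presents:
  assumes vs: "vector_space s" and Z: "Modules.module.subspace s Z" and W: "Modules.module.subspace s W" "W \<subseteq> Z"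
  shows "presents s Z W (\<lambda>v. W +>\<^bsub>vs_of s Z\<^esub> v) (quot_vs (vs_of s Z) W)"
proof -
  interpret vector_space s by fact
  have add: "set_add (vs_of s Z) ((\<lambda>w. w + x) ` W) ((\<lambda>w. w + y) ` W) = (\<lambda>w. w + (x + y)) ` W" for x y
  proof -
    have "w + x + (w' + y) \<in> (\<lambda>w. w + (x + y)) ` W" if "w \<in> W" "w' \<in> W" for w w'
      using subspace_add[OF W(1) that] by (intro image_eqI[of _ _ "w + w'"]) auto
    moreover have "\<exists>a\<in>W. \<exists>b\<in>W. w + (x + y) = a + x + (b + y)" if "w \<in> W" for w
      using that subspace_0[OF W(1)] by (intro bexI[of _ w] bexI[of _ 0]) auto
    ultimately show ?thesis
      by (auto simp: set_add_def set_mult_def vs_of_def)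
  qed
  \<comment> \<open>Scalar multiplication in \<open>quot_vs\<close> is a union over representatives.
    All the cosets in it coincide, and the union is nonempty because \<open>W\<close> contains
    zero.\<close>
  have sc: "(\<Union>a\<in>(\<lambda>w. w + x) ` W. W +>\<^bsub>vs_of s Z\<^esub> (c \<odot>\<^bsub>vs_of s Z\<^esub> a)) = (\<lambda>w. w + s c x) ` W" for c x
  proof -
    have "(\<lambda>w. w + s c (w' + x)) ` W = (\<lambda>w. w + s c x) ` W" if "w' \<in> W" for w'
      using subspace_scale[OF W(1) that, of c] by (subst coset_eq_iff[OF vs W(1)]) (simp add: scale_right_distrib)
    then have "(\<Union>w'\<in>W. (\<lambda>w. w + s c (w' + x)) ` W) = (\<Union>w'\<in>W. (\<lambda>w. w + s c x) ` W)" by (intro SUP_cong) auto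
    also have "\<dots> = (\<lambda>w. w + s c x) ` W" using subspace_0[OF W(1)] by auto
    finally show ?thesis by (simp add: vcoset_eq) (simp add: vs_of_def)
  qed
  show ?thesis
    unfolding presents_def vcoset_eq
  proof (intro conjI ballI allI)
    show "carrier (quot_vs (vs_of s Z) W) = (\<lambda>x. (\<lambda>w. w + x) ` W) ` Z"
      by (auto simp: quot_vs_def A_RCOSETS_def RCOSETS_def r_coset_def vs_of_def)
    show "\<zero>\<^bsub>quot_vs (vs_of s Z) W\<^esub> = (\<lambda>w. w + 0) ` W" by (simp add: quot_vs_def)
    fix x y assume xy: "x \<in> Z" "y \<in> Z"
    show "((\<lambda>w. w + x) ` W = (\<lambda>w. w + y) ` W) = (x - y \<in> W)" by (rule coset_eq_iff[OF vs W(1)])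
    show "(\<lambda>w. w + x) ` W \<oplus>\<^bsub>quot_vs (vs_of s Z) W\<^esub> (\<lambda>w. w + y) ` W = (\<lambda>w. w + (x + y)) ` W"
      using add by (simp add: quot_vs_def)
  next
    fix c x
    show "c \<odot>\<^bsub>quot_vs (vs_of s Z) W\<^esub> (\<lambda>w. w + x) ` W = (\<lambda>w. w + s c x) ` W"
      using sc by (simp add: quot_vs_def)
  qed (use assms in auto)
qed

text \<open>Cohomology is a quotient of a kernel, whereas \<open>vcoset\<close> refers to the whole
  space; the coset itself is the same.\<close>

lemma vcoset_carrier: "W +>\<^bsub>vs_of s Z\<^esub> v = W +>\<^bsub>vs_of s Z'\<^esub> v"
  by (simp add: vcoset_eq)

text \<open>Makes the record-based theory of dimension and span available for every presented
  record.\<close>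

lemma presents_vectorspace:
  fixes V :: "('f::field, 'v) module"
  assumes p: "presents s Z W \<pi> V"
  shows "vectorspace class_ring V"
proof -
  interpret vector_space s by (rule presentsD[OF p])
  note D = presentsD(5-9)[OF p] and Z = presentsD(2)[OF p]
  note Zc = subspace_add[OF Z] subspace_scale[OF Z] subspace_0[OF Z] subspace_neg[OF Z]
  have "abelian_group V"
  proof (rule abelian_groupI)
    fix x assume "x \<in> carrier V"
    then obtain a where a: "a \<in> Z" "x = \<pi> a" using D by auto
    show "\<exists>y\<in>carrier V. y \<oplus>\<^bsub>V\<^esub> x = \<zero>\<^bsub>V\<^esub>"
      using a D Zc by (intro bexI[of _ "\<pi> (- a)"]) auto
  qed (use D Zc in \<open>auto simp: ac_simps\<close>)
  moreover have "module_axioms class_ring V"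
    by (rule module_axioms.intro) (use D Zc in \<open>auto simp: scale_left_distrib scale_right_distrib\<close>)
  moreover have "cring (class_ring :: 'f ring)" by (rule class_cring.cring_axioms)
  ultimately have "Module.module class_ring V" by (intro Module.module.intro)
  then show ?thesis by (intro vectorspace.intro class_field)
qed

lemma presents_finsum:
  fixes V :: "('f::field, 'v) module"
  assumes p: "presents s Z W \<pi> V" and I: "finite I" and x: "\<And>i. i \<in> I \<Longrightarrow> x i \<in> Z"
  shows "(\<Oplus>\<^bsub>V\<^esub>i\<in>I. a i \<odot>\<^bsub>V\<^esub> \<pi> (x i)) = \<pi> (\<Sum>i\<in>I. s (a i) (x i))"
proof -
  interpret vector_space s by (rule presentsD[OF p])
  interpret V: vectorspace class_ring V by (rule presents_vectorspace[OF p])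
  note D = presentsD(5-9)[OF p] and Z = presentsD(2)[OF p]
  show ?thesis
    using I x
  proof (induction I rule: finite_induct)
    case empty then show ?case using D by simp
  next
    case (insert j J)
    have m: "a i \<odot>\<^bsub>V\<^esub> \<pi> (x i) \<in> carrier V" if "i \<in> insert j J" for i
      using D insert.prems[OF that] subspace_scale[OF Z] by auto
    have "(\<Oplus>\<^bsub>V\<^esub>i\<in>insert j J. a i \<odot>\<^bsub>V\<^esub> \<pi> (x i)) = a j \<odot>\<^bsub>V\<^esub> \<pi> (x j) \<oplus>\<^bsub>V\<^esub> (\<Oplus>\<^bsub>V\<^esub>i\<in>J. a i \<odot>\<^bsub>V\<^esub> \<pi> (x i))"
      using insert.hyps m by (intro V.finsum_insert) auto
    also have "\<dots> = \<pi> (s (a j) (x j)) \<oplus>\<^bsub>V\<^esub> \<pi> (\<Sum>i\<in>J. s (a i) (x i))"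
      using insert D by simp
    also have "\<dots> = \<pi> (s (a j) (x j) + (\<Sum>i\<in>J. s (a i) (x i)))"
      using insert.prems by (intro D(3) subspace_sum[OF Z] subspace_scale[OF Z]) auto
    finally show ?case using insert.hyps by simp
  qed
qed

lemma presents_lincomb:
  fixes V :: "('f::field, 'v) module"
  assumes p: "presents s Z W \<pi> V" and A: "finite A" "A \<subseteq> Z" "inj_on \<pi> A"
  shows "LinearCombinations.module.lincomb V a (\<pi> ` A) = \<pi> (\<Sum>x\<in>A. s (a (\<pi> x)) x)"
proof -
  interpret vector_space s by (rule presentsD[OF p])
  interpret V: vectorspace class_ring V by (rule presents_vectorspace[OF p])
  note D = presentsD(5-9)[OF p] and Z = presentsD(2)[OF p]
  have "V.lincomb a (\<pi> ` A) = (\<Oplus>\<^bsub>V\<^esub>v\<in>\<pi> ` A. a v \<odot>\<^bsub>V\<^esub> v)" by (simp add: V.lincomb_def)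
  also have "\<dots> = (\<Oplus>\<^bsub>V\<^esub>x\<in>A. a (\<pi> x) \<odot>\<^bsub>V\<^esub> \<pi> x)"
    using A D subspace_scale[OF Z] by (intro V.add.finprod_reindex) auto
  also have "\<dots> = \<pi> (\<Sum>x\<in>A. s (a (\<pi> x)) x)" using A by (intro presents_finsum[OF p]) auto
  finally show ?thesis .
qed

lemma presents_span:
  fixes V :: "('f::field, 'v) module"
  assumes p: "presents s Z W \<pi> V" and A: "A \<subseteq> Z"
  shows "LinearCombinations.module.span class_ring V (\<pi> ` A) = \<pi> ` Modules.module.span s A"
proof -
  interpret vector_space s by (rule presentsD[OF p])
  interpret V: vectorspace class_ring V by (rule presents_vectorspace[OF p])
  note D = presentsD(5-9)[OF p] and Z = presentsD(2)[OF p]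
  have AZ: "span A \<subseteq> Z" using A Z by (rule span_minimal)
  show ?thesis
  proof
    show "V.span (\<pi> ` A) \<subseteq> \<pi> ` span A"
    proof
      fix v assume "v \<in> V.span (\<pi> ` A)"
      then obtain a B where B: "finite B" "B \<subseteq> \<pi> ` A" "v = V.lincomb a B" by (auto simp: V.span_def)
      then obtain C where C: "C \<subseteq> A" "inj_on \<pi> C" "B = \<pi> ` C" by (meson subset_image_inj)
      with B have "finite C" by (auto dest: finite_imageD)
      with C B have "v = \<pi> (\<Sum>x\<in>C. s (a (\<pi> x)) x)" using A by (simp add: presents_lincomb[OF p])
      moreover have "(\<Sum>x\<in>C. s (a (\<pi> x)) x) \<in> span A"
        using C by (intro span_sum span_scale span_base) auto
      ultimately show "v \<in> \<pi> ` span A" by blast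
    qed
    have sub: "\<pi> ` A \<subseteq> carrier V" using A D by auto
    note sm = V.span_is_submodule[OF sub]
    have "x \<in> Z \<and> \<pi> x \<in> V.span (\<pi> ` A)" if "x \<in> span A" for x
      using that
    proof (induction rule: span_induct_alt)
      case base
      then show ?case using submodule.zero_closed[OF sm] D(5) subspace_0[OF Z] by simp
    next
      case (step c x y)
      have xA: "\<pi> x \<in> V.span (\<pi> ` A)" using V.in_own_span[OF sub] step.hyps by auto
      have "c \<odot>\<^bsub>V\<^esub> \<pi> x \<oplus>\<^bsub>V\<^esub> \<pi> y \<in> V.span (\<pi> ` A)"
        using submodule.m_closed[OF sm submodule.smult_closed[OF sm _ xA], of c "\<pi> y"] step.IH by simp
      moreover have "x \<in> Z" "y \<in> Z" using step.hyps step.IH A by auto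
      ultimately show ?case using D subspace_scale[OF Z] subspace_add[OF Z] by simp
    qed
    then show "\<pi> ` span A \<subseteq> V.span (\<pi> ` A)" by auto
  qed
qed

lemma class_span_eq:
  assumes "vector_space s" "Modules.module.subspace s Z" "R \<subseteq> Z"
  shows "LinearCombinations.module.span class_ring (vs_of s Z) R = Modules.module.span s R"
  using presents_span[OF vs_of_presents[OF assms(1,2)] assms(3)] by simp

lemma presents_lcomb_eq:
  assumes p: "presents s Z W \<pi> V" and q: "qbasis s Z W bs" and x: "x \<in> Z"
  shows "\<pi> x = \<pi> (lcomb s bs (qcoord s W bs x))"
proof -
  interpret vector_space s by (rule presentsD[OF p])
  show ?thesis
    using presentsD(6)[OF p x lcomb_mem[OF presentsD(2)[OF p] qbasis_set[OF q]]] qcoord_rest(1)[OF q x] by simp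
qed

text \<open>\<pi> is injective on the list: an equality of two images would put a difference of two
  entries into \<open>W\<close>, a relation with coefficients 1 and -1. The images then form a basis
  in the sense of the record.\<close>

lemma presents_vdim:
  fixes V :: "('f::field, 'v) module"
  assumes p: "presents s Z W \<pi> V" and q: "qbasis s Z W bs"
  shows "vdim V = length bs"
proof -
  interpret vector_space s by (rule presentsD[OF p])
  interpret V: vectorspace class_ring V by (rule presents_vectorspace[OF p])
  note D = presentsD(5-9)[OF p] and Z = presentsD(2)[OF p]
  have bsZ: "set bs \<subseteq> Z" using qbasis_set[OF q] .
  have eq: "i = j" if ij: "i < length bs" "j < length bs" "\<pi> (bs ! i) = \<pi> (bs ! j)" for i j
  proof (rule ccontr)
    assume ne: "i \<noteq> j"
    have "bs ! i - bs ! j \<in> W" using ij D(2) bsZ by (metis nth_mem subsetD)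
    then have "lcomb s bs (\<lambda>k. (if k = i then 1 else 0) - (if k = j then 1 else 0)) \<in> W"
      unfolding lcomb_diff using ij by (simp add: lcomb_unit)
    from qbasis_indep[OF q this ij(1)] ne show False by simp
  qed
  have d: "distinct bs" "inj_on \<pi> (set bs)"
  proof -
    show "distinct bs" using eq unfolding distinct_conv_nth by metis
    show "inj_on \<pi> (set bs)"
    proof (rule inj_onI)
      fix x y assume "x \<in> set bs" "y \<in> set bs" "\<pi> x = \<pi> y"
      then show "x = y" using eq by (auto simp: in_set_conv_nth)
    qed
  qed
  have bij: "bij_betw ((!) bs) {..<length bs} (set bs)" using d by (simp add: bij_betw_nth)
  have lc: "V.lincomb a (\<pi> ` set bs) = \<pi> (lcomb s bs (\<lambda>i. a (\<pi> (bs ! i))))" for a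
    using presents_lincomb[OF p finite_set bsZ d(2), of a]
    unfolding lcomb_def by (simp add: sum.reindex_bij_betw[OF bij, symmetric])
  have sub: "\<pi> ` set bs \<subseteq> carrier V" using bsZ D by auto
  have "V.basis (\<pi> ` set bs)"
    unfolding V.basis_def
  proof (intro conjI)
    show "\<pi> ` set bs \<subseteq> carrier V" by fact
    show "\<not> V.lin_dep (\<pi> ` set bs)"
    proof
      assume "V.lin_dep (\<pi> ` set bs)"
      from V.finite_lin_dep[OF _ this sub] obtain a v where
        av: "V.lincomb a (\<pi> ` set bs) = \<zero>\<^bsub>V\<^esub>" "v \<in> \<pi> ` set bs" "a v \<noteq> 0" by auto
      then obtain i where i: "i < length bs" "v = \<pi> (bs ! i)" by (auto simp: in_set_conv_nth)
      have "lcomb s bs (\<lambda>i. a (\<pi> (bs ! i))) - 0 \<in> W"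
        using av(1) lc D lcomb_mem[OF Z bsZ] subspace_0[OF Z] by metis
      then show False using qbasis_indep[OF q, of "\<lambda>i. a (\<pi> (bs ! i))" i] i av by simp
    qed
    have "carrier V \<subseteq> \<pi> ` span (set bs)"
      using presents_lcomb_eq[OF p q] lcomb_span D by auto
    moreover have "\<pi> ` span (set bs) \<subseteq> carrier V" using span_minimal[OF bsZ Z] D by auto
    ultimately show "V.span (\<pi> ` set bs) = carrier V"
      using presents_span[OF p bsZ] by auto
  qed
  then have "V.dim = card (\<pi> ` set bs)" by (intro V.dim_basis) auto
  also have "\<dots> = length bs" using d by (simp add: card_image distinct_card)
  finally show ?thesis .
qed

text \<open>Carries the finiteness in \<open>fredholm\<close> over to lists: representatives of a
  finite spanning set span \<open>Z\<close> modulo \<open>W\<close>.\<close>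

lemma presents_fin_dim:
  fixes V :: "('f::field, 'v) module"
  assumes p: "presents s Z W \<pi> V" and f: "vectorspace.fin_dim class_ring V"
  shows "\<exists>bs. qbasis s Z W bs"
proof -
  interpret vector_space s by (rule presentsD[OF p])
  interpret V: vectorspace class_ring V by (rule presents_vectorspace[OF p])
  note D = presentsD(5-9)[OF p] and Z = presentsD(2)[OF p]
  obtain A where A: "finite A" "A \<subseteq> carrier V" "V.span A = carrier V" using f by (auto simp: V.fin_dim_def)
  then obtain B where B: "finite B" "B \<subseteq> Z" "A = \<pi> ` B" by (metis D(1) finite_subset_image)
  show ?thesis
  proof (rule qbasis_exists[OF presentsD(3)[OF p] Z presentsD(4)[OF p] _ B(1)])
    fix x assume x: "x \<in> Z"
    then have "\<pi> x \<in> \<pi> ` span B" using A B D presents_span[OF p B(2)] by auto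
    then obtain y where "y \<in> span B" "\<pi> x = \<pi> y" by auto
    moreover from this have "y \<in> Z" using span_minimal[OF B(2) Z] by auto
    ultimately show "\<exists>y\<in>span B. x - y \<in> W" using D x by auto
  qed
qed

lemma line_of_qbasis:
  assumes p: "presents s Z W \<pi> V" and q: "qbasis s Z W [g]"
  shows "is_line V (\<pi> g)" and "x \<in> Z \<Longrightarrow> \<pi> x = qcoord s W [g] x 0 \<odot>\<^bsub>V\<^esub> \<pi> g"
proof -
  interpret vector_space s by (rule presentsD[OF p])
  note D = presentsD(5-9)[OF p] and Z = presentsD(2)[OF p]
  have g: "g \<in> Z" using qbasis_set[OF q] by simp
  have lc: "lcomb s [g] a = s (a 0) g" for a by (simp add: lcomb_def)
  show x: "\<pi> x = qcoord s W [g] x 0 \<odot>\<^bsub>V\<^esub> \<pi> g" if "x \<in> Z" for x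
    using presents_lcomb_eq[OF p q that] D g by (simp add: lc)
  have carr: "carrier V = range (\<lambda>c. c \<odot>\<^bsub>V\<^esub> \<pi> g)"
  proof
    show "carrier V \<subseteq> range (\<lambda>c. c \<odot>\<^bsub>V\<^esub> \<pi> g)"
    proof
      fix v assume "v \<in> carrier V"
      then obtain z where "z \<in> Z" "v = \<pi> z" using D(1) by auto
      then show "v \<in> range (\<lambda>c. c \<odot>\<^bsub>V\<^esub> \<pi> g)" using x[of z] by blast
    qed
    show "range (\<lambda>c. c \<odot>\<^bsub>V\<^esub> \<pi> g) \<subseteq> carrier V" using D g subspace_scale[OF Z] by auto
  qed
  have inj: "s c g \<in> W \<longleftrightarrow> c = 0" for c
    using qbasis_indep[OF q, of "\<lambda>_. c" 0] subspace_0[OF presentsD(3)[OF p]] by (auto simp: lc)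
  have eq: "\<pi> (s c g) = \<pi> (s d g) \<longleftrightarrow> c - d = 0" for c d
    using D(2)[of "s c g" "s d g"] g subspace_scale[OF Z] inj[of "c - d"] by (simp add: scale_left_diff_distrib)
  interpret F: vector_space "(*) :: 'a \<Rightarrow> 'a \<Rightarrow> 'a" by (rule vector_space_field)
  show "is_line V (\<pi> g)"
    unfolding presents_def
    using D g subspace_scale[OF Z] carr vector_space_field F.subspace_UNIV F.subspace_single_0
    by (auto simp: eq scale_left_distrib[symmetric])
qed

lemma lineD:
  assumes "is_line V g"
  shows "carrier V = range (\<lambda>c. c \<odot>\<^bsub>V\<^esub> g)" "c \<odot>\<^bsub>V\<^esub> g = d \<odot>\<^bsub>V\<^esub> g \<longleftrightarrow> c = d"
    "(c \<odot>\<^bsub>V\<^esub> g) \<oplus>\<^bsub>V\<^esub> (d \<odot>\<^bsub>V\<^esub> g) = (c + d) \<odot>\<^bsub>V\<^esub> g" "c \<odot>\<^bsub>V\<^esub> (d \<odot>\<^bsub>V\<^esub> g) = (c * d) \<odot>\<^bsub>V\<^esub> g"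
    "\<zero>\<^bsub>V\<^esub> = 0 \<odot>\<^bsub>V\<^esub> g"
  using assms by (auto simp: presents_def)

section \<open>Free spaces, and lines given by generators and relations\<close>

lemma free_vs_eq: "free_vs B = vs_of fscale (fsupp B)"
  by (simp add: free_vs_def vs_of_def fsupp_def fscale_def zero_fun_def plus_fun_def fun_eq_iff)

lemma fsupp_subspace: "fs.subspace (fsupp B :: ('c \<Rightarrow> 'f::field) set)"
proof (rule fs.subspaceI)
  show "0 \<in> fsupp B" by (simp add: fsupp_def)
next
  fix x y :: "'c \<Rightarrow> 'f" assume "x \<in> fsupp B" "y \<in> fsupp B"
  moreover have "{b. (x + y) b \<noteq> 0} \<subseteq> {b. x b \<noteq> 0} \<union> {b. y b \<noteq> 0}" by auto
  ultimately show "x + y \<in> fsupp B" unfolding fsupp_def by (auto intro: finite_subset)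
next
  fix c and x :: "'c \<Rightarrow> 'f" assume "x \<in> fsupp B"
  moreover have "{b. fscale c x b \<noteq> 0} \<subseteq> {b. x b \<noteq> 0}" by (auto simp: fscale_def)
  ultimately show "fscale c x \<in> fsupp B" unfolding fsupp_def by (auto intro: finite_subset)
qed

lemma free_gen_fsupp: "b \<in> B \<Longrightarrow> free_gen b \<in> fsupp B"
  by (simp add: fsupp_def free_gen_def)

lemma sum_fun_apply: "(\<Sum>i\<in>I. f i) x = (\<Sum>i\<in>I. f i x)" for f :: "'i \<Rightarrow> 'c \<Rightarrow> 'f::comm_monoid_add"
  by (induction I rule: infinite_finite_induct) auto

lemma fsupp_expand:
  assumes "r \<in> fsupp B"
  shows "r = (\<Sum>b | r b \<noteq> 0. fscale (r b) (free_gen b))"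
proof
  fix x
  have "(\<Sum>b | r b \<noteq> 0. fscale (r b) (free_gen b)) x = (\<Sum>b | r b \<noteq> 0. if x = b then r b else 0)"
    by (simp add: sum_fun_apply fscale_def free_gen_def if_distrib cong: if_cong)
  also have "\<dots> = r x" using assms by (auto simp: fsupp_def)
  finally show "r x = (\<Sum>b | r b \<noteq> 0. fscale (r b) (free_gen b)) x" by simp
qed

lemma fsupp_span: "(fsupp B :: ('c \<Rightarrow> 'f::field) set) = fs.span (free_gen ` B)" (is "?L = ?R")
proof
  show "?L \<subseteq> ?R"
  proof
    fix r :: "'c \<Rightarrow> 'f" assume r: "r \<in> fsupp B"
    have "(\<Sum>b | r b \<noteq> 0. fscale (r b) (free_gen b)) \<in> fs.span (free_gen ` B)"
      using r by (intro fs.span_sum fs.span_scale fs.span_base) (auto simp: fsupp_def)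
    then show "r \<in> fs.span (free_gen ` B)" using fsupp_expand[OF r] by simp
  qed
  show "?R \<subseteq> ?L"
    using free_gen_fsupp fsupp_subspace by (intro fs.span_minimal) auto
qed

text \<open>The linear functional on the free space whose values on the generators are
  \<phi>.\<close>

definition fext :: "('c \<Rightarrow> 'f::field) \<Rightarrow> ('c \<Rightarrow> 'f) \<Rightarrow> 'f" where
  "fext \<phi> r = (\<Sum>b | r b \<noteq> 0. r b * \<phi> b)"

lemma fext_superset:
  assumes "finite A" "{b. r b \<noteq> 0} \<subseteq> A"
  shows "fext \<phi> r = (\<Sum>b\<in>A. r b * \<phi> b)"
  unfolding fext_def using assms by (intro sum.mono_neutral_left) auto

lemma fext_add:
  assumes "r \<in> fsupp B" "r' \<in> fsupp B"
  shows "fext \<phi> (r + r') = fext \<phi> r + fext \<phi> r'"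
proof -
  let ?A = "{b. r b \<noteq> 0} \<union> {b. r' b \<noteq> 0}"
  have A: "finite ?A" using assms by (auto simp: fsupp_def)
  have S: "{b. (r + r') b \<noteq> 0} \<subseteq> ?A" by auto
  show ?thesis
    using fext_superset[OF A, of r \<phi>] fext_superset[OF A, of r' \<phi>] fext_superset[OF A _, of "r + r'" \<phi>] S
    by (simp add: distrib_right sum.distrib)
qed

lemma fext_scale:
  assumes "r \<in> fsupp B"
  shows "fext \<phi> (fscale c r) = c * fext \<phi> r"
proof -
  have A: "finite {b. r b \<noteq> 0}" using assms by (auto simp: fsupp_def)
  show ?thesis
    using fext_superset[OF A, of r \<phi>] fext_superset[OF A, of "fscale c r" \<phi>]
    by (auto simp: fscale_def sum_distrib_left mult.assoc)
qed

lemma fext_diff: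
  assumes "r \<in> fsupp B" "r' \<in> fsupp B"
  shows "fext \<phi> (r - r') = fext \<phi> r - fext \<phi> r'"
  using fext_add[OF fs.subspace_diff[OF fsupp_subspace assms] assms(2)] by simp

lemma fext_free_gen: "fext \<phi> (free_gen b) = (\<phi> b :: 'f::field)"
proof -
  have "{x. free_gen b x \<noteq> (0::'f)} = {b}" by (auto simp: free_gen_def)
  then show ?thesis by (simp add: fext_def free_gen_def)
qed

definition fcls :: "'c set \<Rightarrow> ('c \<Rightarrow> 'f::field) set \<Rightarrow> ('c \<Rightarrow> 'f) \<Rightarrow> ('c \<Rightarrow> 'f) set" where
  "fcls B R r = free_span B R +>\<^bsub>free_vs B\<^esub> r"

lemma free_span_eq: "R \<subseteq> fsupp B \<Longrightarrow> free_span B R = fs.span R"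
  unfolding free_vs_eq by (rule class_span_eq[OF fs.vector_space_axioms fsupp_subspace])

lemma fcls_eq: "R \<subseteq> fsupp B \<Longrightarrow> fcls B R r = (\<lambda>w. w + r) ` fs.span R"
  by (simp add: fcls_def free_span_eq) (simp add: free_vs_eq vcoset_eq)

lemma fcls_presents:
  assumes "R \<subseteq> fsupp B"
  shows "presents fscale (fsupp B) (fs.span R) (fcls B R) (quot_vs (free_vs B) (free_span B R))"
  using quot_presents[OF fs.vector_space_axioms fsupp_subspace fs.subspace_span fs.span_minimal[OF assms fsupp_subspace]]
  unfolding fcls_def free_span_eq[OF assms] by (simp add: free_vs_eq)

text \<open>The generator \<open>b0\<close> spans modulo the relations, so the quotient has
  dimension at most one. A functional that kills the relations and takes the value 1 at
  \<open>b0\<close> shows that it does not collapse, and it reads off all coefficients. Exterior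
  powers and tensor products are both treated in this way.\<close>

lemma presentation_line:
  fixes R :: "('c \<Rightarrow> 'f::field) set"
  assumes R: "R \<subseteq> fsupp B" and b0: "b0 \<in> B" "\<phi> b0 = 1"
    and span: "\<And>b. b \<in> B \<Longrightarrow> \<exists>c. free_gen b - fscale c (free_gen b0) \<in> fs.span R"
    and kill: "\<And>r. r \<in> R \<Longrightarrow> fext \<phi> r = 0"
  defines "V \<equiv> quot_vs (free_vs B) (free_span B R)"
  shows "is_line V (fcls B R (free_gen b0))"
    and "b \<in> B \<Longrightarrow> fcls B R (fscale c (free_gen b)) = (c * \<phi> b) \<odot>\<^bsub>V\<^esub> fcls B R (free_gen b0)"
proof -
  have S: "fs.span R \<subseteq> fsupp B" by (rule fs.span_minimal[OF R fsupp_subspace])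
  have zero': "r \<in> fsupp B \<and> fext \<phi> r = 0" if "r \<in> fs.span R" for r
    using that
  proof (induction rule: fs.span_induct_alt)
    case base show ?case by (intro conjI fs.subspace_0[OF fsupp_subspace]) (simp add: fext_def)
  next
    case (step c x y)
    then have x: "x \<in> fsupp B" "fscale c x \<in> fsupp B" using R fs.subspace_scale[OF fsupp_subspace] by auto
    have "fscale c x + y \<in> fsupp B" using step.IH fs.subspace_add[OF fsupp_subspace x(2)] by blast
    moreover have "fext \<phi> (fscale c x + y) = 0"
      using step kill by (simp add: fext_add[OF x(2)] fext_scale[OF x(1)])
    ultimately show ?case by (rule conjI)
  qed
  have zero: "fext \<phi> r = 0" if "r \<in> fs.span R" for r using zero'[OF that] ..
  have gb: "free_gen b \<in> fsupp B" if "b \<in> B" for b by (rule free_gen_fsupp[OF that])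
  note g0 = gb[OF b0(1)]
  have rel: "free_gen b - fscale (\<phi> b) (free_gen b0) \<in> fs.span R" if b: "b \<in> B" for b
  proof -
    obtain c where c: "free_gen b - fscale c (free_gen b0) \<in> fs.span R" using span[OF b] by auto
    \<comment> \<open>The functional vanishes on the span of the relations, which identifies the
      unspecified scalar \<open>c\<close> as \<open>\<phi> b\<close>.\<close>
    have "fext \<phi> (free_gen b - fscale c (free_gen b0)) = \<phi> b - c"
      by (simp add: fext_diff[OF gb[OF b] fs.subspace_scale[OF fsupp_subspace g0]] fext_scale[OF g0] fext_free_gen b0)
    then show ?thesis using zero[OF c] c by simp
  qed
  have relr: "r - fscale (fext \<phi> r) (free_gen b0) \<in> fs.span R" if r: "r \<in> fsupp B" for r
  proof -
    have "(\<Sum>b | r b \<noteq> 0. fscale (r b) (free_gen b - fscale (\<phi> b) (free_gen b0))) \<in> fs.span R"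
      using r rel by (intro fs.span_sum fs.span_scale) (auto simp: fsupp_def)
    also have "(\<Sum>b | r b \<noteq> 0. fscale (r b) (free_gen b - fscale (\<phi> b) (free_gen b0)))
        = (\<Sum>b | r b \<noteq> 0. fscale (r b) (free_gen b)) - fscale (fext \<phi> r) (free_gen b0)"
      by (simp add: fs.scale_right_diff_distrib sum_subtractf fext_def fs.scale_sum_left)
    finally show ?thesis unfolding fsupp_expand[OF r, symmetric] .
  qed
  have lc: "lcomb fscale [g] a = fscale (a 0) g" for g :: "'c \<Rightarrow> 'f" and a by (simp add: lcomb_def)
  have q: "qbasis fscale (fsupp B) (fs.span R) [free_gen b0]"
  proof (rule fs.qbasisI)
    show "set [free_gen b0] \<subseteq> fsupp B" using g0 by simp
    show "\<exists>a. x - lcomb fscale [free_gen b0] a \<in> fs.span R" if "x \<in> fsupp B" for x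
      using relr[OF that] by (intro exI[of _ "\<lambda>_. fext \<phi> x"]) (simp add: lc)
    fix a :: "nat \<Rightarrow> 'f" and i assume "lcomb fscale [free_gen b0] a \<in> fs.span R" "i < length [free_gen b0]"
    then show "a i = 0" using zero[of "fscale (a 0) (free_gen b0)"] b0
      by (simp add: lc fext_scale[OF g0] fext_free_gen)
  qed
  have p: "presents fscale (fsupp B) (fs.span R) (fcls B R) V"
    unfolding V_def by (rule fcls_presents[OF R])
  show "is_line V (fcls B R (free_gen b0))" by (rule line_of_qbasis(1)[OF p q])
  assume b: "b \<in> B"
  have "fscale c (free_gen b) - fscale (c * \<phi> b) (free_gen b0) \<in> fs.span R"
    using fs.span_scale[OF rel[OF b], of c] by (simp add: fs.scale_right_diff_distrib)
  then have "fcls B R (fscale c (free_gen b)) = fcls B R (fscale (c * \<phi> b) (free_gen b0))"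
    using presentsD(6)[OF p] gb[OF b] g0 fs.subspace_scale[OF fsupp_subspace] by metis
  also have "\<dots> = (c * \<phi> b) \<odot>\<^bsub>V\<^esub> fcls B R (free_gen b0)" using presentsD(8)[OF p g0] by simp
  finally show "fcls B R (fscale c (free_gen b)) = (c * \<phi> b) \<odot>\<^bsub>V\<^esub> fcls B R (free_gen b0)" .
qed

section \<open>Exterior powers\<close>

lemma presents_closed:
  assumes p: "presents s Z W \<pi> V"
  shows "x \<in> carrier V \<Longrightarrow> y \<in> carrier V \<Longrightarrow> x \<oplus>\<^bsub>V\<^esub> y \<in> carrier V"
    and "x \<in> carrier V \<Longrightarrow> c \<odot>\<^bsub>V\<^esub> x \<in> carrier V"
    and "\<zero>\<^bsub>V\<^esub> \<in> carrier V"
proof -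
  interpret vector_space s by (rule presentsD[OF p])
  note Z = presentsD(2)[OF p]
  show "x \<in> carrier V \<Longrightarrow> y \<in> carrier V \<Longrightarrow> x \<oplus>\<^bsub>V\<^esub> y \<in> carrier V"
    using presentsD(5,7)[OF p] subspace_add[OF Z] by auto
  show "x \<in> carrier V \<Longrightarrow> c \<odot>\<^bsub>V\<^esub> x \<in> carrier V"
    using presentsD(5,8)[OF p] subspace_scale[OF Z] by auto
  show "\<zero>\<^bsub>V\<^esub> \<in> carrier V" using presentsD(5,9)[OF p] subspace_0[OF Z] by auto
qed

lemma alt_rels_eq:
  "alt_rels n V =
     {free_gen (vs[i := x \<oplus>\<^bsub>V\<^esub> y]) - free_gen (vs[i := x]) - free_gen (vs[i := y]) | vs i x y.
        vs \<in> tuples n V \<and> i < n \<and> x \<in> carrier V \<and> y \<in> carrier V} \<union>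
     {free_gen (vs[i := c \<odot>\<^bsub>V\<^esub> x]) - fscale c (free_gen (vs[i := x])) | vs i c x.
        vs \<in> tuples n V \<and> i < n \<and> x \<in> carrier V} \<union>
     {free_gen vs | vs. vs \<in> tuples n V \<and> (\<exists>i j. i < j \<and> j < n \<and> vs ! i = vs ! j)}"
  by (simp add: alt_rels_def fscale_def fun_diff_def)

lemma tuples_update: "vs \<in> tuples n V \<Longrightarrow> x \<in> carrier V \<Longrightarrow> vs[i := x] \<in> tuples n V"
  using set_update_subset_insert[of vs i x] by (auto simp: tuples_def)

lemma tuples_nth: "vs \<in> tuples n V \<Longrightarrow> i < n \<Longrightarrow> vs ! i \<in> carrier V"
  by (auto simp: tuples_def)

lemma alt_rels_fsupp:
  fixes V :: "('f::field, 'v) module"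
  assumes p: "presents s Z W \<pi> V"
  shows "alt_rels n V \<subseteq> fsupp (tuples n V)"
  unfolding alt_rels_eq
  using presents_closed[OF p]
  by (auto intro!: fs.subspace_diff[OF fsupp_subspace] fs.subspace_scale[OF fsupp_subspace] free_gen_fsupp tuples_update)

text \<open>\<open>c v\<^sub>1 \<and> \<dots> \<and> v\<^sub>n\<close>\<close>

definition xw :: "nat \<Rightarrow> ('f::field, 'v) module \<Rightarrow> 'f \<Rightarrow> 'v list \<Rightarrow> ('v list \<Rightarrow> 'f) set" where
  "xw n V c vs = fcls (tuples n V) (alt_rels n V) (fscale c (free_gen vs))"

text \<open>Laplace expansion along row \<open>k\<close>; the cofactors do not see that row.\<close>

lemma det_linear_row:
  fixes M :: "nat \<Rightarrow> nat \<Rightarrow> 'f::field"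
  assumes k: "k < n"
  shows "det (mat n n (\<lambda>(i, j). if i = k then a j + b j else M i j))
      = det (mat n n (\<lambda>(i, j). if i = k then a j else M i j)) + det (mat n n (\<lambda>(i, j). if i = k then b j else M i j))"
    and "det (mat n n (\<lambda>(i, j). if i = k then c * a j else M i j))
      = c * det (mat n n (\<lambda>(i, j). if i = k then a j else M i j))"
proof -
  let ?A = "\<lambda>f. mat n n (\<lambda>(i, j). if i = k then f j else M i j)"
  have cof: "cofactor (?A f) k j = cofactor (?A g) k j" for f g :: "nat \<Rightarrow> 'f" and j
  proof -
    have "mat_delete (?A f) k j = mat_delete (?A g) k j"
      unfolding mat_delete_def by (intro eq_matI) auto
    then show ?thesis by (simp add: cofactor_def)
  qed
  have exp: "det (?A f) = (\<Sum>j<n. f j * cofactor (?A (\<lambda>_. 0)) k j)" for f :: "nat \<Rightarrow> 'f"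
  proof -
    have "det (?A f) = (\<Sum>j<n. ?A f $$ (k, j) * cofactor (?A f) k j)"
      by (rule laplace_expansion_row) (use k in auto)
    also have "\<dots> = (\<Sum>j<n. f j * cofactor (?A (\<lambda>_. 0)) k j)"
      using k cof[where f = f and g = "\<lambda>_. 0"] by (intro sum.cong) auto
    finally show ?thesis .
  qed
  show "det (?A (\<lambda>j. a j + b j)) = det (?A a) + det (?A b)"
    by (simp only: exp[of "\<lambda>j. a j + b j"] exp[of a] exp[of b] distrib_right sum.distrib)
  show "det (?A (\<lambda>j. c * a j)) = c * det (?A a)"
    by (simp only: exp[of "\<lambda>j. c * a j"] exp[of a] sum_distrib_left mult.assoc)
qed

text \<open>\<open>P\<close> says that a tuple is a multiple of the basis tuple modulo the
  relations. Multilinearity reduces to tuples of basis vectors, a repeated entry gives zero, and the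
  tuples left over are permutations of the basis, sorted by transpositions.\<close>

lemma ext_power_spanning:
  fixes V :: "('f::field, 'v) module"
  assumes p: "presents s Z W \<pi> V" and q: "qbasis s Z W bs" and n: "n = length bs" and vs: "vs \<in> tuples n V"
  shows "\<exists>c. free_gen vs - fscale c (free_gen (map \<pi> bs)) \<in> fs.span (alt_rels n V)"
proof -
  interpret vector_space s by (rule presentsD[OF p])
  let ?S = "fs.span (alt_rels n V)" and ?b = "map \<pi> bs"
  let ?g = "free_gen :: 'v list \<Rightarrow> 'v list \<Rightarrow> 'f"
  define P where "P vs \<longleftrightarrow> (\<exists>c. ?g vs - fscale c (?g ?b) \<in> ?S)" for vs
  note closed = presents_closed[OF p]
  have radd: "?g (vs[i := x \<oplus>\<^bsub>V\<^esub> y]) - ?g (vs[i := x]) - ?g (vs[i := y]) \<in> ?S"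
    if "vs \<in> tuples n V" "i < n" "x \<in> carrier V" "y \<in> carrier V" for vs i x y
    using that by (intro fs.span_base) (auto simp: alt_rels_eq)
  have rsc: "?g (vs[i := c \<odot>\<^bsub>V\<^esub> x]) - fscale c (?g (vs[i := x])) \<in> ?S"
    if "vs \<in> tuples n V" "i < n" "x \<in> carrier V" for vs i x c
    using that by (intro fs.span_base) (auto simp: alt_rels_eq)
  have rrep: "?g vs \<in> ?S" if "vs \<in> tuples n V" "i < j" "j < n" "vs ! i = vs ! j" for vs i j
    using that by (intro fs.span_base) (auto simp: alt_rels_eq)
  have Padd: "P (vs[i := x \<oplus>\<^bsub>V\<^esub> y])"
    if "vs \<in> tuples n V" "i < n" "x \<in> carrier V" "y \<in> carrier V" and h: "P (vs[i := x])" "P (vs[i := y])" for vs i x y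
  proof -
    obtain c d where cd: "?g (vs[i := x]) - fscale c (?g ?b) \<in> ?S" "?g (vs[i := y]) - fscale d (?g ?b) \<in> ?S"
      using h unfolding P_def by blast
    have "?g (vs[i := x \<oplus>\<^bsub>V\<^esub> y]) - fscale (c + d) (?g ?b)
      = (?g (vs[i := x \<oplus>\<^bsub>V\<^esub> y]) - ?g (vs[i := x]) - ?g (vs[i := y]))
        + ((?g (vs[i := x]) - fscale c (?g ?b)) + (?g (vs[i := y]) - fscale d (?g ?b)))"
      by (simp add: fs.scale_left_distrib)
    also have "\<dots> \<in> ?S" by (intro fs.span_add radd cd that)
    finally show ?thesis by (auto simp: P_def)
  qed
  have Psc: "P (vs[i := c \<odot>\<^bsub>V\<^esub> x])"
    if "vs \<in> tuples n V" "i < n" "x \<in> carrier V" and h: "P (vs[i := x])" for vs i x c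
  proof -
    obtain d where d: "?g (vs[i := x]) - fscale d (?g ?b) \<in> ?S" using h unfolding P_def by blast
    have "?g (vs[i := c \<odot>\<^bsub>V\<^esub> x]) - fscale (c * d) (?g ?b)
      = (?g (vs[i := c \<odot>\<^bsub>V\<^esub> x]) - fscale c (?g (vs[i := x]))) + fscale c (?g (vs[i := x]) - fscale d (?g ?b))"
      by (simp add: fs.scale_right_diff_distrib)
    also have "\<dots> \<in> ?S" by (intro fs.span_add fs.span_scale rsc d that)
    finally show ?thesis by (auto simp: P_def)
  qed
  have Prep: "P vs" if "vs \<in> tuples n V" "i < j" "j < n" "vs ! i = vs ! j" for vs i j
    unfolding P_def using rrep[OF that] by (intro exI[of _ 0]) simp
  \<comment> \<open>Alternating implies antisymmetric: the tuple with \<open>x + y\<close> in both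
    positions vanishes, and so do those with \<open>x\<close> twice or \<open>y\<close> twice. What
    remains of the expansion is the sum of the two mixed tuples.\<close>
  have Pswap: "P (vs[i := y, j := x])"
    if t: "vs \<in> tuples n V" and ij: "i < j" "j < n" and xy: "x \<in> carrier V" "y \<in> carrier V"
      and P: "P (vs[i := x, j := y])" for vs i j x y
  proof -
    let ?G = "\<lambda>x y. ?g (vs[i := x, j := y])"
    have i: "i < n" using ij by simp
    have len: "length vs = n" using t by (simp add: tuples_def)
    have R: "?G x x \<in> ?S" if "x \<in> carrier V" for x
      using that t ij len by (intro rrep[of _ i j] tuples_update) auto
    have A2: "?G x (y \<oplus>\<^bsub>V\<^esub> y') - ?G x y - ?G x y' \<in> ?S"
      if "x \<in> carrier V" "y \<in> carrier V" "y' \<in> carrier V" for x y y'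
      using radd[OF tuples_update[OF t that(1)] ij(2) that(2,3)] .
    have A1: "?G (x \<oplus>\<^bsub>V\<^esub> x') y - ?G x y - ?G x' y \<in> ?S"
      if "x \<in> carrier V" "x' \<in> carrier V" "y \<in> carrier V" for x x' y
      using radd[OF tuples_update[OF t that(3), of j] i that(1,2)] ij by (simp add: list_update_swap)
    let ?z = "x \<oplus>\<^bsub>V\<^esub> y"
    have z: "?z \<in> carrier V" using closed xy by auto
    have "?G x y + ?G y x = ?G ?z ?z - (?G ?z ?z - ?G x ?z - ?G y ?z) - (?G x ?z - ?G x x - ?G x y)
        - (?G y ?z - ?G y x - ?G y y) - ?G x x - ?G y y"
      by (simp add: algebra_simps)
    also have "\<dots> \<in> ?S" by (intro fs.span_diff R A1 A2 xy z)
    finally have 1: "?G x y + ?G y x \<in> ?S" .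
    obtain c where c: "?G x y - fscale c (?g ?b) \<in> ?S" using P unfolding P_def by blast
    have "?G y x - fscale (- c) (?g ?b) = (?G x y + ?G y x) - (?G x y - fscale c (?g ?b))"
      by (simp add: algebra_simps)
    also have "\<dots> \<in> ?S" by (intro fs.span_diff 1 c)
    finally show ?thesis unfolding P_def by (rule exI)
  qed
  have bZ: "set bs \<subseteq> Z" using qbasis_set[OF q] .
  have bc: "set ?b \<subseteq> carrier V" using bZ presentsD(5)[OF p] by auto
  have bt: "?b \<in> tuples n V" using bc n by (auto simp: tuples_def)
  have Pb: "P ?b" unfolding P_def by (intro exI[of _ 1]) (simp add: fs.span_zero)
  \<comment> \<open>Selection sort: the first \<open>m\<close> entries are already in place, and the
    induction is on the number of positions left.\<close>
  have Pperm: "P vs" if "vs \<in> tuples n V" "distinct vs" "set vs = set ?b" "\<forall>i<m. vs ! i = ?b ! i" "m \<le> n" for vs m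
    using that
  proof (induction "n - m" arbitrary: m vs)
    case 0
    then have "vs = ?b" by (intro nth_equalityI) (auto simp: tuples_def n)
    then show ?case using Pb by simp
  next
    case (Suc k)
    then have m: "m < n" by simp
    have len: "length vs = n" using Suc.prems by (simp add: tuples_def)
    have "?b ! m \<in> set vs" using m n Suc.prems by (metis length_map nth_mem)
    then obtain j where j: "j < n" "vs ! j = ?b ! m" using len by (auto simp: in_set_conv_nth)
    have card: "card (set ?b) = n" using Suc.prems(2,3) len by (metis distinct_card)
    then have db: "distinct ?b" using n by (simp add: card_distinct)
    have "j \<ge> m"
    proof (rule ccontr)
      assume "\<not> j \<ge> m"
      then have "?b ! j = ?b ! m" using Suc.prems(4) j by auto
      then show False using nth_eq_iff_index_eq[OF db, of j m] \<open>\<not> j \<ge> m\<close> j m n by simp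
    qed
    show ?case
    proof (cases "j = m")
      case True
      then have "\<forall>i<Suc m. vs ! i = ?b ! i" using j Suc.prems(4) by (auto simp: less_Suc_eq)
      then show ?thesis using Suc.hyps(1)[of "Suc m" vs] Suc.hyps(2) Suc.prems m by simp
    next
      case False
      with \<open>j \<ge> m\<close> have mj: "m < j" by simp
      let ?w = "vs[m := vs ! j, j := vs ! m]"
      have jm: "vs ! j \<in> carrier V" "vs ! m \<in> carrier V" using tuples_nth[OF Suc.prems(1) j(1)] tuples_nth[OF Suc.prems(1) m] by auto
      have wt: "?w \<in> tuples n V" using Suc.prems(1) jm by (intro tuples_update)
      have dw: "distinct ?w" using Suc.prems(2) j(1) m len by (simp add: distinct_swap)
      have sw: "set ?w = set ?b" using Suc.prems(3) j(1) m len by (simp add: set_swap)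
      have "\<forall>i<Suc m. ?w ! i = ?b ! i"
        using j Suc.prems(4) mj m len by (auto simp: less_Suc_eq nth_list_update)
      then have "P ?w" using Suc.hyps(1)[of "Suc m" ?w] Suc.hyps(2) wt dw sw m by simp
      from Pswap[OF Suc.prems(1) mj j(1) jm this] show ?thesis
        using mj len by simp
    qed
  qed
  \<comment> \<open>By counting, \<open>n\<close> distinct entries taken from \<open>n\<close> basis
    vectors exhaust them, so a tuple without repetitions is a permutation.\<close>
  have Pbasis: "P vs" if t: "vs \<in> tuples n V" and b: "\<forall>i<n. vs ! i \<in> set ?b" for vs
  proof (cases "distinct vs")
    case True
    have len: "length vs = n" using t by (simp add: tuples_def)
    have sub: "set vs \<subseteq> set ?b" using b len by (auto simp: in_set_conv_nth)
    have "card (set ?b) \<le> n" using card_length[of ?b] n by simp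
    moreover have "card (set vs) = n" using True len by (simp add: distinct_card)
    ultimately have "set vs = set ?b" using sub by (metis List.finite_set card_seteq)
    then show ?thesis using Pperm[OF t True, of 0] by simp
  next
    case False
    have len: "length vs = n" using t by (simp add: tuples_def)
    obtain i j where "i < j" "j < n" "vs ! i = vs ! j"
      using False len unfolding distinct_conv_nth by (metis linorder_neqE_nat)
    then show ?thesis using Prep[OF t] by blast
  qed
  \<comment> \<open>\<open>k\<close> bounds the positions whose entries are still arbitrary; each
    induction step expands the entry at one position.\<close>
  have "P vs" if "vs \<in> tuples n V" "k \<le> n" "\<forall>i<n. i \<ge> k \<longrightarrow> vs ! i \<in> set ?b" for vs k
    using that
  proof (induction k arbitrary: vs)
    case 0 then show ?case using Pbasis by simp
  next
    case (Suc k)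
    note t = Suc.prems(1)
    have k: "k < n" using Suc.prems by simp
    have len: "length vs = n" using t by (simp add: tuples_def)
    have base: "P (vs[k := ?b ! i])" if "i < n" for i
    proof (rule Suc.IH)
      have "?b ! i \<in> carrier V" using bc that n by (metis length_map nth_mem subsetD)
      then show "vs[k := ?b ! i] \<in> tuples n V" by (rule tuples_update[OF t])
      show "k \<le> n" using k by simp
      show "\<forall>j<n. k \<le> j \<longrightarrow> vs[k := ?b ! i] ! j \<in> set ?b"
        using Suc.prems(3) that len n by (auto simp: nth_list_update)
    qed
    obtain z where z: "z \<in> Z" "vs ! k = \<pi> z" using tuples_nth[OF t k] presentsD(5)[OF p] by auto
    define a where "a = qcoord s W bs z"
    have sums: "(\<Sum>i<m. s (a i) (bs ! i)) \<in> Z \<and> P (vs[k := \<pi> (\<Sum>i<m. s (a i) (bs ! i))])" if "m \<le> n" for m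
      using that
    proof (induction m)
      \<comment> \<open>The empty sum is written as 0 times the first basis vector, which exists
        because \<open>k < n\<close>.\<close>
      case 0
      have "n > 0" using k by simp
      then have b0: "bs ! 0 \<in> Z" using bZ n by auto
      then have "?b ! 0 \<in> carrier V" using presentsD(5)[OF p] \<open>n > 0\<close> n by auto
      from Psc[OF t k this base[OF \<open>n > 0\<close>], of 0] have "P (vs[k := \<pi> 0])"
        using presentsD(8)[OF p b0, of 0] \<open>n > 0\<close> n by simp
      then show ?case using subspace_0[OF presentsD(2)[OF p]] by simp
    next
      case (Suc m)
      then have m: "m < n" by simp
      have bm: "bs ! m \<in> Z" using bZ n m by auto
      have IH: "(\<Sum>i<m. s (a i) (bs ! i)) \<in> Z" "P (vs[k := \<pi> (\<Sum>i<m. s (a i) (bs ! i))])" using Suc by auto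
      have sm: "s (a m) (bs ! m) \<in> Z" using subspace_scale[OF presentsD(2)[OF p] bm] .
      have "?b ! m \<in> carrier V" using presentsD(5)[OF p] bm m n by auto
      from Psc[OF t k this base[OF m], of "a m"] have "P (vs[k := \<pi> (s (a m) (bs ! m))])"
        using presentsD(8)[OF p bm] m n by simp
      from Padd[OF t k _ _ IH(2) this] have "P (vs[k := \<pi> ((\<Sum>i<m. s (a i) (bs ! i)) + s (a m) (bs ! m))])"
        using presentsD(5,7)[OF p] IH(1) sm by auto
      then show ?case using subspace_add[OF presentsD(2)[OF p] IH(1) sm] by simp
    qed
    have "\<pi> z = \<pi> (\<Sum>i<n. s (a i) (bs ! i))"
      using presents_lcomb_eq[OF p q z(1)] by (simp add: a_def lcomb_def n)
    then have "P (vs[k := vs ! k])" using sums[of n] z by simp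
    then show ?case by simp
  qed
  from this[OF vs, of n] show ?thesis by (simp add: P_def)
qed

text \<open>The functional needed for \<open>presentation_line\<close> is the determinant of the
  coordinate matrix. It is multilinear, vanishes when two rows agree, and is 1 on the basis; so it
  kills the relations and does not depend on representatives.\<close>

lemma ext_power_line:
  fixes V :: "('f::field, 'v) module"
  assumes p: "presents s Z W \<pi> V" and q: "qbasis s Z W bs" and n: "n = length bs"
  shows "is_line (ext_power n V) (xw n V 1 (map \<pi> bs))"
    and "length us = n \<Longrightarrow> set us \<subseteq> Z \<Longrightarrow> xw n V c (map \<pi> us) =
      (c * det (mat n n (\<lambda>(i, j). qcoord s W bs (us ! i) j))) \<odot>\<^bsub>ext_power n V\<^esub> xw n V 1 (map \<pi> bs)"
proof -
  interpret vector_space s by (rule presentsD[OF p])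
  note Z = presentsD(2)[OF p] and W = presentsD(3)[OF p]
  let ?b = "map \<pi> bs"
  have bZ: "set bs \<subseteq> Z" using qbasis_set[OF q] .
  \<comment> \<open>Coordinates of an element of the record, taken at a chosen representative; the
    choice does not matter modulo \<open>W\<close>.\<close>
  define \<kappa> where "\<kappa> v = qcoord s W bs (SOME z. z \<in> Z \<and> \<pi> z = v)" for v
  have \<kappa>: "\<kappa> (\<pi> x) = qcoord s W bs x" if x: "x \<in> Z" for x
  proof -
    have "(SOME z. z \<in> Z \<and> \<pi> z = \<pi> x) \<in> Z \<and> \<pi> (SOME z. z \<in> Z \<and> \<pi> z = \<pi> x) = \<pi> x"
      by (rule someI_ex[of "\<lambda>z. z \<in> Z \<and> \<pi> z = \<pi> x"]) (use x in auto)
    then show ?thesis unfolding \<kappa>_def using presentsD(6)[OF p] x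
      by (intro qcoord_cong_mod[OF q W]) auto
  qed
  have \<kappa>add: "\<kappa> (x \<oplus>\<^bsub>V\<^esub> y) = (\<lambda>j. \<kappa> x j + \<kappa> y j)" if xy: "x \<in> carrier V" "y \<in> carrier V" for x y
  proof -
    obtain x' y' where "x' \<in> Z" "y' \<in> Z" "x = \<pi> x'" "y = \<pi> y'" using xy presentsD(5)[OF p] by auto
    then show ?thesis using presentsD(7)[OF p] subspace_add[OF Z] by (simp add: \<kappa> qcoord_add[OF q W Z])
  qed
  have \<kappa>sc: "\<kappa> (c \<odot>\<^bsub>V\<^esub> x) = (\<lambda>j. c * \<kappa> x j)" if x: "x \<in> carrier V" for x c
  proof -
    obtain x' where "x' \<in> Z" "x = \<pi> x'" using x presentsD(5)[OF p] by auto
    then show ?thesis using presentsD(8)[OF p] subspace_scale[OF Z] by (simp add: \<kappa> qcoord_scale[OF q W Z])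
  qed
  define \<phi> where "\<phi> vs = det (mat n n (\<lambda>(i, j). \<kappa> (vs ! i) j))" for vs
  have upd: "\<phi> (vs[k := x]) = det (mat n n (\<lambda>(i, j). if i = k then \<kappa> x j else \<kappa> (vs ! i) j))"
    if "vs \<in> tuples n V" "k < n" for vs k x
    unfolding \<phi>_def using that
    by (intro arg_cong[of _ _ det] eq_matI) (auto simp: tuples_def nth_list_update)
  note sub = alt_rels_fsupp[OF p, of n]
  have b0: "?b \<in> tuples n V" using bZ presentsD(5)[OF p] n by (auto simp: tuples_def)
  have "mat n n (\<lambda>(i, j). \<kappa> (?b ! i) j) = 1\<^sub>m n"
  proof (intro eq_matI)
    fix i j assume ij: "i < dim_row (1\<^sub>m n)" "j < dim_col (1\<^sub>m n)"
    then have "\<kappa> (\<pi> (bs ! i)) = qcoord s W bs (bs ! i)" using bZ n by (intro \<kappa>) auto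
    then show "mat n n (\<lambda>(i, j). \<kappa> (?b ! i) j) $$ (i, j) = 1\<^sub>m n $$ (i, j)"
      using ij n by (auto simp: qcoord_nth[OF q W])
  qed simp_all
  then have \<phi>1: "\<phi> ?b = 1" by (simp add: \<phi>_def)
  have span: "\<exists>c. free_gen b - fscale c (free_gen ?b) \<in> fs.span (alt_rels n V)" if "b \<in> tuples n V" for b
    by (rule ext_power_spanning[OF p q n that])
  have kill: "fext \<phi> r = 0" if r: "r \<in> alt_rels n V" for r
  proof -
    note g = free_gen_fsupp[of _ "tuples n V"] and sc = fs.subspace_scale[OF fsupp_subspace]
      and df = fs.subspace_diff[OF fsupp_subspace]
    consider (add) vs i x y where "r = free_gen (vs[i := x \<oplus>\<^bsub>V\<^esub> y]) - free_gen (vs[i := x]) - free_gen (vs[i := y])"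
        "vs \<in> tuples n V" "i < n" "x \<in> carrier V" "y \<in> carrier V"
      | (scale) vs i c x where "r = free_gen (vs[i := c \<odot>\<^bsub>V\<^esub> x]) - fscale c (free_gen (vs[i := x]))"
        "vs \<in> tuples n V" "i < n" "x \<in> carrier V"
      | (rep) vs i j where "r = free_gen vs" "vs \<in> tuples n V" "i < j" "j < n" "vs ! i = vs ! j"
      using r unfolding alt_rels_eq by blast
    then show ?thesis
    proof cases
      case add
      note t = tuples_update[OF add(2)]
      have m: "vs[i := x \<oplus>\<^bsub>V\<^esub> y] \<in> tuples n V" "vs[i := x] \<in> tuples n V" "vs[i := y] \<in> tuples n V"
        using t presents_closed(1)[OF p] add by auto
      have "fext \<phi> r = \<phi> (vs[i := x \<oplus>\<^bsub>V\<^esub> y]) - \<phi> (vs[i := x]) - \<phi> (vs[i := y])"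
        unfolding add(1) by (simp add: fext_diff[OF df[OF g[OF m(1)] g[OF m(2)]] g[OF m(3)]]
          fext_diff[OF g[OF m(1)] g[OF m(2)]] fext_free_gen)
      also have "\<dots> = 0"
        unfolding upd[OF add(2,3)] \<kappa>add[OF add(4,5)] det_linear_row(1)[OF add(3)] by simp
      finally show ?thesis .
    next
      case scale
      note t = tuples_update[OF scale(2)]
      have m: "vs[i := c \<odot>\<^bsub>V\<^esub> x] \<in> tuples n V" "vs[i := x] \<in> tuples n V"
        using t presents_closed(2)[OF p] scale by auto
      have "fext \<phi> r = \<phi> (vs[i := c \<odot>\<^bsub>V\<^esub> x]) - c * \<phi> (vs[i := x])"
        unfolding scale(1) by (simp add: fext_diff[OF g[OF m(1)] sc[OF g[OF m(2)]]] fext_scale[OF g[OF m(2)]] fext_free_gen)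
      also have "\<dots> = 0"
        unfolding upd[OF scale(2,3)] \<kappa>sc[OF scale(4)] det_linear_row(2)[OF scale(3)] by simp
      finally show ?thesis .
    next
      case rep
      have "\<phi> vs = 0" unfolding \<phi>_def
        by (rule det_identical_rows[of _ n i j]) (use rep in \<open>auto intro!: eq_vecI\<close>)
      then show ?thesis by (simp add: rep(1) fext_free_gen)
    qed
  qed
  have xw1: "xw n V 1 ?b = fcls (tuples n V) (alt_rels n V) (free_gen ?b)" by (simp add: xw_def)
  show "is_line (ext_power n V) (xw n V 1 (map \<pi> bs))"
    unfolding xw1 ext_power_def by (rule presentation_line(1)[where \<phi> = \<phi>, OF sub b0 \<phi>1]) (fact span, fact kill)
  assume us: "length us = n" "set us \<subseteq> Z"
  then have ut: "map \<pi> us \<in> tuples n V" using presentsD(5)[OF p] by (auto simp: tuples_def)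
  have "xw n V c (map \<pi> us) = (c * \<phi> (map \<pi> us)) \<odot>\<^bsub>ext_power n V\<^esub> xw n V 1 ?b"
    unfolding xw1 xw_def[of n V c "map \<pi> us"] ext_power_def
    by (rule presentation_line(2)[where \<phi> = \<phi>, OF sub b0 \<phi>1 _ _ ut]) (fact span, fact kill)
  moreover have "\<phi> (map \<pi> us) = det (mat n n (\<lambda>(i, j). qcoord s W bs (us ! i) j))"
    unfolding \<phi>_def using us \<kappa> by (intro arg_cong[of _ _ det] eq_matI) (auto simp: subset_iff)
  ultimately show "xw n V c (map \<pi> us) =
      (c * det (mat n n (\<lambda>(i, j). qcoord s W bs (us ! i) j))) \<odot>\<^bsub>ext_power n V\<^esub> xw n V 1 (map \<pi> bs)" by simp
qed

text \<open>\<open>ext_map\<close> and its like are unions over all representatives. If changing the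
  representative by a relation changes the value by a relation, all cosets in the union agree and
  one representative suffices.\<close>

lemma push_class:
  assumes R: "R \<subseteq> fsupp B" and R': "R' \<subseteq> fsupp B'"
    and F: "\<And>\<sigma>. \<sigma> \<in> fs.span R \<Longrightarrow> F (\<sigma> + r) - F r \<in> fs.span R'"
  shows "(\<Union>r'\<in>fcls B R r. free_span B' R' +>\<^bsub>free_vs B'\<^esub> F r') = fcls B' R' (F r)"
proof -
  have *: "free_span B' R' +>\<^bsub>free_vs B'\<^esub> F (\<sigma> + r) = fcls B' R' (F r)" if "\<sigma> \<in> fs.span R" for \<sigma>
    unfolding fcls_def[symmetric] fcls_eq[OF R']
    using F[OF that] by (subst coset_eq_iff[OF fs.vector_space_axioms fs.subspace_span]) 
  have "(\<Union>r'\<in>fcls B R r. free_span B' R' +>\<^bsub>free_vs B'\<^esub> F r')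
      = (\<Union>\<sigma>\<in>fs.span R. free_span B' R' +>\<^bsub>free_vs B'\<^esub> F (\<sigma> + r))"
    unfolding fcls_eq[OF R] by simp
  also have "\<dots> = (\<Union>\<sigma>\<in>fs.span R. fcls B' R' (F r))" using * by (intro SUP_cong) auto
  also have "\<dots> = fcls B' R' (F r)" using fs.span_zero[of R] by blast
  finally show ?thesis .
qed

text \<open>The map on representatives that occurs inside \<open>ext_map\<close>.\<close>

definition push :: "('v \<Rightarrow> 'w) \<Rightarrow> ('v list \<Rightarrow> 'f::field) \<Rightarrow> 'w list \<Rightarrow> 'f" where
  "push f r = (\<lambda>ws. \<Sum>vs | r vs \<noteq> 0 \<and> map f vs = ws. r vs)"

lemma push_superset:
  assumes "finite A" "{vs. r vs \<noteq> 0} \<subseteq> A"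
  shows "push f r ws = (\<Sum>vs\<in>A. if map f vs = ws then r vs else 0)"
proof -
  have "push f r ws = (\<Sum>vs | r vs \<noteq> 0 \<and> map f vs = ws. if map f vs = ws then r vs else 0)"
    by (simp add: push_def)
  also have "\<dots> = (\<Sum>vs\<in>A. if map f vs = ws then r vs else 0)"
    using assms by (intro sum.mono_neutral_left) auto
  finally show ?thesis .
qed

lemma push_add:
  assumes "r \<in> fsupp B" "r' \<in> fsupp B"
  shows "push f (r + r') = push f r + push f r'"
proof
  fix ws
  let ?A = "{b. r b \<noteq> 0} \<union> {b. r' b \<noteq> 0}"
  have A: "finite ?A" using assms by (auto simp: fsupp_def)
  have S: "{b. (r + r') b \<noteq> 0} \<subseteq> ?A" by auto
  have "push f (r + r') ws = (\<Sum>vs\<in>?A. (if map f vs = ws then r vs else 0) + (if map f vs = ws then r' vs else 0))"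
    unfolding push_superset[OF A S] by (intro sum.cong) auto
  then show "push f (r + r') ws = (push f r + push f r') ws"
    using push_superset[OF A, of r f ws] push_superset[OF A, of r' f ws] by (simp add: sum.distrib)
qed

lemma push_scale:
  assumes "r \<in> fsupp B"
  shows "push f (fscale c r) = fscale c (push f r)"
proof
  fix ws
  have A: "finite {b. r b \<noteq> 0}" using assms by (auto simp: fsupp_def)
  have S: "{b. fscale c r b \<noteq> 0} \<subseteq> {b. r b \<noteq> 0}" by (auto simp: fscale_def)
  show "push f (fscale c r) ws = fscale c (push f r) ws"
    unfolding push_superset[OF A S] fscale_def[of c "push f r"] push_superset[OF A subset_refl] sum_distrib_left
    by (intro sum.cong) (auto simp: fscale_def)
qed

lemma push_diff:
  assumes "r \<in> fsupp B" "r' \<in> fsupp B"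
  shows "push f (r - r') = push f r - push f r'"
  using push_add[OF fs.subspace_diff[OF fsupp_subspace assms] assms(2), of f] by (simp add: eq_diff_eq)

lemma push_free_gen: "push f (free_gen vs) = (free_gen (map f vs) :: _ \<Rightarrow> 'f::field)"
proof
  fix ws
  have "{x. free_gen vs x \<noteq> (0::'f)} \<subseteq> {vs}" by (auto simp: free_gen_def)
  from push_superset[OF _ this, of f ws]
  show "push f (free_gen vs) ws = (free_gen (map f vs) ws :: 'f)" by (auto simp: free_gen_def)
qed

text \<open>A homomorphism sends every generating relation to a relation of the same kind, so the
  push-forward respects classes.\<close>

lemma ext_map_xw:
  fixes V :: "('f::field, 'v) module" and U :: "('f, 'w) module"
  assumes p: "presents s Z W \<pi> V" and p': "presents s' Z' W' \<pi>' U" and f: "f \<in> hom_vs V U"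
    and vs: "vs \<in> tuples n V"
  shows "ext_map n U f (xw n V c vs) = xw n U c (map f vs)"
proof -
  note sub = alt_rels_fsupp[OF p, of n] and sub' = alt_rels_fsupp[OF p', of n]
  note g = free_gen_fsupp[of _ "tuples n V"] and sc = fs.subspace_scale[OF fsupp_subspace]
      and df = fs.subspace_diff[OF fsupp_subspace]
  have fc: "f x \<in> carrier U" if "x \<in> carrier V" for x using f that by (auto simp: LinearCombinations.module_hom_def)
  have fadd: "f (x \<oplus>\<^bsub>V\<^esub> y) = f x \<oplus>\<^bsub>U\<^esub> f y" if "x \<in> carrier V" "y \<in> carrier V" for x y
    using f that by (auto simp: LinearCombinations.module_hom_def)
  have fsc: "f (c \<odot>\<^bsub>V\<^esub> x) = c \<odot>\<^bsub>U\<^esub> f x" if "x \<in> carrier V" for x c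
    using f that by (auto simp: LinearCombinations.module_hom_def)
  have ft: "map f vs \<in> tuples n U" if "vs \<in> tuples n V" for vs using that fc by (auto simp: tuples_def)
  have gen: "push f r \<in> fs.span (alt_rels n U)" if r: "r \<in> alt_rels n V" for r
  proof (rule fs.span_base)
    consider (add) vs i x y where "r = free_gen (vs[i := x \<oplus>\<^bsub>V\<^esub> y]) - free_gen (vs[i := x]) - free_gen (vs[i := y])"
        "vs \<in> tuples n V" "i < n" "x \<in> carrier V" "y \<in> carrier V"
      | (scale) vs i c x where "r = free_gen (vs[i := c \<odot>\<^bsub>V\<^esub> x]) - fscale c (free_gen (vs[i := x]))"
        "vs \<in> tuples n V" "i < n" "x \<in> carrier V"
      | (rep) vs i j where "r = free_gen vs" "vs \<in> tuples n V" "i < j" "j < n" "vs ! i = vs ! j"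
      using r unfolding alt_rels_eq by blast
    then show "push f r \<in> alt_rels n U"
    proof cases
      case add
      note t = tuples_update[OF add(2)]
      have m: "vs[i := x \<oplus>\<^bsub>V\<^esub> y] \<in> tuples n V" "vs[i := x] \<in> tuples n V" "vs[i := y] \<in> tuples n V"
        using t presents_closed(1)[OF p] add by auto
      have "push f r = free_gen ((map f vs)[i := f x \<oplus>\<^bsub>U\<^esub> f y]) - free_gen ((map f vs)[i := f x]) - free_gen ((map f vs)[i := f y])"
        unfolding add(1) push_diff[OF df[OF g[OF m(1)] g[OF m(2)]] g[OF m(3)]]
          push_diff[OF g[OF m(1)] g[OF m(2)]] push_free_gen by (simp add: map_update fadd add)
      then show ?thesis unfolding alt_rels_eq using ft[OF add(2)] fc add by blast
    next
      case scale
      note t = tuples_update[OF scale(2)]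
      have m: "vs[i := c \<odot>\<^bsub>V\<^esub> x] \<in> tuples n V" "vs[i := x] \<in> tuples n V"
        using t presents_closed(2)[OF p] scale by auto
      have "push f r = free_gen ((map f vs)[i := c \<odot>\<^bsub>U\<^esub> f x]) - fscale c (free_gen ((map f vs)[i := f x]))"
        unfolding scale(1) push_diff[OF g[OF m(1)] sc[OF g[OF m(2)]]] push_scale[OF g[OF m(2)]] push_free_gen
        by (simp add: map_update fsc scale)
      then show ?thesis unfolding alt_rels_eq using ft[OF scale(2)] fc scale by blast
    next
      case rep
      have "push f r = free_gen (map f vs)" unfolding rep(1) by (rule push_free_gen)
      moreover have "map f vs ! i = map f vs ! j" using rep by (simp add: tuples_def)
      ultimately show ?thesis unfolding alt_rels_eq using ft[OF rep(2)] rep by blast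
    qed
  qed
  have sp: "r \<in> fsupp (tuples n V) \<and> push f r \<in> fs.span (alt_rels n U)" if "r \<in> fs.span (alt_rels n V)" for r
    using that
  proof (induction rule: fs.span_induct_alt)
    case base
    have "push f (0 :: 'v list \<Rightarrow> 'f) = 0" by (simp add: push_def fun_eq_iff)
    then have "push f (0 :: 'v list \<Rightarrow> 'f) \<in> fs.span (alt_rels n U)" using fs.span_zero by metis
    then show ?case by (intro conjI fs.subspace_0[OF fsupp_subspace])
  next
    case (step c x y)
    then have x: "x \<in> fsupp (tuples n V)" "fscale c x \<in> fsupp (tuples n V)" using sub sc by auto
    have "push f (fscale c x + y) = fscale c (push f x) + push f y"
      using step.IH by (simp add: push_add[OF x(2)] push_scale[OF x(1)])
    then have "push f (fscale c x + y) \<in> fs.span (alt_rels n U)"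
      using step.IH gen[OF step.hyps(1)] by (metis fs.span_add fs.span_scale)
    moreover have "fscale c x + y \<in> fsupp (tuples n V)"
      using step.IH fs.subspace_add[OF fsupp_subspace x(2)] by blast
    ultimately show ?case by (intro conjI)
  qed
  have m: "fscale c (free_gen vs) \<in> fsupp (tuples n V)" using sc g[OF vs] by auto
  have "ext_map n U f (xw n V c vs)
      = (\<Union>r'\<in>fcls (tuples n V) (alt_rels n V) (fscale c (free_gen vs)). alt_span n U +>\<^bsub>free_vs (tuples n U)\<^esub> push f r')"
    by (simp add: ext_map_def push_def xw_def)
  also have "\<dots> = fcls (tuples n U) (alt_rels n U) (push f (fscale c (free_gen vs)))"
  proof (rule push_class[OF sub sub'])
    fix \<sigma> :: "'v list \<Rightarrow> 'f" assume "\<sigma> \<in> fs.span (alt_rels n V)"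
    with sp have \<sigma>: "\<sigma> \<in> fsupp (tuples n V)" "push f \<sigma> \<in> fs.span (alt_rels n U)" by auto
    show "push f (\<sigma> + fscale c (free_gen vs)) - push f (fscale c (free_gen vs)) \<in> fs.span (alt_rels n U)"
      using \<sigma>(2) by (simp add: push_add[OF \<sigma>(1) m])
  qed
  also have "\<dots> = xw n U c (map f vs)" by (simp add: xw_def push_scale[OF g[OF vs]] push_free_gen)
  finally show ?thesis .
qed

section \<open>Wedge products, tensor products and duals\<close>

lemma ext_power_presents:
  assumes "presents s Z W \<pi> V"
  shows "presents fscale (fsupp (tuples n V)) (fs.span (alt_rels n V)) (fcls (tuples n V) (alt_rels n V)) (ext_power n V)"
  unfolding ext_power_def by (rule fcls_presents[OF alt_rels_fsupp[OF assms]])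

lemma xw_scale:
  assumes p: "presents s Z W \<pi> V" and vs: "vs \<in> tuples n V"
  shows "a \<odot>\<^bsub>ext_power n V\<^esub> xw n V c vs = xw n V (a * c) vs"
  unfolding xw_def using presentsD(8)[OF ext_power_presents[OF p] fs.subspace_scale[OF fsupp_subspace free_gen_fsupp[OF vs]]] by simp

text \<open>The product of representatives that occurs inside \<open>wedge\<close>.\<close>

definition cat_prod :: "nat \<Rightarrow> ('v list \<Rightarrow> 'f::field) \<Rightarrow> ('v list \<Rightarrow> 'f) \<Rightarrow> 'v list \<Rightarrow> 'f" where
  "cat_prod p r r' = (\<lambda>ws. r (take p ws) * r' (drop p ws))"

lemma cat_prod_simps:
  "cat_prod p (r1 + r2) r' = cat_prod p r1 r' + cat_prod p r2 r'"
  "cat_prod p (r1 - r2) r' = cat_prod p r1 r' - cat_prod p r2 r'"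
  "cat_prod p (fscale c r) r' = fscale c (cat_prod p r r')"
  "cat_prod p r (r1' + r2') = cat_prod p r r1' + cat_prod p r r2'"
  "cat_prod p r (r1' - r2') = cat_prod p r r1' - cat_prod p r r2'"
  "cat_prod p r (fscale c r') = fscale c (cat_prod p r r')"
  "cat_prod p 0 r' = 0" "cat_prod p r 0 = 0"
  by (auto simp: cat_prod_def fscale_def fun_eq_iff algebra_simps)

lemma cat_prod_gen: "length us = p \<Longrightarrow> cat_prod p (free_gen us) (free_gen vs) = free_gen (us @ vs)"
  by (auto simp: cat_prod_def free_gen_def fun_eq_iff) (metis append_take_drop_id)+

lemma tuples_append: "us \<in> tuples p V \<Longrightarrow> vs \<in> tuples q V \<Longrightarrow> us @ vs \<in> tuples (p + q) V"
  by (auto simp: tuples_def)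

lemma alt_rels_cases:
  assumes "r \<in> alt_rels n V"
  obtains (add) vs i x y where "r = free_gen (vs[i := x \<oplus>\<^bsub>V\<^esub> y]) - free_gen (vs[i := x]) - free_gen (vs[i := y])"
        "vs \<in> tuples n V" "i < n" "x \<in> carrier V" "y \<in> carrier V"
      | (scale) vs i c x where "r = free_gen (vs[i := c \<odot>\<^bsub>V\<^esub> x]) - fscale c (free_gen (vs[i := x]))"
        "vs \<in> tuples n V" "i < n" "x \<in> carrier V"
      | (rep) vs i j where "r = free_gen vs" "vs \<in> tuples n V" "i < j" "j < n" "vs ! i = vs ! j"
  using assms unfolding alt_rels_eq by blast

lemma alt_rels_intros:
  "vs \<in> tuples n V \<Longrightarrow> i < n \<Longrightarrow> x \<in> carrier V \<Longrightarrow> y \<in> carrier V \<Longrightarrow>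
    free_gen (vs[i := x \<oplus>\<^bsub>V\<^esub> y]) - free_gen (vs[i := x]) - free_gen (vs[i := y]) \<in> alt_rels n V"
  "vs \<in> tuples n V \<Longrightarrow> i < n \<Longrightarrow> x \<in> carrier V \<Longrightarrow>
    free_gen (vs[i := c \<odot>\<^bsub>V\<^esub> x]) - fscale c (free_gen (vs[i := x])) \<in> alt_rels n V"
  "vs \<in> tuples n V \<Longrightarrow> i < j \<Longrightarrow> j < n \<Longrightarrow> vs ! i = vs ! j \<Longrightarrow> free_gen vs \<in> alt_rels n V"
  unfolding alt_rels_eq by blast+

text \<open>A relation followed or preceded by a fixed tuple is again a relation, with its positions
  shifted in the second case. Bilinearity then shows that changing either representative by a
  relation does not change the class of the product.\<close>

lemma wedge_xw:
  fixes V :: "('f::field, 'v) module"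
  assumes p: "presents s Z W \<pi> V" and us: "us \<in> tuples k V" and vs: "vs \<in> tuples m V"
  shows "wedge V k m (xw k V c us) (xw m V d vs) = xw (k + m) V (c * d) (us @ vs)"
proof -
  let ?R = "alt_rels (k + m) V" and ?B = "tuples (k + m) V"
  note subk = alt_rels_fsupp[OF p, of k] and subm = alt_rels_fsupp[OF p, of m] and sub = alt_rels_fsupp[OF p, of "k + m"]
  have genL: "cat_prod k r (free_gen vs) \<in> fs.span ?R" if r: "r \<in> alt_rels k V" and vs: "vs \<in> tuples m V" for r vs
    using r
  proof (rule fs.span_base[OF alt_rels_cases], goal_cases)
    case (1 us i x y)
    then have len: "length us = k" by (simp add: tuples_def)
    have "cat_prod k r (free_gen vs) = free_gen ((us @ vs)[i := x \<oplus>\<^bsub>V\<^esub> y]) - free_gen ((us @ vs)[i := x]) - free_gen ((us @ vs)[i := y])"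
      using 1 len by (simp add: cat_prod_simps cat_prod_gen list_update_append1)
    then show ?case using alt_rels_intros(1)[OF tuples_append[OF 1(2) vs], of i x y] 1 by simp
  next
    case (2 us i c x)
    then have len: "length us = k" by (simp add: tuples_def)
    have "cat_prod k r (free_gen vs) = free_gen ((us @ vs)[i := c \<odot>\<^bsub>V\<^esub> x]) - fscale c (free_gen ((us @ vs)[i := x]))"
      using 2 len by (simp add: cat_prod_simps cat_prod_gen list_update_append1)
    then show ?case using alt_rels_intros(2)[OF tuples_append[OF 2(2) vs], of i x c] 2 by simp
  next
    case (3 us i j)
    then have len: "length us = k" by (simp add: tuples_def)
    have "cat_prod k r (free_gen vs) = free_gen (us @ vs)" using 3 len by (simp add: cat_prod_gen)
    then show ?case using alt_rels_intros(3)[OF tuples_append[OF 3(2) vs], of i j] 3 len by (simp add: nth_append)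
  qed
  have genR: "cat_prod k (free_gen us) r \<in> fs.span ?R" if r: "r \<in> alt_rels m V" and us: "us \<in> tuples k V" for r us
    using r
  proof (rule fs.span_base[OF alt_rels_cases], goal_cases)
    case (1 vs i x y)
    have len: "length us = k" using us by (simp add: tuples_def)
    have "cat_prod k (free_gen us) r = free_gen ((us @ vs)[k + i := x \<oplus>\<^bsub>V\<^esub> y]) - free_gen ((us @ vs)[k + i := x]) - free_gen ((us @ vs)[k + i := y])"
      using 1 len by (simp add: cat_prod_simps cat_prod_gen list_update_append)
    then show ?case using alt_rels_intros(1)[OF tuples_append[OF us 1(2)], of "k + i" x y] 1 by simp
  next
    case (2 vs i c x)
    have len: "length us = k" using us by (simp add: tuples_def)
    have "cat_prod k (free_gen us) r = free_gen ((us @ vs)[k + i := c \<odot>\<^bsub>V\<^esub> x]) - fscale c (free_gen ((us @ vs)[k + i := x]))"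
      using 2 len by (simp add: cat_prod_simps cat_prod_gen list_update_append)
    then show ?case using alt_rels_intros(2)[OF tuples_append[OF us 2(2)], of "k + i" x c] 2 by simp
  next
    case (3 vs i j)
    have len: "length us = k" using us by (simp add: tuples_def)
    have "cat_prod k (free_gen us) r = free_gen (us @ vs)" using 3 len by (simp add: cat_prod_gen)
    then show ?case using alt_rels_intros(3)[OF tuples_append[OF us 3(2)], of "k + i" "k + j"] 3 len by (simp add: nth_append)
  qed
  have L1: "cat_prod k \<sigma> (free_gen vs) \<in> fs.span ?R" if \<sigma>: "\<sigma> \<in> fs.span (alt_rels k V)" and vs: "vs \<in> tuples m V" for \<sigma> vs
    using \<sigma>
  proof (induction rule: fs.span_induct_alt)
    case base show ?case unfolding cat_prod_simps by (rule fs.span_zero)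
  next
    case (step c x y)
    have "cat_prod k (fscale c x + y) (free_gen vs) \<in> fs.span ?R"
      unfolding cat_prod_simps by (intro fs.span_add fs.span_scale genL step vs)
    then show ?case .
  qed
  have R1: "cat_prod k (free_gen us) \<sigma> \<in> fs.span ?R" if \<sigma>: "\<sigma> \<in> fs.span (alt_rels m V)" and us: "us \<in> tuples k V" for \<sigma> us
    using \<sigma>
  proof (induction rule: fs.span_induct_alt)
    case base show ?case unfolding cat_prod_simps by (rule fs.span_zero)
  next
    case (step c x y)
    have "cat_prod k (free_gen us) (fscale c x + y) \<in> fs.span ?R"
      unfolding cat_prod_simps by (intro fs.span_add fs.span_scale genR step us)
    then show ?case .
  qed
  \<comment> \<open>The second factor may be any finitely supported function, because it will be a
    tuple plus a relation.\<close>
  have L2: "cat_prod k \<sigma> r \<in> fs.span ?R" if \<sigma>: "\<sigma> \<in> fs.span (alt_rels k V)" and r: "r \<in> fs.span (free_gen ` tuples m V)" for \<sigma> r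
    using r
  proof (induction rule: fs.span_induct_alt)
    case base show ?case unfolding cat_prod_simps by (rule fs.span_zero)
  next
    case (step c x y)
    then obtain vs where "vs \<in> tuples m V" "x = free_gen vs" by auto
    then have "cat_prod k \<sigma> x \<in> fs.span ?R" using L1[OF \<sigma>] by simp
    then have "cat_prod k \<sigma> (fscale c x + y) \<in> fs.span ?R"
      unfolding cat_prod_simps by (intro fs.span_add fs.span_scale step)
    then show ?case .
  qed
  let ?u = "fscale c (free_gen us)" and ?v = "fscale d (free_gen vs)"
  have lenu: "length us = k" using us by (simp add: tuples_def)
  have cd: "cat_prod k ?u ?v = fscale (c * d) (free_gen (us @ vs))"
    by (simp add: cat_prod_simps cat_prod_gen[OF lenu] mult.commute)
  have *: "fcls ?B ?R (cat_prod k (\<sigma> + ?u) (\<tau> + ?v)) = xw (k + m) V (c * d) (us @ vs)"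
    if \<sigma>: "\<sigma> \<in> fs.span (alt_rels k V)" and \<tau>: "\<tau> \<in> fs.span (alt_rels m V)" for \<sigma> \<tau>
  proof -
    have "\<tau> \<in> fsupp (tuples m V)" using \<tau> fs.span_minimal[OF subm fsupp_subspace] by auto
    then have "\<tau> + ?v \<in> fs.span (free_gen ` tuples m V)"
      unfolding fsupp_span[symmetric] using free_gen_fsupp[OF vs]
      by (intro fs.subspace_add[OF fsupp_subspace] fs.subspace_scale[OF fsupp_subspace])
    from L2[OF \<sigma> this] have 1: "cat_prod k \<sigma> (\<tau> + ?v) \<in> fs.span ?R" .
    have 2: "cat_prod k ?u \<tau> \<in> fs.span ?R" unfolding cat_prod_simps by (intro fs.span_scale R1 \<tau> us)
    have "cat_prod k (\<sigma> + ?u) (\<tau> + ?v) - cat_prod k ?u ?v = cat_prod k \<sigma> (\<tau> + ?v) + cat_prod k ?u \<tau>"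
      by (simp only: cat_prod_simps(1,4)) (simp add: algebra_simps)
    then have "cat_prod k (\<sigma> + ?u) (\<tau> + ?v) - cat_prod k ?u ?v \<in> fs.span ?R"
      using fs.span_add[OF 1 2] by metis
    then have "fcls ?B ?R (cat_prod k (\<sigma> + ?u) (\<tau> + ?v)) = fcls ?B ?R (cat_prod k ?u ?v)"
      unfolding fcls_eq[OF sub] by (subst coset_eq_iff[OF fs.vector_space_axioms fs.subspace_span])
    then show ?thesis unfolding cd xw_def .
  qed
  have "wedge V k m (xw k V c us) (xw m V d vs)
      = (\<Union>r\<in>xw k V c us. \<Union>r'\<in>xw m V d vs. fcls ?B ?R (cat_prod k r r'))"
    by (simp add: wedge_def fcls_def cat_prod_def)
  also have "\<dots> = (\<Union>\<sigma>\<in>fs.span (alt_rels k V). \<Union>\<tau>\<in>fs.span (alt_rels m V). fcls ?B ?R (cat_prod k (\<sigma> + ?u) (\<tau> + ?v)))"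
    unfolding xw_def fcls_eq[OF subk] fcls_eq[OF subm] by blast
  also have "\<dots> = (\<Union>\<sigma>\<in>fs.span (alt_rels k V). \<Union>\<tau>\<in>fs.span (alt_rels m V). xw (k + m) V (c * d) (us @ vs))"
    using * by (intro SUP_cong refl) auto
  also have "\<dots> = xw (k + m) V (c * d) (us @ vs)"
    using fs.span_zero[of "alt_rels k V"] fs.span_zero[of "alt_rels m V"] by auto
  finally show ?thesis .
qed

section \<open>Tensor products and duals of lines\<close>

definition lcoef :: "('f::field, 'v) module \<Rightarrow> 'v \<Rightarrow> 'v \<Rightarrow> 'f" where
  "lcoef V g v = (THE c. v = c \<odot>\<^bsub>V\<^esub> g)"

lemma lcoef_scale:
  assumes "is_line V g"
  shows "lcoef V g (c \<odot>\<^bsub>V\<^esub> g) = c"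
  unfolding lcoef_def lineD(2)[OF assms] by simp

lemma lcoef_add:
  assumes L: "is_line V g" and x: "x \<in> carrier V" and y: "y \<in> carrier V"
  shows "lcoef V g (x \<oplus>\<^bsub>V\<^esub> y) = lcoef V g x + lcoef V g y"
proof -
  obtain a b where "x = a \<odot>\<^bsub>V\<^esub> g" "y = b \<odot>\<^bsub>V\<^esub> g" using x y lineD(1)[OF L] by auto
  then show ?thesis by (simp add: lineD(3)[OF L] lcoef_scale[OF L])
qed

lemma lcoef_mult:
  assumes L: "is_line V g" and x: "x \<in> carrier V"
  shows "lcoef V g (c \<odot>\<^bsub>V\<^esub> x) = c * lcoef V g x"
proof -
  obtain a where "x = a \<odot>\<^bsub>V\<^esub> g" using x lineD(1)[OF L] by auto
  then show ?thesis by (simp add: lineD(4)[OF L] lcoef_scale[OF L])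
qed

text \<open>The functional that separates the generator from the relations is the product of the two
  coefficient functionals.\<close>

lemma tensor_line:
  fixes V :: "('f::field, 'v) module" and U :: "('f, 'w) module"
  assumes V: "is_line V g" "1 \<odot>\<^bsub>V\<^esub> g = g" and U: "is_line U h" "1 \<odot>\<^bsub>U\<^esub> h = h"
  shows "is_line (tensor_vs V U) (tensor V U g h)"
    and "tensor V U (c \<odot>\<^bsub>V\<^esub> g) (d \<odot>\<^bsub>U\<^esub> h) = (c * d) \<odot>\<^bsub>tensor_vs V U\<^esub> tensor V U g h"
proof -
  let ?B = "carrier V \<times> carrier U" and ?R = "tensor_rels V U"
  let ?g = "free_gen :: 'v \<times> 'w \<Rightarrow> 'v \<times> 'w \<Rightarrow> 'f"
  have R: "?R =
     {?g (v \<oplus>\<^bsub>V\<^esub> v', w) - ?g (v, w) - ?g (v', w) | v v' w. v \<in> carrier V \<and> v' \<in> carrier V \<and> w \<in> carrier U} \<union>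
     {?g (v, w \<oplus>\<^bsub>U\<^esub> w') - ?g (v, w) - ?g (v, w') | v w w'. v \<in> carrier V \<and> w \<in> carrier U \<and> w' \<in> carrier U} \<union>
     {?g (c \<odot>\<^bsub>V\<^esub> v, w) - fscale c (?g (v, w)) | c v w. v \<in> carrier V \<and> w \<in> carrier U} \<union>
     {?g (v, c \<odot>\<^bsub>U\<^esub> w) - fscale c (?g (v, w)) | c v w. v \<in> carrier V \<and> w \<in> carrier U}"
    by (simp add: tensor_rels_def fscale_def fun_diff_def)
  note cV = presents_closed[OF V(1)] and cU = presents_closed[OF U(1)]
  have gc: "g \<in> carrier V" "h \<in> carrier U" using V U lineD(1)[OF V(1)] lineD(1)[OF U(1)] by (metis rangeI)+
  note df = fs.subspace_diff[OF fsupp_subspace[of ?B]] and sc = fs.subspace_scale[OF fsupp_subspace[of ?B]]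
    and fg = free_gen_fsupp[of _ ?B]
  have sub: "?R \<subseteq> fsupp ?B"
    unfolding R using cV cU by (auto intro!: df sc fg)
  define \<phi> where "\<phi> = (\<lambda>(v, w). lcoef V g v * lcoef U h w)"
  have b0: "(g, h) \<in> ?B" using gc by simp
  have \<phi>1: "\<phi> (g, h) = 1" using lcoef_scale[OF V(1), of 1] lcoef_scale[OF U(1), of 1] V U by (simp add: \<phi>_def)
  have span: "\<exists>c. free_gen b - fscale c (free_gen (g, h)) \<in> fs.span ?R" if m: "b \<in> ?B" for b
  proof -
    obtain v w where vw: "b = (v, w)" "v \<in> carrier V" "w \<in> carrier U" using m by auto
    obtain c where c: "v = c \<odot>\<^bsub>V\<^esub> g" using vw(2) unfolding lineD(1)[OF V(1)] by blast
    obtain d where d: "w = d \<odot>\<^bsub>U\<^esub> h" using vw(3) unfolding lineD(1)[OF U(1)] by blast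
    note b = vw(1)[unfolded c d]
    have dh: "d \<odot>\<^bsub>U\<^esub> h \<in> carrier U" using gc cU by auto
    have 1: "?g (c \<odot>\<^bsub>V\<^esub> g, d \<odot>\<^bsub>U\<^esub> h) - fscale c (?g (g, d \<odot>\<^bsub>U\<^esub> h)) \<in> ?R"
      unfolding R using gc dh by blast
    have 2: "?g (g, d \<odot>\<^bsub>U\<^esub> h) - fscale d (?g (g, h)) \<in> ?R"
      unfolding R using gc by blast
    have "?g b - fscale (c * d) (?g (g, h)) = (?g (c \<odot>\<^bsub>V\<^esub> g, d \<odot>\<^bsub>U\<^esub> h) - fscale c (?g (g, d \<odot>\<^bsub>U\<^esub> h)))
       + fscale c (?g (g, d \<odot>\<^bsub>U\<^esub> h) - fscale d (?g (g, h)))"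
      by (simp add: b fs.scale_right_diff_distrib)
    also have "\<dots> \<in> fs.span ?R" by (intro fs.span_add fs.span_scale fs.span_base 1 2)
    finally show ?thesis by (rule exI)
  qed
  have kill: "fext \<phi> r = 0" if r: "r \<in> ?R" for r
  proof -
    have ext2: "fext \<phi> (?g x - ?g y - ?g z) = \<phi> x - \<phi> y - \<phi> z" if "x \<in> ?B" "y \<in> ?B" "z \<in> ?B" for x y z
      using that by (simp add: fext_diff[OF df[OF fg fg] fg] fext_diff[OF fg fg] fext_free_gen)
    have ext3: "fext \<phi> (?g x - fscale c (?g y)) = \<phi> x - c * \<phi> y" if "x \<in> ?B" "y \<in> ?B" for x y c
      using that by (simp add: fext_diff[OF fg sc[OF fg]] fext_scale[OF fg] fext_free_gen)
    from r consider (1) v v' w where "r = ?g (v \<oplus>\<^bsub>V\<^esub> v', w) - ?g (v, w) - ?g (v', w)" "v \<in> carrier V" "v' \<in> carrier V" "w \<in> carrier U"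
      | (2) v w w' where "r = ?g (v, w \<oplus>\<^bsub>U\<^esub> w') - ?g (v, w) - ?g (v, w')" "v \<in> carrier V" "w \<in> carrier U" "w' \<in> carrier U"
      | (3) c v w where "r = ?g (c \<odot>\<^bsub>V\<^esub> v, w) - fscale c (?g (v, w))" "v \<in> carrier V" "w \<in> carrier U"
      | (4) c v w where "r = ?g (v, c \<odot>\<^bsub>U\<^esub> w) - fscale c (?g (v, w))" "v \<in> carrier V" "w \<in> carrier U"
      unfolding R by blast
    then show ?thesis
    proof cases
      case 1
      then show ?thesis
        unfolding 1(1) by (subst ext2) (auto simp: cV \<phi>_def lcoef_add[OF V(1)] algebra_simps)
    next
      case 2
      then show ?thesis
        unfolding 2(1) by (subst ext2) (auto simp: cU \<phi>_def lcoef_add[OF U(1)] algebra_simps)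
    next
      case 3
      then show ?thesis
        unfolding 3(1) by (subst ext3) (auto simp: cV \<phi>_def lcoef_mult[OF V(1)] algebra_simps)
    next
      case 4
      then show ?thesis
        unfolding 4(1) by (subst ext3) (auto simp: cU \<phi>_def lcoef_mult[OF U(1)] algebra_simps)
    qed
  qed
  have tens: "tensor V U v w = fcls ?B ?R (free_gen (v, w))" for v w by (simp add: tensor_def fcls_def)
  show "is_line (tensor_vs V U) (tensor V U g h)"
    unfolding tens tensor_vs_def by (rule presentation_line(1)[where \<phi> = \<phi>, OF sub b0 \<phi>1]) (fact span, fact kill)
  have m: "(c \<odot>\<^bsub>V\<^esub> g, d \<odot>\<^bsub>U\<^esub> h) \<in> ?B" using gc cV cU by auto
  have "fcls ?B ?R (fscale 1 (free_gen (c \<odot>\<^bsub>V\<^esub> g, d \<odot>\<^bsub>U\<^esub> h)))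
      = (1 * \<phi> (c \<odot>\<^bsub>V\<^esub> g, d \<odot>\<^bsub>U\<^esub> h)) \<odot>\<^bsub>tensor_vs V U\<^esub> fcls ?B ?R (free_gen (g, h))"
    unfolding tensor_vs_def
    by (rule presentation_line(2)[where \<phi> = \<phi>, OF sub b0 \<phi>1 _ _ m]) (fact span, fact kill)
  then show "tensor V U (c \<odot>\<^bsub>V\<^esub> g) (d \<odot>\<^bsub>U\<^esub> h) = (c * d) \<odot>\<^bsub>tensor_vs V U\<^esub> tensor V U g h"
    unfolding tens by (simp add: \<phi>_def lcoef_scale[OF V(1)] lcoef_scale[OF U(1)])
qed

lemma dual_smult: "c \<odot>\<^bsub>dual_vs V\<^esub> \<phi> = (\<lambda>v\<in>carrier V. c * \<phi> v)"
  by (simp only: dual_vs_def module.simps)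

lemma dual_vec_line:
  fixes V :: "('f::field, 'v) module"
  assumes V: "is_line V g" "1 \<odot>\<^bsub>V\<^esub> g = g" and c: "c \<noteq> 0"
  shows "dual_vec V (c \<odot>\<^bsub>V\<^esub> g) = (\<lambda>v\<in>carrier V. inverse c * lcoef V g v)"
  unfolding dual_vec_def
proof (rule the_equality)
  note L = lineD[OF V(1)]
  let ?\<psi> = "\<lambda>v\<in>carrier V. inverse c * lcoef V g v"
  have cg: "x \<odot>\<^bsub>V\<^esub> g \<in> carrier V" for x using L by auto
  note cV = presents_closed[OF V(1)]
  show "?\<psi> \<in> carrier (dual_vs V) \<and> ?\<psi> (c \<odot>\<^bsub>V\<^esub> g) = 1"
    using c cg cV lcoef_add[OF V(1)] lcoef_mult[OF V(1)] lcoef_scale[OF V(1)]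
    by (auto simp: dual_vs_def LinearCombinations.module_hom_def vs_of_def algebra_simps)
  fix \<phi> assume \<phi>: "\<phi> \<in> carrier (dual_vs V) \<and> \<phi> (c \<odot>\<^bsub>V\<^esub> g) = 1"
  then have hom: "\<phi> (x \<odot>\<^bsub>V\<^esub> v) = x * \<phi> v" if "v \<in> carrier V" for x v
    using that by (auto simp: dual_vs_def LinearCombinations.module_hom_def vs_of_def)
  have ext: "\<phi> \<in> extensional (carrier V)" using \<phi> by (auto simp: dual_vs_def)
  have gc: "g \<in> carrier V" using cg[of 1] V(2) by simp
  have "c * \<phi> g = 1" using \<phi> hom[OF gc] by simp
  then have pg: "\<phi> g = inverse c" using c by (simp add: field_simps)
  show "\<phi> = ?\<psi>"
  proof (rule extensionalityI[OF ext restrict_extensional])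
    fix v assume v: "v \<in> carrier V"
    then obtain x where x: "v = x \<odot>\<^bsub>V\<^esub> g" using L by auto
    show "\<phi> v = ?\<psi> v" using v hom[OF gc] pg unfolding x by (simp add: lcoef_scale[OF V(1)] cg)
  qed
qed

text \<open>A functional on a line is fixed by its value at a generator. The dual vector of
  \<open>c g\<close> is therefore the inverse scalar times that of \<open>g\<close>, and this is
  where the inverses in the generator of \<open>|D|\<close> come from.\<close>

lemma dual_line:
  fixes V :: "('f::field, 'v) module"
  assumes V: "is_line V g" "1 \<odot>\<^bsub>V\<^esub> g = g"
  shows "is_line (dual_vs V) (dual_vec V g)" "1 \<odot>\<^bsub>dual_vs V\<^esub> dual_vec V g = dual_vec V g"
    and "c \<noteq> 0 \<Longrightarrow> dual_vec V (c \<odot>\<^bsub>V\<^esub> g) = inverse c \<odot>\<^bsub>dual_vs V\<^esub> dual_vec V g"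
proof -
  note L = lineD[OF V(1)]
  let ?\<psi> = "\<lambda>v\<in>carrier V. lcoef V g v"
  have dg: "dual_vec V g = ?\<psi>" using dual_vec_line[OF V, of 1] V(2) by simp
  have cg: "x \<odot>\<^bsub>V\<^esub> g \<in> carrier V" for x using L by auto
  note cV = presents_closed[OF V(1)]
  have gc: "g \<in> carrier V" using cg[of 1] V(2) by simp
  have sm: "x \<odot>\<^bsub>dual_vs V\<^esub> ?\<psi> = (\<lambda>v\<in>carrier V. x * lcoef V g v)" for x
    by (auto simp: dual_vs_def)
  have carr: "(\<lambda>v\<in>carrier V. x * lcoef V g v) \<in> carrier (dual_vs V)" for x
    using cV lcoef_add[OF V(1)] lcoef_mult[OF V(1)]
    by (auto simp: dual_vs_def LinearCombinations.module_hom_def vs_of_def algebra_simps)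
  have all: "\<exists>x. \<phi> = (\<lambda>v\<in>carrier V. x * lcoef V g v)" if \<phi>: "\<phi> \<in> carrier (dual_vs V)" for \<phi>
  proof
    have hom: "\<phi> (x \<odot>\<^bsub>V\<^esub> v) = x * \<phi> v" if "v \<in> carrier V" for x v
      using \<phi> that by (auto simp: dual_vs_def LinearCombinations.module_hom_def vs_of_def)
    have ext: "\<phi> \<in> extensional (carrier V)" using \<phi> by (auto simp: dual_vs_def)
    show "\<phi> = (\<lambda>v\<in>carrier V. \<phi> g * lcoef V g v)"
    proof (rule extensionalityI[OF ext restrict_extensional])
      fix v assume v: "v \<in> carrier V"
      then obtain x where x: "v = x \<odot>\<^bsub>V\<^esub> g" using L by auto
      show "\<phi> v = (\<lambda>v\<in>carrier V. \<phi> g * lcoef V g v) v" using v hom[OF gc] unfolding x by (simp add: lcoef_scale[OF V(1)] cg)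
    qed
  qed
  have inj: "(\<lambda>v\<in>carrier V. x * lcoef V g v) = (\<lambda>v\<in>carrier V. y * lcoef V g v) \<longleftrightarrow> x = y" for x y
  proof
    assume "(\<lambda>v\<in>carrier V. x * lcoef V g v) = (\<lambda>v\<in>carrier V. y * lcoef V g v)"
    from fun_cong[OF this, of g] show "x = y" using gc lcoef_scale[OF V(1), of 1] V(2) by simp
  qed simp
  interpret F: vector_space "(*) :: 'f \<Rightarrow> 'f \<Rightarrow> 'f" by (rule vector_space_field)
  let ?p = "\<lambda>x. \<lambda>v\<in>carrier V. x * lcoef V g v"
  have carr': "carrier (dual_vs V) = range ?p" using all carr by blast
  have zero: "\<zero>\<^bsub>dual_vs V\<^esub> = ?p 0" by (simp add: dual_vs_def)
  have plus: "?p x \<oplus>\<^bsub>dual_vs V\<^esub> ?p y = ?p (x + y)" for x y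
  proof -
    have "?p x \<oplus>\<^bsub>dual_vs V\<^esub> ?p y = (\<lambda>v\<in>carrier V. ?p x v + ?p y v)" by (simp add: dual_vs_def)
    also have "\<dots> = ?p (x + y)" by (rule restrict_ext) (simp add: distrib_right)
    finally show ?thesis .
  qed
  have mult: "x \<odot>\<^bsub>dual_vs V\<^esub> ?p y = ?p (x * y)" for x y
  proof -
    have "x \<odot>\<^bsub>dual_vs V\<^esub> ?p y = (\<lambda>v\<in>carrier V. x * ?p y v)" by (rule dual_smult)
    also have "\<dots> = ?p (x * y)" by (rule restrict_ext) (simp only: restrict_apply' mult.assoc)
    finally show ?thesis .
  qed
  show "is_line (dual_vs V) (dual_vec V g)"
    unfolding presents_def dg sm
  proof (intro conjI ballI allI)
    show "carrier (dual_vs V) = range ?p" by (rule carr')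
    show "\<zero>\<^bsub>dual_vs V\<^esub> = ?p 0" by (rule zero)
    show "(?p x = ?p y) = (x - y \<in> {0})" for x y unfolding inj by simp
    show "?p x \<oplus>\<^bsub>dual_vs V\<^esub> ?p y = ?p (x + y)" for x y by (rule plus)
    show "x \<odot>\<^bsub>dual_vs V\<^esub> ?p y = ?p (x * y)" for x y by (rule mult)
  qed (simp_all add: vector_space_field)
  show "1 \<odot>\<^bsub>dual_vs V\<^esub> dual_vec V g = dual_vec V g" unfolding dg sm by simp
  show "dual_vec V (c \<odot>\<^bsub>V\<^esub> g) = inverse c \<odot>\<^bsub>dual_vs V\<^esub> dual_vec V g" if "c \<noteq> 0"
    unfolding dg sm using dual_vec_line[OF V that] .
qed

lemma tensor_dual_line:
  fixes V :: "('f::field, 'v) module" and U :: "('f, 'w) module"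
  assumes V: "is_line V g" "1 \<odot>\<^bsub>V\<^esub> g = g" and U: "is_line U h" "1 \<odot>\<^bsub>U\<^esub> h = h"
  shows "is_line (tensor_vs V (dual_vs U)) (tensor V (dual_vs U) g (dual_vec U h))"
    and "d \<noteq> 0 \<Longrightarrow> tensor V (dual_vs U) (c \<odot>\<^bsub>V\<^esub> g) (dual_vec U (d \<odot>\<^bsub>U\<^esub> h)) =
      (c * inverse d) \<odot>\<^bsub>tensor_vs V (dual_vs U)\<^esub> tensor V (dual_vs U) g (dual_vec U h)"
  using tensor_line[OF V dual_line(1,2)[OF U]] dual_line(3)[OF U] by auto

section \<open>Folded operators\<close>

text \<open>A complex with a pseudo-inverse, as four bare maps. The hypotheses are symmetric under
  exchanging the two spaces, so \<open>swap\<close> yields every statement for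
  \<open>X\<^sub>-\<close> as well.\<close>

locale folded =
  fixes sp :: "'f::field \<Rightarrow> 'a::ab_group_add \<Rightarrow> 'a" and sm :: "'f \<Rightarrow> 'b::ab_group_add \<Rightarrow> 'b"
    and d :: "'a \<Rightarrow> 'b" and e :: "'b \<Rightarrow> 'a" and d' :: "'b \<Rightarrow> 'a" and e' :: "'a \<Rightarrow> 'b"
  assumes lin: "Vector_Spaces.linear sp sm d" "Vector_Spaces.linear sm sp e"
      "Vector_Spaces.linear sm sp d'" "Vector_Spaces.linear sp sm e'"
    and complex: "e (d x) = 0" "d (e y) = 0"
    and pinv: "d (d' (d x)) = d x" "d' (d (d' y)) = d' y" "e (e' (e y)) = e y" "e' (e (e' x)) = e' x"
    and orth: "e' (d' y) = 0" "d' (e' x) = 0"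
begin

lemma swap: "folded sm sp e d e' d'"
  by (rule folded.intro) (fact lin complex pinv orth)+

text \<open>\<open>sg\<close> and \<open>rh\<close> are the folded operators
  \<open>\<sigma>\<^sub>+\<close> and \<open>\<sigma>\<^sub>-\<close>, and \<open>P\<close> is the
  idempotent \<open>P\<^sub>+\<close> onto the kernel of \<open>sg\<close>.\<close>

definition sg where "sg x = d x + e' x"
definition rh where "rh y = e y + d' y"
definition P where "P x = x - rh (sg x)"

sublocale d: Vector_Spaces.linear sp sm d by (rule lin)
sublocale e: Vector_Spaces.linear sm sp e by (rule lin)
sublocale d': Vector_Spaces.linear sm sp d' by (rule lin)
sublocale e': Vector_Spaces.linear sp sm e' by (rule lin)

lemmas maps_simps = d.add d.diff d.zero d.scale e.add e.diff e.zero e.scale d'.add d'.diff d'.zero d'.scale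
  e'.add e'.diff e'.zero e'.scale complex pinv orth

lemma linear_sg: "Vector_Spaces.linear sp sm sg"
  by (unfold_locales) (simp_all add: sg_def maps_simps d.vs2.scale_right_distrib algebra_simps)

lemma linear_rh: "Vector_Spaces.linear sm sp rh"
  by (unfold_locales) (simp_all add: rh_def maps_simps d.vs1.scale_right_distrib algebra_simps)

sublocale sg: Vector_Spaces.linear sp sm sg by (rule linear_sg)
sublocale rh: Vector_Spaces.linear sm sp rh by (rule linear_rh)

lemma linear_P: "Vector_Spaces.linear sp sp P"
  by (unfold_locales) (simp_all add: P_def sg.add rh.add sg.scale rh.scale d.vs1.scale_right_diff_distrib algebra_simps)

sublocale P: Vector_Spaces.linear sp sp P by (rule linear_P)

text \<open>The mixed terms vanish by \<open>complex\<close> and \<open>orth\<close>. This is the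
  decomposition of \<open>X\<^sub>+\<close> into the image of \<open>e\<close>, the kernel of
  \<open>sg\<close> and the image of \<open>d'\<close>.\<close>

lemma P_eq: "P x = x - e (e' x) - d' (d x)"
  by (simp add: P_def rh_def sg_def maps_simps algebra_simps)

lemma rh_sg: "rh (sg (rh y)) = rh y" "sg (rh (sg x)) = sg x"
  by (simp_all add: rh_def sg_def maps_simps)

lemma P_simps: "d (P x) = 0" "e' (P x) = 0" "P (e y) = 0" "P (d' y) = 0" "P (P x) = P x" "sg (P x) = 0" "P (rh y) = 0"
proof -
  show 1: "d (P x) = 0" "e' (P x) = 0" for x by (simp_all add: P_eq maps_simps)
  show "P (e y) = 0" "P (d' y) = 0" by (simp_all add: P_eq maps_simps)
  then show "P (rh y) = 0" by (simp add: rh_def P.add P_eq maps_simps)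
  show "sg (P x) = 0" by (simp add: sg_def 1)
  then show "P (P x) = P x" by (simp add: P_def[of "P x"] rh.zero)
qed

lemma ker_sg: "sg x = 0 \<longleftrightarrow> d x = 0 \<and> e' x = 0"
proof
  assume h: "sg x = 0"
  \<comment> \<open>Applying \<open>e' e\<close> kills the summand \<open>d x\<close> and returns
    the other one.\<close>
  have "e' (e (sg x)) = e' x" by (simp add: sg_def maps_simps)
  with h have "e' x = 0" by (simp add: maps_simps)
  with h show "d x = 0 \<and> e' x = 0" by (simp add: sg_def)
qed (simp add: sg_def)

lemma P_ker: "sg x = 0 \<Longrightarrow> P x = x"
  by (simp add: P_def rh.zero)

lemma range_rh: "x \<in> range rh \<longleftrightarrow> P x = 0"
proof
  assume "P x = 0"
  then have "x = rh (sg x)" by (simp add: P_def)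
  then show "x \<in> range rh" by blast
qed (auto simp: P_simps)

lemma subspace_range_rh: "d.vs1.subspace (range rh)"
  by (rule linear_range_subspace[OF linear_rh])

lemma subspace_range_e: "d.vs1.subspace (range e)"
  by (rule linear_range_subspace[OF lin(2)])

lemma range_e_le: "range e \<subseteq> ker_set d"
  by (auto simp: complex)

lemma mod_e: "d x = 0 \<Longrightarrow> x - P x \<in> range e"
  by (auto simp: P_eq d'.zero)

text \<open>\<open>P\<close> identifies the quotient by the image of \<open>rh\<close> with
  cohomology: its kernel is exactly the image of \<open>rh\<close>, and it moves an element of the
  kernel of \<open>d\<close> only by an element of the image of \<open>e\<close>.\<close>

lemma qbasis_H:
  assumes q: "qbasis sp UNIV (range rh) ss"
  shows "qbasis sp (ker_set d) (range e) (map P ss)"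
proof (rule d.vs1.qbasisI)
  show "set (map P ss) \<subseteq> ker_set d" by (auto simp: P_simps)
next
  fix x assume x: "x \<in> ker_set d"
  obtain a where "x - lcomb sp ss a \<in> range rh" using d.vs1.qcoord_rest(1)[OF q UNIV_I] by blast
  then have "P x = lcomb sp (map P ss) a" by (simp add: range_rh P.diff linear_lcomb[OF linear_P])
  then show "\<exists>a. x - lcomb sp (map P ss) a \<in> range e" using mod_e[of x] x by auto
next
  fix a i assume "lcomb sp (map P ss) a \<in> range e" and i: "i < length (map P ss)"
  then obtain y where "P (lcomb sp ss a) = e y" by (auto simp: linear_lcomb[OF linear_P])
  then have "P (lcomb sp ss a) = 0" using P_simps(3,5) by metis
  then show "a i = 0" using d.vs1.qbasis_indep[OF q] i by (simp add: range_rh)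
qed

lemma qbasis_ker:
  assumes q: "qbasis sp (ker_set d) (range e) hs"
  shows "qbasis sp (ker_set sg) {0} (map P hs)"
proof (rule d.vs1.qbasisI)
  show "set (map P hs) \<subseteq> ker_set sg" by (auto simp: P_simps)
next
  fix x assume x: "x \<in> ker_set sg"
  then have "x \<in> ker_set d" by (simp add: ker_sg)
  from d.vs1.qcoord_rest(1)[OF q this] obtain a where "x - lcomb sp hs a \<in> range e" by blast
  then have "P (x - lcomb sp hs a) = 0" by (auto simp: P_simps)
  then show "\<exists>a. x - lcomb sp (map P hs) a \<in> {0}"
    using P_ker[of x] x by (auto simp: P.diff linear_lcomb[OF linear_P])
next
  fix a i assume "lcomb sp (map P hs) a \<in> {0}" and i: "i < length (map P hs)"
  then have "P (lcomb sp hs a) = 0" by (simp add: linear_lcomb[OF linear_P])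
  moreover have "lcomb sp hs a \<in> ker_set d"
    by (rule d.vs1.lcomb_mem[OF linear_kernel_subspace[OF lin(1)] d.vs1.qbasis_set[OF q]])
  ultimately have "lcomb sp hs a \<in> range e" using mod_e[of "lcomb sp hs a"] by simp
  then show "a i = 0" using d.vs1.qbasis_indep[OF q] i by simp
qed

lemma qbasis_ker_UNIV:
  assumes q: "qbasis sp (ker_set sg) {0} ss"
  shows "qbasis sp UNIV (range rh) ss"
proof (rule d.vs1.qbasisI)
  fix x
  have "P x \<in> ker_set sg" by (simp add: P_simps)
  from d.vs1.qcoord_rest(1)[OF q this] obtain a where "P x - lcomb sp ss a \<in> {0}" by blast
  then have "x - lcomb sp ss a = rh (sg x)" by (simp add: P_def algebra_simps)
  then show "\<exists>a. x - lcomb sp ss a \<in> range rh" by (metis rangeI)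
next
  fix a i assume "lcomb sp ss a \<in> range rh" and i: "i < length ss"
  moreover have "lcomb sp ss a \<in> ker_set sg"
    by (rule d.vs1.lcomb_mem[OF linear_kernel_subspace[OF linear_sg] d.vs1.qbasis_set[OF q]])
  ultimately have "lcomb sp ss a = 0" using P_ker[of "lcomb sp ss a"] by (simp add: range_rh)
  then show "a i = 0" using d.vs1.qbasis_indep[OF q] i by simp
qed simp

lemma map_P_ker: "set ss \<subseteq> ker_set sg \<Longrightarrow> map P ss = ss"
  by (rule map_idI) (auto intro: P_ker)

end

section \<open>Two pseudo-inverses of one complex\<close>

locale folded2 = A: folded sp sm d e d1 e1 + B: folded sp sm d e d2 e2
  for sp :: "'f::field \<Rightarrow> 'a::ab_group_add \<Rightarrow> 'a" and sm :: "'f \<Rightarrow> 'b::ab_group_add \<Rightarrow> 'b"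
    and d e d1 e1 d2 e2
begin

text \<open>
  The unipotent automorphism of \<open>X\<^sub>+\<close> that carries the decomposition \<open>1 = e e\<^sub>1 + P\<^sub>1 + d\<^sub>1 d\<close> given by the first pseudo-inverse
  to the one given by the second.
\<close>

definition u where "u x = e (e1 x) + B.P (A.P x) + d2 (d x)"

lemma swap2: "folded2 sp sm d e d2 e2 d1 e1"
  by unfold_locales

lemma swap: "folded2 sm sp e d e1 d1 e2 d2"
  unfolding folded2_def using A.swap B.swap by simp

lemma linear_u: "Vector_Spaces.linear sp sp u"
  by unfold_locales (simp_all add: u_def A.maps_simps B.maps_simps A.P.add B.P.add A.P.scale B.P.scale
      A.d.vs1.scale_right_distrib)

lemma P_absorb: "d x = 0 \<Longrightarrow> B.P (A.P x) = B.P x"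
proof -
  assume "d x = 0"
  then have "B.P (x - A.P x) = 0" using A.mod_e[of x] B.P_simps(3) by auto
  then show ?thesis by (simp add: B.P.diff)
qed

lemma P_u: "B.P (u x) = B.P (A.P x)"
  by (simp add: u_def B.P.add B.P_simps)

end

text \<open>The same construction with the pseudo-inverses exchanged is the inverse; each of the
  three summands is carried back separately. For the middle one, \<open>A.P\<close> and
  \<open>B.P\<close> agree on the kernel of \<open>d\<close> up to the image of
  \<open>e\<close>.\<close>

lemma (in folded2) u_inverse: "folded2.u d e d2 e2 d1 e1 (u x) = x"
proof -
  interpret S: folded2 sp sm d e d2 e2 d1 e1 by (rule swap2)
  have 1: "e (e2 (u x)) = e (e1 x)" by (simp add: u_def A.maps_simps B.maps_simps B.P_simps)
  have 2: "d1 (d (u x)) = d1 (d x)" by (simp add: u_def A.maps_simps B.maps_simps B.P_simps)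
  have "A.P (B.P (u x)) = A.P (B.P (A.P x))" by (simp add: P_u)
  also have "\<dots> = A.P (A.P x)" by (rule S.P_absorb) (simp add: A.P_simps)
  finally have 3: "A.P (B.P (u x)) = A.P x" by (simp add: A.P_simps)
  show ?thesis unfolding S.u_def 1 2 3 by (simp add: A.P_eq)
qed

context folded2
begin

lemma bijlin_u: "bijlin sp sp u"
proof -
  interpret S: folded2 sp sm d e d2 e2 d1 e1 by (rule swap2)
  have "bij u" by (rule o_bij[of S.u]) (auto simp: fun_eq_iff u_inverse S.u_inverse)
  then show ?thesis using linear_u by (simp add: bijlin_def)
qed

text \<open>The automorphisms of the two spaces intertwine the folded operators: the summands
  \<open>e e1\<close> and \<open>d1 d\<close> are matched with those for the second pseudo-inverse,
  and the middle summand does not meet the image of \<open>rh\<close>.\<close>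

lemma u_rh: "u (A.rh y) = B.rh (folded2.u e d e1 d1 e2 d2 y)"
proof -
  interpret S: folded2 sm sp e d e1 d1 e2 d2 by (rule swap)
  show ?thesis
    by (simp add: u_def S.u_def A.rh_def B.rh_def A.maps_simps B.maps_simps A.P_simps B.P_simps S.B.P_simps A.P.add
        A.P.zero B.P.zero)
qed

text \<open>\<open>u\<close> acts trivially on the quotients of the flag given by the image of
  \<open>e\<close>, the kernel of \<open>d\<close> and the whole space: \<open>u - 1\<close> maps
  each step into the one before. Hence its cube is zero.\<close>

lemma u_unipotent: "(let n = (\<lambda>x. u x - x) in n (n (n x))) = 0"
proof -
  have 1: "d (u x - x) = 0" for x by (simp add: u_def A.maps_simps B.maps_simps B.P_simps)
  have 2: "u x - x = e (e1 x - e2 x)" if "d x = 0" for x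
  proof -
    have "u x = e (e1 x) + B.P x" using that by (simp add: u_def P_absorb B.d'.zero)
    then show ?thesis using that by (simp add: B.P_eq B.d'.zero A.e.diff)
  qed
  have 3: "u (e y) - e y = 0" for y
    by (simp add: u_def A.maps_simps B.maps_simps A.P_simps B.P.zero)
  show ?thesis unfolding Let_def 2[OF 1[of x]] by (rule 3)
qed

text \<open>A finite rank correction of \<open>u\<close> that keeps its values on the image of
  \<open>A.rh\<close> but sends the vectors of \<open>s1\<close> to those of \<open>s2\<close>. It
  carries one completion exactly to another and not only up to a base change.\<close>

definition U where
  "U s1 s2 x = u x + lcomb sp (map (\<lambda>i. s2 ! i - u (s1 ! i)) [0..<length s1]) (qcoord sp (range A.rh) s1 x)"

context
  fixes s1 s2
  assumes q1: "qbasis sp UNIV (range A.rh) s1" and q2: "qbasis sp UNIV (range B.rh) s2"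
begin

lemma length_s: "length s1 = length s2"
proof -
  have "qbasis sp (ker_set d) (range e) (map A.P s1)" "qbasis sp (ker_set d) (range e) (map B.P s2)"
    using A.qbasis_H[OF q1] B.qbasis_H[OF q2] .
  from A.d.vs1.qbasis_length[OF this A.subspace_range_e linear_kernel_subspace[OF A.lin(1)]] show ?thesis by simp
qed

lemma linear_U: "Vector_Spaces.linear sp sp (U s1 s2)"
proof -
  interpret u: Vector_Spaces.linear sp sp u by (rule linear_u)
  note W = A.subspace_range_rh
  show ?thesis
    by unfold_locales
      (simp_all add: U_def u.add u.scale A.d.vs1.qcoord_add[OF q1 W] A.d.vs1.qcoord_scale[OF q1 W]
        A.d.vs1.lcomb_add A.d.vs1.lcomb_scale A.d.vs1.scale_right_distrib)
qed

lemma U_rh: "U s1 s2 (A.rh y) = u (A.rh y)"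
  by (simp add: U_def A.d.vs1.qcoord_zero[OF q1 A.subspace_range_rh] A.d.vs1.lcomb_zero)

lemma U_nth: "i < length s1 \<Longrightarrow> U s1 s2 (s1 ! i) = s2 ! i"
  by (simp add: U_def A.d.vs1.qcoord_nth[OF q1 A.subspace_range_rh] A.d.vs1.lcomb_unit)

end

end

lemma (in folded2) U_inverse:
  assumes q1: "qbasis sp UNIV (range A.rh) s1" and q2: "qbasis sp UNIV (range B.rh) s2"
  shows "folded2.U sp d e d2 e2 d1 e1 s2 s1 (U s1 s2 x) = x"
proof -
  interpret S: folded2 sp sm d e d2 e2 d1 e1 by (rule swap2)
  interpret V: folded2 sm sp e d e1 d1 e2 d2 by (rule swap)
  show ?thesis
  proof (rule A.d.vs1.linear_eq_on_qbasis[OF q1 linear_comp[OF linear_U[OF q1 q2] S.linear_U[OF q2 q1]] A.d.vs1.linear_ident])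
    fix x assume "x \<in> range A.rh"
    then obtain y where y: "x = A.rh y" by auto
    have "S.U s2 s1 (U s1 s2 x) = S.U s2 s1 (B.rh (V.u y))" by (simp add: y U_rh[OF q1 q2] u_rh)
    also have "\<dots> = S.u (u (A.rh y))" by (simp add: S.U_rh[OF q2 q1] u_rh)
    finally show "S.U s2 s1 (U s1 s2 x) = x" by (simp add: u_inverse y)
  next
    fix i assume "i < length s1"
    then show "S.U s2 s1 (U s1 s2 (s1 ! i)) = s1 ! i"
      by (simp add: U_nth[OF q1 q2] S.U_nth[OF q2 q1] length_s[OF q1 q2])
  qed simp
qed

context folded2
begin

lemma bijlin_U:
  assumes q1: "qbasis sp UNIV (range A.rh) s1" and q2: "qbasis sp UNIV (range B.rh) s2"
  shows "bijlin sp sp (U s1 s2)"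
proof -
  interpret S: folded2 sp sm d e d2 e2 d1 e1 by (rule swap2)
  have "bij (U s1 s2)"
    by (rule o_bij[of "S.U s2 s1"]) (auto simp: fun_eq_iff U_inverse[OF q1 q2] S.U_inverse[OF q2 q1])
  then show ?thesis using linear_U[OF q1 q2] by (simp add: bijlin_def)
qed

lemma U_u_finite_rank:
  "finite_rank sp (\<lambda>x. U s1 s2 x - u x)"
  unfolding U_def using A.d.vs1.finite_rank_lcomb by simp

text \<open>The composite of \<open>U\<close> with the inverse of \<open>u\<close> is the identity
  on the image of \<open>B.rh\<close>. On the quotient it sends the class of
  \<open>u (s1 ! j)\<close> to that of \<open>s2 ! j\<close>, which is the base change
  \<open>C\<close> between the two bases of cohomology; \<open>class_det_mod\<close>
  applies.\<close>

lemma class_det_U: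
  assumes q1: "qbasis sp UNIV (range A.rh) s1" and q2: "qbasis sp UNIV (range B.rh) s2"
    and C: "C \<in> carrier_mat (length s1) (length s1)"
    and rel: "\<And>j. j < length s1 \<Longrightarrow> B.P (s2 ! j) - lcomb sp (map A.P s1) (\<lambda>i. C $$ (i, j)) \<in> range e"
  shows "class_det sp (\<lambda>x. U s1 s2 (finv u x)) = det C"
proof -
  interpret V: folded2 sm sp e d e1 d1 e2 d2 by (rule swap)
  let ?W = "\<lambda>x. U s1 s2 (finv u x)"
  note bu = bijlinD[OF bijlin_u]
  have W: "Vector_Spaces.linear sp sp ?W"
    by (rule linear_comp[OF bijlinD(1)[OF bijlin_inv[OF bijlin_u]] linear_U[OF q1 q2]])
  have us: "qbasis sp UNIV (range B.rh) (map u s1)"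
  proof (rule A.d.vs1.qbasisI)
    fix x
    obtain a y where "finv u x - lcomb sp s1 a = A.rh y" using A.d.vs1.qcoord_rest(1)[OF q1 UNIV_I] by blast
    then have "u (finv u x - lcomb sp s1 a) = B.rh (V.u y)" by (simp add: u_rh)
    moreover have "u (finv u x - lcomb sp s1 a) = x - lcomb sp (map u s1) a"
    proof -
      interpret u: Vector_Spaces.linear sp sp u by (rule linear_u)
      show ?thesis by (simp add: u.diff bu linear_lcomb[OF linear_u])
    qed
    ultimately show "\<exists>a. x - lcomb sp (map u s1) a \<in> range B.rh" by (metis rangeI)
  next
    fix a i assume "lcomb sp (map u s1) a \<in> range B.rh" and i: "i < length (map u s1)"
    then obtain y where "u (lcomb sp s1 a) = B.rh y" by (auto simp: linear_lcomb[OF linear_u])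
    also have "B.rh y = u (A.rh (finv V.u y))" by (simp add: u_rh bijlinD[OF V.bijlin_u])
    finally have "lcomb sp s1 a = A.rh (finv V.u y)" using bu(3) by (auto dest: injD)
    then show "a i = 0" using A.d.vs1.qbasis_indep[OF q1, of a i] i by simp
  qed simp
  show ?thesis
  proof (rule class_det_mod(1)[OF W B.subspace_range_rh _ us])
    fix x assume "x \<in> range B.rh"
    then obtain y where "x = B.rh y" by auto
    then have "x = u (A.rh (finv V.u y))" by (simp add: u_rh bijlinD[OF V.bijlin_u])
    then show "?W x = x" by (simp add: bu U_rh[OF q1 q2])
  next
    show "C \<in> carrier_mat (length (map u s1)) (length (map u s1))" using C by simp
    fix j assume j: "j < length (map u s1)"
    let ?c = "\<lambda>i. C $$ (i, j)"
    have "?W (map u s1 ! j) = s2 ! j" using j by (simp add: bu U_nth[OF q1 q2])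
    \<comment> \<open>By \<open>P_u\<close>, \<open>B.P\<close> does not distinguish
      \<open>u x\<close> from \<open>A.P x\<close>, so the relation assumed in cohomology becomes
      membership in the kernel of \<open>B.P\<close>.\<close>
    moreover have "B.P (s2 ! j - lcomb sp (map u s1) ?c) = 0"
    proof -
      obtain y where y: "B.P (s2 ! j) - A.P (lcomb sp s1 ?c) = e y"
        using rel[of j] j by (auto simp: linear_lcomb[OF A.linear_P])
      have "B.P (s2 ! j - lcomb sp (map u s1) ?c) = B.P (B.P (s2 ! j) - A.P (lcomb sp s1 ?c))"
        by (simp add: B.P.diff linear_lcomb[OF linear_u, symmetric] P_u B.P_simps)
      then show ?thesis unfolding y by (simp add: B.P_simps)
    qed
    ultimately show "?W (map u s1 ! j) - lcomb sp (map u s1) ?c \<in> range B.rh"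
      by (simp add: B.range_rh)
  qed
qed

end

section \<open>Two complexes that differ by finite rank\<close>

lemma folded_diff:
  assumes "folded sp sm d e d1 e1" "folded sp sm \<delta> \<epsilon> \<delta>1 \<epsilon>1"
    and fr: "finite_rank sm (\<lambda>x. d x - \<delta> x)" "finite_rank sp (\<lambda>y. e y - \<epsilon> y)"
      "finite_rank sp (\<lambda>y. d1 y - \<delta>1 y)" "finite_rank sm (\<lambda>x. e1 x - \<epsilon>1 x)"
  shows "finite_rank sm (\<lambda>x. folded.sg d e1 x - folded.sg \<delta> \<epsilon>1 x)"
    and "finite_rank sp (\<lambda>y. folded.rh e d1 y - folded.rh \<epsilon> \<delta>1 y)"
    and "finite_rank sp (\<lambda>x. folded.P d e d1 e1 x - folded.P \<delta> \<epsilon> \<delta>1 \<epsilon>1 x)"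
proof -
  interpret A: folded sp sm d e d1 e1 by fact
  interpret B: folded sp sm \<delta> \<epsilon> \<delta>1 \<epsilon>1 by fact
  show 1: "finite_rank sm (\<lambda>x. A.sg x - B.sg x)"
    unfolding A.sg_def B.sg_def by (intro A.d.vs2.finite_rank_diff_add fr)
  show 2: "finite_rank sp (\<lambda>y. A.rh y - B.rh y)"
    unfolding A.rh_def B.rh_def by (intro A.d.vs1.finite_rank_diff_add fr)
  show "finite_rank sp (\<lambda>x. A.P x - B.P x)"
    unfolding A.P_def B.P_def
    by (rule A.d.vs1.finite_rank_diff_diff[OF A.d.vs1.finite_rank_diff_refl finite_rank_diff_compose[OF A.linear_rh 2 1]])
qed

text \<open>Each \<open>U\<close> is the product of a map of determinant class, whose determinant is
  that of the base change, and the unipotent \<open>u\<close>. The two unipotents differ by finite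
  rank, since the complexes and both pairs of pseudo-inverses do, and their relative determinant is
  1 by \<open>kappa_unipotent\<close>.\<close>

lemma kappa_U:
  assumes D: "folded2 sp sm d e d1 e1 d2 e2" and E: "folded2 sp sm \<delta> \<epsilon> \<delta>1 \<epsilon>1 \<delta>2 \<epsilon>2"
    and fr: "finite_rank sm (\<lambda>x. d x - \<delta> x)" "finite_rank sp (\<lambda>y. e y - \<epsilon> y)"
      "finite_rank sp (\<lambda>y. d1 y - \<delta>1 y)" "finite_rank sm (\<lambda>x. e1 x - \<epsilon>1 x)"
      "finite_rank sp (\<lambda>y. d2 y - \<delta>2 y)" "finite_rank sm (\<lambda>x. e2 x - \<epsilon>2 x)"
    and q: "qbasis sp UNIV (range (folded.rh e d1)) s1" "qbasis sp UNIV (range (folded.rh e d2)) s2"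
      "qbasis sp UNIV (range (folded.rh \<epsilon> \<delta>1)) t1" "qbasis sp UNIV (range (folded.rh \<epsilon> \<delta>2)) t2"
    and C: "C \<in> carrier_mat (length s1) (length s1)"
      "\<And>j. j < length s1 \<Longrightarrow> folded.P d e d2 e2 (s2 ! j) - lcomb sp (map (folded.P d e d1 e1) s1) (\<lambda>i. C $$ (i, j)) \<in> range e"
    and G: "G \<in> carrier_mat (length t1) (length t1)"
      "\<And>j. j < length t1 \<Longrightarrow> folded.P \<delta> \<epsilon> \<delta>2 \<epsilon>2 (t2 ! j) - lcomb sp (map (folded.P \<delta> \<epsilon> \<delta>1 \<epsilon>1) t1) (\<lambda>i. G $$ (i, j)) \<in> range \<epsilon>"
  shows "det C * kappa sp (folded2.U sp d e d1 e1 d2 e2 s1 s2) (folded2.U sp \<delta> \<epsilon> \<delta>1 \<epsilon>1 \<delta>2 \<epsilon>2 t1 t2) = det G"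
    and "finite_rank sp (\<lambda>x. folded2.U sp d e d1 e1 d2 e2 s1 s2 x - folded2.U sp \<delta> \<epsilon> \<delta>1 \<epsilon>1 \<delta>2 \<epsilon>2 t1 t2 x)"
proof -
  interpret D: folded2 sp sm d e d1 e1 d2 e2 by fact
  interpret E: folded2 sp sm \<delta> \<epsilon> \<delta>1 \<epsilon>1 \<delta>2 \<epsilon>2 by fact
  let ?W = "\<lambda>x. D.U s1 s2 (finv D.u x)" and ?W' = "\<lambda>x. E.U t1 t2 (finv E.u x)"
  note FA = folded_diff[OF D.A.folded_axioms E.A.folded_axioms fr(1-4)]
    and FB = folded_diff[OF D.B.folded_axioms E.B.folded_axioms fr(1,2,5,6)]
  note vs = D.A.d.vs1.vector_space_axioms
  have fu: "finite_rank sp (\<lambda>x. D.u x - E.u x)"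
    unfolding D.u_def E.u_def
    by (rule D.A.d.vs1.finite_rank_diff_add[OF D.A.d.vs1.finite_rank_diff_add[OF
        finite_rank_diff_compose[OF D.A.lin(2) fr(2) fr(4)] finite_rank_diff_compose[OF D.B.linear_P FB(3) FA(3)]]
        finite_rank_diff_compose[OF D.B.lin(3) fr(5) fr(1)]])
  have fU: "finite_rank sp (\<lambda>x. D.U s1 s2 x - E.U t1 t2 x)"
    by (rule D.A.d.vs1.finite_rank_diff_trans[OF D.U_u_finite_rank D.A.d.vs1.finite_rank_diff_trans[OF fu
          D.A.d.vs1.finite_rank_diff_swap[OF E.U_u_finite_rank]]])
  then show "finite_rank sp (\<lambda>x. D.U s1 s2 x - E.U t1 t2 x)" .
  note bU = D.bijlin_U[OF q(1,2)] and bU' = E.bijlin_U[OF q(3,4)]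
  note bi = bijlin_inv[OF D.bijlin_u] and bi' = bijlin_inv[OF E.bijlin_u]
  have bW: "bijlin sp sp ?W" and bW': "bijlin sp sp ?W'"
    using bijlin_comp[OF bi bU] bijlin_comp[OF bi' bU'] by auto
  have I: "bijlin sp sp (\<lambda>x. x)" using D.A.d.vs1.linear_ident by (simp add: bijlin_def bij_id[unfolded id_def])
  have fW: "finite_rank sp (\<lambda>x. x - ?W x)"
  proof -
    have "finite_rank sp (\<lambda>x. D.U s1 s2 (finv D.u x) - D.u (finv D.u x))"
      using finite_rank_compose_right[OF D.U_u_finite_rank, where g = "finv D.u"] .
    from D.A.d.vs1.finite_rank_diff_swap[OF this] show ?thesis by (simp add: bijlinD[OF D.bijlin_u])
  qed
  have fW': "finite_rank sp (\<lambda>x. x - ?W' x)"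
  proof -
    have "finite_rank sp (\<lambda>x. E.U t1 t2 (finv E.u x) - E.u (finv E.u x))"
      using finite_rank_compose_right[OF E.U_u_finite_rank, where g = "finv E.u"] .
    from D.A.d.vs1.finite_rank_diff_swap[OF this] show ?thesis by (simp add: bijlinD[OF E.bijlin_u])
  qed
  have fWW: "finite_rank sp (\<lambda>x. ?W x - ?W' x)"
    by (rule D.A.d.vs1.finite_rank_diff_trans[OF D.A.d.vs1.finite_rank_diff_swap[OF fW] fW'])
  have ki: "kappa sp (\<lambda>x. x) V = class_det sp V" for V :: "'b \<Rightarrow> 'b"
    by (simp add: kappa_def inv_into_def)
  have "kappa sp (\<lambda>x. ?W (D.u x)) (\<lambda>x. ?W' (E.u x)) = kappa sp ?W ?W' * kappa sp D.u E.u"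
    by (rule kappa_compose[OF bW bijlinD(1)[OF bW'] fWW D.bijlin_u E.linear_u fu])
  moreover have "kappa sp D.u E.u = 1"
    by (rule kappa_unipotent[OF D.bijlin_u E.linear_u fu D.u_unipotent E.u_unipotent])
  moreover have "(\<lambda>x. ?W (D.u x)) = D.U s1 s2" "(\<lambda>x. ?W' (E.u x)) = E.U t1 t2"
    by (simp_all add: bijlinD[OF D.bijlin_u] bijlinD[OF E.bijlin_u])
  ultimately have "kappa sp (D.U s1 s2) (E.U t1 t2) = kappa sp ?W ?W'" by simp
  moreover have "kappa sp (\<lambda>x. x) ?W * kappa sp ?W ?W' = kappa sp (\<lambda>x. x) ?W'"
    by (rule kappa_trans[OF I bW bijlinD(1)[OF bW'] fW fWW])
  moreover have "class_det sp ?W = det C" by (rule D.class_det_U[OF q(1,2) C])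
  moreover have "class_det sp ?W' = det G" by (rule E.class_det_U[OF q(3,4) G])
  ultimately show "det C * kappa sp (D.U s1 s2) (E.U t1 t2) = det G" by (simp add: ki)
qed

section \<open>Invertible completions of folded operators\<close>

definition pscale :: "('f::field \<Rightarrow> 'v::ab_group_add \<Rightarrow> 'v) \<Rightarrow> 'f \<Rightarrow> 'v \<times> (nat \<Rightarrow> 'f) \<Rightarrow> 'v \<times> (nat \<Rightarrow> 'f)" where
  "pscale s c z = (s c (fst z), fscale c (snd z))"

text \<open>Drops the first \<open>m\<close> entries and then puts \<open>l\<close> zeros in front.
  Its kernel has dimension \<open>m\<close> and its cokernel dimension \<open>l\<close>, so that its
  index is \<open>m - l\<close>.\<close>

definition shift :: "nat \<Rightarrow> nat \<Rightarrow> (nat \<Rightarrow> 'f) \<Rightarrow> nat \<Rightarrow> 'f::field" where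
  "shift l m f = (\<lambda>i. if i < l then 0 else f (i - l + m))"

lemma pscale_vector_space: "vector_space s \<Longrightarrow> vector_space (pscale s)"
proof -
  assume "vector_space s"
  then interpret vector_space s .
  show ?thesis
    by unfold_locales (auto simp: pscale_def scale_left_distrib scale_right_distrib fs.scale_left_distrib fs.scale_right_distrib)
qed

lemma pscale_linear_fst: "vector_space s \<Longrightarrow> Vector_Spaces.linear s (pscale s) (\<lambda>x. (x, 0))"
proof -
  assume v: "vector_space s"
  then interpret v: vector_space s .
  interpret p: vector_space "pscale s" by (rule pscale_vector_space[OF v])
  show ?thesis by unfold_locales (auto simp: pscale_def fs.scale_zero_right)
qed

lemma pscale_linear_snd: "vector_space s \<Longrightarrow> Vector_Spaces.linear fscale (pscale s) (\<lambda>f. (0, f))"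
proof -
  assume v: "vector_space s"
  then interpret v: vector_space s .
  interpret p: vector_space "pscale s" by (rule pscale_vector_space[OF v])
  show ?thesis by unfold_locales (auto simp: pscale_def v.scale_zero_right)
qed

lemma linear_prod_id:
  assumes "Vector_Spaces.linear s s' F"
  shows "Vector_Spaces.linear (pscale s) (pscale s') (\<lambda>z. (F (fst z), snd z))"
proof -
  interpret F: Vector_Spaces.linear s s' F by fact
  interpret p: vector_space "pscale s" by (rule pscale_vector_space) unfold_locales
  interpret p': vector_space "pscale s'" by (rule pscale_vector_space) unfold_locales
  show ?thesis by unfold_locales (auto simp: pscale_def F.add F.scale)
qed

lemma bijlin_prod_id:
  assumes F: "bijlin s s' F"
  shows "bijlin (pscale s) (pscale s') (\<lambda>z. (F (fst z), snd z))"
proof (rule bijlinI[OF linear_prod_id[OF bijlinD(1)[OF F]]])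
  show "bij (\<lambda>z. (F (fst z), snd z))"
    by (rule o_bij[of "\<lambda>z. (finv F (fst z), snd z)"]) (auto simp: bijlinD[OF F])
qed

lemma class_det_prod:
  assumes F: "Vector_Spaces.linear s s F" and fr: "finite_rank s (\<lambda>x. x - F x)"
  shows "class_det (pscale s) (\<lambda>z. (F (fst z), snd z)) = class_det s F"
proof (rule class_det_transfer[OF pscale_linear_fst _ F fr linear_prod_id[OF F]])
  show "vector_space s" using linear_vs[OF F] by simp
  show "inj (\<lambda>x. (x, 0))" by (auto intro: injI)
  show "\<exists>x. y - (F (fst y), snd y) = (x - F x, 0)" for y :: "'b \<times> (nat \<Rightarrow> 'a)"
    by (intro exI[of _ "fst y"]) (auto simp: prod_eq_iff)
qed auto

lemma kappa_prod:
  assumes F: "bijlin s s' F" and G: "Vector_Spaces.linear s s' G" and fr: "finite_rank s' (\<lambda>x. F x - G x)"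
  shows "kappa (pscale s) (\<lambda>z. (F (fst z), snd z)) (\<lambda>z. (G (fst z), snd z)) = kappa s F G"
proof -
  have "finv (\<lambda>z. (F (fst z), snd z)) = (\<lambda>z :: _ \<times> (nat \<Rightarrow> 'a). (finv F (fst z), snd z))"
    by (rule inv_equality) (auto simp: bijlinD[OF F])
  then show ?thesis
    unfolding kappa_def using class_det_prod[OF kappa_linear_finite_rank[OF F G fr]] by simp
qed

lemma finite_rank_prod:
  assumes "vector_space s" and fr: "finite_rank s (\<lambda>x. F x - G x)"
  shows "finite_rank (pscale s) (\<lambda>z. (F (fst z), snd z) - (G (fst z), snd z))"
proof -
  have "finite_rank (pscale s) (\<lambda>z. (F (fst z) - G (fst z), 0 :: nat \<Rightarrow> 'a))"
    by (rule finite_rank_compose_left[OF pscale_linear_fst[OF assms(1)]], rule finite_rank_compose_right[OF fr])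
  then show ?thesis by simp
qed

lemma shift_add: "shift l m (f + g) = shift l m f + shift l m g"
  by (auto simp: shift_def fun_eq_iff)

lemma shift_scale: "shift l m (fscale c f) = fscale c (shift l m f)"
  by (auto simp: shift_def fun_eq_iff fscale_def)

text \<open>Three kinds of vectors generate the enlarged space. The identities between completions
  below are verified on each kind separately.\<close>

lemma hat_gen_eq:
  assumes rh: "Modules.module.subspace sp (range rh)" and q: "qbasis sp UNIV (range rh) ss"
    and F: "Vector_Spaces.linear (pscale sp) s' F" and G: "Vector_Spaces.linear (pscale sp) s' G"
    and 1: "\<And>y. F (rh y, 0) = G (rh y, 0)" and 2: "\<And>i. i < length ss \<Longrightarrow> F (ss ! i, 0) = G (ss ! i, 0)"
    and 3: "\<And>f. F (0, f) = G (0, f)"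
  shows "F z = G z"
proof -
  interpret F: Vector_Spaces.linear "pscale sp" s' F by fact
  interpret G: Vector_Spaces.linear "pscale sp" s' G by fact
  have vs: "vector_space sp"
  proof -
    show ?thesis
    proof
      show "sp a (x + y) = sp a x + sp a y" for a x y
        using F.vs1.scale_right_distrib[of a "(x, 0)" "(y, 0)"] by (simp add: pscale_def)
      show "sp (a + b) x = sp a x + sp b x" for a b x
        using F.vs1.scale_left_distrib[of a b "(x, 0)"] by (simp add: pscale_def)
      show "sp a (sp b x) = sp (a * b) x" for a b x
        using F.vs1.scale_scale[of a b "(x, 0)"] by (simp add: pscale_def)
      show "sp 1 x = x" for x
        using F.vs1.scale_one[of "(x, 0)"] by (simp add: pscale_def)
    qed
  qed
  interpret v: vector_space sp by (rule vs)
  have x: "F (x, 0) = G (x, 0)" for x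
    by (rule v.linear_eq_on_qbasis[OF q linear_comp[OF pscale_linear_fst[OF vs] F] linear_comp[OF pscale_linear_fst[OF vs] G]])
      (use 1 2 in auto)
  have "F z = F ((fst z, 0) + (0, snd z))" by simp
  also have "\<dots> = G ((fst z, 0) + (0, snd z))" unfolding F.add G.add using x 3 by simp
  finally show ?thesis by simp
qed

text \<open>The hypothesis says that the two shifts have equal index. From position
  \<open>max l l'\<close> on they read the same entry, so only finitely many coordinates of the
  difference survive.\<close>

lemma finite_rank_shift:
  fixes l m :: nat
  assumes "l + m' = l' + m"
  shows "finite_rank (fscale :: 'f::field \<Rightarrow> _) (\<lambda>f. shift l m f - shift l' m' f)"
proof -
  have *: "finite_rank (fscale :: 'f \<Rightarrow> _) (\<lambda>f. shift l m f - shift l' m' f)"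
    if le: "l \<le> l'" and eq: "l + m' = l' + m" for l m l' m'
  proof -
    have "shift l m f - shift l' m' f = lcomb fscale (map free_gen [0..<l']) (\<lambda>i. shift l m f i)" for f :: "nat \<Rightarrow> 'f"
    proof
      fix i
      have "lcomb fscale (map free_gen [0..<l']) (\<lambda>i. shift l m f i) i = (\<Sum>j<l'. if i = j then shift l m f j else 0)"
        by (simp add: lcomb_def sum_fun_apply fscale_def free_gen_def if_distrib cong: if_cong)
      also have "\<dots> = (if i < l' then shift l m f i else 0)" by simp
      also have "\<dots> = (shift l m f - shift l' m' f) i"
      proof (cases "i < l'")
        case False
        then have "i - l + m = i - l' + m'" using le eq by simp
        then show ?thesis using False le by (simp add: shift_def)
      qed (simp add: shift_def)
      finally show "(shift l m f - shift l' m' f) i = lcomb fscale (map free_gen [0..<l']) (\<lambda>i. shift l m f i) i" ..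
    qed
    then show ?thesis using fs.finite_rank_lcomb by simp
  qed
  show ?thesis
  proof (cases "l \<le> l'")
    case True then show ?thesis using *[OF True assms] by simp
  next
    case False
    then have "finite_rank (fscale :: 'f \<Rightarrow> _) (\<lambda>f. shift l' m' f - shift l m f)" using assms by (intro *) auto
    then show ?thesis by (rule fs.finite_rank_diff_swap)
  qed
qed

locale hat_data = A: folded sp sm d e d' e' + B: folded sm sp e d e' d'
  for sp :: "'f::field \<Rightarrow> 'a::ab_group_add \<Rightarrow> 'a" and sm :: "'f \<Rightarrow> 'b::ab_group_add \<Rightarrow> 'b"
    and d e d' e' +
  fixes ss :: "'a list" and cs :: "'b list"
  assumes qs: "qbasis sp UNIV (range A.rh) ss" and qc: "qbasis sm UNIV (range B.rh) cs"
begin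

lemma B_rh: "B.rh = A.sg" "B.sg = A.rh"
  by (auto simp: fun_eq_iff A.sg_def B.rh_def B.sg_def A.rh_def add.commute)

text \<open>Subtraction is truncated: at most one of \<open>l\<close> and \<open>m\<close> is
  nonzero, according to the sign of the index.\<close>

abbreviation l where "l \<equiv> length ss - length cs"
abbreviation m where "m \<equiv> length cs - length ss"

text \<open>
  \<open>A.sg\<close> has index \<open>length ss - length cs\<close>. A shift on an additional space of sequences cancels the index, and sending \<open>ss\<close> to
  \<open>cs\<close> (with the surplus vectors on either side matched with unit sequences) then completes \<open>A.sg\<close> to an isomorphism \<open>T\<close>.
\<close>

definition ws where
  "ws = map (\<lambda>i. (if i < l then (0, free_gen i) else (cs ! (i - l), 0)) - (A.sg (ss ! i), 0)) [0..<length ss]"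

text \<open>The folded operator with the shift, the correction that forces the prescribed values on
  \<open>ss\<close>, and the first \<open>m\<close> entries of the sequence sent to the surplus of
  \<open>cs\<close>. The surplus sits at the front of \<open>ss\<close> but at the end of
  \<open>cs\<close>, which is the order of \<open>s0 @ s1\<close> and \<open>t0 @ t1\<close> in the
  two defining formulas; thus no signs arise.\<close>

definition T where
  "T z = (A.sg (fst z), shift l m (snd z)) + lcomb (pscale sm) ws (qcoord sp (range A.rh) ss (fst z))
     + (lcomb sm (drop (length ss) cs) (snd z), 0)"

lemma linear_T: "Vector_Spaces.linear (pscale sp) (pscale sm) T"
proof -
  interpret p: vector_space "pscale sp" by (rule pscale_vector_space) unfold_locales
  interpret p': vector_space "pscale sm" by (rule pscale_vector_space) unfold_locales
  note W = A.subspace_range_rh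
  have 1: "lcomb sm bs (f + g) = lcomb sm bs f + lcomb sm bs g" for bs f g
    using A.d.vs2.lcomb_add[of bs f g] by (simp add: plus_fun_def)
  have 2: "lcomb sm bs (fscale c f) = sm c (lcomb sm bs f)" for bs f c
    using A.d.vs2.lcomb_scale[of bs c f] by (simp add: fscale_def)
  show ?thesis
  proof (unfold_locales, goal_cases)
    case (1 x y)
    have "lcomb (pscale sm) ws (qcoord sp (range A.rh) ss (fst x + fst y))
      = lcomb (pscale sm) ws (qcoord sp (range A.rh) ss (fst x)) + lcomb (pscale sm) ws (qcoord sp (range A.rh) ss (fst y))"
      by (simp add: A.d.vs1.qcoord_add[OF qs W] p'.lcomb_add)
    then show ?case by (simp add: T_def A.sg.add shift_add \<open>\<And>g f bs. lcomb sm bs (f + g) = _\<close>)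
  next
    case (2 c x)
    have "lcomb (pscale sm) ws (qcoord sp (range A.rh) ss (sp c (fst x)))
      = pscale sm c (lcomb (pscale sm) ws (qcoord sp (range A.rh) ss (fst x)))"
      by (simp add: A.d.vs1.qcoord_scale[OF qs W] p'.lcomb_scale)
    then show ?case
      by (simp add: T_def p'.scale_right_distrib)
        (simp add: pscale_def A.sg.scale shift_scale \<open>\<And>f c bs. lcomb sm bs (fscale c f) = _\<close> fs.scale_zero_right)
  qed
qed

lemma T_rh: "T (A.rh y, 0) = (A.sg (A.rh y), 0)"
proof -
  interpret p': vector_space "pscale sm" by (rule pscale_vector_space) unfold_locales
  have "lcomb sm bs 0 = 0" for bs using A.d.vs2.lcomb_zero[of bs] by (simp add: zero_fun_def)
  moreover have "shift l m 0 = 0" by (simp add: shift_def fun_eq_iff)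
  ultimately show ?thesis
    by (simp add: T_def A.d.vs1.qcoord_zero[OF qs A.subspace_range_rh] p'.lcomb_zero)
qed

lemma T_nth:
  assumes i: "i < length ss"
  shows "T (ss ! i, 0) = (if i < l then (0, free_gen i) else (cs ! (i - l), 0))"
proof -
  interpret p': vector_space "pscale sm" by (rule pscale_vector_space) unfold_locales
  have 1: "lcomb sm bs 0 = 0" for bs using A.d.vs2.lcomb_zero[of bs] by (simp add: zero_fun_def)
  have 2: "shift l m 0 = 0" by (simp add: shift_def fun_eq_iff)
  have len: "length ws = length ss" by (simp add: ws_def)
  have "lcomb (pscale sm) ws (qcoord sp (range A.rh) ss (ss ! i)) = ws ! i"
    using i by (simp add: A.d.vs1.qcoord_nth[OF qs A.subspace_range_rh] p'.lcomb_unit len)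
  then show ?thesis using i by (simp add: T_def 1 2) (simp add: ws_def zero_prod_def[symmetric])
qed

lemma T_snd: "T (0, f) = (lcomb sm (drop (length ss) cs) f, shift l m f)"
proof -
  interpret p': vector_space "pscale sm" by (rule pscale_vector_space) unfold_locales
  have "0 \<in> range A.rh" using A.rh.zero by (metis rangeI)
  then show ?thesis
    by (simp add: T_def A.d.vs1.qcoord_zero[OF qs A.subspace_range_rh] p'.lcomb_zero A.sg.zero)
qed

lemma T_lcomb:
  "T (lcomb sp ss a, 0) =
     (lcomb sm cs (\<lambda>i. if i + l < length ss then a (i + l) else 0), \<lambda>i. if i < l then a i else 0)"
proof -
  interpret p': vector_space "pscale sm" by (rule pscale_vector_space) unfold_locales
  have lin: "Vector_Spaces.linear sp (pscale sm) (\<lambda>x. T (x, 0))"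
    by (rule linear_comp[OF pscale_linear_fst linear_T]) unfold_locales
  have "T (lcomb sp ss a, 0) = lcomb (pscale sm) (map (\<lambda>x. T (x, 0)) ss) a"
    by (rule linear_lcomb[OF lin])
  also have "\<dots> = (\<Sum>i<length ss. pscale sm (a i) (if i < l then (0, free_gen i) else (cs ! (i - l), 0)))"
    by (simp add: lcomb_def T_nth)
  finally have T: "T (lcomb sp ss a, 0) = (\<Sum>i<length ss. pscale sm (a i) (if i < l then (0, free_gen i) else (cs ! (i - l), 0)))" .
  have fst: "fst (T (lcomb sp ss a, 0)) = (\<Sum>i<length ss. if i < l then 0 else sm (a i) (cs ! (i - l)))"
    unfolding T fst_sum by (intro sum.cong) (auto simp: pscale_def A.d.vs2.scale_zero_right)
  have "(\<Sum>i<length ss. if i < l then 0 else sm (a i) (cs ! (i - l))) = (\<Sum>i\<in>{l..<length ss}. sm (a i) (cs ! (i - l)))"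
    by (rule sum.mono_neutral_cong_right) auto
  also have "\<dots> = (\<Sum>i<length ss - l. sm (a (i + l)) (cs ! i))"
    by (rule sum.reindex_bij_witness[of _ "\<lambda>i. i + l" "\<lambda>i. i - l"]) auto
  also have "\<dots> = lcomb sm cs (\<lambda>i. if i + l < length ss then a (i + l) else 0)"
    unfolding lcomb_def by (rule sum.mono_neutral_cong_left) auto
  finally have 1: "fst (T (lcomb sp ss a, 0)) = lcomb sm cs (\<lambda>i. if i + l < length ss then a (i + l) else 0)"
    using fst by simp
  have "snd (T (lcomb sp ss a, 0)) = (\<Sum>i<length ss. if i < l then fscale (a i) (free_gen i) else 0)"
    unfolding T snd_sum by (intro sum.cong) (auto simp: pscale_def fs.scale_zero_right)
  also have "\<dots> = (\<lambda>i. if i < l then a i else 0)"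
  proof
    fix k
    have "(\<Sum>i<length ss. if i < l then fscale (a i) (free_gen i) else 0) k = (\<Sum>i<length ss. if k = i then (if i < l then a i else 0) else 0)"
      unfolding sum_fun_apply by (intro sum.cong) (auto simp: fscale_def free_gen_def)
    also have "\<dots> = (if k < l then a k else 0)" by auto
    finally show "(\<Sum>i<length ss. if i < l then fscale (a i) (free_gen i) else 0) k = (if k < l then a k else 0)" .
  qed
  finally show ?thesis using 1 by (simp add: prod_eq_iff)
qed

text \<open>One formula for both signs of the index. If \<open>l > 0\<close>, every index below
  \<open>length cs\<close> falls into the first branch; if \<open>l = 0\<close>, the indices from
  \<open>length ss\<close> on read the sequence.\<close>

lemma T_eq:
  assumes x: "x = A.rh y + lcomb sp ss a"
  shows "T (x, f) = (A.sg (A.rh y) + lcomb sm cs (\<lambda>i. if i + l < length ss then a (i + l) else f (i + l - length ss)),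
     \<lambda>i. if i < l then a i else f (i - l + m))"
proof -
  interpret T: Vector_Spaces.linear "pscale sp" "pscale sm" T by (rule linear_T)
  have "(x, f) = (A.rh y, 0) + (lcomb sp ss a, 0) + (0, f)" using x by simp
  then have T: "T (x, f) = T (A.rh y, 0) + T (lcomb sp ss a, 0) + T (0, f)" by (simp only: T.add)
  have "lcomb sm (drop (length ss) cs) f = lcomb sm cs (\<lambda>i. if i + l < length ss then 0 else f (i + l - length ss))"
  proof -
    have "lcomb sm cs (\<lambda>i. if i + l < length ss then 0 else f (i + l - length ss))
      = (\<Sum>i\<in>{length ss..<length cs}. sm (f (i - length ss)) (cs ! i))"
      unfolding lcomb_def by (rule sum.mono_neutral_cong_right) auto
    also have "\<dots> = (\<Sum>i<length cs - length ss. sm (f i) (cs ! (length ss + i)))"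
      by (rule sum.reindex_bij_witness[of _ "\<lambda>i. i + length ss" "\<lambda>i. i - length ss"]) auto
    finally show ?thesis by (simp add: lcomb_def)
  qed
  then have "lcomb sm cs (\<lambda>i. if i + l < length ss then a (i + l) else 0) + lcomb sm (drop (length ss) cs) f
    = lcomb sm cs (\<lambda>i. if i + l < length ss then a (i + l) else f (i + l - length ss))"
    by (simp only: A.d.vs2.lcomb_add[symmetric])
      (intro A.d.vs2.lcomb_cong, case_tac "i + l < length ss", simp_all only: if_True if_False add_0_left add_0_right)
  moreover have "(\<lambda>i. if i < l then a i else 0) + shift l m f = (\<lambda>i. if i < l then a i else f (i - l + m))"
    by (auto simp: shift_def fun_eq_iff)
  ultimately show ?thesis unfolding T T_rh T_lcomb T_snd by (simp add: add.assoc)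
qed

lemma bijlin_T: "bijlin (pscale sp) (pscale sm) T"
proof (rule bijlinI[OF linear_T])
  interpret T: Vector_Spaces.linear "pscale sp" "pscale sm" T by (rule linear_T)
  have "inj T"
  proof (subst T.inj_iff_eq_0, intro allI impI)
    fix z assume T0: "T z = 0"
    obtain x f where z: "z = (x, f)" by (cases z)
    define a where "a = qcoord sp (range A.rh) ss x"
    obtain y where y: "x - lcomb sp ss a = A.rh y" using A.d.vs1.qcoord_rest(1)[OF qs UNIV_I, of x] by (auto simp: a_def)
    then have x: "x = A.rh y + lcomb sp ss a" by (simp add: algebra_simps)
    let ?h = "\<lambda>i. if i + l < length ss then a (i + l) else f (i + l - length ss)"
    have 1: "A.sg (A.rh y) + lcomb sm cs ?h = 0" and 2: "\<And>i. (if i < l then a i else f (i - l + m)) = 0"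
      using T0 unfolding z T_eq[OF x] by (auto simp: zero_prod_def fun_eq_iff)
    \<comment> \<open>The combination of \<open>cs\<close> lies in the image of \<open>A.sg\<close>,
      modulo which \<open>cs\<close> is independent.\<close>
    have "lcomb sm cs ?h = B.rh (- A.rh y)" using 1 by (simp add: B_rh A.sg.neg eq_neg_iff_add_eq_0 add.commute)
    then have h: "?h i = 0" if "i < length cs" for i using A.d.vs2.qbasis_indep[OF qc _ that] by blast
    have a0: "a i = 0" if "i < length ss" for i
    proof (cases "i < l")
      case True then show ?thesis using 2[of i] by simp
    next
      case False
      then have "i - l < length cs" using that by auto
      from h[OF this] show ?thesis using False that by simp
    qed
    then have la: "lcomb sp ss a = 0" using A.d.vs1.lcomb_cong[of ss a "\<lambda>_. 0"] A.d.vs1.lcomb_zero by simp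
    have "lcomb sm cs ?h = lcomb sm cs (\<lambda>_. 0)" using h by (intro A.d.vs2.lcomb_cong) auto
    then have "A.sg (A.rh y) = 0" using 1 A.d.vs2.lcomb_zero by simp
    then have "A.rh y = 0" using A.rh_sg(1)[of y] A.rh.zero by metis
    then have "x = 0" using x la by simp
    moreover have "f j = 0" for j
    proof (cases "j < m")
      case True
      then have "length ss + j < length cs" by simp
      from h[OF this] show ?thesis using True by simp
    next
      case False
      \<comment> \<open>Entry \<open>j\<close> of the sequence is found at position
        \<open>j - m + l\<close> of the output.\<close>
      then have "j - m + l - l + m = j" "\<not> j - m + l < l" by auto
      with 2[of "j - m + l"] show ?thesis by (simp only: if_False)
    qed
    ultimately show "z = 0" by (simp add: z zero_prod_def fun_eq_iff)
  qed
  moreover have "surj T"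
    unfolding surj_def
  proof
    fix w :: "'b \<times> (nat \<Rightarrow> 'f)"
    obtain v g where w: "w = (v, g)" by (cases w)
    define b where "b = qcoord sm (range B.rh) cs v"
    obtain t where t: "v - lcomb sm cs b = B.rh t" using A.d.vs2.qcoord_rest(1)[OF qc UNIV_I, of v] by (auto simp: b_def)
    \<comment> \<open>The preimage is read off by inverting \<open>T_eq\<close>: the output sequence
      supplies the first \<open>l\<close> coefficients, and the surplus coefficients of
      \<open>cs\<close> become the first \<open>m\<close> entries of \<open>f\<close>.\<close>
    define a where "a i = (if i < l then g i else b (i - l))" for i
    define f where "f j = (if j < m then b (length ss + j) else g (j - m + l))" for j
    have "lcomb sm cs (\<lambda>i. if i + l < length ss then a (i + l) else f (i + l - length ss)) = lcomb sm cs b"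
      by (intro A.d.vs2.lcomb_cong) (auto simp: a_def f_def)
    moreover have "(\<lambda>i. if i < l then a i else f (i - l + m)) = g"
      by (auto simp: a_def f_def fun_eq_iff)
    ultimately have "T (A.rh (A.sg t) + lcomb sp ss a, f) = (A.sg (A.rh (A.sg t)) + lcomb sm cs b, g)"
      using T_eq[OF refl] by simp
    also have "\<dots> = w" using t by (simp add: w A.rh_sg B_rh algebra_simps)
    finally show "\<exists>z. w = T z" by metis
  qed
  ultimately show "bij T" by (rule bijI)
qed

end

context hat_data
begin

lemma finite_rank_T_approx: "finite_rank (pscale sm) (\<lambda>z. T z - (A.sg (fst z), shift l m (snd z)))"
proof -
  have vs: "vector_space sm" by unfold_locales
  interpret p': vector_space "pscale sm" by (rule pscale_vector_space[OF vs])
  have "finite_rank (pscale sm) (\<lambda>z :: 'a \<times> (nat \<Rightarrow> 'f). (lcomb sm (drop (length ss) cs) (snd z), 0 :: nat \<Rightarrow> 'f))"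
    by (rule finite_rank_compose_left[OF pscale_linear_fst[OF vs] A.d.vs2.finite_rank_lcomb])
  with p'.finite_rank_lcomb
  have "finite_rank (pscale sm) (\<lambda>z. lcomb (pscale sm) ws (qcoord sp (range A.rh) ss (fst z))
     + (lcomb sm (drop (length ss) cs) (snd z), 0))"
    by (rule p'.finite_rank_add)
  then show ?thesis by (simp add: T_def add.assoc)
qed

end

text \<open>Equality of the indices is not yet known at this point. A gap \<open>k\<close> is
  compensated by a further shift of the output, which is what \<open>index_le\<close> exploits;
  afterwards only \<open>k = 0\<close> occurs.\<close>

lemma finite_rank_hats:
  assumes D: "hat_data sp sm d e d' e' ss cs" and E: "hat_data sp sm \<delta> \<epsilon> \<delta>' \<epsilon>' st ct"
    and fr: "finite_rank sm (\<lambda>x. folded.sg d e' x - folded.sg \<delta> \<epsilon>' x)"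
    and idx: "length ss + k + length ct = length st + length cs"
  shows "finite_rank (pscale sm) (\<lambda>z. (fst (hat_data.T sp sm d e d' e' ss cs z), shift k 0 (snd (hat_data.T sp sm d e d' e' ss cs z)))
      - hat_data.T sp sm \<delta> \<epsilon> \<delta>' \<epsilon>' st ct z)"
proof -
  interpret D: hat_data sp sm d e d' e' ss cs by fact
  interpret E: hat_data sp sm \<delta> \<epsilon> \<delta>' \<epsilon>' st ct by fact
  have vs: "vector_space sm" by unfold_locales
  interpret p': vector_space "pscale sm" by (rule pscale_vector_space[OF vs])
  let ?S = "\<lambda>w :: 'c \<times> (nat \<Rightarrow> 'a). (fst w, shift k 0 (snd w))"
  have S: "Vector_Spaces.linear (pscale sm) (pscale sm) ?S"
    by unfold_locales (auto simp: pscale_def shift_add shift_scale)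
  interpret S: Vector_Spaces.linear "pscale sm" "pscale sm" ?S by (rule S)
  have ss: "shift k 0 (shift D.l D.m f) = shift (k + D.l) D.m f" for f :: "nat \<Rightarrow> 'a"
    by (auto simp: shift_def fun_eq_iff)
  have "finite_rank (pscale sm) (\<lambda>z. ?S (D.T z - (D.A.sg (fst z), shift D.l D.m (snd z))))"
    by (rule finite_rank_compose_left[OF S D.finite_rank_T_approx])
  then have 1: "finite_rank (pscale sm) (\<lambda>z. ?S (D.T z) - (D.A.sg (fst z), shift (k + D.l) D.m (snd z)))"
    by (simp only: S.diff fst_conv snd_conv ss)
  have "finite_rank fscale (\<lambda>f :: nat \<Rightarrow> 'a. shift (k + D.l) D.m f - shift E.l E.m f)"
    by (rule finite_rank_shift) (use idx in auto)
  from finite_rank_compose_right[OF this, where g = snd]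
  have "finite_rank (pscale sm) (\<lambda>z :: 'b \<times> (nat \<Rightarrow> 'a). (0 :: 'c, shift (k + D.l) D.m (snd z) - shift E.l E.m (snd z)))"
    by (rule finite_rank_compose_left[OF pscale_linear_snd[OF vs]])
  moreover from finite_rank_compose_right[OF fr, where g = fst]
  have "finite_rank (pscale sm) (\<lambda>z :: 'b \<times> (nat \<Rightarrow> 'a). (D.A.sg (fst z) - E.A.sg (fst z), 0 :: nat \<Rightarrow> 'a))"
    by (rule finite_rank_compose_left[OF pscale_linear_fst[OF vs]])
  ultimately have "finite_rank (pscale sm) (\<lambda>z :: 'b \<times> (nat \<Rightarrow> 'a). (D.A.sg (fst z) - E.A.sg (fst z), 0 :: nat \<Rightarrow> 'a)
      + (0 :: 'c, shift (k + D.l) D.m (snd z) - shift E.l E.m (snd z)))"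
    by (intro p'.finite_rank_add)
  then have 2: "finite_rank (pscale sm) (\<lambda>z. (D.A.sg (fst z), shift (k + D.l) D.m (snd z)) - (E.A.sg (fst z), shift E.l E.m (snd z)))"
    by simp
  show ?thesis
    by (rule p'.finite_rank_diff_trans[OF 1 p'.finite_rank_diff_trans[OF 2 p'.finite_rank_diff_swap[OF E.finite_rank_T_approx]]])
qed

text \<open>If the second index were larger by \<open>k > 0\<close>, the inverse of
  \<open>E.T\<close> after the shift by \<open>k\<close> after \<open>D.T\<close> would be an
  injective finite rank perturbation of the identity, hence surjective. But no output of that shift
  has a nonzero entry at position 0.\<close>

lemma index_le:
  assumes D: "hat_data sp sm d e d' e' ss cs" and E: "hat_data sp sm \<delta> \<epsilon> \<delta>' \<epsilon>' st ct"
    and fr: "finite_rank sm (\<lambda>x. folded.sg d e' x - folded.sg \<delta> \<epsilon>' x)"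
  shows "length st + length cs \<le> length ss + length ct"
proof (rule ccontr)
  assume neg: "\<not> ?thesis"
  interpret D: hat_data sp sm d e d' e' ss cs by fact
  interpret E: hat_data sp sm \<delta> \<epsilon> \<delta>' \<epsilon>' st ct by fact
  define k where "k = length st + length cs - (length ss + length ct)"
  have k: "k > 0" "length ss + k + length ct = length st + length cs" using neg by (auto simp: k_def)
  have vs: "vector_space sm" "vector_space sp" by unfold_locales
  interpret p: vector_space "pscale sp" by (rule pscale_vector_space[OF vs(2)])
  interpret p': vector_space "pscale sm" by (rule pscale_vector_space[OF vs(1)])
  let ?S = "\<lambda>w :: 'c \<times> (nat \<Rightarrow> 'a). (fst w, shift k 0 (snd w))"
  have S: "Vector_Spaces.linear (pscale sm) (pscale sm) ?S"
    by unfold_locales (auto simp: pscale_def shift_add shift_scale)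
  let ?G = "\<lambda>z. finv E.T (?S (D.T z))"
  have lS: "Vector_Spaces.linear (pscale sp) (pscale sm) (\<lambda>z. ?S (D.T z))" by (rule linear_comp[OF D.linear_T S])
  note G = kappa_linear_finite_rank[OF E.bijlin_T lS p'.finite_rank_diff_swap[OF finite_rank_hats[OF D E fr k(2)]]]
  have "inj ?S"
  proof (rule injI)
    fix v w :: "'c \<times> (nat \<Rightarrow> 'a)" assume h: "?S v = ?S w"
    then have "shift k 0 (snd v) = shift k 0 (snd w)" by simp
    then have "shift k 0 (snd v) (j + k) = shift k 0 (snd w) (j + k)" for j by simp
    then have "snd v j = snd w j" for j by (simp add: shift_def)
    with h show "v = w" by (auto simp: prod_eq_iff)
  qed
  have "inj ?G"
  proof (rule injI)
    fix v w assume "?G v = ?G w"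
    from injD[OF \<open>inj ?S\<close> injD[OF bijlinD(3)[OF bijlin_inv[OF E.bijlin_T]] this]]
    show "v = w" by (rule injD[OF bijlinD(3)[OF D.bijlin_T]])
  qed
  from p.inj_imp_surj_finite_rank[OF G this] have "surj ?G" .
  then obtain z where z: "finv E.T (0, free_gen 0) = ?G z" by (rule surjE)
  have "(0, free_gen 0) = ?S (D.T z)"
    by (rule injD[OF bijlinD(3)[OF bijlin_inv[OF E.bijlin_T]] z])
  then have "free_gen 0 (0 :: nat) = shift k 0 (snd (D.T z)) 0" by (simp add: prod_eq_iff)
  then show False using k(1) by (simp add: free_gen_def shift_def)
qed

lemma index_eq:
  assumes D: "hat_data sp sm d e d' e' ss cs" and E: "hat_data sp sm \<delta> \<epsilon> \<delta>' \<epsilon>' st ct"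
    and fr: "finite_rank sm (\<lambda>x. folded.sg d e' x - folded.sg \<delta> \<epsilon>' x)"
  shows "length ss + length ct = length st + length cs"
proof -
  interpret D: hat_data sp sm d e d' e' ss cs by fact
  show ?thesis using index_le[OF D E fr] index_le[OF E D D.A.d.vs2.finite_rank_diff_swap[OF fr]] by simp
qed

lemma finite_rank_hats_diff:
  assumes D: "hat_data sp sm d e d' e' ss cs" and E: "hat_data sp sm \<delta> \<epsilon> \<delta>' \<epsilon>' st ct"
    and fr: "finite_rank sm (\<lambda>x. folded.sg d e' x - folded.sg \<delta> \<epsilon>' x)"
  shows "finite_rank (pscale sm) (\<lambda>z. hat_data.T sp sm d e d' e' ss cs z - hat_data.T sp sm \<delta> \<epsilon> \<delta>' \<epsilon>' st ct z)"
proof -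
  have "shift 0 0 f = f" for f :: "nat \<Rightarrow> 'a" by (simp add: shift_def)
  then show ?thesis
    using finite_rank_hats[OF D E fr, of 0] index_eq[OF D E fr] by simp
qed

text \<open>On the image of \<open>rh\<close> this is \<open>u_rh\<close>. On the basis vectors and
  on the sequences it holds because \<open>U\<close> was corrected so as to match the lists, on both
  spaces.\<close>

lemma hat_intertwine:
  assumes D1: "hat_data sp sm d e d1 e1 ss1 cs1" and D2: "hat_data sp sm d e d2 e2 ss2 cs2"
  shows "hat_data.T sp sm d e d2 e2 ss2 cs2 (folded2.U sp d e d1 e1 d2 e2 ss1 ss2 (fst z), snd z) =
    (folded2.U sm e d e1 d1 e2 d2 cs1 cs2 (fst (hat_data.T sp sm d e d1 e1 ss1 cs1 z)), snd (hat_data.T sp sm d e d1 e1 ss1 cs1 z))"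
proof -
  interpret D1: hat_data sp sm d e d1 e1 ss1 cs1 by fact
  interpret D2: hat_data sp sm d e d2 e2 ss2 cs2 by fact
  interpret F: folded2 sp sm d e d1 e1 d2 e2 by unfold_locales
  interpret G: folded2 sm sp e d e1 d1 e2 d2 by (rule F.swap)
  let ?U = "F.U ss1 ss2" and ?V = "G.U cs1 cs2"
  note U = F.linear_U[OF D1.qs D2.qs] and V = G.linear_U[OF D1.qc D2.qc]
  have ls: "length ss1 = length ss2" by (rule F.length_s[OF D1.qs D2.qs])
  have lc: "length cs1 = length cs2" by (rule G.length_s[OF D1.qc D2.qc])
  interpret V: Vector_Spaces.linear sm sm ?V by (rule V)
  interpret U: Vector_Spaces.linear sp sp ?U by (rule U)
  show ?thesis
  proof (rule hat_gen_eq[OF D1.A.subspace_range_rh D1.qs linear_comp[OF linear_prod_id[OF U] D2.linear_T]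
        linear_comp[OF D1.linear_T linear_prod_id[OF V]], unfolded fst_conv snd_conv])
    fix y
    have 1: "D2.T (?U (D1.A.rh y), 0) = (D2.A.sg (F.u (D1.A.rh y)), 0)"
      by (simp add: F.U_rh[OF D1.qs D2.qs] F.u_rh D2.T_rh)
    have "?V (D1.A.sg (D1.A.rh y)) = G.u (D1.B.rh (D1.A.rh y))"
      using G.U_rh[OF D1.qc D2.qc] by (simp add: D1.B_rh)
    also have "\<dots> = D2.A.sg (F.u (D1.A.rh y))" by (simp add: G.u_rh D2.B_rh)
    finally show "D2.T (?U (D1.A.rh y), 0) = (?V (fst (D1.T (D1.A.rh y, 0))), snd (D1.T (D1.A.rh y, 0)))"
      unfolding 1 D1.T_rh by simp
  next
    fix i assume i: "i < length ss1"
    show "D2.T (?U (ss1 ! i), 0) = (?V (fst (D1.T (ss1 ! i, 0))), snd (D1.T (ss1 ! i, 0)))"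
    proof (cases "i < D1.l")
      case True
      then show ?thesis
        using i ls lc by (simp add: F.U_nth[OF D1.qs D2.qs] D1.T_nth D2.T_nth V.zero)
    next
      case False
      then have "i - D1.l < length cs1" using i by auto
      then show ?thesis
        using i ls lc False by (simp add: F.U_nth[OF D1.qs D2.qs] G.U_nth[OF D1.qc D2.qc] D1.T_nth D2.T_nth)
    qed
  next
    fix f
    have "map ?V cs1 = cs2" using lc by (intro nth_equalityI) (auto simp: G.U_nth[OF D1.qc D2.qc])
    then have "map ?V (drop (length ss1) cs1) = drop (length ss1) cs2" by (simp add: drop_map[symmetric])
    then show "D2.T (?U 0, f) = (?V (fst (D1.T (0, f))), snd (D1.T (0, f)))"
      using ls lc by (simp add: U.zero D1.T_snd D2.T_snd linear_lcomb[OF V])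
  qed
qed

text \<open>\<open>kappa_compose\<close> is applied to both sides of \<open>hat_intertwine\<close>
  for the two complexes. The factors for the \<open>U\<close> maps are quotients of base change
  determinants by \<open>kappa_U\<close>, with \<open>C\<close> and \<open>G\<close> on the plus
  side and \<open>C'\<close> and \<open>G'\<close> on the minus side; denominators are
  cleared.\<close>

lemma kappa_hats:
  assumes D1: "hat_data sp sm d e d1 e1 ss1 cs1" and D2: "hat_data sp sm d e d2 e2 ss2 cs2"
    and E1: "hat_data sp sm \<delta> \<epsilon> \<delta>1 \<epsilon>1 st1 ct1" and E2: "hat_data sp sm \<delta> \<epsilon> \<delta>2 \<epsilon>2 st2 ct2"
    and fr: "finite_rank sm (\<lambda>x. d x - \<delta> x)" "finite_rank sp (\<lambda>y. e y - \<epsilon> y)"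
      "finite_rank sp (\<lambda>y. d1 y - \<delta>1 y)" "finite_rank sm (\<lambda>x. e1 x - \<epsilon>1 x)"
      "finite_rank sp (\<lambda>y. d2 y - \<delta>2 y)" "finite_rank sm (\<lambda>x. e2 x - \<epsilon>2 x)"
    and C: "C \<in> carrier_mat (length ss1) (length ss1)"
      "\<And>j. j < length ss1 \<Longrightarrow> folded.P d e d2 e2 (ss2 ! j) - lcomb sp (map (folded.P d e d1 e1) ss1) (\<lambda>i. C $$ (i, j)) \<in> range e"
    and G: "G \<in> carrier_mat (length st1) (length st1)"
      "\<And>j. j < length st1 \<Longrightarrow> folded.P \<delta> \<epsilon> \<delta>2 \<epsilon>2 (st2 ! j) - lcomb sp (map (folded.P \<delta> \<epsilon> \<delta>1 \<epsilon>1) st1) (\<lambda>i. G $$ (i, j)) \<in> range \<epsilon>"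
    and C': "C' \<in> carrier_mat (length cs1) (length cs1)"
      "\<And>j. j < length cs1 \<Longrightarrow> folded.P e d e2 d2 (cs2 ! j) - lcomb sm (map (folded.P e d e1 d1) cs1) (\<lambda>i. C' $$ (i, j)) \<in> range d"
    and G': "G' \<in> carrier_mat (length ct1) (length ct1)"
      "\<And>j. j < length ct1 \<Longrightarrow> folded.P \<epsilon> \<delta> \<epsilon>2 \<delta>2 (ct2 ! j) - lcomb sm (map (folded.P \<epsilon> \<delta> \<epsilon>1 \<delta>1) ct1) (\<lambda>i. G' $$ (i, j)) \<in> range \<delta>"
  shows "kappa (pscale sp) (hat_data.T sp sm d e d2 e2 ss2 cs2) (hat_data.T sp sm \<delta> \<epsilon> \<delta>2 \<epsilon>2 st2 ct2) * (det G * det C') =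
    kappa (pscale sp) (hat_data.T sp sm d e d1 e1 ss1 cs1) (hat_data.T sp sm \<delta> \<epsilon> \<delta>1 \<epsilon>1 st1 ct1) * (det C * det G')"
proof -
  interpret D1: hat_data sp sm d e d1 e1 ss1 cs1 by fact
  interpret D2: hat_data sp sm d e d2 e2 ss2 cs2 by fact
  interpret E1: hat_data sp sm \<delta> \<epsilon> \<delta>1 \<epsilon>1 st1 ct1 by fact
  interpret E2: hat_data sp sm \<delta> \<epsilon> \<delta>2 \<epsilon>2 st2 ct2 by fact
  have FD: "folded2 sp sm d e d1 e1 d2 e2" and FE: "folded2 sp sm \<delta> \<epsilon> \<delta>1 \<epsilon>1 \<delta>2 \<epsilon>2" by unfold_locales
  interpret FD: folded2 sp sm d e d1 e1 d2 e2 by fact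
  interpret FE: folded2 sp sm \<delta> \<epsilon> \<delta>1 \<epsilon>1 \<delta>2 \<epsilon>2 by fact
  interpret GD: folded2 sm sp e d e1 d1 e2 d2 by (rule FD.swap)
  interpret GE: folded2 sm sp \<epsilon> \<delta> \<epsilon>1 \<delta>1 \<epsilon>2 \<delta>2 by (rule FE.swap)
  have vs: "vector_space sm" "vector_space sp" by unfold_locales
  let ?x = "\<lambda>F z. (F (fst z), snd z)"
  let ?UD = "FD.U ss1 ss2" and ?UE = "FE.U st1 st2" and ?VD = "GD.U cs1 cs2" and ?VE = "GE.U ct1 ct2"
  note kU = kappa_U[OF FD FE fr D1.qs D2.qs E1.qs E2.qs C G]
  note kV = kappa_U[OF FD.swap FE.swap fr(2,1,4,3,6,5) D1.qc D2.qc E1.qc E2.qc C' G']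
  note bUD = FD.bijlin_U[OF D1.qs D2.qs] and bUE = FE.bijlin_U[OF E1.qs E2.qs]
    and bVD = GD.bijlin_U[OF D1.qc D2.qc] and bVE = GE.bijlin_U[OF E1.qc E2.qc]
  have sg1: "finite_rank sm (\<lambda>x. D1.A.sg x - E1.A.sg x)" and sg2: "finite_rank sm (\<lambda>x. D2.A.sg x - E2.A.sg x)"
    using folded_diff(1)[OF D1.A.folded_axioms E1.A.folded_axioms fr(1-4)]
      folded_diff(1)[OF D2.A.folded_axioms E2.A.folded_axioms fr(1,2,5,6)] .
  note fT1 = finite_rank_hats_diff[OF D1 E1 sg1] and fT2 = finite_rank_hats_diff[OF D2 E2 sg2]
  have "kappa (pscale sp) (\<lambda>z. D2.T (?x ?UD z)) (\<lambda>z. E2.T (?x ?UE z)) = kappa (pscale sp) D2.T E2.T * kappa (pscale sp) (?x ?UD) (?x ?UE)"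
    by (rule kappa_compose[OF D2.bijlin_T E2.linear_T fT2 bijlin_prod_id[OF bUD]
          linear_prod_id[OF bijlinD(1)[OF bUE]] finite_rank_prod[OF vs(2) kU(2)]])
  moreover have "kappa (pscale sp) (\<lambda>z. ?x ?VD (D1.T z)) (\<lambda>z. ?x ?VE (E1.T z)) = kappa (pscale sm) (?x ?VD) (?x ?VE) * kappa (pscale sp) D1.T E1.T"
    by (rule kappa_compose[OF bijlin_prod_id[OF bVD] linear_prod_id[OF bijlinD(1)[OF bVE]]
          finite_rank_prod[OF vs(1) kV(2)] D1.bijlin_T E1.linear_T fT1])
  moreover have "(\<lambda>z. D2.T (?x ?UD z)) = (\<lambda>z. ?x ?VD (D1.T z))" "(\<lambda>z. E2.T (?x ?UE z)) = (\<lambda>z. ?x ?VE (E1.T z))"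
    using hat_intertwine[OF D1 D2] hat_intertwine[OF E1 E2] by (simp_all add: fun_eq_iff)
  ultimately have "kappa (pscale sp) D2.T E2.T * kappa (pscale sp) (?x ?UD) (?x ?UE)
     = kappa (pscale sm) (?x ?VD) (?x ?VE) * kappa (pscale sp) D1.T E1.T" by metis
  then have eq: "kappa (pscale sp) D2.T E2.T * kappa sp ?UD ?UE = kappa sm ?VD ?VE * kappa (pscale sp) D1.T E1.T"
    using kappa_prod[OF bUD bijlinD(1)[OF bUE] kU(2)] kappa_prod[OF bVD bijlinD(1)[OF bVE] kV(2)] by simp
  have "kappa (pscale sp) D2.T E2.T * (det G * det C') = kappa (pscale sp) D2.T E2.T * ((det C * kappa sp ?UD ?UE) * det C')"
    by (simp only: kU(1))
  also have "\<dots> = (kappa (pscale sp) D2.T E2.T * kappa sp ?UD ?UE) * det C * det C'"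
    by (simp only: ac_simps)
  also have "\<dots> = kappa (pscale sp) D1.T E1.T * (det C * (det C' * kappa sm ?VD ?VE))"
    unfolding eq by (simp only: ac_simps)
  finally show ?thesis by (simp only: kV(1))
qed

section \<open>Compatible pseudo-inverses\<close>

text \<open>\<open>F\<close> factors through the finite dimensional image of \<open>G\<close>.
  Finite rank can thus be concluded from where a map vanishes, without a bound on its range.\<close>

lemma finite_rank_factor:
  assumes F: "Vector_Spaces.linear s s1 F" and G: "Vector_Spaces.linear s s2 G" and fr: "finite_rank s2 G"
    and ker: "\<And>x. G x = 0 \<Longrightarrow> F x = 0"
  shows "finite_rank s1 F"
proof -
  interpret F: Vector_Spaces.linear s s1 F by fact
  interpret G: Vector_Spaces.linear s s2 G by fact
  obtain B where B: "finite B" "range G \<subseteq> G.vs2.span B" using fr by (auto simp: finite_rank_def)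
  obtain gs where gs: "qbasis s2 (range G) {0} gs"
    using G.vs2.qbasis_exists_span[OF linear_range_subspace[OF G] B(2,1)] by auto
  define xs where "xs = map (\<lambda>g. SOME x. G x = g) gs"
  have "map G xs = gs"
    unfolding xs_def map_map o_def
  proof (rule map_idI)
    fix g assume "g \<in> set gs"
    then have "g \<in> range G" using G.vs2.qbasis_set[OF gs] by auto
    then have "\<exists>x. G x = g" by auto
    then show "G (SOME x. G x = g) = g" by (rule someI_ex)
  qed
  have "F x = lcomb s1 (map F xs) (qcoord s2 {0} gs (G x))" for x
  proof -
    have "G x = lcomb s2 (map G xs) (qcoord s2 {0} gs (G x))"
      using G.vs2.qcoord_rest(1)[OF gs, of "G x"] \<open>map G xs = gs\<close> by simp
    also have "\<dots> = G (lcomb s xs (qcoord s2 {0} gs (G x)))" by (rule linear_lcomb[OF G, symmetric])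
    finally have "G (x - lcomb s xs (qcoord s2 {0} gs (G x))) = 0" by (simp add: G.diff)
    from ker[OF this] show ?thesis by (simp add: F.diff linear_lcomb[OF F])
  qed
  then have "F = (\<lambda>x. lcomb s1 (map F xs) (qcoord s2 {0} gs (G x)))" ..
  then show ?thesis using F.vs2.finite_rank_lcomb by metis
qed

context vector_space
begin

lemma projection_along:
  assumes S: "subspace S" and K: "subspace K" and SK: "S \<inter> K = {0}" and sum: "\<And>x. \<exists>y\<in>S. x - y \<in> K"
  shows "\<exists>p. Vector_Spaces.linear scale scale p \<and> (\<forall>x. p x \<in> S) \<and> (\<forall>x\<in>S. p x = x) \<and> (\<forall>x\<in>K. p x = 0)"
proof -
  have uniq: "y = z" if "y \<in> S" "z \<in> S" "x - y \<in> K" "x - z \<in> K" for x y z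
  proof -
    have "y - z \<in> S" using subspace_diff[OF S] that by blast
    moreover have "y - z \<in> K" using subspace_diff[OF K that(4,3)] subspace_neg[OF K, of "(x - z) - (x - y)"] by simp
    ultimately have "y - z \<in> S \<inter> K" by (rule IntI)
    then have "y - z = 0" unfolding SK by simp
    then show ?thesis by simp
  qed
  define p where "p x = (SOME y. y \<in> S \<and> x - y \<in> K)" for x
  have p: "p x \<in> S \<and> x - p x \<in> K" for x
    unfolding p_def by (rule someI_ex) (use sum in blast)
  have eq: "p x = y" if "y \<in> S" "x - y \<in> K" for x y using uniq[of "p x" y x] p that by blast
  have "Vector_Spaces.linear scale scale p"
  proof (unfold_locales, goal_cases)
    case (1 a b)
    have "(a - p a) + (b - p b) \<in> K" using p subspace_add[OF K] by blast
    then show ?case using p subspace_add[OF S] by (intro eq) (auto simp: algebra_simps)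
  next
    case (2 r b)
    have "scale r (b - p b) \<in> K" using p subspace_scale[OF K] by blast
    then show ?case using p subspace_scale[OF S] by (intro eq) (auto simp: scale_right_diff_distrib)
  qed
  moreover have "p x = x" if "x \<in> S" for x using that subspace_0[OF K] by (intro eq) auto
  moreover have "p x = 0" if "x \<in> K" for x using that subspace_0[OF S] by (intro eq) auto
  ultimately show ?thesis using p by blast
qed

text \<open>A complement of \<open>B + K\<close> is added to \<open>B\<close>.\<close>

lemma complement_extend:
  assumes K: "subspace K" and B: "subspace B" and KB: "B \<inter> K = {0}"
  shows "\<exists>C. subspace C \<and> B \<subseteq> C \<and> C \<inter> K = {0} \<and> (\<forall>x. \<exists>y\<in>C. x - y \<in> K)"
proof -
  let ?S = "{x + y |x y. x \<in> B \<and> y \<in> K}"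
  have S: "subspace ?S" by (rule subspace_sums[OF B K])
  obtain E where E: "subspace E" "E \<inter> ?S = {0}" "\<And>x. \<exists>y\<in>E. x - y \<in> ?S"
    using subspace_complement[OF S subspace_UNIV] by auto
  let ?C = "{x + y |x y. x \<in> B \<and> y \<in> E}"
  have C: "subspace ?C" by (rule subspace_sums[OF B E(1)])
  have BC: "B \<subseteq> ?C" using subspace_0[OF E(1)] by (metis (mono_tags, lifting) add.right_neutral mem_Collect_eq subsetI)
  have "x = 0" if x: "x \<in> ?C" "x \<in> K" for x
  proof -
    obtain b c where bc: "b \<in> B" "c \<in> E" "x = b + c" using x by auto
    have "c = (- b) + x" using bc by simp
    moreover have "- b \<in> B" using subspace_neg[OF B bc(1)] .
    ultimately have "c \<in> ?S" using x(2) by blast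
    then have "c \<in> E \<inter> ?S" using bc(2) by (rule IntI[rotated])
    then have "c = 0" unfolding E(2) by simp
    then have "x \<in> B \<inter> K" using bc(1,3) x(2) by simp
    then show "x = 0" unfolding KB by simp
  qed
  moreover have "0 \<in> ?C \<inter> K" using subspace_0[OF C] subspace_0[OF K] by simp
  ultimately have CK: "?C \<inter> K = {0}" by blast
  have "\<exists>y\<in>?C. x - y \<in> K" for x
  proof -
    obtain c where c: "c \<in> E" "x - c \<in> ?S" using E(3) by blast
    then obtain b k where bk: "b \<in> B" "k \<in> K" "x - c = b + k" by auto
    have "x - (b + c) = k" using bk(3) by (simp add: algebra_simps)
    then have "x - (b + c) \<in> K" using bk(2) by simp
    moreover have "b + c \<in> ?C" using bk(1) c(1) by blast
    ultimately show ?thesis by (rule bexI)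
  qed
  with C BC CK show ?thesis by blast
qed

text \<open>If \<open>H\<close> is a complement of \<open>R\<close> in \<open>K\<close>, then
  \<open>H + B\<close> is a complement of \<open>R\<close> in the whole space; the projection onto
  \<open>R\<close> is taken along it.\<close>

lemma complement_sum:
  assumes R: "subspace R" and K: "subspace K" "R \<subseteq> K" and B: "subspace B" "B \<inter> K = {0}" "\<And>x. \<exists>y\<in>B. x - y \<in> K"
  shows "\<exists>p. Vector_Spaces.linear scale scale p \<and> (\<forall>x. p x \<in> R) \<and> (\<forall>x\<in>R. p x = x) \<and> (\<forall>x\<in>B. p x = 0)"
proof -
  obtain H where H: "subspace H" "H \<subseteq> K" "H \<inter> R = {0}" "\<And>x. x \<in> K \<Longrightarrow> \<exists>y\<in>H. x - y \<in> R"
    using subspace_complement[OF R K] by auto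
  let ?M = "{x + y |x y. x \<in> H \<and> y \<in> B}"
  have M: "subspace ?M" by (rule subspace_sums[OF H(1) B(1)])
  have "x = 0" if x: "x \<in> R" "x \<in> ?M" for x
  proof -
    obtain h b where hb: "h \<in> H" "b \<in> B" "x = h + b" using x by auto
    have "x - h \<in> K" using x hb K H subspace_diff[OF K(1)] by blast
    then have "b \<in> K" using hb by simp
    then have "b = 0" using B hb by blast
    then show "x = 0" using hb x H by auto
  qed
  then have RM: "R \<inter> ?M = {0}" using subspace_0[OF R] subspace_0[OF M] by blast
  have sum: "\<exists>y\<in>R. x - y \<in> ?M" for x
  proof -
    obtain b where b: "b \<in> B" "x - b \<in> K" using B(3) by blast
    obtain h where h: "h \<in> H" "x - b - h \<in> R" using H(4)[OF b(2)] by blast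
    have "x - (x - b - h) = h + b" by simp
    moreover have "h + b \<in> ?M" using h(1) b(1) by blast
    ultimately have "x - (x - b - h) \<in> ?M" by simp
    then show ?thesis using h(2) by (rule bexI)
  qed
  obtain p where "Vector_Spaces.linear scale scale p" "\<forall>x. p x \<in> R" "\<forall>x\<in>R. p x = x" "\<forall>x\<in>?M. p x = 0"
    using projection_along[OF R M RM sum] by auto
  moreover have "B \<subseteq> ?M" using subspace_0[OF H(1)] by (metis (mono_tags, lifting) add_0 mem_Collect_eq subsetI)
  ultimately show ?thesis by blast
qed

end

text \<open>
  The ranges of the pseudo-inverses can be prescribed on \<open>B\<close> and \<open>B'\<close>: taking for these the places where two complexes agree
  makes their pseudo-inverses differ by maps of finite rank.
\<close>

lemma pinv_exists:
  assumes lin: "Vector_Spaces.linear sp sm d" "Vector_Spaces.linear sm sp e"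
    and cx: "\<And>x. e (d x) = 0" "\<And>y. d (e y) = 0"
    and B: "Modules.module.subspace sp B" "B \<inter> ker_set d = {0}" and B': "Modules.module.subspace sm B'" "B' \<inter> ker_set e = {0}"
  shows "\<exists>d' e'. folded sp sm d e d' e' \<and> B \<subseteq> range d' \<and> B' \<subseteq> range e'"
proof -
  interpret d: Vector_Spaces.linear sp sm d by fact
  interpret e: Vector_Spaces.linear sm sp e by fact
  interpret P: vector_space_pair sp sm by unfold_locales
  interpret P': vector_space_pair sm sp by unfold_locales
  note kd = linear_kernel_subspace[OF lin(1)] and ke = linear_kernel_subspace[OF lin(2)]
    and rd = linear_range_subspace[OF lin(1)] and re = linear_range_subspace[OF lin(2)]
  obtain C where C: "d.vs1.subspace C" "B \<subseteq> C" "C \<inter> ker_set d = {0}" "\<And>x. \<exists>y\<in>C. x - y \<in> ker_set d"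
    using d.vs1.complement_extend[OF kd B] by blast
  obtain C' where C': "d.vs2.subspace C'" "B' \<subseteq> C'" "C' \<inter> ker_set e = {0}" "\<And>x. \<exists>y\<in>C'. x - y \<in> ker_set e"
    using d.vs2.complement_extend[OF ke B'] by blast
  have "range e \<subseteq> ker_set d" "range d \<subseteq> ker_set e" using cx by auto
  note sub = this
  obtain q where q: "Vector_Spaces.linear sp sp q" "\<And>x. q x \<in> range e" "\<And>x. x \<in> range e \<Longrightarrow> q x = x" "\<And>x. x \<in> C \<Longrightarrow> q x = 0"
    using d.vs1.complement_sum[OF re kd sub(1) C(1,3,4)] by blast
  obtain p where p: "Vector_Spaces.linear sm sm p" "\<And>x. p x \<in> range d" "\<And>x. x \<in> range d \<Longrightarrow> p x = x" "\<And>x. x \<in> C' \<Longrightarrow> p x = 0"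
    using d.vs2.complement_sum[OF rd ke sub(2) C'(1,3,4)] by blast
  have inj: "inj_on d C"
  proof (rule inj_onI)
    fix x y assume "x \<in> C" "y \<in> C" "d x = d y"
    then have "x - y \<in> C \<inter> ker_set d" using d.vs1.subspace_diff[OF C(1)] by (simp add: d.diff)
    then show "x = y" using C(3) by simp
  qed
  have inj': "inj_on e C'"
  proof (rule inj_onI)
    fix x y assume "x \<in> C'" "y \<in> C'" "e x = e y"
    then have "x - y \<in> C' \<inter> ker_set e" using d.vs2.subspace_diff[OF C'(1)] by (simp add: e.diff)
    then show "x = y" using C'(3) by simp
  qed
  obtain g where g: "range g \<subseteq> C" "Vector_Spaces.linear sm sp g" "\<And>x. x \<in> C \<Longrightarrow> g (d x) = x"
    using P.linear_exists_left_inverse_on[OF lin(1) C(1) inj] by blast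
  obtain h where h: "range h \<subseteq> C'" "Vector_Spaces.linear sp sm h" "\<And>x. x \<in> C' \<Longrightarrow> h (e x) = x"
    using P'.linear_exists_left_inverse_on[OF lin(2) C'(1) inj'] by blast
  have dg: "d (g y) = y" if y: "y \<in> range d" for y
  proof -
    obtain x where x: "y = d x" using y by blast
    obtain c where c: "c \<in> C" "x - c \<in> ker_set d" using C(4) by blast
    then have "y = d c" using x by (simp add: d.diff)
    then show ?thesis using g(3)[OF c(1)] by simp
  qed
  have eh: "e (h y) = y" if y: "y \<in> range e" for y
  proof -
    obtain x where x: "y = e x" using y by blast
    obtain c where c: "c \<in> C'" "x - c \<in> ker_set e" using C'(4) by blast
    then have "y = e c" using x by (simp add: e.diff)
    then show ?thesis using h(3)[OF c(1)] by simp
  qed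
  interpret g: Vector_Spaces.linear sm sp g by (rule g)
  interpret h: Vector_Spaces.linear sp sm h by (rule h)
  have gC: "g y \<in> C" "h x \<in> C'" for x y using g(1) h(1) by auto
  \<comment> \<open>\<open>g\<close> and \<open>h\<close> invert \<open>d\<close> and
    \<open>e\<close> on the complements \<open>C\<close> and \<open>C'\<close> of their kernels, and
    \<open>p\<close> and \<open>q\<close> project onto their images. The pseudo-inverses are
    orthogonal because \<open>q\<close> kills \<open>C\<close> and \<open>p\<close> kills
    \<open>C'\<close>.\<close>
  have "folded sp sm d e (\<lambda>y. g (p y)) (\<lambda>x. h (q x))"
  proof (rule folded.intro)
    show "Vector_Spaces.linear sm sp (\<lambda>y. g (p y))" by (rule linear_comp[OF p(1) g(2)])
    show "Vector_Spaces.linear sp sm (\<lambda>x. h (q x))" by (rule linear_comp[OF q(1) h(2)])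
    show "d (g (p (d x))) = d x" for x using dg p by simp
    show "g (p (d (g (p y)))) = g (p y)" for y using dg[OF p(2)] p(3)[OF p(2)] by simp
    show "e (h (q (e y))) = e y" for y using eh q by simp
    show "h (q (e (h (q x)))) = h (q x)" for x using eh[OF q(2)] q(3)[OF q(2)] by simp
    show "h (q (g (p y))) = 0" for y using q(4)[OF gC(1)] h.zero by simp
    show "g (p (h (q x))) = 0" for x using p(4)[OF gC(2)] g.zero by simp
  qed (fact lin cx)+
  moreover have "b \<in> range (\<lambda>y. g (p y))" if "b \<in> B" for b
  proof -
    have "b = g (p (d b))" using that C(2) g(3) p(3) by auto
    then show ?thesis by blast
  qed
  moreover have "b \<in> range (\<lambda>x. h (q x))" if "b \<in> B'" for b
  proof -
    have "b = h (q (e b))" using that C'(2) h(3) q(3) by auto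
    then show ?thesis by blast
  qed
  ultimately show ?thesis by blast
qed

lemma folded_range:
  assumes "folded sp sm d e d' e'"
  shows "x \<in> range d' \<longleftrightarrow> d' (d x) = x" "range d' \<inter> ker_set d = {0}" "Modules.module.subspace sp (range d')"
proof -
  interpret folded sp sm d e d' e' by fact
  show 1: "x \<in> range d' \<longleftrightarrow> d' (d x) = x" for x by (auto simp: pinv) (metis rangeI)
  have "x = 0" if "x \<in> range d'" "d x = 0" for x using that 1[of x] d'.zero by simp
  moreover have "0 \<in> range d'" using d'.zero by (metis rangeI)
  ultimately show "range d' \<inter> ker_set d = {0}" using d.zero by blast
  show "d.vs1.subspace (range d')" by (rule linear_range_subspace[OF lin(3)])
qed

text \<open>The identity of \<open>X\<^sub>-\<close> is split into \<open>S.P\<close>,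
  \<open>d d1\<close> and \<open>e1 e\<close>. The first has finite rank. On the second the
  difference vanishes wherever \<open>d\<close> and \<delta> agree at \<open>d1 y\<close>; on the
  third both maps vanish wherever \<open>e\<close> and \<epsilon> agree at \<open>e1 (e y)\<close>.
  So \<open>finite_rank_factor\<close> reduces both to the finite rank of
  \<open>d - \<delta>\<close> and \<open>e - \<epsilon>\<close>.\<close>

lemma pinv_half_finite_rank:
  assumes F: "folded sp sm d e d1 e1" and G: "folded sp sm \<delta> \<epsilon> \<delta>1 \<epsilon>1"
    and fr: "finite_rank sm (\<lambda>x. d x - \<delta> x)" "finite_rank sp (\<lambda>y. e y - \<epsilon> y)"
    and fQ: "finite_rank sm (folded.P e d e1 d1)"
    and B: "\<And>x. x \<in> range d1 \<Longrightarrow> d x = \<delta> x \<Longrightarrow> x \<in> range \<delta>1"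
    and B': "\<And>y. y \<in> range e1 \<Longrightarrow> e y = \<epsilon> y \<Longrightarrow> y \<in> range \<epsilon>1"
  shows "finite_rank sp (\<lambda>y. d1 y - \<delta>1 y)"
proof -
  interpret F: folded sp sm d e d1 e1 by fact
  interpret G: folded sp sm \<delta> \<epsilon> \<delta>1 \<epsilon>1 by fact
  interpret S: folded sm sp e d e1 d1 by (rule F.swap)
  let ?f = "\<lambda>y. d1 y - \<delta>1 y"
  have lf: "Vector_Spaces.linear sm sp ?f"
    by unfold_locales (simp_all add: F.d'.add G.d'.add F.d'.scale G.d'.scale F.d.vs1.scale_right_diff_distrib)
  interpret f: Vector_Spaces.linear sm sp ?f by (rule lf)
  have ld: "Vector_Spaces.linear sp sm (\<lambda>x. d x - \<delta> x)"
    by unfold_locales (simp_all add: F.d.add G.d.add F.d.scale G.d.scale F.d.vs2.scale_right_diff_distrib)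
  have le: "Vector_Spaces.linear sm sp (\<lambda>y. e y - \<epsilon> y)"
    by unfold_locales (simp_all add: F.e.add G.e.add F.e.scale G.e.scale F.d.vs1.scale_right_diff_distrib)
  have 1: "finite_rank sp (\<lambda>y. ?f (d (d1 y)))"
  proof (rule finite_rank_factor[OF linear_comp[OF linear_comp[OF F.lin(3,1)] lf] linear_comp[OF F.lin(3) ld]])
    show "finite_rank sm (\<lambda>x. d (d1 x) - \<delta> (d1 x))" by (rule finite_rank_compose_right[OF fr(1)])
    fix y assume "d (d1 y) - \<delta> (d1 y) = 0"
    then have eq: "d (d1 y) = \<delta> (d1 y)" by simp
    then have "d1 y \<in> range \<delta>1" using B by blast
    then have "\<delta>1 (\<delta> (d1 y)) = d1 y" using folded_range(1)[OF G] by blast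
    then have "\<delta>1 (d (d1 y)) = d1 y" using eq by simp
    then show "?f (d (d1 y)) = 0" by (simp add: F.pinv)
  qed
  have 2: "finite_rank sp (\<lambda>y. ?f (e1 (e y)))"
  proof (rule finite_rank_factor[OF linear_comp[OF linear_comp[OF F.lin(2,4)] lf] linear_comp[OF linear_comp[OF F.lin(2,4)] le]])
    show "finite_rank sp (\<lambda>y. e (e1 (e y)) - \<epsilon> (e1 (e y)))" by (rule finite_rank_compose_right[OF fr(2)])
    fix y assume "e (e1 (e y)) - \<epsilon> (e1 (e y)) = 0"
    then have "e1 (e y) \<in> range \<epsilon>1" using B'[of "e1 (e y)"] by simp
    then obtain z where "e1 (e y) = \<epsilon>1 z" by blast
    then show "?f (e1 (e y)) = 0" using F.orth(2)[of "e y"] by (simp add: G.orth)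
  qed
  have 3: "finite_rank sp (\<lambda>y. ?f (S.P y))" by (rule finite_rank_compose_left[OF lf fQ])
  have eq: "?f y = ?f (S.P y) + ?f (d (d1 y)) + ?f (e1 (e y))" for y
  proof -
    have "y = S.P y + d (d1 y) + e1 (e y)" by (simp add: S.P_eq)
    then have "?f y = ?f (S.P y + d (d1 y) + e1 (e y))" by simp
    then show ?thesis by (simp only: f.add)
  qed
  have "finite_rank sp (\<lambda>y. ?f (S.P y) + ?f (d (d1 y)) + ?f (e1 (e y)))"
    by (rule F.d.vs1.finite_rank_add[OF F.d.vs1.finite_rank_add[OF 3 1] 2])
  then show ?thesis unfolding eq[symmetric] .
qed

lemma folded_P_finite_rank:
  assumes F: "folded sp sm d e d' e'" and q: "qbasis sp UNIV (range (folded.rh e d')) ss"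
  shows "finite_rank sp (folded.P d e d' e')"
proof -
  interpret folded sp sm d e d' e' by fact
  have "P x = lcomb sp (map P ss) (qcoord sp (range rh) ss x)" for x
    using d.vs1.qcoord_rest(1)[OF q UNIV_I, of x] by (simp add: range_rh P.diff linear_lcomb[OF linear_P])
  then have "P = (\<lambda>x. lcomb sp (map P ss) (qcoord sp (range rh) ss x))" ..
  then show ?thesis using d.vs1.finite_rank_lcomb by metis
qed

lemma pinv_compatible:
  assumes F: "hat_data sp sm d e d1 e1 ss cs"
    and lin: "Vector_Spaces.linear sp sm \<delta>" "Vector_Spaces.linear sm sp \<epsilon>"
    and cx: "\<And>x. \<epsilon> (\<delta> x) = 0" "\<And>y. \<delta> (\<epsilon> y) = 0"
    and fr: "finite_rank sm (\<lambda>x. d x - \<delta> x)" "finite_rank sp (\<lambda>y. e y - \<epsilon> y)"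
  shows "\<exists>\<delta>1 \<epsilon>1. folded sp sm \<delta> \<epsilon> \<delta>1 \<epsilon>1 \<and> finite_rank sp (\<lambda>y. d1 y - \<delta>1 y) \<and> finite_rank sm (\<lambda>x. e1 x - \<epsilon>1 x)"
proof -
  interpret F: hat_data sp sm d e d1 e1 ss cs by fact
  interpret d: Vector_Spaces.linear sp sm \<delta> by fact
  interpret e: Vector_Spaces.linear sm sp \<epsilon> by fact
  let ?B = "range d1 \<inter> {x. d x = \<delta> x}" and ?B' = "range e1 \<inter> {y. e y = \<epsilon> y}"
  note R = folded_range[OF F.A.folded_axioms] and R' = folded_range[OF F.B.folded_axioms]
  have B: "F.A.d.vs1.subspace ?B"
  proof (rule F.A.d.vs1.subspace_inter[OF R(3)])
    show "F.A.d.vs1.subspace {x. d x = \<delta> x}"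
      by (rule F.A.d.vs1.subspaceI) (simp_all add: F.A.d.zero d.zero F.A.d.add d.add F.A.d.scale d.scale)
  qed
  have B': "F.A.d.vs2.subspace ?B'"
  proof (rule F.A.d.vs2.subspace_inter[OF R'(3)])
    show "F.A.d.vs2.subspace {y. e y = \<epsilon> y}"
      by (rule F.A.d.vs2.subspaceI) (simp_all add: F.A.e.zero e.zero F.A.e.add e.add F.A.e.scale e.scale)
  qed
  have KB: "?B \<inter> ker_set \<delta> = {0}"
  proof
    show "?B \<inter> ker_set \<delta> \<subseteq> {0}"
    proof
      fix x assume "x \<in> ?B \<inter> ker_set \<delta>"
      then have "x \<in> range d1 \<inter> ker_set d" by simp
      then show "x \<in> {0}" unfolding R(2) .
    qed
    show "{0} \<subseteq> ?B \<inter> ker_set \<delta>" using F.A.d.vs1.subspace_0[OF B] d.zero by simp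
  qed
  have KB': "?B' \<inter> ker_set \<epsilon> = {0}"
  proof
    show "?B' \<inter> ker_set \<epsilon> \<subseteq> {0}"
    proof
      fix x assume "x \<in> ?B' \<inter> ker_set \<epsilon>"
      then have "x \<in> range e1 \<inter> ker_set e" by simp
      then show "x \<in> {0}" unfolding R'(2) .
    qed
    show "{0} \<subseteq> ?B' \<inter> ker_set \<epsilon>" using F.A.d.vs2.subspace_0[OF B'] e.zero by simp
  qed
  have "\<exists>\<delta>1 \<epsilon>1. folded sp sm \<delta> \<epsilon> \<delta>1 \<epsilon>1 \<and> ?B \<subseteq> range \<delta>1 \<and> ?B' \<subseteq> range \<epsilon>1"
    by (rule pinv_exists[OF lin cx B KB B' KB'])
  then obtain \<delta>1 \<epsilon>1 where G0: "folded sp sm \<delta> \<epsilon> \<delta>1 \<epsilon>1 \<and> ?B \<subseteq> range \<delta>1 \<and> ?B' \<subseteq> range \<epsilon>1"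
    by (elim exE)
  note G = conjunct1[OF G0] conjunct1[OF conjunct2[OF G0]] conjunct2[OF conjunct2[OF G0]]
  interpret G: folded sp sm \<delta> \<epsilon> \<delta>1 \<epsilon>1 by (rule G(1))
  have b: "x \<in> range \<delta>1" if "x \<in> range d1" "d x = \<delta> x" for x using subsetD[OF G(2), of x] that by simp
  have b': "y \<in> range \<epsilon>1" if "y \<in> range e1" "e y = \<epsilon> y" for y using subsetD[OF G(3), of y] that by simp
  have "finite_rank sp (\<lambda>y. d1 y - \<delta>1 y)"
    by (rule pinv_half_finite_rank[OF F.A.folded_axioms G(1) fr folded_P_finite_rank[OF F.B.folded_axioms F.qc] b b'])
  moreover have "finite_rank sm (\<lambda>x. e1 x - \<epsilon>1 x)"
    by (rule pinv_half_finite_rank[OF F.B.folded_axioms G.swap fr(2,1) folded_P_finite_rank[OF F.A.folded_axioms F.qs] b' b])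
  ultimately show ?thesis using G(1) by blast
qed

section \<open>Generators of the determinant line\<close>

lemma det_line_facts:
  fixes V :: "('f::field, 'v) module"
  assumes p: "presents s Z W \<pi> V" and q: "qbasis s Z W bs"
  shows "det_line V = ext_power (length bs) V"
    and "is_line (det_line V) (xw (length bs) V 1 (map \<pi> bs))"
    and "c \<odot>\<^bsub>det_line V\<^esub> xw (length bs) V a (map \<pi> bs) = xw (length bs) V (c * a) (map \<pi> bs)"
    and "\<omega> \<in> nonzero (det_line V) \<longleftrightarrow> (\<exists>x. x \<noteq> 0 \<and> \<omega> = xw (length bs) V x (map \<pi> bs))"
proof -
  interpret vector_space s by (rule presentsD[OF p])
  show dl: "det_line V = ext_power (length bs) V" by (simp add: det_line_def presents_vdim[OF p q])
  show L: "is_line (det_line V) (xw (length bs) V 1 (map \<pi> bs))"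
    unfolding dl by (rule ext_power_line(1)[OF p q refl])
  have t: "map \<pi> bs \<in> tuples (length bs) V" using qbasis_set[OF q] presentsD(5)[OF p] by (auto simp: tuples_def)
  show sc: "c \<odot>\<^bsub>det_line V\<^esub> xw (length bs) V a (map \<pi> bs) = xw (length bs) V (c * a) (map \<pi> bs)" for c a
    unfolding dl by (rule xw_scale[OF p t])
  have x: "xw (length bs) V x (map \<pi> bs) = x \<odot>\<^bsub>det_line V\<^esub> xw (length bs) V 1 (map \<pi> bs)" for x
    by (simp add: sc)
  have z: "\<zero>\<^bsub>det_line V\<^esub> = 0 \<odot>\<^bsub>det_line V\<^esub> xw (length bs) V 1 (map \<pi> bs)" by (rule lineD(5)[OF L])
  show "\<omega> \<in> nonzero (det_line V) \<longleftrightarrow> (\<exists>x. x \<noteq> 0 \<and> \<omega> = xw (length bs) V x (map \<pi> bs))"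
  proof
    assume "\<omega> \<in> nonzero (det_line V)"
    then have "\<omega> \<in> carrier (det_line V)" "\<omega> \<noteq> \<zero>\<^bsub>det_line V\<^esub>" by (auto simp: nonzero_def)
    then obtain y where y: "\<omega> = y \<odot>\<^bsub>det_line V\<^esub> xw (length bs) V 1 (map \<pi> bs)" unfolding lineD(1)[OF L] by blast
    with \<open>\<omega> \<noteq> \<zero>\<^bsub>det_line V\<^esub>\<close> z have "y \<noteq> 0" by auto
    then show "\<exists>x. x \<noteq> 0 \<and> \<omega> = xw (length bs) V x (map \<pi> bs)" using y x by blast
  next
    assume "\<exists>x. x \<noteq> 0 \<and> \<omega> = xw (length bs) V x (map \<pi> bs)"
    then obtain y where y0: "y \<noteq> 0" "\<omega> = xw (length bs) V y (map \<pi> bs)" by blast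
    note y = y0(1) y0(2)[unfolded x[of y]]
    then have "\<omega> \<noteq> \<zero>\<^bsub>det_line V\<^esub>" unfolding z y(2) lineD(2)[OF L] by simp
    then show "\<omega> \<in> nonzero (det_line V)" unfolding nonzero_def y(2) lineD(1)[OF L] by blast
  qed
qed

lemma hom_presentsI:
  fixes V :: "('f::field, 'v) module" and U :: "('f, 'w) module"
  assumes p: "presents s Z W \<pi> V" and p': "presents s' Z' W' \<pi>' U"
    and g: "Vector_Spaces.linear s s' g" "\<And>x. x \<in> Z \<Longrightarrow> g x \<in> Z'" and f: "\<And>x. x \<in> Z \<Longrightarrow> f (\<pi> x) = \<pi>' (g x)"
  shows "f \<in> hom_vs V U"
proof -
  interpret Vector_Spaces.linear s s' g by fact
  show ?thesis
    unfolding LinearCombinations.module_hom_def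
  proof (intro CollectI conjI allI impI)
    show "f \<in> carrier V \<rightarrow> carrier U" using f g(2) presentsD(5)[OF p] presentsD(5)[OF p'] by auto
    fix x y assume "x \<in> carrier V \<and> y \<in> carrier V"
    then obtain a b where ab: "a \<in> Z" "b \<in> Z" "x = \<pi> a" "y = \<pi> b" using presentsD(5)[OF p] by auto
    have "a + b \<in> Z" using vs1.subspace_add[OF presentsD(2)[OF p]] ab by blast
    then show "f (x \<oplus>\<^bsub>V\<^esub> y) = f x \<oplus>\<^bsub>U\<^esub> f y"
      using ab by (simp add: presentsD(7)[OF p] presentsD(7)[OF p'] f g(2) add)
  next
    fix r :: 'f and x assume "r \<in> carrier class_ring \<and> x \<in> carrier V"
    then obtain a where a: "a \<in> Z" "x = \<pi> a" using presentsD(5)[OF p] by auto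
    have "s r a \<in> Z" using vs1.subspace_scale[OF presentsD(2)[OF p]] a by blast
    then show "f (r \<odot>\<^bsub>V\<^esub> x) = r \<odot>\<^bsub>U\<^esub> f x"
      using a by (simp add: presentsD(8)[OF p] presentsD(8)[OF p'] f g(2) scale)
  qed
qed

context folded
begin

abbreviation "H \<equiv> quot_vs (vs_of sp (ker_set d)) (range e)"
abbreviation "hcls \<equiv> vcoset sp (range e)"
abbreviation "kcls \<equiv> vcoset sp (range rh)"

text \<open>\<open>ss\<close> represents a basis modulo the image of \<open>rh\<close>, and
  \<open>P\<close> moves its vectors into the kernel of \<open>sg\<close>, where they represent
  cohomology classes. The images of kernel and cokernel generators are both expressed by this one
  vector of \<open>|H|\<close>.\<close>

definition hv where "hv c ss = xw (length ss) H c (map hcls (map P ss))"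

lemma H_presents: "presents sp (ker_set d) (range e) hcls H"
proof -
  have "vector_space sp" by unfold_locales
  note q = quot_presents[OF this linear_kernel_subspace[OF lin(1)] subspace_range_e range_e_le]
  have "(\<lambda>v. range e +>\<^bsub>vs_of sp (ker_set d)\<^esub> v) = hcls" by (rule ext) (rule vcoset_carrier)
  with q show ?thesis by (simp only:)
qed

lemma coker_presents: "presents sp UNIV (range rh) kcls (coker_vs sp rh)"
  by (rule quot_presents[OF _ d.vs1.subspace_UNIV subspace_range_rh]) (unfold_locales, simp)

lemma ker_presents: "presents sp (ker_set sg) {0} (\<lambda>x. x) (ker_vs sp sg)"
  by (rule vs_of_presents[OF _ linear_kernel_subspace[OF linear_sg]]) unfold_locales

lemma ker_to_H_xw:
  assumes q: "qbasis sp (ker_set sg) {0} ss"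
  shows "ker_to_H sp sg (range e) H (xw (length ss) (ker_vs sp sg) c ss) = hv c ss"
proof -
  have hom: "hcls \<in> hom_vs (ker_vs sp sg) H"
    by (rule hom_presentsI[OF ker_presents H_presents d.vs1.linear_ident]) (auto simp: ker_sg)
  have t: "ss \<in> tuples (length ss) (ker_vs sp sg)"
    using d.vs1.qbasis_set[OF q] by (auto simp: tuples_def vs_of_def)
  show ?thesis
    unfolding ker_to_H_def presents_vdim[OF ker_presents q] ext_map_xw[OF ker_presents H_presents hom t] hv_def
    using map_P_ker[OF d.vs1.qbasis_set[OF q]] by simp
qed

text \<open>\<open>coker_to_H\<close> is defined by \<open>inv_into\<close>, so it suffices to
  exhibit a preimage and injectivity. The vectors \<open>P ss\<close> and \<open>ss\<close> have the
  same classes in the cokernel, since \<open>P (x - P x) = 0\<close>.\<close>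

lemma coker_to_H_xw:
  assumes q: "qbasis sp UNIV (range rh) ss"
  shows "coker_to_H sp rh H (xw (length ss) (coker_vs sp rh) c (map kcls ss)) = hv c ss"
proof -
  let ?f = "\<lambda>A. \<Union>a\<in>A. kcls a" and ?n = "length ss" and ?C = "coker_vs sp rh"
  note qH = qbasis_H[OF q]
  note p = coker_presents and pH = H_presents
  have sub: "range e \<subseteq> range rh" using P_simps(3) by (auto simp: range_rh)
  have k: "kcls x = kcls y \<longleftrightarrow> P (x - y) = 0" for x y
    using presentsD(6)[OF p, of x y] by (simp add: range_rh)
  have f: "?f (hcls x) = kcls x" for x
  proof -
    have "kcls (w + x) = kcls x" if "w \<in> range e" for w using that by (auto simp: k P_simps)
    then have "(\<Union>w\<in>range e. kcls (w + x)) = (\<Union>w\<in>range e. kcls x)" by (intro SUP_cong) auto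
    then show ?thesis by (simp add: vcoset_eq)
  qed
  have hom: "?f \<in> hom_vs H ?C"
    by (rule hom_presentsI[OF pH p d.vs1.linear_ident]) (auto simp only: f UNIV_I)
  have t: "map hcls (map P ss) \<in> tuples ?n H"
    using presentsD(5)[OF pH] P_simps by (auto simp: tuples_def)
  have kP: "map ?f (map hcls (map P ss)) = map kcls ss"
    unfolding map_map o_def f by (intro map_cong refl) (simp add: k P.diff P_simps)
  have em: "ext_map ?n ?C ?f (hv a ss) = xw ?n ?C a (map kcls ss)" for a
    unfolding hv_def ext_map_xw[OF pH p hom t] kP ..
  have vd: "vdim H = ?n" using presents_vdim[OF pH qH] by simp
  note LH = det_line_facts[OF pH qH, unfolded length_map, folded hv_def] and LC = det_line_facts[OF p q]
  have carr: "carrier (det_line H) = range (\<lambda>a. hv a ss)"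
    using lineD(1)[OF LH(2)] by (simp add: LH(3))
  have inj: "inj_on (ext_map ?n ?C ?f) (carrier (det_line H))"
  proof (rule inj_onI)
    fix x y assume "x \<in> carrier (det_line H)" "y \<in> carrier (det_line H)" and eq: "ext_map ?n ?C ?f x = ext_map ?n ?C ?f y"
    then obtain a b where ab: "x = hv a ss" "y = hv b ss" unfolding carr by blast
    have "a \<odot>\<^bsub>det_line ?C\<^esub> xw ?n ?C 1 (map kcls ss) = b \<odot>\<^bsub>det_line ?C\<^esub> xw ?n ?C 1 (map kcls ss)"
      using eq unfolding ab em by (simp add: LC(3))
    then have "a = b" unfolding lineD(2)[OF LC(2)] .
    then show "x = y" by (simp add: ab)
  qed
  have "inv_into (carrier (det_line H)) (ext_map ?n ?C ?f) (ext_map ?n ?C ?f (hv c ss)) = hv c ss"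
    by (rule inv_into_f_f[OF inj]) (simp add: carr)
  then show ?thesis unfolding coker_to_H_def vd em .
qed

lemma hv_line:
  assumes q: "qbasis sp UNIV (range rh) ss"
  shows "is_line (det_line H) (hv 1 ss)" "c \<odot>\<^bsub>det_line H\<^esub> hv a ss = hv (c * a) ss"
  using det_line_facts[OF H_presents qbasis_H[OF q], unfolded length_map, folded hv_def] by auto

end

context folded2
begin

text \<open>Both lists give bases of the same cohomology group, and \<open>C\<close> is the base
  change between them. It is the matrix that enters \<open>class_det_U\<close>, so the generators
  and the relative determinants change by the same scalars.\<close>

lemma hv_change:
  assumes q1: "qbasis sp UNIV (range A.rh) s1" and q2: "qbasis sp UNIV (range B.rh) s2"
  shows "\<exists>C. C \<in> carrier_mat (length s1) (length s1) \<and>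
    (\<forall>j<length s1. B.P (s2 ! j) - lcomb sp (map A.P s1) (\<lambda>i. C $$ (i, j)) \<in> range e) \<and>
    det C \<noteq> 0 \<and> B.hv 1 s2 = det C \<odot>\<^bsub>det_line A.H\<^esub> A.hv 1 s1"
proof -
  let ?n = "length s1" and ?b = "map A.P s1"
  note qH = A.qbasis_H[OF q1] and len = length_s[OF q1 q2]
  define C where "C = mat ?n ?n (\<lambda>(i, j). qcoord sp (range e) ?b (map B.P s2 ! j) i)"
  have C: "C \<in> carrier_mat ?n ?n" by (simp add: C_def)
  have rel: "B.P (s2 ! j) - lcomb sp ?b (\<lambda>i. C $$ (i, j)) \<in> range e" if j: "j < ?n" for j
  proof -
    have "lcomb sp ?b (\<lambda>i. C $$ (i, j)) = lcomb sp ?b (qcoord sp (range e) ?b (B.P (s2 ! j)))"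
      using j len by (intro A.d.vs1.lcomb_cong) (auto simp: C_def)
    then show ?thesis using A.d.vs1.qcoord_rest(1)[OF qH, of "B.P (s2 ! j)"] by (simp add: B.P_simps)
  qed
  have sub: "set (map B.P s2) \<subseteq> ker_set d" by (auto simp: B.P_simps)
  have "B.hv 1 s2 = xw ?n A.H 1 (map A.hcls (map B.P s2))" by (simp add: B.hv_def len)
  also have "\<dots> = (1 * det (mat ?n ?n (\<lambda>(i, j). qcoord sp (range e) ?b (map B.P s2 ! i) j)))
      \<odot>\<^bsub>ext_power ?n A.H\<^esub> xw ?n A.H 1 (map A.hcls ?b)"
    by (rule ext_power_line(2)[OF A.H_presents qH _ _ sub]) (simp_all add: len)
  \<comment> \<open>In \<open>ext_power_line\<close> coordinates fill rows, whereas in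
    \<open>C\<close> they fill columns.\<close>
  also have "mat ?n ?n (\<lambda>(i, j). qcoord sp (range e) ?b (map B.P s2 ! i) j) = transpose_mat C"
    by (intro eq_matI) (auto simp: C_def)
  also have "det (transpose_mat C) = det C" by (rule det_transpose[OF C])
  also have "ext_power ?n A.H = det_line A.H" using det_line_facts(1)[OF A.H_presents qH] by simp
  finally have eq: "B.hv 1 s2 = det C \<odot>\<^bsub>det_line A.H\<^esub> A.hv 1 s1" by (simp add: A.hv_def)
  have "det C \<noteq> 0"
  proof
    assume 0: "det C = 0"
    have "1 \<odot>\<^bsub>det_line A.H\<^esub> B.hv 1 s2 = B.hv 1 s2" using B.hv_line(2)[OF q2, of 1 1] by simp
    also have "\<dots> = 0 \<odot>\<^bsub>det_line A.H\<^esub> A.hv 1 s1" using eq 0 by simp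
    also have "\<dots> = 0 \<odot>\<^bsub>det_line A.H\<^esub> B.hv 1 s2"
      using lineD(5)[OF A.hv_line(1)[OF q1]] lineD(5)[OF B.hv_line(1)[OF q2]] by simp
    finally show False using lineD(2)[OF B.hv_line(1)[OF q2]] by simp
  qed
  with C rel eq show ?thesis by blast
qed

end

abbreviation cx_folded where
  "cx_folded sp sm D D' \<equiv> folded sp sm (d_plus D) (d_minus D) (pinv_plus D') (pinv_minus D')"

abbreviation cx_hat_data where
  "cx_hat_data sp sm D D' ss cs \<equiv> hat_data sp sm (d_plus D) (d_minus D) (pinv_plus D') (pinv_minus D') ss cs"

abbreviation cx_hat where
  "cx_hat sp sm D D' ss cs \<equiv> hat_data.T sp sm (d_plus D) (d_minus D) (pinv_plus D') (pinv_minus D') ss cs"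

abbreviation hv_plus where
  "hv_plus sp D D' \<equiv> folded.hv sp (d_plus D) (d_minus D) (pinv_plus D') (pinv_minus D')"

abbreviation hv_minus where
  "hv_minus sm D D' \<equiv> folded.hv sm (d_minus D) (d_plus D) (pinv_minus D') (pinv_plus D')"

definition xi where
  "xi sp sm D D' ss cs = cx_tensor sp sm D (hv_plus sp D D' 1 ss) (hv_minus sm D D' 1 cs)"

lemma cx_foldedI:
  assumes "is_complex sp sm D" "cx_pseudo_inverse sp sm D D'"
  shows "cx_folded sp sm D D'"
  using assms by (intro folded.intro) (auto simp: is_complex_def cx_pseudo_inverse_def pseudo_inverse_def)

lemma cx_foldedD:
  assumes "cx_folded sp sm D D'"
  shows "cx_pseudo_inverse sp sm D D'" "fold_plus D D' = folded.sg (d_plus D) (pinv_minus D')"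
    "fold_minus D D' = folded.rh (d_minus D) (pinv_plus D')"
proof -
  interpret folded sp sm "d_plus D" "d_minus D" "pinv_plus D'" "pinv_minus D'" by fact
  show "cx_pseudo_inverse sp sm D D'"
    unfolding cx_pseudo_inverse_def pseudo_inverse_def using lin pinv orth by simp
  show "fold_plus D D' = sg" "fold_minus D D' = rh"
    by (simp_all add: fun_eq_iff fold_plus_def fold_minus_def sg_def rh_def)
qed

lemma cx_tensor_hv:
  assumes h: "cx_hat_data sp sm D D' ss cs"
  shows "is_line (cx_line sp sm D) (xi sp sm D D' ss cs)"
    and "c' \<noteq> 0 \<Longrightarrow> cx_tensor sp sm D (hv_plus sp D D' c ss) (hv_minus sm D D' c' cs)
      = (c * inverse c') \<odot>\<^bsub>cx_line sp sm D\<^esub> xi sp sm D D' ss cs"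
proof -
  interpret hat_data sp sm "d_plus D" "d_minus D" "pinv_plus D'" "pinv_minus D'" ss cs by fact
  note LA = A.hv_line[OF qs] and LB = B.hv_line[OF qc]
  have one: "1 \<odot>\<^bsub>det_line A.H\<^esub> A.hv 1 ss = A.hv 1 ss" "1 \<odot>\<^bsub>det_line B.H\<^esub> B.hv 1 cs = B.hv 1 cs"
    using LA(2)[of 1 1] LB(2)[of 1 1] by simp_all
  note T = tensor_dual_line[OF LA(1) one(1) LB(1) one(2)]
  show "is_line (cx_line sp sm D) (xi sp sm D D' ss cs)"
    using T(1) by (simp add: cx_line_def xi_def cx_tensor_def H_plus_def H_minus_def)
  show "cx_tensor sp sm D (A.hv c ss) (B.hv c' cs) = (c * inverse c') \<odot>\<^bsub>cx_line sp sm D\<^esub> xi sp sm D D' ss cs"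
    if "c' \<noteq> 0"
    using T(2)[OF that, of c] LA(2)[of c 1] LB(2)[of c' 1]
    by (simp add: cx_line_def xi_def cx_tensor_def H_plus_def H_minus_def)
qed

text \<open>The determinant on the minus side appears inverted because that factor of the line is a
  dual.\<close>

lemma xi_change:
  assumes h1: "cx_hat_data sp sm D D1 s1 c1" and h2: "cx_hat_data sp sm D D2 s2 c2"
  shows "\<exists>C C'. C \<in> carrier_mat (length s1) (length s1) \<and>
    (\<forall>j<length s1. folded.P (d_plus D) (d_minus D) (pinv_plus D2) (pinv_minus D2) (s2 ! j)
       - lcomb sp (map (folded.P (d_plus D) (d_minus D) (pinv_plus D1) (pinv_minus D1)) s1) (\<lambda>i. C $$ (i, j)) \<in> range (d_minus D)) \<and>
    C' \<in> carrier_mat (length c1) (length c1) \<and>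
    (\<forall>j<length c1. folded.P (d_minus D) (d_plus D) (pinv_minus D2) (pinv_plus D2) (c2 ! j)
       - lcomb sm (map (folded.P (d_minus D) (d_plus D) (pinv_minus D1) (pinv_plus D1)) c1) (\<lambda>i. C' $$ (i, j)) \<in> range (d_plus D)) \<and>
    det C \<noteq> 0 \<and> det C' \<noteq> 0 \<and>
    xi sp sm D D2 s2 c2 = (det C * inverse (det C')) \<odot>\<^bsub>cx_line sp sm D\<^esub> xi sp sm D D1 s1 c1"
proof -
  interpret h1: hat_data sp sm "d_plus D" "d_minus D" "pinv_plus D1" "pinv_minus D1" s1 c1 by fact
  interpret h2: hat_data sp sm "d_plus D" "d_minus D" "pinv_plus D2" "pinv_minus D2" s2 c2 by fact
  interpret F: folded2 sp sm "d_plus D" "d_minus D" "pinv_plus D1" "pinv_minus D1" "pinv_plus D2" "pinv_minus D2"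
    by unfold_locales
  interpret G: folded2 sm sp "d_minus D" "d_plus D" "pinv_minus D1" "pinv_plus D1" "pinv_minus D2" "pinv_plus D2"
    by (rule F.swap)
  obtain C where C: "C \<in> carrier_mat (length s1) (length s1)"
    "\<forall>j<length s1. h2.A.P (s2 ! j) - lcomb sp (map h1.A.P s1) (\<lambda>i. C $$ (i, j)) \<in> range (d_minus D)"
    "det C \<noteq> 0" "h2.A.hv 1 s2 = det C \<odot>\<^bsub>det_line h1.A.H\<^esub> h1.A.hv 1 s1"
    using F.hv_change[OF h1.qs h2.qs] by blast
  obtain C' where C': "C' \<in> carrier_mat (length c1) (length c1)"
    "\<forall>j<length c1. h2.B.P (c2 ! j) - lcomb sm (map h1.B.P c1) (\<lambda>i. C' $$ (i, j)) \<in> range (d_plus D)"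
    "det C' \<noteq> 0" "h2.B.hv 1 c2 = det C' \<odot>\<^bsub>det_line h1.B.H\<^esub> h1.B.hv 1 c1"
    using G.hv_change[OF h1.qc h2.qc] by blast
  have "h2.A.hv 1 s2 = h1.A.hv (det C) s1" using C(4) h1.A.hv_line(2)[OF h1.qs, of "det C" 1] by simp
  moreover have "h2.B.hv 1 c2 = h1.B.hv (det C') c1" using C'(4) h1.B.hv_line(2)[OF h1.qc, of "det C'" 1] by simp
  ultimately have "xi sp sm D D2 s2 c2 = (det C * inverse (det C')) \<odot>\<^bsub>cx_line sp sm D\<^esub> xi sp sm D D1 s1 c1"
    using cx_tensor_hv(2)[OF h1 C'(3), of "det C"] by (simp add: xi_def[of sp sm D D2])
  with C C' show ?thesis by blast
qed

section \<open>Admissible choices\<close>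

context vector_space
begin

lemma lcomb_take_drop:
  "p \<le> length cs \<Longrightarrow> lcomb scale cs b = lcomb scale (take p cs) b + lcomb scale (drop p cs) (\<lambda>i. b (i + p))"
  using lcomb_append[of "take p cs" "drop p cs" b] by simp

text \<open>With the roles of the two operators exchanged, \<open>admissible_bases\<close> yields
  the blocks in the opposite order to the one used by the formula for nonnegative index.\<close>

lemma qbasis_append_swap:
  assumes q: "qbasis scale Z W (us @ vs)"
  shows "qbasis scale Z W (vs @ us)"
proof (rule qbasisI)
  let ?n = "length us" and ?k = "length vs"
  show "set (vs @ us) \<subseteq> Z" using qbasis_set[OF q] by auto
  have sw: "lcomb scale (vs @ us) a = lcomb scale (us @ vs) (\<lambda>i. if i < ?n then a (i + ?k) else a (i - ?n))" for a
  proof -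
    have "lcomb scale us (\<lambda>i. a (i + ?k)) = lcomb scale us (\<lambda>i. if i < ?n then a (i + ?k) else a (i - ?n))"
      by (intro lcomb_cong) auto
    then show ?thesis by (simp add: lcomb_append add.commute)
  qed
  fix x assume x: "x \<in> Z"
  obtain b where b: "x - lcomb scale (us @ vs) b \<in> W" using qcoord_rest(1)[OF q x] by blast
  let ?a = "\<lambda>i. if i < ?k then b (i + ?n) else b (i - ?k)"
  have "lcomb scale (vs @ us) ?a = lcomb scale (us @ vs) b"
    unfolding sw by (intro lcomb_cong) auto
  then show "\<exists>a. x - lcomb scale (vs @ us) a \<in> W" using b by metis
next
  let ?n = "length us" and ?k = "length vs"
  fix a i assume a: "lcomb scale (vs @ us) a \<in> W" and i: "i < length (vs @ us)"
  have "lcomb scale us (\<lambda>i. a (i + ?k)) = lcomb scale us (\<lambda>i. if i < ?n then a (i + ?k) else a (i - ?n))"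
    by (intro lcomb_cong) auto
  then have "lcomb scale (us @ vs) (\<lambda>i. if i < ?n then a (i + ?k) else a (i - ?n)) \<in> W"
    using a by (simp add: lcomb_append add.commute)
  note z = qbasis_indep[OF q this]
  show "a i = 0"
  proof (cases "i < ?k")
    case True then show ?thesis using z[of "i + ?n"] by simp
  next
    case False
    then have e: "i - ?k + ?k = i" "i - ?k < ?n" "i - ?k < length (us @ vs)" using i by auto
    from z[OF e(3)] e show ?thesis by (simp only: if_True)
  qed
qed

lemma vcoset_iff: "subspace W \<Longrightarrow> vcoset scale W x = vcoset scale W y \<longleftrightarrow> x - y \<in> W"
  unfolding vcoset_eq by (rule coset_eq_iff) unfold_locales

lemma carrier_quot: "subspace W \<Longrightarrow> carrier (quot_vs (vs_of scale UNIV) W) = range (vcoset scale W)"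
  using presentsD(5)[OF quot_presents[OF vector_space_axioms subspace_UNIV _ subset_UNIV]] by blast

text \<open>The choices \<open>L\<close>, \<open>M\<close>, \<open>N\<close> are linear only on a
  kernel; composing with a projection onto it gives a linear map on the whole space.\<close>

lemma hom_extension:
  assumes f: "f \<in> hom_vs (vs_of scale Z) (vs_of s' UNIV)" and Z: "subspace Z" and s': "vector_space s'"
  shows "\<exists>F. Vector_Spaces.linear scale s' F \<and> (\<forall>x\<in>Z. F x = f x)"
proof -
  interpret s': vector_space s' by fact
  obtain p where p: "Vector_Spaces.linear scale scale p" "range p = Z" "\<And>x. x \<in> Z \<Longrightarrow> p x = x"
    using subspace_projection[OF Z] by metis
  interpret p: Vector_Spaces.linear scale scale p by fact
  have pZ: "p x \<in> Z" for x using p(2) by auto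
  have fa: "f (x + y) = f x + f y" if "x \<in> Z" "y \<in> Z" for x y
    using f that by (auto simp: LinearCombinations.module_hom_def vs_of_def)
  have fs: "f (scale c x) = s' c (f x)" if "x \<in> Z" for c x
    using f that by (auto simp: LinearCombinations.module_hom_def vs_of_def)
  have "Vector_Spaces.linear scale s' (\<lambda>x. f (p x))"
    by unfold_locales (simp_all add: p.add p.scale fa fs pZ)
  then show ?thesis using p(3) by (intro exI[of _ "\<lambda>x. f (p x)"]) simp
qed

lemma qbasis_complement:
  assumes bs: "qbasis scale A {0} bs" and A: "subspace A" "A \<subseteq> Z" and AU: "A \<inter> U = {0}"
    and sum: "\<And>x. x \<in> Z \<Longrightarrow> \<exists>y\<in>A. x - y \<in> U"
  shows "qbasis scale Z U bs"
proof (rule qbasisI)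
  show "set bs \<subseteq> Z" using qbasis_set[OF bs] A(2) by auto
next
  fix x assume "x \<in> Z"
  then obtain y where y: "y \<in> A" "x - y \<in> U" using sum by blast
  from qcoord_rest(1)[OF bs y(1)] have "y = lcomb scale bs (qcoord scale {0} bs y)" by simp
  then show "\<exists>a. x - lcomb scale bs a \<in> U" using y(2) by metis
next
  fix a i assume a: "lcomb scale bs a \<in> U" and i: "i < length bs"
  have "lcomb scale bs a \<in> A \<inter> U" using a lcomb_mem[OF A(1) qbasis_set[OF bs]] by (intro IntI)
  then have "lcomb scale bs a \<in> {0}" unfolding AU .
  then show "a i = 0" by (rule qbasis_indep[OF bs _ i])
qed

end

text \<open>The last three hypotheses say that \<open>F\<close> induces an isomorphism of
  \<open>A\<close> onto \<open>Z/W\<close>.\<close>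

lemma qbasis_map_mod:
  assumes F: "Vector_Spaces.linear s s' F" and bs: "qbasis s A {0} bs" and A: "Modules.module.subspace s A"
    and inj: "\<And>x. x \<in> A \<Longrightarrow> F x \<in> W \<Longrightarrow> x = 0" and sub: "\<And>x. x \<in> A \<Longrightarrow> F x \<in> Z"
    and surj: "\<And>z. z \<in> Z \<Longrightarrow> \<exists>x\<in>A. z - F x \<in> W"
  shows "qbasis s' Z W (map F bs)"
proof -
  interpret F: Vector_Spaces.linear s s' F by fact
  show ?thesis
  proof (rule F.vs2.qbasisI)
    show "set (map F bs) \<subseteq> Z" using F.vs1.qbasis_set[OF bs] sub by auto
  next
    fix z assume "z \<in> Z"
    then obtain x where x: "x \<in> A" "z - F x \<in> W" using surj by blast
    from F.vs1.qcoord_rest(1)[OF bs x(1)] have "x = lcomb s bs (qcoord s {0} bs x)" by simp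
    then have "F x = lcomb s' (map F bs) (qcoord s {0} bs x)" using linear_lcomb[OF F] by metis
    then show "\<exists>a. z - lcomb s' (map F bs) a \<in> W" using x(2) by metis
  next
    fix a i assume a: "lcomb s' (map F bs) a \<in> W" and i: "i < length (map F bs)"
    have "lcomb s bs a = 0"
      by (rule inj[OF F.vs1.lcomb_mem[OF A F.vs1.qbasis_set[OF bs]]]) (simp add: a linear_lcomb[OF F])
    then show "a i = 0" using F.vs1.qbasis_indep[OF bs] i by simp
  qed
qed

text \<open>The target is filtered by the image of \<sigma> and by \<open>I\<close>, the sum of that
  image and the image of \<open>L\<close>: \<open>L\<close> supplies a basis of the lower quotient
  and \<open>N\<close> one of the upper quotient. The kernel of \<tau> is the direct sum of the
  kernels of \<open>N\<close> and \<open>M\<close> in it, and \<open>M\<close> maps the former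
  isomorphically onto the cokernel of \<tau>.\<close>

lemma admissible_bases:
  assumes lin: "Vector_Spaces.linear sx sy \<sigma>" "Vector_Spaces.linear sy sx \<tau>" and adm: "admissible sx sy \<sigma> \<tau> L M N"
    and ss: "qbasis sx (ker_set \<sigma>) {0} ss" and t0: "qbasis sy {y \<in> ker_set \<tau>. N y = 0} {0} t0"
    and t1: "qbasis sy {y \<in> ker_set \<tau>. M y = 0} {0} t1"
  shows "qbasis sy UNIV (range \<sigma>) (map L ss @ map N t1)" "qbasis sx UNIV (range \<tau>) (map M t0)"
    "qbasis sy (ker_set \<tau>) {0} (t0 @ t1)"
proof -
  interpret S: Vector_Spaces.linear sx sy \<sigma> by fact
  interpret T: Vector_Spaces.linear sy sx \<tau> by fact
  have vx: "vector_space sx" and vy: "vector_space sy" by unfold_locales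
  define KM where "KM = {y \<in> ker_set \<tau>. M y = 0}"
  define KN where "KN = {y \<in> ker_set \<tau>. N y = 0}"
  define I where "I = {a + b | a b. a \<in> range \<sigma> \<and> b \<in> L ` ker_set \<sigma>}"
  have L: "L \<in> hom_vs (ker_vs sx \<sigma>) (vs_of sy UNIV)"
    and Linj: "inj_on (\<lambda>x. vcoset sy (range \<sigma>) (L x)) (ker_set \<sigma>)"
    and M: "M \<in> hom_vs (ker_vs sy \<tau>) (vs_of sx UNIV)"
    and Msurj: "(\<lambda>y. vcoset sx (range \<tau>) (M y)) ` ker_set \<tau> = carrier (coker_vs sx \<tau>)"
    and M0: "M ` ker_set \<tau> \<inter> range \<tau> = {0}"
    and N: "N \<in> hom_vs (ker_vs sy \<tau>) (vs_of sy UNIV)"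
    and Nbij: "bij_betw (\<lambda>y. vcoset sy I (N y)) KM (carrier (quot_vs (vs_of sy UNIV) I))"
    and CEx: "\<exists>C. S.vs2.subspace C \<and> C \<inter> KM = {0} \<and>
            {a + b | a b. a \<in> C \<and> b \<in> KM} = ker_set \<tau> \<and> (\<forall>y\<in>C. N y = 0)"
    using adm unfolding admissible_def Let_def I_def KM_def by auto
  note rs = linear_range_subspace[OF lin(1)] and rt = linear_range_subspace[OF lin(2)]
    and ks = linear_kernel_subspace[OF lin(1)] and kt = linear_kernel_subspace[OF lin(2)]
  obtain L' where L': "Vector_Spaces.linear sx sy L'" "\<And>x. \<sigma> x = 0 \<Longrightarrow> L' x = L x"
    using S.vs1.hom_extension[OF L ks vy] by auto
  obtain M' where M': "Vector_Spaces.linear sy sx M'" "\<And>y. \<tau> y = 0 \<Longrightarrow> M' y = M y"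
    using S.vs2.hom_extension[OF M kt vx] by auto
  obtain N' where N': "Vector_Spaces.linear sy sy N'" "\<And>y. \<tau> y = 0 \<Longrightarrow> N' y = N y"
    using S.vs2.hom_extension[OF N kt vy] by auto
  interpret L: Vector_Spaces.linear sx sy L' by (rule L')
  interpret M: Vector_Spaces.linear sy sx M' by (rule M')
  interpret N: Vector_Spaces.linear sy sy N' by (rule N')
  have "L ` ker_set \<sigma> = L' ` ker_set \<sigma>" using L'(2) by (intro image_cong) auto
  then have Is: "S.vs2.subspace I" unfolding I_def
    using S.vs2.subspace_sums[OF rs L.subspace_image[OF ks]] by simp
  have rsI: "range \<sigma> \<subseteq> I"
  proof
    fix y assume y: "y \<in> range \<sigma>"
    have "L' 0 = L 0" "\<sigma> 0 = 0" using L'(2)[of 0] S.zero by auto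
    then have "0 \<in> L ` ker_set \<sigma>" using L.zero by (metis (mono_tags) image_eqI mem_Collect_eq)
    then show "y \<in> I" unfolding I_def using y by (intro CollectI exI[of _ y] exI[of _ 0]) simp
  qed
  have LI: "L' x \<in> I" if "\<sigma> x = 0" for x
    unfolding I_def using that L'(2)[OF that] S.vs2.subspace_0[OF rs]
    by (intro CollectI exI[of _ 0] exI[of _ "L' x"]) auto
  have KMeq: "KM = {y \<in> ker_set \<tau>. M' y = 0}" and KNeq: "KN = {y \<in> ker_set \<tau>. N' y = 0}"
    using M'(2) N'(2) by (auto simp: KM_def KN_def)
  have KMs: "S.vs2.subspace KM" unfolding KMeq
    by (rule S.vs2.subspaceI) (auto simp: T.zero M.zero T.add M.add T.scale M.scale S.vs1.scale_zero_right)
  have KNs: "S.vs2.subspace KN" unfolding KNeq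
    by (rule S.vs2.subspaceI) (auto simp: T.zero N.zero T.add N.add T.scale N.scale S.vs1.scale_zero_right S.vs2.scale_zero_right)
  have KMt: "\<tau> y = 0" "M' y = 0" if "y \<in> KM" for y using that by (auto simp: KMeq)
  have KNt: "\<tau> y = 0" "N' y = 0" if "y \<in> KN" for y using that by (auto simp: KNeq)
  have Ninj: "y = 0" if y: "y \<in> KM" "N' y \<in> I" for y
  proof -
    have "0 \<in> KM" using S.vs2.subspace_0[OF KMs] .
    moreover have "vcoset sy I (N y) = vcoset sy I (N 0)"
      unfolding S.vs2.vcoset_iff[OF Is] using y KMt(1)[OF y(1)] N'(2)[of y] N'(2)[of 0] T.zero N.zero by simp
    ultimately show ?thesis using Nbij y(1) unfolding bij_betw_def inj_on_def by blast
  qed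
  \<comment> \<open>\<open>N\<close> is injective modulo \<open>I\<close> on the kernel of
    \<open>M\<close>, so it cannot vanish at a nonzero vector there.\<close>
  have KMN: "KM \<inter> KN = {0}"
  proof
    show "KM \<inter> KN \<subseteq> {0}" using Ninj KNt(2) S.vs2.subspace_0[OF Is] by auto
    show "{0} \<subseteq> KM \<inter> KN" using S.vs2.subspace_0[OF KMs] S.vs2.subspace_0[OF KNs] by simp
  qed
  have dec: "\<exists>y\<in>KM. x - y \<in> KN" if x: "\<tau> x = 0" for x
  proof -
    obtain C where C: "{a + b | a b. a \<in> C \<and> b \<in> KM} = ker_set \<tau>" "\<forall>y\<in>C. N y = 0" using CEx by blast
    have "x \<in> {a + b | a b. a \<in> C \<and> b \<in> KM}" unfolding C(1) using x by simp
    then obtain a b where ab: "x = a + b" "a \<in> C" "b \<in> KM" by blast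
    have "a = x - b" using ab(1) by simp
    moreover have "\<tau> a = 0" using KMt(1)[OF ab(3)] x calculation by (simp add: T.diff)
    ultimately have "x - b \<in> KN" using C(2) ab(2) by (simp add: KN_def)
    then show ?thesis using ab(3) by blast
  qed
  have qKN: "qbasis sy (ker_set \<tau>) KN t1"
    by (rule S.vs2.qbasis_complement[OF t1[folded KM_def] KMs _ KMN]) (use dec KMt in auto)
  show "qbasis sy (ker_set \<tau>) {0} (t0 @ t1)"
    by (rule S.vs2.qbasis_append[OF qKN t0[folded KN_def] KNs]) (use KNt S.vs2.subspace_0[OF KNs] in auto)
  have "qbasis sx UNIV (range \<tau>) (map M' t0)"
  proof (rule qbasis_map_mod[OF M'(1) t0[folded KN_def] KNs])
    fix x assume x: "x \<in> KN" "M' x \<in> range \<tau>"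
    then have "M' x \<in> M ` ker_set \<tau> \<inter> range \<tau>" using M'(2) KNt(1) by auto
    then have "M' x = 0" unfolding M0 by simp
    then have "x \<in> KM \<inter> KN" using x KNt(1) by (simp add: KMeq)
    then show "x = 0" unfolding KMN by simp
  next
    fix z
    have "vcoset sx (range \<tau>) z \<in> (\<lambda>y. vcoset sx (range \<tau>) (M y)) ` ker_set \<tau>"
      unfolding Msurj S.vs1.carrier_quot[OF rt] by simp
    then obtain y where y: "\<tau> y = 0" "vcoset sx (range \<tau>) z = vcoset sx (range \<tau>) (M y)" by blast
    obtain b where b: "b \<in> KM" "y - b \<in> KN" using dec[OF y(1)] by blast
    have "z - M' y \<in> range \<tau>" using y(2) M'(2)[OF y(1)] unfolding S.vs1.vcoset_iff[OF rt] by simp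
    moreover have "M' y = M' (y - b)" using KMt(2)[OF b(1)] by (simp add: M.diff)
    ultimately show "\<exists>x\<in>KN. z - M' x \<in> range \<tau>" using b(2) by metis
  qed simp
  moreover have "map M' t0 = map M t0"
    using S.vs2.qbasis_set[OF t0] M'(2) by (intro map_cong) auto
  ultimately show "qbasis sx UNIV (range \<tau>) (map M t0)" by simp
  have "qbasis sy UNIV I (map N' t1)"
  proof (rule qbasis_map_mod[OF N'(1) t1[folded KM_def] KMs])
    fix z
    have "vcoset sy I z \<in> (\<lambda>y. vcoset sy I (N y)) ` KM"
      using Nbij unfolding bij_betw_def S.vs2.carrier_quot[OF Is] by simp
    then obtain y where y: "y \<in> KM" "vcoset sy I z = vcoset sy I (N y)" by blast
    then have "z - N' y \<in> I" using N'(2)[OF KMt(1)[OF y(1)]] unfolding S.vs2.vcoset_iff[OF Is] by simp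
    then show "\<exists>x\<in>KM. z - N' x \<in> I" using y(1) by blast
  qed (use Ninj in auto)
  moreover have "map N' t1 = map N t1"
    using S.vs2.qbasis_set[OF t1] N'(2) by (intro map_cong) auto
  ultimately have N1: "qbasis sy UNIV I (map N t1)" by simp
  have "qbasis sy I (range \<sigma>) (map L' ss)"
  proof (rule qbasis_map_mod[OF L'(1) ss ks])
    fix x assume x: "x \<in> ker_set \<sigma>" "L' x \<in> range \<sigma>"
    have "vcoset sy (range \<sigma>) (L x) = vcoset sy (range \<sigma>) (L 0)"
      unfolding S.vs2.vcoset_iff[OF rs] using x L'(2)[of x] L'(2)[of 0] S.zero L.zero by simp
    then show "x = 0" using Linj x(1) S.zero unfolding inj_on_def by blast
  next
    fix x assume "x \<in> ker_set \<sigma>" then show "L' x \<in> I" using LI by simp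
  next
    fix z assume "z \<in> I"
    then obtain a x where ax: "z = a + L x" "a \<in> range \<sigma>" "\<sigma> x = 0" unfolding I_def by blast
    then have "z - L' x \<in> range \<sigma>" using L'(2)[OF ax(3)] by simp
    then show "\<exists>x\<in>ker_set \<sigma>. z - L' x \<in> range \<sigma>" using ax(3) by blast
  qed
  moreover have "map L' ss = map L ss"
    using S.vs1.qbasis_set[OF ss] L'(2) by (intro map_cong) auto
  ultimately have L1: "qbasis sy I (range \<sigma>) (map L ss)" by simp
  show "qbasis sy UNIV (range \<sigma>) (map L ss @ map N t1)"
    by (rule S.vs2.qbasis_append[OF N1 L1 Is subset_UNIV rsI])
qed

text \<open>\<open>L\<close> sends \<open>ss\<close> to the first \<open>?p\<close> vectors of
  \<open>cs\<close>. \<open>M\<close> sends the first \<open>?n\<close> vectors of \<open>ct\<close>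
  to \<open>st\<close> and the others to zero; \<open>N\<close> sends those others to the rest of
  \<open>cs\<close> and the first \<open>?n\<close> to zero. Equality of the indices makes the two
  rests equally long.\<close>

lemma admissible_exists:
  assumes lin: "Vector_Spaces.linear sx sy \<sigma>" "Vector_Spaces.linear sy sx \<tau>"
    and ss: "qbasis sx (ker_set \<sigma>) {0} ss" and cs: "qbasis sy UNIV (range \<sigma>) cs"
    and st: "qbasis sx UNIV (range \<tau>) st" and ct: "qbasis sy (ker_set \<tau>) {0} ct"
    and len: "length ss \<le> length cs" "length ss + length ct = length st + length cs"
  shows "\<exists>L M N. admissible sx sy \<sigma> \<tau> L M N"
proof -
  interpret S: Vector_Spaces.linear sx sy \<sigma> by fact
  interpret T: Vector_Spaces.linear sy sx \<tau> by fact
  let ?p = "length ss" and ?n = "length st"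
  have nr: "?n \<le> length ct" using len by simp
  note rs = linear_range_subspace[OF lin(1)] and rt = linear_range_subspace[OF lin(2)]
    and ks = linear_kernel_subspace[OF lin(1)] and kt = linear_kernel_subspace[OF lin(2)]
  define ca where "ca = qcoord sx {0} ss"
  define cb where "cb = qcoord sy {0} ct"
  note ca_add = S.vs1.qcoord_add[OF ss S.vs1.subspace_single_0 ks, folded ca_def]
    and ca_scale = S.vs1.qcoord_scale[OF ss S.vs1.subspace_single_0 ks, folded ca_def]
    and cb_add = S.vs2.qcoord_add[OF ct S.vs2.subspace_single_0 kt, folded cb_def]
    and cb_scale = S.vs2.qcoord_scale[OF ct S.vs2.subspace_single_0 kt, folded cb_def]
  have ca: "x = lcomb sx ss (ca x)" if "\<sigma> x = 0" for x
    using S.vs1.qcoord_rest(1)[OF ss, of x] that by (simp add: ca_def)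
  have cb: "y = lcomb sy ct (cb y)" if "\<tau> y = 0" for y
    using S.vs2.qcoord_rest(1)[OF ct, of y] that by (simp add: cb_def)
  have ca_lc: "ca (lcomb sx ss a) = a" if "\<And>i. i \<ge> ?p \<Longrightarrow> a i = 0" for a
    unfolding ca_def by (rule S.vs1.qcoord_lcomb[OF ss S.vs1.subspace_single_0 ks that])
  have cb_lc: "cb (lcomb sy ct a) = a" if "\<And>i. i \<ge> length ct \<Longrightarrow> a i = 0" for a
    unfolding cb_def by (rule S.vs2.qcoord_lcomb[OF ct S.vs2.subspace_single_0 kt that])
  have cb0: "cb y i = 0" if "\<tau> y = 0" "i \<ge> length ct" for y i
    unfolding cb_def using S.vs2.qcoord_rest(2)[OF ct _ that(2), of y] that(1) by simp
  have lcs: "\<sigma> (lcomb sx ss a) = 0" for a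
    using S.vs1.lcomb_mem[OF ks S.vs1.qbasis_set[OF ss], of a] by simp
  have lct: "\<tau> (lcomb sy ct a) = 0" for a
    using S.vs2.lcomb_mem[OF kt S.vs2.qbasis_set[OF ct], of a] by simp
  have y0: "y = 0" if "\<tau> y = 0" "\<And>i. i < length ct \<Longrightarrow> cb y i = 0" for y
    using cb[OF that(1)] S.vs2.lcomb_cong[of ct "cb y" "\<lambda>_. 0"] that(2) S.vs2.lcomb_zero by simp
  let ?L = "\<lambda>x. lcomb sy (take ?p cs) (ca x)"
  let ?M = "\<lambda>y. lcomb sx st (cb y)"
  let ?N = "\<lambda>y. lcomb sy (drop ?p cs) (\<lambda>i. cb y (i + ?n))"
  define KM where "KM = {y \<in> ker_set \<tau>. ?M y = 0}"
  define I where "I = {a + b | a b. a \<in> range \<sigma> \<and> b \<in> ?L ` ker_set \<sigma>}"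
  have hL: "?L \<in> hom_vs (ker_vs sx \<sigma>) (vs_of sy UNIV)"
    by (auto simp: LinearCombinations.module_hom_def vs_of_def ca_add ca_scale S.vs2.lcomb_add S.vs2.lcomb_scale)
  have hM: "?M \<in> hom_vs (ker_vs sy \<tau>) (vs_of sx UNIV)"
    by (auto simp: LinearCombinations.module_hom_def vs_of_def cb_add cb_scale S.vs1.lcomb_add S.vs1.lcomb_scale)
  have hN: "?N \<in> hom_vs (ker_vs sy \<tau>) (vs_of sy UNIV)"
    by (auto simp: LinearCombinations.module_hom_def vs_of_def cb_add cb_scale S.vs2.lcomb_add S.vs2.lcomb_scale)
  have split: "lcomb sy (take ?p cs) a + lcomb sy (drop ?p cs) b = lcomb sy cs (\<lambda>i. if i < ?p then a i else b (i - ?p))" for a b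
    unfolding S.vs2.lcomb_take_drop[OF len(1), of "\<lambda>i. if i < ?p then a i else b (i - ?p)"]
    by (intro arg_cong2[where f = "(+)"] S.vs2.lcomb_cong) auto
  have zero_drop: "lcomb sy (drop ?p cs) (\<lambda>_. 0) = 0" and zero_take: "lcomb sy (take ?p cs) (\<lambda>_. 0) = 0"
    by (rule S.vs2.lcomb_zero)+
  have Linj: "inj_on (\<lambda>x. vcoset sy (range \<sigma>) (?L x)) (ker_set \<sigma>)"
  proof (rule inj_onI)
    fix x y assume xy: "x \<in> ker_set \<sigma>" "y \<in> ker_set \<sigma>" "vcoset sy (range \<sigma>) (?L x) = vcoset sy (range \<sigma>) (?L y)"
    then have "?L x - ?L y \<in> range \<sigma>" unfolding S.vs2.vcoset_iff[OF rs] by simp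
    moreover have "?L x - ?L y = lcomb sy cs (\<lambda>i. if i < ?p then ca x i - ca y i else 0)"
      using split[of "\<lambda>i. ca x i - ca y i" "\<lambda>_. 0"] by (simp add: S.vs2.lcomb_diff zero_drop)
    ultimately have "lcomb sy cs (\<lambda>i. if i < ?p then ca x i - ca y i else 0) \<in> range \<sigma>" by simp
    note z = S.vs2.qbasis_indep[OF cs this]
    have "ca x i = ca y i" if "i < ?p" for i using z[of i] that len(1) by simp
    then have "lcomb sx ss (ca x) = lcomb sx ss (ca y)" by (intro S.vs1.lcomb_cong) auto
    then show "x = y" using ca[of x] ca[of y] xy(1,2) by simp
  qed
  have Mz: "cb y i = 0" if "?M y \<in> range \<tau>" "i < ?n" for y i
    using S.vs1.qbasis_indep[OF st that] .
  have Mcong: "?M y = 0" if "\<And>i. i < ?n \<Longrightarrow> cb y i = 0" for y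
    using S.vs1.lcomb_cong[of st "cb y" "\<lambda>_. 0"] that S.vs1.lcomb_zero by simp
  have KM: "y \<in> KM \<longleftrightarrow> \<tau> y = 0 \<and> (\<forall>i<?n. cb y i = 0)" for y
  proof
    assume "y \<in> KM"
    then have "\<tau> y = 0" "?M y \<in> range \<tau>" using S.vs1.subspace_0[OF rt] by (simp_all add: KM_def)
    then show "\<tau> y = 0 \<and> (\<forall>i<?n. cb y i = 0)" using Mz[of y] by simp
  next
    assume h: "\<tau> y = 0 \<and> (\<forall>i<?n. cb y i = 0)"
    have "?M y = 0" by (rule Mcong) (use h in simp)
    then show "y \<in> KM" using h by (simp add: KM_def)
  qed
  have Msurj: "(\<lambda>y. vcoset sx (range \<tau>) (?M y)) ` ker_set \<tau> = carrier (coker_vs sx \<tau>)"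
    unfolding S.vs1.carrier_quot[OF rt]
  proof (intro equalityI subsetI)
    fix A assume "A \<in> range (vcoset sx (range \<tau>))"
    then obtain z where z: "A = vcoset sx (range \<tau>) z" by blast
    obtain b where b: "z - lcomb sx st b \<in> range \<tau>" using S.vs1.qcoord_rest(1)[OF st UNIV_I] by blast
    let ?y = "lcomb sy ct (\<lambda>i. if i < ?n then b i else 0)"
    have "cb ?y = (\<lambda>i. if i < ?n then b i else 0)" using nr by (intro cb_lc) auto
    then have "?M ?y = lcomb sx st b" by (simp only:) (intro S.vs1.lcomb_cong, simp)
    then have "A = vcoset sx (range \<tau>) (?M ?y)" unfolding z S.vs1.vcoset_iff[OF rt] using b by simp
    then show "A \<in> (\<lambda>y. vcoset sx (range \<tau>) (?M y)) ` ker_set \<tau>" using lct by (intro image_eqI) auto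
  qed auto
  have M0: "?M ` ker_set \<tau> \<inter> range \<tau> = {0}"
  proof
    show "?M ` ker_set \<tau> \<inter> range \<tau> \<subseteq> {0}"
    proof
      fix x assume "x \<in> ?M ` ker_set \<tau> \<inter> range \<tau>"
      then have h: "x \<in> ?M ` ker_set \<tau>" "x \<in> range \<tau>" by (rule IntD1, rule IntD2)
      from h(1) obtain y where y: "x = ?M y" by (rule imageE)
      have "?M y = 0" by (rule Mcong) (rule Mz[OF h(2)[unfolded y]])
      then show "x \<in> {0}" using y by simp
    qed
    have "cb 0 = (\<lambda>_. 0)" unfolding cb_def
      by (rule S.vs2.qcoord_zero[OF ct S.vs2.subspace_single_0]) (auto simp: T.zero)
    then have "?M 0 = 0" by (intro Mcong) simp
    then have "0 \<in> ?M ` ker_set \<tau>" using T.zero by (metis (mono_tags) image_eqI mem_Collect_eq)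
    then show "{0} \<subseteq> ?M ` ker_set \<tau> \<inter> range \<tau>" using S.vs1.subspace_0[OF rt] by simp
  qed
  have Is: "S.vs2.subspace I"
  proof -
    obtain L' where L': "Vector_Spaces.linear sx sy L'" "\<And>x. \<sigma> x = 0 \<Longrightarrow> L' x = ?L x"
      using S.vs1.hom_extension[OF hL ks] S.vs2.vector_space_axioms by auto
    interpret L': Vector_Spaces.linear sx sy L' by (rule L')
    have "?L ` ker_set \<sigma> = L' ` ker_set \<sigma>" using L'(2) by (intro image_cong) auto
    then show ?thesis unfolding I_def using S.vs2.subspace_sums[OF rs L'.subspace_image[OF ks]] by simp
  qed
  have Nbij: "bij_betw (\<lambda>y. vcoset sy I (?N y)) KM (carrier (quot_vs (vs_of sy UNIV) I))"
    unfolding bij_betw_def S.vs2.carrier_quot[OF Is]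
  proof
    show "inj_on (\<lambda>y. vcoset sy I (?N y)) KM"
    proof (rule inj_onI)
      fix x y assume xy: "x \<in> KM" "y \<in> KM" "vcoset sy I (?N x) = vcoset sy I (?N y)"
      then have "?N x - ?N y \<in> I" unfolding S.vs2.vcoset_iff[OF Is] by simp
      then obtain a z where az: "?N x - ?N y = a + ?L z" "a \<in> range \<sigma>" unfolding I_def by blast
      have "lcomb sy (take ?p cs) (\<lambda>i. 0 - ca z i) = - ?L z"
        using S.vs2.lcomb_diff[of "take ?p cs" "\<lambda>_. 0" "ca z"] by (simp add: zero_take)
      then have "lcomb sy cs (\<lambda>i. if i < ?p then 0 - ca z i else cb x (i - ?p + ?n) - cb y (i - ?p + ?n)) = - ?L z + (?N x - ?N y)"
        using split[of "\<lambda>i. 0 - ca z i" "\<lambda>i. cb x (i + ?n) - cb y (i + ?n)"] by (simp add: S.vs2.lcomb_diff)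
      also have "\<dots> = a" using az(1) by simp
      finally have "lcomb sy cs (\<lambda>i. if i < ?p then 0 - ca z i else cb x (i - ?p + ?n) - cb y (i - ?p + ?n)) \<in> range \<sigma>"
        using az(2) by simp
      note z = S.vs2.qbasis_indep[OF cs this]
      have "cb x i = cb y i" if i: "i < length ct" for i
      proof (cases "i < ?n")
        case True then show ?thesis using xy(1,2) by (simp add: KM)
      next
        case False
        then have "i - ?n + ?p < length cs" using i len by simp
        note zi = z[OF this]
        have "i - ?n + ?p - ?p + ?n = i" "\<not> i - ?n + ?p < ?p" using False by auto
        then have "cb x i - cb y i = 0" using zi by (simp only: if_False)
        then show ?thesis by simp
      qed
      then have "lcomb sy ct (cb x) = lcomb sy ct (cb y)" by (intro S.vs2.lcomb_cong) auto
      then show "x = y" using cb[of x] cb[of y] xy(1,2) by (simp add: KM)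
    qed
    show "(\<lambda>y. vcoset sy I (?N y)) ` KM = range (vcoset sy I)"
    proof (intro equalityI subsetI)
      fix A assume "A \<in> range (vcoset sy I)"
      then obtain z where z: "A = vcoset sy I z" by blast
      obtain b where b: "z - lcomb sy cs b \<in> range \<sigma>" using S.vs2.qcoord_rest(1)[OF cs UNIV_I] by blast
      \<comment> \<open>Coefficients for the last vectors of \<open>ct\<close>, shifted to hit the
        rest of \<open>cs\<close>; the zeros beyond \<open>length ct\<close> make \<open>c\<close>
        the coordinate function of \<open>?y\<close>.\<close>
      define c where "c i = (if i < ?n \<or> i \<ge> length ct then 0 else b (i - ?n + ?p))" for i
      let ?y = "lcomb sy ct c"
      have cy: "cb ?y = c" by (rule cb_lc) (simp add: c_def)
      have yK: "?y \<in> KM" unfolding KM cy using lct by (simp add: c_def)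
      have "?N ?y = lcomb sy (drop ?p cs) (\<lambda>i. b (i + ?p))"
        unfolding cy using len by (intro S.vs2.lcomb_cong) (auto simp: c_def)
      then have "lcomb sy cs b = lcomb sy (take ?p cs) b + ?N ?y"
        using S.vs2.lcomb_take_drop[OF len(1), of b] by simp
      moreover have "lcomb sy (take ?p cs) b = ?L (lcomb sx ss (\<lambda>i. if i < ?p then b i else 0))"
        by (subst ca_lc) (auto intro!: S.vs2.lcomb_cong)
      ultimately have "z - ?N ?y = (z - lcomb sy cs b) + ?L (lcomb sx ss (\<lambda>i. if i < ?p then b i else 0))"
        by (simp add: algebra_simps)
      then have "z - ?N ?y \<in> I" unfolding I_def using b lcs
        by (intro CollectI exI[of _ "z - lcomb sy cs b"] exI[of _ "?L (lcomb sx ss (\<lambda>i. if i < ?p then b i else 0))"]) auto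
      then have "A = vcoset sy I (?N ?y)" unfolding z S.vs2.vcoset_iff[OF Is] .
      then show "A \<in> (\<lambda>y. vcoset sy I (?N y)) ` KM" using yK by (rule image_eqI)
    qed auto
  qed
  \<comment> \<open>The span of the first \<open>?n\<close> vectors of \<open>ct\<close>, a
    complement of the kernel of \<open>M\<close> on which \<open>N\<close> vanishes.\<close>
  let ?C = "{y \<in> ker_set \<tau>. \<forall>i\<ge>?n. cb y i = 0}"
  have C1: "S.vs2.subspace ?C"
  proof (rule S.vs2.subspaceI)
    have "cb 0 = (\<lambda>_. 0)" unfolding cb_def
      by (rule S.vs2.qcoord_zero[OF ct S.vs2.subspace_single_0]) (auto simp: T.zero)
    then show "0 \<in> ?C" by (simp add: T.zero)
  qed (auto simp: T.add T.scale cb_add cb_scale S.vs1.scale_zero_right)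
  have KMs0: "0 \<in> KM"
  proof -
    have "cb 0 = (\<lambda>_. 0)" unfolding cb_def
      by (rule S.vs2.qcoord_zero[OF ct S.vs2.subspace_single_0]) (auto simp: T.zero)
    then show ?thesis by (simp add: KM T.zero)
  qed
  have C2: "?C \<inter> KM = {0}"
  proof
    show "?C \<inter> KM \<subseteq> {0}"
    proof
      fix y assume "y \<in> ?C \<inter> KM"
      then have h: "\<tau> y = 0" "\<forall>i\<ge>?n. cb y i = 0" "\<forall>i<?n. cb y i = 0" by (auto simp: KM)
      then have "cb y i = 0" for i by (cases "i < ?n") auto
      then show "y \<in> {0}" using y0[OF h(1)] by simp
    qed
    show "{0} \<subseteq> ?C \<inter> KM" using KMs0 S.vs2.subspace_0[OF C1] by simp
  qed
  have C3: "{a + b | a b. a \<in> ?C \<and> b \<in> KM} = ker_set \<tau>"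
  proof (intro equalityI subsetI)
    fix y assume "y \<in> ker_set \<tau>"
    then have y: "\<tau> y = 0" by simp
    let ?a = "\<lambda>i. if i < ?n then cb y i else 0" and ?b = "\<lambda>i. if i < ?n then 0 else cb y i"
    have ca': "cb (lcomb sy ct ?a) = ?a" using nr by (intro cb_lc) auto
    have cb': "cb (lcomb sy ct ?b) = ?b" using cb0[OF y] by (intro cb_lc) auto
    have "y = lcomb sy ct (\<lambda>i. ?a i + ?b i)"
      using cb[OF y] S.vs2.lcomb_cong[of ct "\<lambda>i. ?a i + ?b i" "cb y"] by simp
    then have "y = lcomb sy ct ?a + lcomb sy ct ?b" unfolding S.vs2.lcomb_add .
    moreover have "lcomb sy ct ?a \<in> ?C" using lct[of ?a] by (simp add: ca')
    moreover have "lcomb sy ct ?b \<in> KM" using lct[of ?b] by (simp add: KM cb')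
    ultimately show "y \<in> {a + b | a b. a \<in> ?C \<and> b \<in> KM}" by blast
  qed (auto simp: T.add KM)
  have C4: "\<forall>y\<in>?C. ?N y = 0"
  proof
    fix y assume "y \<in> ?C"
    then have "lcomb sy (drop ?p cs) (\<lambda>i. cb y (i + ?n)) = lcomb sy (drop ?p cs) (\<lambda>_. 0)"
      by (intro S.vs2.lcomb_cong) simp
    then show "?N y = 0" by (simp add: zero_drop)
  qed
  have "admissible sx sy \<sigma> \<tau> ?L ?M ?N"
    unfolding admissible_def Let_def I_def[symmetric] KM_def[symmetric]
    using hL Linj hM Msurj M0 hN Nbij C1 C2 C3 C4 by (intro conjI exI[of _ ?C])
  then show ?thesis by blast
qed

section \<open>The operator \<open>\<Sigma>\<close>\<close>

lemma pscale_fst_linear: "vector_space s \<Longrightarrow> Vector_Spaces.linear (pscale s) s fst"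
proof -
  assume v: "vector_space s"
  then interpret v: vector_space s .
  interpret p: vector_space "pscale s" by (rule pscale_vector_space[OF v])
  show ?thesis by unfold_locales (auto simp: pscale_def)
qed

text \<open>For these lists \<open>D.T\<close> is \<Sigma>, extended by the identity on sequences,
  after \<open>E.T\<close>. Hence \<Sigma> plus an identity is conjugate, by \<open>E.T\<close>, to
  the inverse of \<open>E.T\<close> followed after \<open>D.T\<close>, and
  \<open>class_det_transfer\<close> applies.\<close>

lemma Sigma_nonpos:
  assumes D: "hat_data sp sm d e d1 e1 ss (map L ss @ map N t1)"
    and E: "hat_data sp sm \<delta> \<epsilon> \<delta>1 \<epsilon>1 (map M t0) (t0 @ t1)"
    and fr: "finite_rank sm (\<lambda>x. folded.sg d e1 x - folded.sg \<delta> \<epsilon>1 x)"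
    and L: "L \<in> hom_vs (ker_vs sp (folded.sg d e1)) (vs_of sm UNIV)"
    and M: "M \<in> hom_vs (ker_vs sm (folded.rh \<epsilon> \<delta>1)) (vs_of sp UNIV)"
    and N: "N \<in> hom_vs (ker_vs sm (folded.rh \<epsilon> \<delta>1)) (vs_of sm UNIV)"
    and ss: "set ss \<subseteq> ker_set (folded.sg d e1)"
    and t0: "set t0 \<subseteq> {y \<in> ker_set (folded.rh \<epsilon> \<delta>1). N y = 0}"
    and t1: "set t1 \<subseteq> {y \<in> ker_set (folded.rh \<epsilon> \<delta>1). M y = 0}"
  shows "class_det sm (Sigma_op (folded.sg d e1) (folded.rh e d1) (folded.rh \<epsilon> \<delta>1) (folded.sg \<delta> \<epsilon>1) L M N)
    = kappa (pscale sp) (hat_data.T sp sm \<delta> \<epsilon> \<delta>1 \<epsilon>1 (map M t0) (t0 @ t1)) (hat_data.T sp sm d e d1 e1 ss (map L ss @ map N t1))"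
proof -
  interpret D: hat_data sp sm d e d1 e1 ss "map L ss @ map N t1" by fact
  interpret E: hat_data sp sm \<delta> \<epsilon> \<delta>1 \<epsilon>1 "map M t0" "t0 @ t1" by fact
  have vp: "vector_space sp" and vm: "vector_space sm" by unfold_locales
  obtain L' where L': "Vector_Spaces.linear sp sm L'" "\<And>x. D.A.sg x = 0 \<Longrightarrow> L' x = L x"
    using D.A.d.vs1.hom_extension[OF L linear_kernel_subspace[OF D.A.linear_sg] vm] by auto
  obtain M' where M': "Vector_Spaces.linear sm sp M'" "\<And>x. E.A.rh x = 0 \<Longrightarrow> M' x = M x"
    using D.A.d.vs2.hom_extension[OF M linear_kernel_subspace[OF E.A.linear_rh] vp] by auto
  obtain N' where N': "Vector_Spaces.linear sm sm N'" "\<And>x. E.A.rh x = 0 \<Longrightarrow> N' x = N x"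
    using D.A.d.vs2.hom_extension[OF N linear_kernel_subspace[OF E.A.linear_rh] vm] by auto
  interpret L: Vector_Spaces.linear sp sm L' by (rule L')
  interpret M: Vector_Spaces.linear sm sp M' by (rule M')
  interpret N: Vector_Spaces.linear sm sm N' by (rule N')
  define X where "X y = E.A.rh y + M' (E.B.P y)" for y
  define S where "S y = D.A.sg (X y) + L' (D.A.P (X y)) + N' (E.B.P y)" for y
  have Qk: "E.A.rh (E.B.P y) = 0" for y using E.B.P_simps(6) by (simp add: E.B_rh)
  have Qdef: "E.B.P y = y - E.A.sg (E.A.rh y)" for y by (simp add: E.B.P_def E.B_rh)
  have Q_sg: "E.B.P (E.A.sg x) = 0" for x using E.B.P_simps(7) by (simp add: E.B_rh)
  have S_eq: "Sigma_op D.A.sg D.A.rh E.A.rh E.A.sg L M N = S"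
  proof
    fix y
    have "M (E.B.P y) = M' (E.B.P y)" "N (E.B.P y) = N' (E.B.P y)" using M'(2) N'(2) Qk by simp_all
    moreover have "L (D.A.P (X y)) = L' (D.A.P (X y))" using L'(2) D.A.P_simps by simp
    ultimately show "Sigma_op D.A.sg D.A.rh E.A.rh E.A.sg L M N y = S y"
      unfolding Sigma_op_def Let_def Qdef[symmetric] by (simp add: S_def X_def D.A.P_def)
  qed
  have lX: "Vector_Spaces.linear sm sp X"
    by unfold_locales (simp_all add: X_def E.A.rh.add E.A.rh.scale M.add M.scale E.B.P.add E.B.P.scale D.A.d.vs1.scale_right_distrib)
  interpret X: Vector_Spaces.linear sm sp X by (rule lX)
  have lS: "Vector_Spaces.linear sm sm S"
    by unfold_locales (simp_all add: S_def X.add X.scale D.A.sg.add D.A.sg.scale D.A.P.add D.A.P.scale L.add L.scale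
        N.add N.scale E.B.P.add E.B.P.scale D.A.d.vs2.scale_right_distrib)
  interpret S: Vector_Spaces.linear sm sm S by (rule lS)
  \<comment> \<open>Here \<open>ss\<close> is no longer than the list on the minus side, so all of
    it is matched and \<open>D.T\<close> restricts to \<sigma> + \<open>L P\<close> on
    \<open>X\<^sub>+\<close>.\<close>
  have Tx: "D.T (x, 0) = (D.A.sg x + L' (D.A.P x), 0)" for x
  proof (rule D.A.d.vs1.linear_eq_on_qbasis[OF D.qs linear_comp[OF pscale_linear_fst[OF vp] D.linear_T]
        linear_comp[OF _ pscale_linear_fst[OF vm]]])
    show "Vector_Spaces.linear sp sm (\<lambda>x. D.A.sg x + L' (D.A.P x))"
      by unfold_locales (simp_all add: D.A.sg.add D.A.sg.scale D.A.P.add D.A.P.scale L.add L.scale D.A.d.vs2.scale_right_distrib)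
    fix x assume "x \<in> range D.A.rh"
    then obtain y where "x = D.A.rh y" by blast
    then show "D.T (x, 0) = (D.A.sg x + L' (D.A.P x), 0)" by (simp add: D.T_rh D.A.P_simps L.zero)
  next
    fix i assume i: "i < length ss"
    then have k: "D.A.sg (ss ! i) = 0" using ss nth_mem by blast
    then show "D.T (ss ! i, 0) = (D.A.sg (ss ! i) + L' (D.A.P (ss ! i)), 0)"
      using i by (simp add: D.T_nth D.A.P_ker L'(2) nth_append)
  qed simp
  \<comment> \<open>\<open>E.T\<close> sends \<open>M t0\<close> to \<open>t0\<close>, and the first
    sequence entries to \<open>t1\<close>. There \<Sigma> takes the values
    \<open>(\<sigma> + L P) (M t0)\<close> and \<open>N t1\<close>, as \<open>N\<close> kills
    \<open>t0\<close> and \<open>M\<close> kills \<open>t1\<close>; these are the values of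
    \<open>D.T\<close>.\<close>
  have TS: "D.T z = (S (fst (E.T z)), snd (E.T z))" for z
  proof (rule hat_gen_eq[OF E.A.subspace_range_rh E.qs D.linear_T linear_comp[OF E.linear_T linear_prod_id[OF lS]]])
    fix y
    show "D.T (E.A.rh y, 0) = (S (fst (E.T (E.A.rh y, 0))), snd (E.T (E.A.rh y, 0)))"
      by (simp add: E.T_rh Tx S_def X_def Q_sg M.zero N.zero E.A.rh_sg)
  next
    fix i assume i: "i < length (map M t0)"
    then have k: "E.A.rh (t0 ! i) = 0" "N (t0 ! i) = 0" using t0 nth_mem by fastforce+
    then have q: "E.B.P (t0 ! i) = t0 ! i" by (simp add: Qdef E.A.sg.zero)
    have n0: "N' (t0 ! i) = 0" using k N'(2) by simp
    show "D.T (map M t0 ! i, 0) = (S (fst (E.T (map M t0 ! i, 0))), snd (E.T (map M t0 ! i, 0)))"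
      unfolding E.T_nth[OF i] using i k(1) by (simp add: nth_append Tx S_def X_def q n0 M'(2))
  next
    fix f
    have "S (t1 ! j) = N (t1 ! j)" if j: "j < length t1" for j
    proof -
      have k: "E.A.rh (t1 ! j) = 0" "M (t1 ! j) = 0" using t1 j nth_mem by fastforce+
      then have q: "E.B.P (t1 ! j) = t1 ! j" by (simp add: Qdef E.A.sg.zero)
      have m0: "M' (t1 ! j) = 0" using k M'(2) by simp
      show ?thesis using k(1) by (simp add: S_def X_def q m0 D.A.sg.zero D.A.P.zero L.zero N'(2))
    qed
    then have "map S t1 = map N t1" by (intro nth_equalityI) auto
    then have "S (lcomb sm t1 f) = lcomb sm (map N t1) f" using linear_lcomb[OF lS, of t1 f] by (simp only:)
    then show "D.T (0, f) = (S (fst (E.T (0, f))), snd (E.T (0, f)))"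
      by (simp add: D.T_snd E.T_snd)
  qed
  note fT = finite_rank_hats_diff[OF D E fr]
  interpret pm: vector_space "pscale sm" by (rule pscale_vector_space[OF vm])
  \<comment> \<open>\<open>1 - \<Sigma>\<close> is the first component of \<open>E.T - D.T\<close>
    composed with the inverse of \<open>E.T\<close>.\<close>
  have fS: "finite_rank sm (\<lambda>y. y - S y)"
  proof -
    have "finite_rank sm (\<lambda>w. fst (E.T w - D.T w))"
      by (rule finite_rank_compose_left[OF pscale_fst_linear[OF vm] pm.finite_rank_diff_swap[OF fT]])
    from finite_rank_compose_right[OF this, where g = "\<lambda>y. finv E.T (y, 0)"]
    show ?thesis by (simp add: TS bijlinD[OF E.bijlin_T])
  qed
  note K = kappa_linear_finite_rank[OF E.bijlin_T D.linear_T pm.finite_rank_diff_swap[OF fT]]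
  interpret ET: Vector_Spaces.linear "pscale sp" "pscale sm" E.T by (rule E.linear_T)
  have "class_det (pscale sm) (\<lambda>z. (S (fst z), snd z)) = class_det (pscale sp) (\<lambda>z. finv E.T (D.T z))"
  proof (rule class_det_transfer[OF E.linear_T bijlinD(3)[OF E.bijlin_T] K linear_prod_id[OF lS]])
    show "(S (fst (E.T z)), snd (E.T z)) = E.T (finv E.T (D.T z))" for z by (simp add: TS[symmetric] bijlinD[OF E.bijlin_T])
    show "\<exists>x. y - (S (fst y), snd y) = E.T (x - finv E.T (D.T x))" for y
      by (rule exI[of _ "finv E.T y"]) (simp add: ET.diff bijlinD[OF E.bijlin_T] TS)
  qed
  then show ?thesis unfolding S_eq kappa_def using class_det_prod[OF lS fS] by simp
qed

text \<open>In this case the inverse of \<open>E.T\<close> composed with \<open>D.T\<close> is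
  itself \<Sigma> with the identity on sequences, without a conjugation: \<Sigma> acts before
  \<open>E.T\<close>, whereas for nonpositive index it acts after it.\<close>

lemma Sigma_nonneg:
  assumes D: "hat_data sp sm d e d1 e1 (s0 @ s1) (map L s1)"
    and E: "hat_data sp sm \<delta> \<epsilon> \<delta>1 \<epsilon>1 (map N s0 @ map M t) t"
    and fr: "finite_rank sm (\<lambda>x. folded.sg d e1 x - folded.sg \<delta> \<epsilon>1 x)"
    and L: "L \<in> hom_vs (ker_vs sp (folded.sg d e1)) (vs_of sm UNIV)"
    and M: "M \<in> hom_vs (ker_vs sm (folded.rh \<epsilon> \<delta>1)) (vs_of sp UNIV)"
    and N: "N \<in> hom_vs (ker_vs sp (folded.sg d e1)) (vs_of sp UNIV)"
    and t: "set t \<subseteq> ker_set (folded.rh \<epsilon> \<delta>1)"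
    and s0: "set s0 \<subseteq> {y \<in> ker_set (folded.sg d e1). L y = 0}"
    and s1: "set s1 \<subseteq> {y \<in> ker_set (folded.sg d e1). N y = 0}"
  shows "class_det sp (Sigma_op (folded.rh \<epsilon> \<delta>1) (folded.sg \<delta> \<epsilon>1) (folded.sg d e1) (folded.rh e d1) M L N)
    = kappa (pscale sp) (hat_data.T sp sm \<delta> \<epsilon> \<delta>1 \<epsilon>1 (map N s0 @ map M t) t) (hat_data.T sp sm d e d1 e1 (s0 @ s1) (map L s1))"
proof -
  interpret D: hat_data sp sm d e d1 e1 "s0 @ s1" "map L s1" by fact
  interpret E: hat_data sp sm \<delta> \<epsilon> \<delta>1 \<epsilon>1 "map N s0 @ map M t" t by fact
  have vp: "vector_space sp" and vm: "vector_space sm" by unfold_locales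
  obtain L' where L': "Vector_Spaces.linear sp sm L'" "\<And>x. D.A.sg x = 0 \<Longrightarrow> L' x = L x"
    using D.A.d.vs1.hom_extension[OF L linear_kernel_subspace[OF D.A.linear_sg] vm] by auto
  obtain M' where M': "Vector_Spaces.linear sm sp M'" "\<And>x. E.A.rh x = 0 \<Longrightarrow> M' x = M x"
    using D.A.d.vs2.hom_extension[OF M linear_kernel_subspace[OF E.A.linear_rh] vp] by auto
  obtain N' where N': "Vector_Spaces.linear sp sp N'" "\<And>x. D.A.sg x = 0 \<Longrightarrow> N' x = N x"
    using D.A.d.vs1.hom_extension[OF N linear_kernel_subspace[OF D.A.linear_sg] vp] by auto
  interpret L: Vector_Spaces.linear sp sm L' by (rule L')
  interpret M: Vector_Spaces.linear sm sp M' by (rule M')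
  interpret N: Vector_Spaces.linear sp sp N' by (rule N')
  define X where "X y = D.A.sg y + L' (D.A.P y)" for y
  define R where "R w = E.A.rh w + M' (E.B.P w)" for w
  define S where "S y = R (X y) + N' (D.A.P y)" for y
  have Qk: "E.A.rh (E.B.P y) = 0" for y using E.B.P_simps(6) by (simp add: E.B_rh)
  have Qdef: "E.B.P y = y - E.A.sg (E.A.rh y)" for y by (simp add: E.B.P_def E.B_rh)
  have Q_sg: "E.B.P (E.A.sg x) = 0" for x using E.B.P_simps(7) by (simp add: E.B_rh)
  have S_eq: "Sigma_op E.A.rh E.A.sg D.A.sg D.A.rh M L N = S"
  proof
    fix y
    have "L (D.A.P y) = L' (D.A.P y)" "N (D.A.P y) = N' (D.A.P y)" using L'(2) N'(2) D.A.P_simps by simp_all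
    moreover have "M (E.B.P (X y)) = M' (E.B.P (X y))" using M'(2) Qk by simp
    ultimately show "Sigma_op E.A.rh E.A.sg D.A.sg D.A.rh M L N y = S y"
      unfolding Sigma_op_def Let_def Qdef[symmetric] D.A.P_def[symmetric] by (simp add: S_def R_def X_def)
  qed
  have lX: "Vector_Spaces.linear sp sm X"
    by unfold_locales (simp_all add: X_def D.A.sg.add D.A.sg.scale L.add L.scale D.A.P.add D.A.P.scale D.A.d.vs2.scale_right_distrib)
  have lR: "Vector_Spaces.linear sm sp R"
    by unfold_locales (simp_all add: R_def E.A.rh.add E.A.rh.scale M.add M.scale E.B.P.add E.B.P.scale D.A.d.vs1.scale_right_distrib)
  interpret X: Vector_Spaces.linear sp sm X by (rule lX)
  interpret R: Vector_Spaces.linear sm sp R by (rule lR)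
  have lS: "Vector_Spaces.linear sp sp S"
    by unfold_locales (simp_all add: S_def X.add X.scale R.add R.scale D.A.P.add D.A.P.scale
        N.add N.scale D.A.d.vs1.scale_right_distrib)
  interpret S: Vector_Spaces.linear sp sp S by (rule lS)
  \<comment> \<open>\<open>R\<close> is \<tau> + \<open>M Q\<close>; it inverts \<open>E.T\<close>
    on the vectors with zero sequence, because \<open>E.T\<close> sends \<open>M t\<close> back to
    \<open>t\<close>.\<close>
  have TR: "E.T (R w, 0) = (w, 0)" for w
  proof (rule D.A.d.vs2.linear_eq_on_qbasis[OF E.qc linear_comp[OF linear_comp[OF lR pscale_linear_fst[OF vp]] E.linear_T]
        pscale_linear_fst[OF vm]])
    fix w assume "w \<in> range E.B.rh"
    then obtain x where w: "w = E.A.sg x" unfolding E.B_rh by blast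
    show "E.T (R w, 0) = (w, 0)" by (simp add: R_def w Q_sg M.zero E.T_rh E.A.rh_sg)
  next
    fix i assume i: "i < length t"
    then have k: "E.A.rh (t ! i) = 0" using t nth_mem by blast
    then have q: "E.B.P (t ! i) = t ! i" by (simp add: Qdef E.A.sg.zero)
    have "R (t ! i) = (map N s0 @ map M t) ! (length s0 + i)" using i k by (simp add: R_def q M'(2) nth_append)
    then show "E.T (R (t ! i), 0) = (t ! i, 0)"
      using i E.T_nth[of "length s0 + i"] by simp
  qed simp
  \<comment> \<open>Both completions send their surplus, \<open>s0\<close> and \<open>N s0\<close>,
    to the same unit sequences, and \<Sigma> sends \<open>s0\<close> to \<open>N s0\<close>.\<close>
  have TS: "D.T z = E.T (S (fst z), snd z)" for z
  proof (rule hat_gen_eq[OF D.A.subspace_range_rh D.qs D.linear_T linear_comp[OF linear_prod_id[OF lS] E.linear_T]], unfold fst_conv snd_conv)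
    fix y
    have "S (D.A.rh y) = R (D.A.sg (D.A.rh y))" by (simp add: S_def X_def D.A.P_simps L.zero N.zero)
    then show "D.T (D.A.rh y, 0) = E.T (S (D.A.rh y), 0)" by (simp add: D.T_rh TR)
  next
    fix i assume i: "i < length (s0 @ s1)"
    show "D.T ((s0 @ s1) ! i, 0) = E.T (S ((s0 @ s1) ! i), 0)"
    proof (cases "i < length s0")
      case True
      then have k: "D.A.sg (s0 ! i) = 0" "L (s0 ! i) = 0" using s0 nth_mem by fastforce+
      then have "S (s0 ! i) = N (s0 ! i)" by (simp add: S_def X_def D.A.P_ker L'(2) N'(2) R.zero)
      then have "S ((s0 @ s1) ! i) = (map N s0 @ map M t) ! i" using True by (simp add: nth_append)
      then show ?thesis using D.T_nth[OF i] E.T_nth[of i] True by simp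
    next
      case False
      then have j: "i - length s0 < length s1" using i by auto
      then have k: "D.A.sg (s1 ! (i - length s0)) = 0" "N (s1 ! (i - length s0)) = 0" using s1 nth_mem by fastforce+
      then have "S (s1 ! (i - length s0)) = R (L (s1 ! (i - length s0)))" by (simp add: S_def X_def D.A.P_ker L'(2) N'(2))
      then have "S ((s0 @ s1) ! i) = R (L (s1 ! (i - length s0)))" using False by (simp add: nth_append)
      then show ?thesis using D.T_nth[OF i] False j by (simp add: TR)
    qed
  next
    fix f
    show "D.T (0, f) = E.T (S 0, f)" by (simp add: S.zero D.T_snd E.T_snd)
  qed
  note fT = finite_rank_hats_diff[OF D E fr]
  interpret pm: vector_space "pscale sm" by (rule pscale_vector_space[OF vm])
  note K = kappa_linear_finite_rank[OF E.bijlin_T D.linear_T pm.finite_rank_diff_swap[OF fT]]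
  have inv: "finv E.T (D.T z) = (S (fst z), snd z)" for z by (simp add: TS bijlinD[OF E.bijlin_T])
  have fS: "finite_rank sp (\<lambda>y. y - S y)"
  proof -
    have "finite_rank sp (\<lambda>w. fst (w - finv E.T (D.T w)))"
      by (rule finite_rank_compose_left[OF pscale_fst_linear[OF vp] K(2)])
    from finite_rank_compose_right[OF this, where g = "\<lambda>y. (y, 0)"]
    show ?thesis by (simp add: inv)
  qed
  show ?thesis unfolding S_eq kappa_def inv using class_det_prod[OF lS fS] by simp
qed

section \<open>The defining formulas\<close>

lemma hom_vs_restrict: "f \<in> hom_vs (vs_of s Z) U \<Longrightarrow> Z' \<subseteq> Z \<Longrightarrow> f \<in> hom_vs (vs_of s Z') U"
  by (auto simp: LinearCombinations.module_hom_def vs_of_def subset_iff)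

lemma hom_vs_comp: "f \<in> hom_vs V U \<Longrightarrow> g \<in> hom_vs U W \<Longrightarrow> (\<lambda>x. g (f x)) \<in> hom_vs V W"
  by (auto simp: LinearCombinations.module_hom_def Pi_iff)

lemma hom_vs_id: "Z \<subseteq> Z' \<Longrightarrow> id \<in> hom_vs (vs_of s Z) (vs_of s Z')"
  by (auto simp: LinearCombinations.module_hom_def vs_of_def)

context vector_space
begin

lemma vcoset_hom: "subspace W \<Longrightarrow> vcoset scale W \<in> hom_vs (vs_of scale UNIV) (quot_vs (vs_of scale UNIV) W)"
  by (rule hom_presentsI[OF vs_of_presents[OF vector_space_axioms subspace_UNIV]
        quot_presents[OF vector_space_axioms subspace_UNIV _ subset_UNIV] linear_ident]) auto

lemma hom_kernel_subspace:
  assumes "f \<in> hom_vs (vs_of scale Z) (vs_of s' UNIV)" "subspace Z" "vector_space s'"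
  shows "subspace {x \<in> Z. f x = 0}"
proof -
  obtain F where F: "Vector_Spaces.linear scale s' F" "\<forall>x\<in>Z. F x = f x" using hom_extension[OF assms] by blast
  have "{x \<in> Z. f x = 0} = Z \<inter> ker_set F" using F(2) by auto
  then show ?thesis using subspace_inter[OF assms(2) linear_kernel_subspace[OF F(1)]] by simp
qed

lemma tuples_vs_of: "set bs \<subseteq> Z \<Longrightarrow> bs \<in> tuples (length bs) (vs_of scale Z)"
  by (simp add: tuples_def vs_of_def)

lemma ext_map_vs_of:
  assumes "subspace Z" "presents s' Z' W' \<pi>' U" "f \<in> hom_vs (vs_of scale Z) U" "set bs \<subseteq> Z"
  shows "ext_map (length bs) U f (xw (length bs) (vs_of scale Z) c bs) = xw (length bs) U c (map f bs)"
  by (rule ext_map_xw[OF vs_of_presents[OF vector_space_axioms assms(1)] assms(2,3) tuples_vs_of[OF assms(4)]])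

lemma wedge_vs_of:
  assumes "subspace Z" "set us \<subseteq> Z" "set vs \<subseteq> Z"
  shows "wedge (vs_of scale Z) (length us) (length vs) (xw (length us) (vs_of scale Z) c us) (xw (length vs) (vs_of scale Z) c' vs)
    = xw (length us + length vs) (vs_of scale Z) (c * c') (us @ vs)"
  by (rule wedge_xw[OF vs_of_presents[OF vector_space_axioms assms(1)] tuples_vs_of[OF assms(2)] tuples_vs_of[OF assms(3)]])

lemma ball_nonzero_vs_of:
  assumes "subspace Z" "qbasis scale Z {0} bs"
  shows "(\<forall>\<omega>\<in>nonzero (det_line (vs_of scale Z)). Q \<omega>) \<longleftrightarrow> (\<forall>x. x \<noteq> 0 \<longrightarrow> Q (xw (length bs) (vs_of scale Z) x bs))"
  using det_line_facts(4)[OF vs_of_presents[OF vector_space_axioms assms(1)] assms(2)] by (auto simp: map_idI)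

lemma vdim_vs_of: "subspace Z \<Longrightarrow> qbasis scale Z {0} bs \<Longrightarrow> vdim (vs_of scale Z) = length bs"
  by (rule presents_vdim[OF vs_of_presents[OF vector_space_axioms]])

end

text \<open>The defining formulas quantify over the nonzero vectors of three lines. Their scalars
  will cancel, so the formula amounts to a single equation.\<close>

lemma all_nonzero_iff:
  fixes Q :: "'f::field \<Rightarrow> 'f \<Rightarrow> 'f \<Rightarrow> bool"
  assumes "\<And>x y z. x \<noteq> 0 \<Longrightarrow> y \<noteq> 0 \<Longrightarrow> z \<noteq> 0 \<Longrightarrow> Q x y z \<longleftrightarrow> R"
  shows "(\<forall>x. x \<noteq> 0 \<longrightarrow> (\<forall>y. y \<noteq> 0 \<longrightarrow> (\<forall>z. z \<noteq> 0 \<longrightarrow> Q x y z))) \<longleftrightarrow> R"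
proof
  assume "\<forall>x. x \<noteq> 0 \<longrightarrow> (\<forall>y. y \<noteq> 0 \<longrightarrow> (\<forall>z. z \<noteq> 0 \<longrightarrow> Q x y z))"
  then have "Q 1 1 1" using one_neq_zero[where ?'a = 'f] by blast
  then show R using assms[of 1 1 1] by simp
qed (use assms in blast)

lemma line_hom_iff:
  assumes V: "is_line V g" "g \<in> carrier V" and U: "is_line U h" and \<phi>: "\<phi> \<in> hom_vs V U" and a: "a \<noteq> 0"
  shows "\<phi> (a \<odot>\<^bsub>V\<^esub> g) = c \<odot>\<^bsub>U\<^esub> (a \<odot>\<^bsub>U\<^esub> h) \<longleftrightarrow> \<phi> g = c \<odot>\<^bsub>U\<^esub> h"
proof -
  have "\<phi> g \<in> carrier U" and s: "\<phi> (a \<odot>\<^bsub>V\<^esub> g) = a \<odot>\<^bsub>U\<^esub> \<phi> g"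
    using \<phi> V(2) by (auto simp: LinearCombinations.module_hom_def)
  then obtain p where p: "\<phi> g = p \<odot>\<^bsub>U\<^esub> h" unfolding lineD(1)[OF U] by blast
  show ?thesis unfolding s p lineD(2,4)[OF U] using a by simp
qed

lemma xi_carrier:
  assumes "cx_hat_data sp sm D D' ss cs"
  shows "1 \<odot>\<^bsub>cx_line sp sm D\<^esub> xi sp sm D D' ss cs = xi sp sm D D' ss cs" "xi sp sm D D' ss cs \<in> carrier (cx_line sp sm D)"
proof -
  show 1: "1 \<odot>\<^bsub>cx_line sp sm D\<^esub> xi sp sm D D' ss cs = xi sp sm D D' ss cs"
    using cx_tensor_hv(2)[OF assms, of 1 1] by (simp add: xi_def)
  show "xi sp sm D D' ss cs \<in> carrier (cx_line sp sm D)"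
    unfolding lineD(1)[OF cx_tensor_hv(1)[OF assms]] using 1 by (metis rangeI)
qed

lemma cx_folded_swap:
  assumes "cx_folded sp sm D D'"
  shows "fold_plus D D' = folded.rh (d_plus D) (pinv_minus D')" "fold_minus D D' = folded.sg (d_minus D) (pinv_plus D')"
proof -
  interpret A: folded sp sm "d_plus D" "d_minus D" "pinv_plus D'" "pinv_minus D'" by fact
  interpret B: folded sm sp "d_minus D" "d_plus D" "pinv_minus D'" "pinv_plus D'" by (rule A.swap)
  show "fold_plus D D' = B.rh" "fold_minus D D' = B.sg"
    by (simp_all add: fun_eq_iff fold_plus_def fold_minus_def B.sg_def B.rh_def)
qed

lemma cx_folded_linear:
  assumes "cx_folded sp sm D D'"
  shows "Vector_Spaces.linear sp sm (fold_plus D D')" "Vector_Spaces.linear sm sp (fold_minus D D')"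
  unfolding cx_foldedD(2,3)[OF assms] using folded.linear_sg[OF assms] folded.linear_rh[OF assms] by auto

lemma cx_to_H:
  assumes F: "cx_folded sp sm D D'"
  shows "qbasis sp (ker_set (fold_plus D D')) {0} ss \<Longrightarrow>
      ker_to_H sp (fold_plus D D') (range (d_minus D)) (H_plus sp D) (xw (length ss) (ker_vs sp (fold_plus D D')) c ss) = hv_plus sp D D' c ss"
    and "qbasis sp UNIV (range (fold_minus D D')) ss \<Longrightarrow>
      coker_to_H sp (fold_minus D D') (H_plus sp D) (xw (length ss) (coker_vs sp (fold_minus D D')) c (map (vcoset sp (range (fold_minus D D'))) ss)) = hv_plus sp D D' c ss"
    and "qbasis sm (ker_set (fold_minus D D')) {0} cs \<Longrightarrow>
      ker_to_H sm (fold_minus D D') (range (d_plus D)) (H_minus sm D) (xw (length cs) (ker_vs sm (fold_minus D D')) c cs) = hv_minus sm D D' c cs"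
    and "qbasis sm UNIV (range (fold_plus D D')) cs \<Longrightarrow>
      coker_to_H sm (fold_plus D D') (H_minus sm D) (xw (length cs) (coker_vs sm (fold_plus D D')) c (map (vcoset sm (range (fold_plus D D'))) cs)) = hv_minus sm D D' c cs"
proof -
  interpret A: folded sp sm "d_plus D" "d_minus D" "pinv_plus D'" "pinv_minus D'" by fact
  interpret B: folded sm sp "d_minus D" "d_plus D" "pinv_minus D'" "pinv_plus D'" by (rule A.swap)
  note d = cx_foldedD(2,3)[OF F] cx_folded_swap[OF F]
  show "ker_to_H sp (fold_plus D D') (range (d_minus D)) (H_plus sp D) (xw (length ss) (ker_vs sp (fold_plus D D')) c ss) = A.hv c ss"
    if "qbasis sp (ker_set (fold_plus D D')) {0} ss"
    using that unfolding d(1) H_plus_def by (rule A.ker_to_H_xw)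
  show "coker_to_H sp (fold_minus D D') (H_plus sp D) (xw (length ss) (coker_vs sp (fold_minus D D')) c (map (vcoset sp (range (fold_minus D D'))) ss)) = A.hv c ss"
    if "qbasis sp UNIV (range (fold_minus D D')) ss"
    using that unfolding d(2) H_plus_def by (rule A.coker_to_H_xw)
  show "ker_to_H sm (fold_minus D D') (range (d_plus D)) (H_minus sm D) (xw (length cs) (ker_vs sm (fold_minus D D')) c cs) = B.hv c cs"
    if "qbasis sm (ker_set (fold_minus D D')) {0} cs"
    using that unfolding d(4) H_minus_def by (rule B.ker_to_H_xw)
  show "coker_to_H sm (fold_plus D D') (H_minus sm D) (xw (length cs) (coker_vs sm (fold_plus D D')) c (map (vcoset sm (range (fold_plus D D'))) cs)) = B.hv c cs"
    if "qbasis sm UNIV (range (fold_plus D D')) cs"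
    using that unfolding d(3) H_minus_def by (rule B.coker_to_H_xw)
qed

lemma cx_hat_dataI:
  assumes F: "cx_folded sp sm D D'" and "qbasis sp UNIV (range (fold_minus D D')) ss" "qbasis sm UNIV (range (fold_plus D D')) cs"
  shows "cx_hat_data sp sm D D' ss cs"
  using F folded.swap[OF F] assms(2,3) unfolding cx_foldedD(3)[OF F] cx_folded_swap(1)[OF F]
  by (intro hat_data.intro hat_data_axioms.intro)

lemma cx_qbasis_ker_UNIV:
  assumes F: "cx_folded sp sm D D'"
  shows "qbasis sp (ker_set (fold_plus D D')) {0} ss \<Longrightarrow> qbasis sp UNIV (range (fold_minus D D')) ss"
    and "qbasis sm (ker_set (fold_minus D D')) {0} cs \<Longrightarrow> qbasis sm UNIV (range (fold_plus D D')) cs"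
proof -
  show "qbasis sp UNIV (range (fold_minus D D')) ss" if "qbasis sp (ker_set (fold_plus D D')) {0} ss"
    using that unfolding cx_foldedD(2,3)[OF F] by (rule folded.qbasis_ker_UNIV[OF F])
  show "qbasis sm UNIV (range (fold_plus D D')) cs" if "qbasis sm (ker_set (fold_minus D D')) {0} cs"
    using that unfolding cx_folded_swap[OF F] by (rule folded.qbasis_ker_UNIV[OF folded.swap[OF F]])
qed

lemma fredholm_bases:
  assumes f: "fredholm sp sm D" and F: "cx_folded sp sm D D'"
  shows "\<exists>ss. qbasis sp (ker_set (fold_plus D D')) {0} ss" "\<exists>cs. qbasis sm (ker_set (fold_minus D D')) {0} cs"
proof -
  interpret A: folded sp sm "d_plus D" "d_minus D" "pinv_plus D'" "pinv_minus D'" by fact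
  interpret B: folded sm sp "d_minus D" "d_plus D" "pinv_minus D'" "pinv_plus D'" by (rule A.swap)
  have fin: "vectorspace.fin_dim class_ring A.H" "vectorspace.fin_dim class_ring B.H"
    using f by (simp_all add: fredholm_def H_plus_def H_minus_def)
  obtain hs where "qbasis sp (ker_set (d_plus D)) (range (d_minus D)) hs"
    using presents_fin_dim[OF A.H_presents fin(1)] by (rule exE)
  from A.qbasis_ker[OF this] show "\<exists>ss. qbasis sp (ker_set (fold_plus D D')) {0} ss"
    unfolding cx_foldedD(2)[OF F] by (rule exI)
  obtain hs' where "qbasis sm (ker_set (d_minus D)) (range (d_plus D)) hs'"
    using presents_fin_dim[OF B.H_presents fin(2)] by (rule exE)
  from B.qbasis_ker[OF this] show "\<exists>cs. qbasis sm (ker_set (fold_minus D D')) {0} cs"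
    unfolding cx_folded_swap(2)[OF F] by (rule exI)
qed

lemma Ind_hat_data:
  assumes "cx_hat_data sp sm D D' ss cs"
  shows "Ind sp sm D = int (length ss) - int (length cs)"
proof -
  interpret hat_data sp sm "d_plus D" "d_minus D" "pinv_plus D'" "pinv_minus D'" ss cs by fact
  show ?thesis
    using presents_vdim[OF A.H_presents A.qbasis_H[OF qs]] presents_vdim[OF B.H_presents B.qbasis_H[OF qc]]
    by (simp add: Ind_def H_plus_def H_minus_def)
qed

text \<open>With scalars \<open>x\<close>, \<open>y\<close>, \<open>z\<close> for \<open>s\<close>,
  \<open>t1\<close>, \<open>t0\<close>, the source vector carries \<open>x / (x y)\<close> and the
  target vector \<open>z / (z y)\<close>, both equal to \<open>1 / y\<close>.\<close>

lemma formula_nonpos_iff: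
  assumes D: "cx_folded sp sm D D'" and E: "cx_folded sp sm \<Delta> \<Delta>'"
    and adm: "admissible sp sm (fold_plus D D') (fold_minus \<Delta> \<Delta>') L M N"
    and ss: "qbasis sp (ker_set (fold_plus D D')) {0} ss"
    and t0: "qbasis sm {y \<in> ker_set (fold_minus \<Delta> \<Delta>'). N y = 0} {0} t0"
    and t1: "qbasis sm {y \<in> ker_set (fold_minus \<Delta> \<Delta>'). M y = 0} {0} t1"
  shows "cx_hat_data sp sm D D' ss (map L ss @ map N t1)" "cx_hat_data sp sm \<Delta> \<Delta>' (map M t0) (t0 @ t1)"
    "\<phi> \<in> hom_vs (cx_line sp sm D) (cx_line sp sm \<Delta>) \<Longrightarrow> formula_nonpos sp sm \<Delta> D \<Delta>' D' L M N \<phi> \<longleftrightarrow>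
      \<phi> (xi sp sm D D' ss (map L ss @ map N t1)) =
        inverse (class_det sm (Sigma_op (fold_plus D D') (fold_minus D D') (fold_minus \<Delta> \<Delta>') (fold_plus \<Delta> \<Delta>') L M N))
          \<odot>\<^bsub>cx_line sp sm \<Delta>\<^esub> xi sp sm \<Delta> \<Delta>' (map M t0) (t0 @ t1)"
proof -
  define \<sigma> \<tau> where "\<sigma> = fold_plus D D'" and "\<tau> = fold_minus \<Delta> \<Delta>'"
  note folds = \<sigma>_def[symmetric] \<tau>_def[symmetric]
  note lD = cx_folded_linear[OF D, unfolded folds] and lE = cx_folded_linear[OF E, unfolded folds]
  interpret S: Vector_Spaces.linear sp sm \<sigma> by (rule lD)
  interpret T: Vector_Spaces.linear sm sp \<tau> by (rule lE)
  note q = admissible_bases[OF lD(1) lE(2) adm[unfolded folds] ss[unfolded folds] t0[unfolded folds] t1[unfolded folds]]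
  show hD: "cx_hat_data sp sm D D' ss (map L ss @ map N t1)"
    by (rule cx_hat_dataI[OF D cx_qbasis_ker_UNIV(1)[OF D ss] q(1)[unfolded \<sigma>_def]])
  show hE: "cx_hat_data sp sm \<Delta> \<Delta>' (map M t0) (t0 @ t1)"
    by (rule cx_hat_dataI[OF E q(2)[unfolded \<tau>_def] cx_qbasis_ker_UNIV(2)[OF E q(3)[unfolded \<tau>_def]]])
  have L: "L \<in> hom_vs (ker_vs sp \<sigma>) (vs_of sm UNIV)" and M: "M \<in> hom_vs (ker_vs sm \<tau>) (vs_of sp UNIV)"
    and N: "N \<in> hom_vs (ker_vs sm \<tau>) (vs_of sm UNIV)"
    using adm unfolding admissible_def Let_def folds by auto
  note vp = S.vs1.vector_space_axioms and vm = S.vs2.vector_space_axioms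
  note K\<sigma> = linear_kernel_subspace[OF lD(1)] and K\<tau> = linear_kernel_subspace[OF lE(2)]
    and R\<sigma> = linear_range_subspace[OF lD(1)] and R\<tau> = linear_range_subspace[OF lE(2)]
  note KM = S.vs2.hom_kernel_subspace[OF M K\<tau> vp] and KN = S.vs2.hom_kernel_subspace[OF N K\<tau> vm]
  have KM_le: "{y \<in> ker_set \<tau>. M y = 0} \<subseteq> ker_set \<tau>" and KN_le: "{y \<in> ker_set \<tau>. N y = 0} \<subseteq> ker_set \<tau>" by auto
  note ss' = ss[unfolded folds] and t0' = t0[unfolded folds] and t1' = t1[unfolded folds]
  note sub = S.vs1.qbasis_set[OF ss'] S.vs2.qbasis_set[OF t0'] S.vs2.qbasis_set[OF t1']
  note pXm = vs_of_presents[OF vm S.vs2.subspace_UNIV]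
    and pK\<tau> = vs_of_presents[OF vm K\<tau>]
    and pC\<sigma> = quot_presents[OF vm S.vs2.subspace_UNIV R\<sigma> subset_UNIV]
    and pC\<tau> = quot_presents[OF vp S.vs1.subspace_UNIV R\<tau> subset_UNIV]
  note dims = S.vs1.vdim_vs_of[OF K\<sigma> ss'] S.vs2.vdim_vs_of[OF KM t1'] S.vs2.vdim_vs_of[OF KN t0']
  \<comment> \<open>The equations \<open>1\<close>, \<open>2\<close> and \<open>3\<close> evaluate
    the vectors built from \<open>Ls_Nt1\<close>, \<open>Mt0\<close> and \<open>t0_t1\<close> as
    multiples of generators given by lists.\<close>
  have 1: "coker_to_H sm \<sigma> (H_minus sm D) (ext_map (length ss + length t1) (coker_vs sm \<sigma>) (vcoset sm (range \<sigma>))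
      (wedge (vs_of sm UNIV) (length ss) (length t1)
        (ext_map (length ss) (vs_of sm UNIV) L (xw (length ss) (ker_vs sp \<sigma>) x ss))
        (ext_map (length t1) (vs_of sm UNIV) N (xw (length t1) (vs_of sm {y \<in> ker_set \<tau>. M y = 0}) y t1))))
    = hv_minus sm D D' (x * y) (map L ss @ map N t1)" for x y
    unfolding S.vs1.ext_map_vs_of[OF K\<sigma> pXm L sub(1)] S.vs2.ext_map_vs_of[OF KM pXm hom_vs_restrict[OF N KM_le] sub(3)]
    using S.vs2.wedge_vs_of[OF S.vs2.subspace_UNIV subset_UNIV subset_UNIV, of "map L ss" "map N t1"]
      S.vs2.ext_map_vs_of[OF S.vs2.subspace_UNIV pC\<sigma> S.vs2.vcoset_hom[OF R\<sigma>] subset_UNIV, of "map L ss @ map N t1"]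
      cx_to_H(4)[OF D, unfolded folds, OF q(1), of "x * y"]
    by simp
  have 2: "coker_to_H sp \<tau> (H_plus sp \<Delta>) (ext_map (length t0) (coker_vs sp \<tau>) (\<lambda>y. vcoset sp (range \<tau>) (M y))
      (xw (length t0) (vs_of sm {y \<in> ker_set \<tau>. N y = 0}) z t0)) = hv_plus sp \<Delta> \<Delta>' z (map M t0)" for z
    unfolding S.vs2.ext_map_vs_of[OF KN pC\<tau> hom_vs_comp[OF hom_vs_restrict[OF M KN_le] S.vs1.vcoset_hom[OF R\<tau>]] sub(2), of z]
    using cx_to_H(2)[OF E, unfolded folds, OF q(2), of z]
    by (simp add: o_def)
  have 3: "ker_to_H sm \<tau> (range (d_plus \<Delta>)) (H_minus sm \<Delta>) (wedge (ker_vs sm \<tau>) (length t0) (length t1)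
      (ext_map (length t0) (ker_vs sm \<tau>) id (xw (length t0) (vs_of sm {y \<in> ker_set \<tau>. N y = 0}) z t0))
      (ext_map (length t1) (ker_vs sm \<tau>) id (xw (length t1) (vs_of sm {y \<in> ker_set \<tau>. M y = 0}) y t1)))
    = hv_minus sm \<Delta> \<Delta>' (z * y) (t0 @ t1)" for z y
    unfolding S.vs2.ext_map_vs_of[OF KN pK\<tau> hom_vs_id[OF KN_le] sub(2)] S.vs2.ext_map_vs_of[OF KM pK\<tau> hom_vs_id[OF KM_le] sub(3)]
    using S.vs2.wedge_vs_of[OF K\<tau> subset_trans[OF sub(2) KN_le] subset_trans[OF sub(3) KM_le]]
      cx_to_H(3)[OF E, unfolded folds, OF q(3), of "z * y"]
    by simp
  note X = cx_tensor_hv[OF hD] cx_tensor_hv[OF hE]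
  assume \<phi>: "\<phi> \<in> hom_vs (cx_line sp sm D) (cx_line sp sm \<Delta>)"
  define c where "c = inverse (class_det sm (Sigma_op \<sigma> (fold_minus D D') \<tau> (fold_plus \<Delta> \<Delta>') L M N))"
  have eq: "\<phi> (cx_tensor sp sm D (hv_plus sp D D' x ss) (hv_minus sm D D' (x * y) (map L ss @ map N t1)))
      = c \<odot>\<^bsub>cx_line sp sm \<Delta>\<^esub> cx_tensor sp sm \<Delta> (hv_plus sp \<Delta> \<Delta>' z (map M t0)) (hv_minus sm \<Delta> \<Delta>' (z * y) (t0 @ t1))
    \<longleftrightarrow> \<phi> (xi sp sm D D' ss (map L ss @ map N t1)) = c \<odot>\<^bsub>cx_line sp sm \<Delta>\<^esub> xi sp sm \<Delta> \<Delta>' (map M t0) (t0 @ t1)"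
    if "x \<noteq> 0" "y \<noteq> 0" "z \<noteq> 0" for x y z
  proof -
    have h: "x * y \<noteq> 0" "z * y \<noteq> 0" "inverse y \<noteq> 0" "x * inverse (x * y) = inverse y" "z * inverse (z * y) = inverse y"
      using that by simp_all
    show ?thesis unfolding X(2)[OF h(1)] X(4)[OF h(2)] h(4,5)
      by (rule line_hom_iff[OF X(1) xi_carrier(2)[OF hD] X(3) \<phi> h(3)])
  qed
  have "formula_nonpos sp sm \<Delta> D \<Delta>' D' L M N \<phi> \<longleftrightarrow> (\<forall>x. x \<noteq> 0 \<longrightarrow> (\<forall>y. y \<noteq> 0 \<longrightarrow> (\<forall>z. z \<noteq> 0 \<longrightarrow>
      \<phi> (cx_tensor sp sm D (hv_plus sp D D' x ss) (hv_minus sm D D' (x * y) (map L ss @ map N t1)))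
      = c \<odot>\<^bsub>cx_line sp sm \<Delta>\<^esub> cx_tensor sp sm \<Delta> (hv_plus sp \<Delta> \<Delta>' z (map M t0)) (hv_minus sm \<Delta> \<Delta>' (z * y) (t0 @ t1)))))"
    unfolding formula_nonpos_def Let_def folds dims S.vs1.ball_nonzero_vs_of[OF K\<sigma> ss'] S.vs2.ball_nonzero_vs_of[OF KM t1']
      S.vs2.ball_nonzero_vs_of[OF KN t0'] 1 2 3 cx_to_H(1)[OF D, unfolded folds, OF ss'] c_def[symmetric] ..
  also have "\<dots> \<longleftrightarrow> \<phi> (xi sp sm D D' ss (map L ss @ map N t1)) = c \<odot>\<^bsub>cx_line sp sm \<Delta>\<^esub> xi sp sm \<Delta> \<Delta>' (map M t0) (t0 @ t1)"
    by (rule all_nonzero_iff) (rule eq)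
  finally show "formula_nonpos sp sm \<Delta> D \<Delta>' D' L M N \<phi> \<longleftrightarrow>
      \<phi> (xi sp sm D D' ss (map L ss @ map N t1)) =
        inverse (class_det sm (Sigma_op (fold_plus D D') (fold_minus D D') (fold_minus \<Delta> \<Delta>') (fold_plus \<Delta> \<Delta>') L M N))
          \<odot>\<^bsub>cx_line sp sm \<Delta>\<^esub> xi sp sm \<Delta> \<Delta>' (map M t0) (t0 @ t1)"
    unfolding c_def folds .
qed

text \<open>With scalars \<open>x\<close>, \<open>y\<close>, \<open>z\<close> for \<open>s0\<close>,
  \<open>s1\<close>, \<open>t\<close>, the source vector carries \<open>(x y) / y\<close> and the
  target vector \<open>(x z) / z\<close>, both equal to \<open>x\<close>.\<close>

lemma formula_nonneg_iff:
  assumes D: "cx_folded sp sm D D'" and E: "cx_folded sp sm \<Delta> \<Delta>'"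
    and adm: "admissible sm sp (fold_minus \<Delta> \<Delta>') (fold_plus D D') M L N"
    and t: "qbasis sm (ker_set (fold_minus \<Delta> \<Delta>')) {0} t"
    and s0: "qbasis sp {x \<in> ker_set (fold_plus D D'). L x = 0} {0} s0"
    and s1: "qbasis sp {x \<in> ker_set (fold_plus D D'). N x = 0} {0} s1"
  shows "cx_hat_data sp sm D D' (s0 @ s1) (map L s1)" "cx_hat_data sp sm \<Delta> \<Delta>' (map N s0 @ map M t) t"
    "\<phi> \<in> hom_vs (cx_line sp sm D) (cx_line sp sm \<Delta>) \<Longrightarrow> formula_nonneg sp sm \<Delta> D \<Delta>' D' L M N \<phi> \<longleftrightarrow>
      \<phi> (xi sp sm D D' (s0 @ s1) (map L s1)) =
        inverse (class_det sp (Sigma_op (fold_minus \<Delta> \<Delta>') (fold_plus \<Delta> \<Delta>') (fold_plus D D') (fold_minus D D') M L N))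
          \<odot>\<^bsub>cx_line sp sm \<Delta>\<^esub> xi sp sm \<Delta> \<Delta>' (map N s0 @ map M t) t"
proof -
  define \<sigma> \<tau> where "\<sigma> = fold_plus D D'" and "\<tau> = fold_minus \<Delta> \<Delta>'"
  note folds = \<sigma>_def[symmetric] \<tau>_def[symmetric]
  note lD = cx_folded_linear[OF D, unfolded folds] and lE = cx_folded_linear[OF E, unfolded folds]
  interpret S: Vector_Spaces.linear sp sm \<sigma> by (rule lD)
  interpret T: Vector_Spaces.linear sm sp \<tau> by (rule lE)
  \<comment> \<open>The operators \<tau> and \<sigma> exchange roles here, and with them
    \<open>s1\<close> and \<open>s0\<close>.\<close>
  note q0 = admissible_bases[OF lE(2) lD(1) adm[unfolded folds] t[unfolded folds] s1[unfolded folds] s0[unfolded folds]]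
  note q = S.vs1.qbasis_append_swap[OF q0(1)] q0(2) S.vs1.qbasis_append_swap[OF q0(3)]
  show hD: "cx_hat_data sp sm D D' (s0 @ s1) (map L s1)"
    by (rule cx_hat_dataI[OF D cx_qbasis_ker_UNIV(1)[OF D q(3)[unfolded \<sigma>_def]] q(2)[unfolded \<sigma>_def]])
  show hE: "cx_hat_data sp sm \<Delta> \<Delta>' (map N s0 @ map M t) t"
    by (rule cx_hat_dataI[OF E q(1)[unfolded \<tau>_def] cx_qbasis_ker_UNIV(2)[OF E t]])
  have L: "L \<in> hom_vs (ker_vs sp \<sigma>) (vs_of sm UNIV)" and M: "M \<in> hom_vs (ker_vs sm \<tau>) (vs_of sp UNIV)"
    and N: "N \<in> hom_vs (ker_vs sp \<sigma>) (vs_of sp UNIV)"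
    using adm unfolding admissible_def Let_def folds by auto
  note vp = S.vs1.vector_space_axioms and vm = S.vs2.vector_space_axioms
  note K\<sigma> = linear_kernel_subspace[OF lD(1)] and K\<tau> = linear_kernel_subspace[OF lE(2)]
    and R\<sigma> = linear_range_subspace[OF lD(1)] and R\<tau> = linear_range_subspace[OF lE(2)]
  note KL = S.vs1.hom_kernel_subspace[OF L K\<sigma> vm] and KN = S.vs1.hom_kernel_subspace[OF N K\<sigma> vp]
  have KL_le: "{x \<in> ker_set \<sigma>. L x = 0} \<subseteq> ker_set \<sigma>" and KN_le: "{x \<in> ker_set \<sigma>. N x = 0} \<subseteq> ker_set \<sigma>" by auto
  note t' = t[unfolded folds] and s0' = s0[unfolded folds] and s1' = s1[unfolded folds]
  note sub = S.vs2.qbasis_set[OF t'] S.vs1.qbasis_set[OF s0'] S.vs1.qbasis_set[OF s1']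
  note pXp = vs_of_presents[OF vp S.vs1.subspace_UNIV]
    and pK\<sigma> = vs_of_presents[OF vp K\<sigma>]
    and pC\<sigma> = quot_presents[OF vm S.vs2.subspace_UNIV R\<sigma> subset_UNIV]
    and pC\<tau> = quot_presents[OF vp S.vs1.subspace_UNIV R\<tau> subset_UNIV]
  note dims = S.vs2.vdim_vs_of[OF K\<tau> t'] S.vs1.vdim_vs_of[OF KL s0'] S.vs1.vdim_vs_of[OF KN s1']
  have 1: "coker_to_H sp \<tau> (H_plus sp \<Delta>) (ext_map (length s0 + length t) (coker_vs sp \<tau>) (vcoset sp (range \<tau>))
      (wedge (vs_of sp UNIV) (length s0) (length t)
        (ext_map (length s0) (vs_of sp UNIV) N (xw (length s0) (vs_of sp {x \<in> ker_set \<sigma>. L x = 0}) x s0))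
        (ext_map (length t) (vs_of sp UNIV) M (xw (length t) (ker_vs sm \<tau>) z t))))
    = hv_plus sp \<Delta> \<Delta>' (x * z) (map N s0 @ map M t)" for x z
    unfolding S.vs2.ext_map_vs_of[OF K\<tau> pXp M sub(1)] S.vs1.ext_map_vs_of[OF KL pXp hom_vs_restrict[OF N KL_le] sub(2)]
    using S.vs1.wedge_vs_of[OF S.vs1.subspace_UNIV subset_UNIV subset_UNIV, of "map N s0" "map M t"]
      S.vs1.ext_map_vs_of[OF S.vs1.subspace_UNIV pC\<tau> S.vs1.vcoset_hom[OF R\<tau>] subset_UNIV, of "map N s0 @ map M t"]
      cx_to_H(2)[OF E, unfolded folds, OF q(1), of "x * z"]
    by simp
  have 2: "coker_to_H sm \<sigma> (H_minus sm D) (ext_map (length s1) (coker_vs sm \<sigma>) (\<lambda>x. vcoset sm (range \<sigma>) (L x))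
      (xw (length s1) (vs_of sp {x \<in> ker_set \<sigma>. N x = 0}) y s1)) = hv_minus sm D D' y (map L s1)" for y
    unfolding S.vs1.ext_map_vs_of[OF KN pC\<sigma> hom_vs_comp[OF hom_vs_restrict[OF L KN_le] S.vs2.vcoset_hom[OF R\<sigma>]] sub(3), of y]
    using cx_to_H(4)[OF D, unfolded folds, OF q(2), of y]
    by (simp add: o_def)
  have 3: "ker_to_H sp \<sigma> (range (d_minus D)) (H_plus sp D) (wedge (ker_vs sp \<sigma>) (length s0) (length s1)
      (ext_map (length s0) (ker_vs sp \<sigma>) id (xw (length s0) (vs_of sp {x \<in> ker_set \<sigma>. L x = 0}) x s0))
      (ext_map (length s1) (ker_vs sp \<sigma>) id (xw (length s1) (vs_of sp {x \<in> ker_set \<sigma>. N x = 0}) y s1)))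
    = hv_plus sp D D' (x * y) (s0 @ s1)" for x y
    unfolding S.vs1.ext_map_vs_of[OF KL pK\<sigma> hom_vs_id[OF KL_le] sub(2)] S.vs1.ext_map_vs_of[OF KN pK\<sigma> hom_vs_id[OF KN_le] sub(3)]
    using S.vs1.wedge_vs_of[OF K\<sigma> subset_trans[OF sub(2) KL_le] subset_trans[OF sub(3) KN_le]]
      cx_to_H(1)[OF D, unfolded folds, OF q(3), of "x * y"]
    by simp
  note X = cx_tensor_hv[OF hD] cx_tensor_hv[OF hE]
  assume \<phi>: "\<phi> \<in> hom_vs (cx_line sp sm D) (cx_line sp sm \<Delta>)"
  define c where "c = inverse (class_det sp (Sigma_op \<tau> (fold_plus \<Delta> \<Delta>') \<sigma> (fold_minus D D') M L N))"
  have eq: "\<phi> (cx_tensor sp sm D (hv_plus sp D D' (x * y) (s0 @ s1)) (hv_minus sm D D' y (map L s1)))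
      = c \<odot>\<^bsub>cx_line sp sm \<Delta>\<^esub> cx_tensor sp sm \<Delta> (hv_plus sp \<Delta> \<Delta>' (x * z) (map N s0 @ map M t)) (hv_minus sm \<Delta> \<Delta>' z t)
    \<longleftrightarrow> \<phi> (xi sp sm D D' (s0 @ s1) (map L s1)) = c \<odot>\<^bsub>cx_line sp sm \<Delta>\<^esub> xi sp sm \<Delta> \<Delta>' (map N s0 @ map M t) t"
    if "x \<noteq> 0" "y \<noteq> 0" "z \<noteq> 0" for x y z
  proof -
    have h: "x * y * inverse y = x" "x * z * inverse z = x" using that by simp_all
    show ?thesis unfolding X(2)[OF that(2)] X(4)[OF that(3)] h
      by (rule line_hom_iff[OF X(1) xi_carrier(2)[OF hD] X(3) \<phi> that(1)])
  qed
  have "formula_nonneg sp sm \<Delta> D \<Delta>' D' L M N \<phi> \<longleftrightarrow> (\<forall>x. x \<noteq> 0 \<longrightarrow> (\<forall>y. y \<noteq> 0 \<longrightarrow> (\<forall>z. z \<noteq> 0 \<longrightarrow>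
      \<phi> (cx_tensor sp sm D (hv_plus sp D D' (x * y) (s0 @ s1)) (hv_minus sm D D' y (map L s1)))
      = c \<odot>\<^bsub>cx_line sp sm \<Delta>\<^esub> cx_tensor sp sm \<Delta> (hv_plus sp \<Delta> \<Delta>' (x * z) (map N s0 @ map M t)) (hv_minus sm \<Delta> \<Delta>' z t))))"
    unfolding formula_nonneg_def Let_def folds dims S.vs2.ball_nonzero_vs_of[OF K\<tau> t'] S.vs1.ball_nonzero_vs_of[OF KL s0']
      S.vs1.ball_nonzero_vs_of[OF KN s1'] 1 2 3 cx_to_H(3)[OF E, unfolded folds, OF t'] c_def[symmetric] ..
  also have "\<dots> \<longleftrightarrow> \<phi> (xi sp sm D D' (s0 @ s1) (map L s1)) = c \<odot>\<^bsub>cx_line sp sm \<Delta>\<^esub> xi sp sm \<Delta> \<Delta>' (map N s0 @ map M t) t"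
    by (rule all_nonzero_iff) (rule eq)
  finally show "formula_nonneg sp sm \<Delta> D \<Delta>' D' L M N \<phi> \<longleftrightarrow>
      \<phi> (xi sp sm D D' (s0 @ s1) (map L s1)) =
        inverse (class_det sp (Sigma_op (fold_minus \<Delta> \<Delta>') (fold_plus \<Delta> \<Delta>') (fold_plus D D') (fold_minus D D') M L N))
          \<odot>\<^bsub>cx_line sp sm \<Delta>\<^esub> xi sp sm \<Delta> \<Delta>' (map N s0 @ map M t) t"
    unfolding c_def folds .
qed

section \<open>Perturbation maps\<close>

abbreviation cx_kappa where
  "cx_kappa sp sm D D' ss cs \<Delta> \<Delta>' st ct \<equiv> kappa (pscale sp) (cx_hat sp sm D D' ss cs) (cx_hat sp sm \<Delta> \<Delta>' st ct)"

abbreviation cx_close :: "('f::field \<Rightarrow> 'a::ab_group_add \<Rightarrow> 'a) \<Rightarrow> ('f \<Rightarrow> 'b::ab_group_add \<Rightarrow> 'b) \<Rightarrow>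
    ('a, 'b) z2_complex \<Rightarrow> ('a, 'b) z2_complex \<Rightarrow> bool" where
  "cx_close sp sm D \<Delta> \<equiv> finite_rank sm (\<lambda>x. d_plus D x - d_plus \<Delta> x) \<and> finite_rank sp (\<lambda>y. d_minus D y - d_minus \<Delta> y)"

abbreviation pinv_close :: "('f::field \<Rightarrow> 'a::ab_group_add \<Rightarrow> 'a) \<Rightarrow> ('f \<Rightarrow> 'b::ab_group_add \<Rightarrow> 'b) \<Rightarrow>
    ('a, 'b) z2_pinv \<Rightarrow> ('a, 'b) z2_pinv \<Rightarrow> bool" where
  "pinv_close sp sm D' \<Delta>' \<equiv> finite_rank sp (\<lambda>y. pinv_plus D' y - pinv_plus \<Delta>' y) \<and> finite_rank sm (\<lambda>x. pinv_minus D' x - pinv_minus \<Delta>' x)"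

lemma (in vector_space) qbasis_subspace:
  assumes q: "qbasis scale Z {0} bs" and U: "subspace U" "U \<subseteq> Z"
  shows "\<exists>us. qbasis scale U {0} us"
proof (rule qbasis_exists_span[OF U(1)])
  show "U \<subseteq> span (set bs)"
  proof
    fix x assume "x \<in> U"
    then have "x - lcomb scale bs (qcoord scale {0} bs x) \<in> {0}" using qcoord_rest(1)[OF q] U(2) by blast
    then have "x = lcomb scale bs (qcoord scale {0} bs x)" by simp
    then show "x \<in> span (set bs)" using lcomb_span by metis
  qed
qed simp

lemma cx_hats:
  assumes hD: "cx_hat_data sp sm D D' ss cs" and hE: "cx_hat_data sp sm \<Delta> \<Delta>' st ct"
    and cl: "cx_close sp sm D \<Delta>" "pinv_close sp sm D' \<Delta>'"
  shows "bijlin (pscale sp) (pscale sm) (cx_hat sp sm D D' ss cs)" "bijlin (pscale sp) (pscale sm) (cx_hat sp sm \<Delta> \<Delta>' st ct)"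
    "finite_rank (pscale sm) (\<lambda>z. cx_hat sp sm D D' ss cs z - cx_hat sp sm \<Delta> \<Delta>' st ct z)"
    "finite_rank sm (\<lambda>x. folded.sg (d_plus D) (pinv_minus D') x - folded.sg (d_plus \<Delta>) (pinv_minus \<Delta>') x)"
    "length ss + length ct = length st + length cs"
    "cx_kappa sp sm D D' ss cs \<Delta> \<Delta>' st ct * cx_kappa sp sm \<Delta> \<Delta>' st ct D D' ss cs = 1"
proof -
  interpret D: hat_data sp sm "d_plus D" "d_minus D" "pinv_plus D'" "pinv_minus D'" ss cs by fact
  interpret E: hat_data sp sm "d_plus \<Delta>" "d_minus \<Delta>" "pinv_plus \<Delta>'" "pinv_minus \<Delta>'" st ct by fact
  show 1: "bijlin (pscale sp) (pscale sm) D.T" by (rule D.bijlin_T)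
  show 2: "bijlin (pscale sp) (pscale sm) E.T" by (rule E.bijlin_T)
  show 3: "finite_rank sm (\<lambda>x. D.A.sg x - E.A.sg x)"
    using folded_diff(1)[OF D.A.folded_axioms E.A.folded_axioms] cl by blast
  show 4: "finite_rank (pscale sm) (\<lambda>z. D.T z - E.T z)" by (rule finite_rank_hats_diff[OF hD hE 3])
  show "length ss + length ct = length st + length cs" by (rule index_eq[OF hD hE 3])
  show "kappa (pscale sp) D.T E.T * kappa (pscale sp) E.T D.T = 1" by (rule kappa_swap[OF 1 2 4])
qed

text \<open>
  The condition on \<open>\<phi>\<close> is independent of the pseudo-inverses and bases, because the generators \<open>xi\<close> and the numbers
  \<open>cx_kappa\<close> change by the same base change determinants.
\<close>

lemma xi_kappa_invariant:
  assumes hD1: "cx_hat_data sp sm D D1 s1 c1" and hD2: "cx_hat_data sp sm D D2 s2 c2"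
    and hE1: "cx_hat_data sp sm \<Delta> \<Delta>1 t1 u1" and hE2: "cx_hat_data sp sm \<Delta> \<Delta>2 t2 u2"
    and cl: "cx_close sp sm D \<Delta>" "pinv_close sp sm D1 \<Delta>1" "pinv_close sp sm D2 \<Delta>2"
    and \<phi>: "\<phi> \<in> hom_vs (cx_line sp sm D) (cx_line sp sm \<Delta>)"
  shows "\<phi> (xi sp sm D D2 s2 c2) = cx_kappa sp sm D D2 s2 c2 \<Delta> \<Delta>2 t2 u2 \<odot>\<^bsub>cx_line sp sm \<Delta>\<^esub> xi sp sm \<Delta> \<Delta>2 t2 u2 \<longleftrightarrow>
    \<phi> (xi sp sm D D1 s1 c1) = cx_kappa sp sm D D1 s1 c1 \<Delta> \<Delta>1 t1 u1 \<odot>\<^bsub>cx_line sp sm \<Delta>\<^esub> xi sp sm \<Delta> \<Delta>1 t1 u1"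
proof -
  note changeD = xi_change[OF hD1 hD2] and changeE = xi_change[OF hE1 hE2]
  from changeD obtain C C' where C: "C \<in> carrier_mat (length s1) (length s1)"
    "\<And>j. j < length s1 \<Longrightarrow> folded.P (d_plus D) (d_minus D) (pinv_plus D2) (pinv_minus D2) (s2 ! j)
       - lcomb sp (map (folded.P (d_plus D) (d_minus D) (pinv_plus D1) (pinv_minus D1)) s1) (\<lambda>i. C $$ (i, j)) \<in> range (d_minus D)"
    "C' \<in> carrier_mat (length c1) (length c1)"
    "\<And>j. j < length c1 \<Longrightarrow> folded.P (d_minus D) (d_plus D) (pinv_minus D2) (pinv_plus D2) (c2 ! j)
       - lcomb sm (map (folded.P (d_minus D) (d_plus D) (pinv_minus D1) (pinv_plus D1)) c1) (\<lambda>i. C' $$ (i, j)) \<in> range (d_plus D)"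
    "det C \<noteq> 0" "det C' \<noteq> 0"
    "xi sp sm D D2 s2 c2 = (det C * inverse (det C')) \<odot>\<^bsub>cx_line sp sm D\<^esub> xi sp sm D D1 s1 c1"
    by (elim exE conjE) metis
  from changeE obtain G G' where G: "G \<in> carrier_mat (length t1) (length t1)"
    "\<And>j. j < length t1 \<Longrightarrow> folded.P (d_plus \<Delta>) (d_minus \<Delta>) (pinv_plus \<Delta>2) (pinv_minus \<Delta>2) (t2 ! j)
       - lcomb sp (map (folded.P (d_plus \<Delta>) (d_minus \<Delta>) (pinv_plus \<Delta>1) (pinv_minus \<Delta>1)) t1) (\<lambda>i. G $$ (i, j)) \<in> range (d_minus \<Delta>)"
    "G' \<in> carrier_mat (length u1) (length u1)"
    "\<And>j. j < length u1 \<Longrightarrow> folded.P (d_minus \<Delta>) (d_plus \<Delta>) (pinv_minus \<Delta>2) (pinv_plus \<Delta>2) (u2 ! j)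
       - lcomb sm (map (folded.P (d_minus \<Delta>) (d_plus \<Delta>) (pinv_minus \<Delta>1) (pinv_plus \<Delta>1)) u1) (\<lambda>i. G' $$ (i, j)) \<in> range (d_plus \<Delta>)"
    "det G \<noteq> 0" "det G' \<noteq> 0"
    "xi sp sm \<Delta> \<Delta>2 t2 u2 = (det G * inverse (det G')) \<odot>\<^bsub>cx_line sp sm \<Delta>\<^esub> xi sp sm \<Delta> \<Delta>1 t1 u1"
    by (elim exE conjE) metis
  let ?a = "det C * inverse (det C')" and ?b = "det G * inverse (det G')"
  define k1 k2 where "k1 = cx_kappa sp sm D D1 s1 c1 \<Delta> \<Delta>1 t1 u1" and "k2 = cx_kappa sp sm D D2 s2 c2 \<Delta> \<Delta>2 t2 u2"
  have "k2 * (det G * det C') = k1 * (det C * det G')"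
    unfolding k1_def k2_def
    by (rule kappa_hats[OF hD1 hD2 hE1 hE2 conjunct1[OF cl(1)] conjunct2[OF cl(1)] conjunct1[OF cl(2)] conjunct2[OF cl(2)]
        conjunct1[OF cl(3)] conjunct2[OF cl(3)] C(1) C(2) G(1) G(2) C(3) C(4) G(3) G(4)])
  \<comment> \<open>\<open>kappa_hats\<close> divided by both minus side determinants: exactly the
    scalars by which the two generators change.\<close>
  then have k: "k2 * ?b = k1 * ?a" using C(6) G(6) by (simp add: field_simps)
  note L = cx_tensor_hv(1)[OF hE1]
  have "?a \<noteq> 0" using C(5,6) by simp
  note line_hom_iff[OF cx_tensor_hv(1)[OF hD1] xi_carrier(2)[OF hD1] L \<phi> this, of k1]
  then show ?thesis unfolding k1_def[symmetric] k2_def[symmetric] C(7) G(7) lineD(4)[OF L] k .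
qed

lemma perturbation_dataD:
  assumes "perturbation_data sp sm \<Delta> D \<Delta>' D'" "fredholm sp sm D" "fredholm sp sm \<Delta>"
  shows "cx_folded sp sm D D'" "cx_folded sp sm \<Delta> \<Delta>'" "pinv_close sp sm D' \<Delta>'"
  using assms by (auto simp: perturbation_data_def fredholm_def intro: cx_foldedI)

text \<open>The reference data may be unrelated to the pseudo-inverses and maps in the formula.
  Every choice thus leads to the same equation for \<phi>, which is the independence of all
  choices.\<close>

lemma formula_nonpos_reference:
  assumes hD: "cx_hat_data sp sm D D1 s1 c1" and hE: "cx_hat_data sp sm \<Delta> \<Delta>1 t1 u1"
    and cl: "cx_close sp sm D \<Delta>" "pinv_close sp sm D1 \<Delta>1"
    and \<phi>: "\<phi> \<in> hom_vs (cx_line sp sm D) (cx_line sp sm \<Delta>)"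
    and fred: "fredholm sp sm D" "fredholm sp sm \<Delta>" and pd: "perturbation_data sp sm \<Delta> D \<Delta>' D'"
    and adm: "admissible sp sm (fold_plus D D') (fold_minus \<Delta> \<Delta>') L M N"
  shows "formula_nonpos sp sm \<Delta> D \<Delta>' D' L M N \<phi> \<longleftrightarrow>
    \<phi> (xi sp sm D D1 s1 c1) = cx_kappa sp sm D D1 s1 c1 \<Delta> \<Delta>1 t1 u1 \<odot>\<^bsub>cx_line sp sm \<Delta>\<^esub> xi sp sm \<Delta> \<Delta>1 t1 u1"
proof -
  note F = perturbation_dataD[OF pd fred]
  let ?\<tau> = "fold_minus \<Delta> \<Delta>'"
  note lin = cx_folded_linear(1)[OF F(1)] cx_folded_linear(2)[OF F(2)]
  interpret S: Vector_Spaces.linear sp sm "fold_plus D D'" by (rule lin)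
  have L: "L \<in> hom_vs (ker_vs sp (fold_plus D D')) (vs_of sm UNIV)" and M: "M \<in> hom_vs (ker_vs sm ?\<tau>) (vs_of sp UNIV)"
    and N: "N \<in> hom_vs (ker_vs sm ?\<tau>) (vs_of sm UNIV)"
    using adm unfolding admissible_def Let_def by auto
  note K = linear_kernel_subspace[OF lin(2)]
  obtain ss where ss: "qbasis sp (ker_set (fold_plus D D')) {0} ss" using fredholm_bases(1)[OF fred(1) F(1)] by (rule exE)
  obtain ct where ct: "qbasis sm (ker_set ?\<tau>) {0} ct" using fredholm_bases(2)[OF fred(2) F(2)] by (rule exE)
  have "\<exists>t0. qbasis sm {y \<in> ker_set ?\<tau>. N y = 0} {0} t0"
    by (rule S.vs2.qbasis_subspace[OF ct S.vs2.hom_kernel_subspace[OF N K S.vs2.vector_space_axioms]]) auto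
  then obtain t0 where t0: "qbasis sm {y \<in> ker_set ?\<tau>. N y = 0} {0} t0" by (rule exE)
  have "\<exists>t1. qbasis sm {y \<in> ker_set ?\<tau>. M y = 0} {0} t1"
    by (rule S.vs2.qbasis_subspace[OF ct S.vs2.hom_kernel_subspace[OF M K S.vs1.vector_space_axioms]]) auto
  then obtain t where t: "qbasis sm {y \<in> ker_set ?\<tau>. M y = 0} {0} t" by (rule exE)
  note I = formula_nonpos_iff[OF F(1,2) adm ss t0 t]
  note H = cx_hats[OF I(1,2) cl(1) F(3)]
  note d = cx_foldedD(2,3)[OF F(1)] cx_foldedD(2,3)[OF F(2)]
  have "class_det sm (Sigma_op (fold_plus D D') (fold_minus D D') ?\<tau> (fold_plus \<Delta> \<Delta>') L M N)
      = cx_kappa sp sm \<Delta> \<Delta>' (map M t0) (t0 @ t) D D' ss (map L ss @ map N t)"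
    using L M N S.vs1.qbasis_set[OF ss] S.vs2.qbasis_set[OF t0] S.vs2.qbasis_set[OF t]
    unfolding d by (rule Sigma_nonpos[OF I(1,2) H(4)])
  \<comment> \<open>The determinant of \<Sigma> compares \<Delta> with \<open>D\<close>; its inverse
    compares \<open>D\<close> with \<Delta> by \<open>kappa_swap\<close>, and this accounts for the
    inverse determinant in the definition.\<close>
  then have "inverse (class_det sm (Sigma_op (fold_plus D D') (fold_minus D D') ?\<tau> (fold_plus \<Delta> \<Delta>') L M N))
      = cx_kappa sp sm D D' ss (map L ss @ map N t) \<Delta> \<Delta>' (map M t0) (t0 @ t)"
    using inverse_unique[of "cx_kappa sp sm \<Delta> \<Delta>' (map M t0) (t0 @ t) D D' ss (map L ss @ map N t)"] H(6)
    by (simp add: mult.commute)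
  then show ?thesis
    unfolding I(3)[OF \<phi>] xi_kappa_invariant[OF hD I(1) hE I(2) cl F(3) \<phi>, symmetric] by (simp only:)
qed

text \<open>The same reference equation as for nonpositive index, which shows in particular that the
  two constructions agree for index zero.\<close>

lemma formula_nonneg_reference:
  assumes hD: "cx_hat_data sp sm D D1 s1 c1" and hE: "cx_hat_data sp sm \<Delta> \<Delta>1 t1 u1"
    and cl: "cx_close sp sm D \<Delta>" "pinv_close sp sm D1 \<Delta>1"
    and \<phi>: "\<phi> \<in> hom_vs (cx_line sp sm D) (cx_line sp sm \<Delta>)"
    and fred: "fredholm sp sm D" "fredholm sp sm \<Delta>" and pd: "perturbation_data sp sm \<Delta> D \<Delta>' D'"
    and adm: "admissible sm sp (fold_minus \<Delta> \<Delta>') (fold_plus D D') M L N"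
  shows "formula_nonneg sp sm \<Delta> D \<Delta>' D' L M N \<phi> \<longleftrightarrow>
    \<phi> (xi sp sm D D1 s1 c1) = cx_kappa sp sm D D1 s1 c1 \<Delta> \<Delta>1 t1 u1 \<odot>\<^bsub>cx_line sp sm \<Delta>\<^esub> xi sp sm \<Delta> \<Delta>1 t1 u1"
proof -
  note F = perturbation_dataD[OF pd fred]
  let ?\<sigma> = "fold_plus D D'"
  note lin = cx_folded_linear(1)[OF F(1)] cx_folded_linear(2)[OF F(2)]
  interpret S: Vector_Spaces.linear sp sm ?\<sigma> by (rule lin)
  have L: "L \<in> hom_vs (ker_vs sp ?\<sigma>) (vs_of sm UNIV)" and M: "M \<in> hom_vs (ker_vs sm (fold_minus \<Delta> \<Delta>')) (vs_of sp UNIV)"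
    and N: "N \<in> hom_vs (ker_vs sp ?\<sigma>) (vs_of sp UNIV)"
    using adm unfolding admissible_def Let_def by auto
  note K = linear_kernel_subspace[OF lin(1)]
  obtain ss where ss: "qbasis sp (ker_set ?\<sigma>) {0} ss" using fredholm_bases(1)[OF fred(1) F(1)] by (rule exE)
  obtain t where t: "qbasis sm (ker_set (fold_minus \<Delta> \<Delta>')) {0} t" using fredholm_bases(2)[OF fred(2) F(2)] by (rule exE)
  have "\<exists>s0. qbasis sp {x \<in> ker_set ?\<sigma>. L x = 0} {0} s0"
    by (rule S.vs1.qbasis_subspace[OF ss S.vs1.hom_kernel_subspace[OF L K S.vs2.vector_space_axioms]]) auto
  then obtain s0 where s0: "qbasis sp {x \<in> ker_set ?\<sigma>. L x = 0} {0} s0" by (rule exE)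
  have "\<exists>s1. qbasis sp {x \<in> ker_set ?\<sigma>. N x = 0} {0} s1"
    by (rule S.vs1.qbasis_subspace[OF ss S.vs1.hom_kernel_subspace[OF N K S.vs1.vector_space_axioms]]) auto
  then obtain s where s: "qbasis sp {x \<in> ker_set ?\<sigma>. N x = 0} {0} s" by (rule exE)
  note I = formula_nonneg_iff[OF F(1,2) adm t s0 s]
  note H = cx_hats[OF I(1,2) cl(1) F(3)]
  note d = cx_foldedD(2,3)[OF F(1)] cx_foldedD(2,3)[OF F(2)]
  have "class_det sp (Sigma_op (fold_minus \<Delta> \<Delta>') (fold_plus \<Delta> \<Delta>') ?\<sigma> (fold_minus D D') M L N)
      = cx_kappa sp sm \<Delta> \<Delta>' (map N s0 @ map M t) t D D' (s0 @ s) (map L s)"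
    using L M N S.vs2.qbasis_set[OF t] S.vs1.qbasis_set[OF s0] S.vs1.qbasis_set[OF s]
    unfolding d by (rule Sigma_nonneg[OF I(1,2) H(4)])
  then have "inverse (class_det sp (Sigma_op (fold_minus \<Delta> \<Delta>') (fold_plus \<Delta> \<Delta>') ?\<sigma> (fold_minus D D') M L N))
      = cx_kappa sp sm D D' (s0 @ s) (map L s) \<Delta> \<Delta>' (map N s0 @ map M t) t"
    using inverse_unique[of "cx_kappa sp sm \<Delta> \<Delta>' (map N s0 @ map M t) t D D' (s0 @ s) (map L s)"] H(6)
    by (simp add: mult.commute)
  then show ?thesis
    unfolding I(3)[OF \<phi>] xi_kappa_invariant[OF hD I(1) hE I(2) cl F(3) \<phi>, symmetric] by (simp only:)
qed

text \<open>Any choices force the reference equation. Conversely, the reference pseudo-inverses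
  admit some \<open>L\<close>, \<open>M\<close>, \<open>N\<close> in the case given by the sign of
  the index, and the formula for them follows from the equation.\<close>

lemma is_perturbation_map_iff:
  assumes hD: "cx_hat_data sp sm D D1 s1 c1" and hE: "cx_hat_data sp sm \<Delta> \<Delta>1 t1 u1"
    and cl: "cx_close sp sm D \<Delta>" "pinv_close sp sm D1 \<Delta>1"
    and fred: "fredholm sp sm D" "fredholm sp sm \<Delta>"
  shows "is_perturbation_map sp sm \<Delta> D \<phi> \<longleftrightarrow>
    \<phi> \<in> hom_vs (cx_line sp sm D) (cx_line sp sm \<Delta>) \<and> \<phi> \<in> extensional (carrier (cx_line sp sm D)) \<and>
    \<phi> (xi sp sm D D1 s1 c1) = cx_kappa sp sm D D1 s1 c1 \<Delta> \<Delta>1 t1 u1 \<odot>\<^bsub>cx_line sp sm \<Delta>\<^esub> xi sp sm \<Delta> \<Delta>1 t1 u1"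
    (is "_ \<longleftrightarrow> ?hom \<and> ?ext \<and> ?eq")
proof
  assume p: "is_perturbation_map sp sm \<Delta> D \<phi>"
  then have h: ?hom ?ext by (simp_all add: is_perturbation_map_def)
  from p obtain \<Delta>' D' where pd: "perturbation_data sp sm \<Delta> D \<Delta>' D'"
    and or: "(\<exists>L M N. admissible sp sm (fold_plus D D') (fold_minus \<Delta> \<Delta>') L M N \<and> formula_nonpos sp sm \<Delta> D \<Delta>' D' L M N \<phi>)
      \<or> (\<exists>L M N. admissible sm sp (fold_minus \<Delta> \<Delta>') (fold_plus D D') M L N \<and> formula_nonneg sp sm \<Delta> D \<Delta>' D' L M N \<phi>)"
    unfolding is_perturbation_map_def by blast
  have ?eq using or
  proof
    assume "\<exists>L M N. admissible sp sm (fold_plus D D') (fold_minus \<Delta> \<Delta>') L M N \<and> formula_nonpos sp sm \<Delta> D \<Delta>' D' L M N \<phi>"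
    then show ?eq using formula_nonpos_reference[OF hD hE cl h(1) fred pd] by blast
  next
    assume "\<exists>L M N. admissible sm sp (fold_minus \<Delta> \<Delta>') (fold_plus D D') M L N \<and> formula_nonneg sp sm \<Delta> D \<Delta>' D' L M N \<phi>"
    then show ?eq using formula_nonneg_reference[OF hD hE cl h(1) fred pd] by blast
  qed
  with h show "?hom \<and> ?ext \<and> ?eq" by blast
next
  assume h: "?hom \<and> ?ext \<and> ?eq"
  interpret D: hat_data sp sm "d_plus D" "d_minus D" "pinv_plus D1" "pinv_minus D1" s1 c1 by fact
  interpret E: hat_data sp sm "d_plus \<Delta>" "d_minus \<Delta>" "pinv_plus \<Delta>1" "pinv_minus \<Delta>1" t1 u1 by fact
  note F = D.A.folded_axioms and G = E.A.folded_axioms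
  have pd: "perturbation_data sp sm \<Delta> D \<Delta>1 D1"
    unfolding perturbation_data_def using cx_foldedD(1)[OF F] cx_foldedD(1)[OF G] cl(2) by blast
  note lin = cx_folded_linear(1)[OF F] cx_folded_linear(2)[OF G]
  obtain ss where ss: "qbasis sp (ker_set (fold_plus D D1)) {0} ss" using fredholm_bases(1)[OF fred(1) F] by (rule exE)
  obtain cs where cs: "qbasis sm (ker_set (fold_minus D D1)) {0} cs" using fredholm_bases(2)[OF fred(1) F] by (rule exE)
  obtain st where st: "qbasis sp (ker_set (fold_plus \<Delta> \<Delta>1)) {0} st" using fredholm_bases(1)[OF fred(2) G] by (rule exE)
  obtain ct where ct: "qbasis sm (ker_set (fold_minus \<Delta> \<Delta>1)) {0} ct" using fredholm_bases(2)[OF fred(2) G] by (rule exE)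
  note cs' = cx_qbasis_ker_UNIV(2)[OF F cs] and st' = cx_qbasis_ker_UNIV(1)[OF G st]
  note hD' = cx_hat_dataI[OF F cx_qbasis_ker_UNIV(1)[OF F ss] cs']
    and hE' = cx_hat_dataI[OF G st' cx_qbasis_ker_UNIV(2)[OF G ct]]
  note idx = cx_hats(5)[OF hD' hE' cl] and Ind = Ind_hat_data[OF hD']
  show "is_perturbation_map sp sm \<Delta> D \<phi>"
  \<comment> \<open>The sign of the index decides which construction has admissible maps; index zero
    falls under the first.\<close>
  proof (cases "length ss \<le> length cs")
    case True
    then have I: "Ind sp sm D \<le> 0" by (simp add: Ind)
    obtain L M N where adm: "admissible sp sm (fold_plus D D1) (fold_minus \<Delta> \<Delta>1) L M N"
      using admissible_exists[OF lin ss cs' st' ct True idx] by blast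
    have "formula_nonpos sp sm \<Delta> D \<Delta>1 D1 L M N \<phi>"
      using formula_nonpos_reference[OF hD hE cl _ fred pd adm] h by blast
    then show ?thesis unfolding is_perturbation_map_def using h I pd adm by blast
  next
    case False
    then have I: "Ind sp sm D \<ge> 0" and le: "length ct \<le> length st" and idx': "length ct + length ss = length cs + length st"
      using idx by (simp_all add: Ind)
    obtain M L N where adm: "admissible sm sp (fold_minus \<Delta> \<Delta>1) (fold_plus D D1) M L N"
      using admissible_exists[OF lin(2,1) ct st' cs' ss le idx'] by blast
    have "formula_nonneg sp sm \<Delta> D \<Delta>1 D1 L M N \<phi>"
      using formula_nonneg_reference[OF hD hE cl _ fred pd adm] h by blast
    then show ?thesis unfolding is_perturbation_map_def using h I pd adm by blast
  qed
qed

text \<open>The map of lines sending \<open>g\<close> to \<open>c h\<close>. Its restriction to the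
  carrier makes it extensional, as required of perturbation maps, so that identities of maps become
  equations of functions.\<close>

definition line_map where
  "line_map V g U h c = (\<lambda>v\<in>carrier V. (lcoef V g v * c) \<odot>\<^bsub>U\<^esub> h)"

lemma line_map_scale:
  assumes V: "is_line V g"
  shows "line_map V g U h c (a \<odot>\<^bsub>V\<^esub> g) = (a * c) \<odot>\<^bsub>U\<^esub> h"
  using lineD(1)[OF V] by (simp add: line_map_def lcoef_scale[OF V])

lemma line_map_iff:
  assumes V: "is_line V g" "1 \<odot>\<^bsub>V\<^esub> g = g" and U: "is_line U h"
  shows "\<phi> \<in> hom_vs V U \<and> \<phi> \<in> extensional (carrier V) \<and> \<phi> g = c \<odot>\<^bsub>U\<^esub> h \<longleftrightarrow> \<phi> = line_map V g U h c"
proof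
  assume \<phi>: "\<phi> \<in> hom_vs V U \<and> \<phi> \<in> extensional (carrier V) \<and> \<phi> g = c \<odot>\<^bsub>U\<^esub> h"
  show "\<phi> = line_map V g U h c"
  proof (rule extensionalityI[of _ "carrier V"])
    fix v assume "v \<in> carrier V"
    then obtain a where a: "v = a \<odot>\<^bsub>V\<^esub> g" unfolding lineD(1)[OF V(1)] by blast
    have "g \<in> carrier V" unfolding lineD(1)[OF V(1)] using V(2) by (metis rangeI)
    then have "\<phi> (a \<odot>\<^bsub>V\<^esub> g) = a \<odot>\<^bsub>U\<^esub> \<phi> g" using \<phi> by (simp add: LinearCombinations.module_hom_def)
    then show "\<phi> v = line_map V g U h c v" unfolding a line_map_scale[OF V(1)] using \<phi> lineD(4)[OF U] by simp
  qed (use \<phi> in \<open>simp_all add: line_map_def\<close>)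
next
  assume \<phi>: "\<phi> = line_map V g U h c"
  have "line_map V g U h c \<in> hom_vs V U"
    unfolding LinearCombinations.module_hom_def
  proof (intro CollectI conjI allI impI)
    show "line_map V g U h c \<in> carrier V \<rightarrow> carrier U" by (auto simp: line_map_def lineD(1)[OF U])
    fix x y assume "x \<in> carrier V \<and> y \<in> carrier V"
    then obtain a b where "x = a \<odot>\<^bsub>V\<^esub> g" "y = b \<odot>\<^bsub>V\<^esub> g" unfolding lineD(1)[OF V(1)] by blast
    then show "line_map V g U h c (x \<oplus>\<^bsub>V\<^esub> y) = line_map V g U h c x \<oplus>\<^bsub>U\<^esub> line_map V g U h c y"
      by (simp add: lineD(3)[OF V(1)] lineD(3)[OF U] line_map_scale[OF V(1)] distrib_right)
  next
    fix r :: 'a and x assume "r \<in> carrier class_ring \<and> x \<in> carrier V"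
    then obtain a where "x = a \<odot>\<^bsub>V\<^esub> g" unfolding lineD(1)[OF V(1)] by blast
    then show "line_map V g U h c (r \<odot>\<^bsub>V\<^esub> x) = r \<odot>\<^bsub>U\<^esub> line_map V g U h c x"
      by (simp add: lineD(4)[OF V(1)] lineD(4)[OF U] line_map_scale[OF V(1)] mult.assoc)
  qed
  then show "\<phi> \<in> hom_vs V U \<and> \<phi> \<in> extensional (carrier V) \<and> \<phi> g = c \<odot>\<^bsub>U\<^esub> h"
    unfolding \<phi> using line_map_scale[OF V(1), of U h c 1] V(2) by (simp add: line_map_def)
qed

lemma line_map_inverse:
  assumes V: "is_line V g" and U: "is_line U h" and c: "c * c' = 1"
  shows "bij_betw (line_map V g U h c) (carrier V) (carrier U)"
    and "restrict (inv_into (carrier V) (line_map V g U h c)) (carrier U) = line_map U h V g c'"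
proof -
  have c': "c' * c = 1" using c by (simp only: mult.commute)
  have inv: "line_map V g U h c (line_map U h V g c' u) = u" if u: "u \<in> carrier U" for u
  proof -
    obtain a where "u = a \<odot>\<^bsub>U\<^esub> h" using u[unfolded lineD(1)[OF U]] by (rule rangeE)
    then show ?thesis by (simp only: line_map_scale[OF U] line_map_scale[OF V] mult.assoc c' mult_1_right)
  qed
  have inv': "line_map U h V g c' (line_map V g U h c v) = v" if v: "v \<in> carrier V" for v
  proof -
    obtain a where "v = a \<odot>\<^bsub>V\<^esub> g" using v[unfolded lineD(1)[OF V]] by (rule rangeE)
    then show ?thesis by (simp only: line_map_scale[OF U] line_map_scale[OF V] mult.assoc c mult_1_right)
  qed
  have mem: "line_map V g U h c v \<in> carrier U" if "v \<in> carrier V" for v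
    using that by (simp add: line_map_def lineD(1)[OF U])
  have mem': "line_map U h V g c' u \<in> carrier V" if "u \<in> carrier U" for u
    using that by (simp add: line_map_def lineD(1)[OF V])
  show bij: "bij_betw (line_map V g U h c) (carrier V) (carrier U)"
    by (rule bij_betw_byWitness[where f' = "line_map U h V g c'"]) (use inv inv' mem mem' in auto)
  show "restrict (inv_into (carrier V) (line_map V g U h c)) (carrier U) = line_map U h V g c'"
  proof (rule extensionalityI[of _ "carrier U"])
    fix u assume u: "u \<in> carrier U"
    have "inv_into (carrier V) (line_map V g U h c) u = line_map U h V g c' u"
      by (rule inv_into_f_eq[OF bij_betw_imp_inj_on[OF bij] mem'[OF u] inv[OF u]])
    then show "restrict (inv_into (carrier V) (line_map V g U h c)) (carrier U) u = line_map U h V g c' u"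
      using u by simp
  qed (simp_all add: line_map_def)
qed

lemma line_map_compose:
  assumes V: "is_line V g" and U: "is_line U h"
  shows "compose (carrier V) (line_map U h W k c') (line_map V g U h c) = line_map V g W k (c * c')"
proof (rule extensionalityI[of _ "carrier V"])
  fix v assume v: "v \<in> carrier V"
  then obtain a where "v = a \<odot>\<^bsub>V\<^esub> g" using lineD(1)[OF V] by blast
  then show "compose (carrier V) (line_map U h W k c') (line_map V g U h c) v = line_map V g W k (c * c') v"
    using v by (simp add: compose_def line_map_scale[OF V] line_map_scale[OF U] mult.assoc)
qed (simp_all add: line_map_def compose_def)

text \<open>A linear map on a line is fixed by its value at a generator, so the characterisation
  singles out one function and resolves the definite description.\<close>

lemma perturbation_iso_eq:
  assumes hD: "cx_hat_data sp sm D D1 s1 c1" and hE: "cx_hat_data sp sm \<Delta> \<Delta>1 t1 u1"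
    and cl: "cx_close sp sm D \<Delta>" "pinv_close sp sm D1 \<Delta>1"
    and fred: "fredholm sp sm D" "fredholm sp sm \<Delta>"
  shows "perturbation_iso sp sm \<Delta> D = line_map (cx_line sp sm D) (xi sp sm D D1 s1 c1) (cx_line sp sm \<Delta>) (xi sp sm \<Delta> \<Delta>1 t1 u1)
    (cx_kappa sp sm D D1 s1 c1 \<Delta> \<Delta>1 t1 u1)"
  unfolding perturbation_iso_def is_perturbation_map_iff[OF assms]
    line_map_iff[OF cx_tensor_hv(1)[OF hD] xi_carrier(1)[OF hD] cx_tensor_hv(1)[OF hE]]
  by (rule the_eq_trivial)

lemma fredholm_hat_data:
  fixes D' :: "('a::ab_group_add, 'b::ab_group_add) z2_pinv"
  assumes "fredholm sp sm D" "cx_folded sp sm D D'"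
  shows "\<exists>ss cs. cx_hat_data sp sm D D' ss cs"
  using fredholm_bases[OF assms] cx_qbasis_ker_UNIV[OF assms(2)] cx_hat_dataI[OF assms(2)] by blast

lemma fredholm_compatible_hat_data:
  assumes hD: "cx_hat_data sp sm D D' ss cs" and f: "fredholm sp sm \<Delta>" and cl: "cx_close sp sm D \<Delta>"
  shows "\<exists>\<Delta>' st ct. cx_hat_data sp sm \<Delta> \<Delta>' st ct \<and> pinv_close sp sm D' (\<Delta>' :: ('a::ab_group_add, 'b::ab_group_add) z2_pinv)"
proof -
  have cx: "Vector_Spaces.linear sp sm (d_plus \<Delta>)" "Vector_Spaces.linear sm sp (d_minus \<Delta>)"
    "\<And>x. d_minus \<Delta> (d_plus \<Delta> x) = 0" "\<And>y. d_plus \<Delta> (d_minus \<Delta> y) = 0"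
    using f by (auto simp: fredholm_def is_complex_def)
  obtain p m where pm: "folded sp sm (d_plus \<Delta>) (d_minus \<Delta>) p m \<and> finite_rank sp (\<lambda>y. pinv_plus D' y - p y)
      \<and> finite_rank sm (\<lambda>x. pinv_minus D' x - m x)"
    using pinv_compatible[OF hD cx conjunct1[OF cl] conjunct2[OF cl]] by (elim exE)
  let ?E = "\<lparr>pinv_plus = p, pinv_minus = m\<rparr>"
  have "cx_folded sp sm \<Delta> ?E" using pm by simp
  from fredholm_hat_data[OF f this] obtain st ct where "cx_hat_data sp sm \<Delta> ?E st ct" by (elim exE)
  moreover have "pinv_close sp sm D' ?E" using pm by simp
  ultimately show ?thesis by (intro exI) (rule conjI)
qed

theorem theorem3p3:
  fixes sp :: "'f::field \<Rightarrow> 'a::ab_group_add \<Rightarrow> 'a"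
    and sm :: "'f \<Rightarrow> 'b::ab_group_add \<Rightarrow> 'b"
    and D1 D2 D3 :: "('a, 'b) z2_complex"
  assumes "vector_space sp" and "vector_space sm"
    and "fredholm sp sm D1" and "fredholm sp sm D2" and "fredholm sp sm D3"
    and "finite_rank sm (\<lambda>x. d_plus D1 x - d_plus D2 x)"
    and "finite_rank sp (\<lambda>y. d_minus D1 y - d_minus D2 y)"
    and "finite_rank sm (\<lambda>x. d_plus D2 x - d_plus D3 x)"
    and "finite_rank sp (\<lambda>y. d_minus D2 y - d_minus D3 y)"
  shows "(bij_betw (perturbation_iso sp sm D2 D1)
            (carrier (cx_line sp sm D1)) (carrier (cx_line sp sm D2)) \<and>
          perturbation_iso sp sm D1 D2 =
            restrict (inv_into (carrier (cx_line sp sm D1)) (perturbation_iso sp sm D2 D1))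
              (carrier (cx_line sp sm D2))) \<and>
         compose (carrier (cx_line sp sm D1))
           (perturbation_iso sp sm D3 D2) (perturbation_iso sp sm D2 D1)
         = perturbation_iso sp sm D3 D1"
proof -
  interpret p: vector_space sp by fact
  interpret m: vector_space sm by fact
  note f = assms(3-5)
  have c12: "cx_close sp sm D1 D2" and c23: "cx_close sp sm D2 D3" using assms(6-9) by blast+
  have c13: "cx_close sp sm D1 D3"
    using m.finite_rank_diff_trans[OF assms(6,8)] p.finite_rank_diff_trans[OF assms(7,9)] by blast
  have c21: "cx_close sp sm D2 D1"
    using m.finite_rank_diff_swap[OF assms(6)] p.finite_rank_diff_swap[OF assms(7)] by blast
  have cx: "Vector_Spaces.linear sp sm (d_plus D1)" "Vector_Spaces.linear sm sp (d_minus D1)"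
    "\<And>x. d_minus D1 (d_plus D1 x) = 0" "\<And>y. d_plus D1 (d_minus D1 y) = 0"
    using f(1) by (auto simp: fredholm_def is_complex_def)
  interpret d: Vector_Spaces.linear sp sm "d_plus D1" by (rule cx)
  interpret e: Vector_Spaces.linear sm sp "d_minus D1" by (rule cx)
  \<comment> \<open>The zero subspaces prescribe nothing: any pseudo-inverse of \<open>D1\<close>
    will do as a starting point.\<close>
  have z: "{0} \<inter> ker_set (d_plus D1) = {0}" "{0} \<inter> ker_set (d_minus D1) = {0}" by (auto simp: d.zero e.zero)
  obtain q r where "folded sp sm (d_plus D1) (d_minus D1) q r \<and> {0} \<subseteq> range q \<and> {0} \<subseteq> range r"
    using pinv_exists[OF cx p.subspace_single_0 z(1) m.subspace_single_0 z(2)] by (elim exE)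
  then have "cx_folded sp sm D1 \<lparr>pinv_plus = q, pinv_minus = r\<rparr>" by simp
  note fredholm_hat_data[OF f(1) this]
  then have "\<exists>D1'. \<exists>s1 c1. cx_hat_data sp sm D1 (D1' :: ('a, 'b) z2_pinv) s1 c1" by (rule exI)
  then obtain D1' :: "('a, 'b) z2_pinv" and s1 c1 where h1: "cx_hat_data sp sm D1 D1' s1 c1" by (elim exE)
  obtain D2' s2 c2 where hp2: "cx_hat_data sp sm D2 D2' s2 c2 \<and> pinv_close sp sm D1' D2'"
    using fredholm_compatible_hat_data[OF h1 f(2) c12] by (elim exE)
  note h2 = conjunct1[OF hp2] and p12 = conjunct2[OF hp2]
  obtain D3' s3 c3 where hp3: "cx_hat_data sp sm D3 D3' s3 c3 \<and> pinv_close sp sm D1' D3'"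
    using fredholm_compatible_hat_data[OF h1 f(3) c13] by (elim exE)
  note h3 = conjunct1[OF hp3] and p13 = conjunct2[OF hp3]
  \<comment> \<open>Both other pseudo-inverses were chosen close to that of \<open>D1\<close>, hence
    they are close to each other.\<close>
  have p21: "pinv_close sp sm D2' D1'"
    using p.finite_rank_diff_swap[OF conjunct1[OF p12]] m.finite_rank_diff_swap[OF conjunct2[OF p12]] by (rule conjI)
  have p23: "pinv_close sp sm D2' D3'"
    using p.finite_rank_diff_trans[OF conjunct1[OF p21] conjunct1[OF p13]]
      m.finite_rank_diff_trans[OF conjunct2[OF p21] conjunct2[OF p13]] by (rule conjI)
  note H12 = cx_hats[OF h1 h2 c12 p12] and H23 = cx_hats[OF h2 h3 c23 p23]
  note L = cx_tensor_hv(1)[OF h1] cx_tensor_hv(1)[OF h2]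
  note P21 = perturbation_iso_eq[OF h1 h2 c12 p12 f(1,2)] and P12 = perturbation_iso_eq[OF h2 h1 c21 p21 f(2,1)]
    and P32 = perturbation_iso_eq[OF h2 h3 c23 p23 f(2,3)] and P31 = perturbation_iso_eq[OF h1 h3 c13 p13 f(1,3)]
  \<comment> \<open>The completions are now fixed once for each complex: inversion is
    \<open>kappa_swap\<close> and composition is \<open>kappa_trans\<close>.\<close>
  note inv = line_map_inverse[OF L H12(6)]
    and k = kappa_trans[OF H12(1,2) bijlinD(1)[OF H23(2)] H12(3) H23(3)]
  show ?thesis
    unfolding P21 P12 P32 P31 line_map_compose[OF L] k using inv by simp
qed

end
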